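(* Let $k\ge2$, let $\Delta,\Delta'$ be positive integers, let $c^*\ge k(4k+1)$ and $h^*\ge k(4k+1)+k\Delta'$ be integers, and let a valid ensemble of parameters be given. Let $\phi$ be a partial embedding of a $k$-complex $H$ of maximum degree $\Delta$ and vertex-degeneracy at most $\Delta'$, and suppose that the stack of candidate graphs $\mathcal C^{(0)},\dots,\mathcal C^{(k)}$ gives a $k$-GPE. Write $r=v(H)-|\mathrm{Dom}\,\phi|$. Then $$\mathcal C^{(k)}(H-\mathrm{Dom}\,\phi)\ \ge\ (1-\eta_k)^r\,\frac{c^{(k)}(\emptyset)}{\prod_{0\le\ell\le k}d^{(\ell)}_\phi(\emptyset)}\prod_{0\le\ell\le k}\mathcal D^{(\ell)}_\phi(H-\mathrm{Dom}\,\phi).$$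
   Context: Basics. Write $x=a\pm b$ for $a-b\le x\le a+b$. A $k$-complex $H$ is a finite vertex set with a down-closed family of subsets (edges, including $\emptyset$) of size at most $k$; $v(H)=|V(H)|$; maximum degree is the maximum number of edges containing a given vertex; $H-\mathrm{Dom}\,\phi$ is the complex induced on $V(H)\setminus\mathrm{Dom}\,\phi$, viewed as partite with parts of size one. A weighted hypergraph $\mathcal G$ on $V$ is a function $g$ from the power set of $V$ to the nonnegative reals (lower-case letters denote weight functions); it is a $k$-graph if $g(e)=1$ whenever $|e|\ge k+1$. $J$-partite means the vertex set is partitioned into parts indexed by $J$; crossing sets meet each part at most once; edges of partite complexes are crossing; $V_f$ ($f\subseteq J$) is the set of crossing $|f|$-sets with one vertex in each $V_j$, $j\in f$. For a $J$-partite complex $R$, $\mathcal G(R)=\mathbb E_\phi\prod_{e\in R}g(\phi(e))$ over uniformly random maps $\phi$ sending each part of $R$ into the corresponding part (product includes $\emptyset$). A density $k$-graph $\mathcal D$ on $J$ is a $k$-graph on vertex set $J$ (one vertex per part), so $\mathcal D(R)=\prod_{e\in R}d(\pi(e))$ with $\pi(e)$ the set of part indices of $e$. (A quotient such as $\mathcal D(R)/d(\emptyset)$ is the product over nonempty edges.) The link of $v\in V_i$ is $\mathcal G_v$ on the parts other than $V_i$ with $g_v(e)=g(e)g(e\cup\{v\})$ ($e=\emptyset$ included); likewise for density graphs. For $U\subseteq V_j$, $\|U\|_{\mathcal G}=\mathbb E_{v\in V_j}[\mathbf1_{v\in U}g(v)]$. Regularity. $O^m(\mathbf a)$ is the $m$-partite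 complex with $\mathbf a_j$ vertices in part $j$ and all crossing sets as edges. For $m$-partite $\mathcal G,\Gamma$ on the same parts, equal on edges of size $<m$ and with $g\le\gamma$ on $m$-edges, $\mathcal G$ is $(\varepsilon,d)$-regular w.r.t. $\Gamma$ if $\mathcal G(O^m(\mathbf1^m))=(d\pm\varepsilon)\Gamma(O^m(\mathbf1^m))$ and $\mathcal G(O^m(\mathbf2^m))\le(d^{2^m}+\varepsilon)\Gamma(O^m(\mathbf2^m))$. THC (recursive). For a linearly ordered finite $J$ and density $k$-graph $\mathcal P$ on $J$, a $J$-partite $k$-graph $\Gamma$ is an $(\eta,c^* )$-THC graph with density graph $\mathcal P$ if (1) for every $J$-partite $k$-complex $R$ with at most $4$ vertices per part and at most $c^*$ vertices, $\Gamma(R)=(1\pm v(R)\eta)\frac{\gamma(\emptyset)}{p(\emptyset)}\mathcal P(R)$; (2) if $|J|\ge2$ and $x$ is the first element of $J$, there is $V_x'\subseteq V_x$ with $\|V'_x\|_\Gamma\ge(1-\eta)\|V_x\|_\Gamma$ such that for $v\in V_x'$, $\Gamma_v$ is an $(\eta,c^* )$-THC graph on $J\setminus\{x\}$ with density graph $\mathcal P_x$. Stack. $V(H)$ has a fixed linear order, $\phi$ is a partial embedding of $H$ whose domain $\mathrm{Dom}\,\phi\subseteq V(H)$ is an initial segment, and each unembedded $x\in V(H)\setminus\mathrm{Dom}\,\phi$ has a vertex set $V_x$ (pairwise disjoint). A stack of candidate graphs is a sequence $\mathcal C^{(0)}\ge\mathcal C^{(1)}\ge\dots\ge\mathcal C^{(k)}$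 (pointwise) of $k$-graphs with parts $\{V_x\}_{x\in V(H)\setminus\mathrm{Dom}\,\phi}$, with weights $c^{(\ell)}$. Convention: $c^{(\ell)}$ is identically $1$ on $V_f$ if $f\notin H$. For $\emptyset\ne e\subseteq V(H)\setminus\mathrm{Dom}\,\phi$, $\overline{\mathcal C}^{(\ell-1)}(e)$ is the subgraph of $\mathcal C^{(\ell-1)}$ induced on $\bigcup_{x\in e}V_x$, and $\widetilde{\mathcal C}^{(\ell)}(e)$ is obtained from it by replacing the weights on $V_e$ by those of $\mathcal C^{(\ell)}$. Hits and degeneracy. $\pi_\phi(e)=|\{x\in\mathrm{Dom}\,\phi:\{x\}\cup e'\in H\text{ for some }\emptyset\ne e'\subseteq e\}|$; the vertex-degeneracy is $\mathrm{vdeg}(H)=\max_{e\in H}|\{x\in V(H): x\le y\ \forall y\in e,\ \{x\}\cup e'\in H\text{ for some }\emptyset\ne e'\subseteq e\}|$. Ensemble of parameters (for integers $k,c^*,h^*,\Delta$): numbers in $(0,1)$, namely minimum relative densities $\delta_1,\dots,\delta_k$, counting accuracies $\eta_0,\dots,\eta_k$, and regularity parameters $\varepsilon_{\ell,r,h}$ ($\ell,r\in[k]$, $0\le h\le h^*$). Put $\varepsilon'_\ell=\max_{r,h}\varepsilon_{\ell,r,h}$. It is valid if for each $1\le\ell\le k$: (VE1) $\eta_0\le\frac{\eta_\ell}{72(k+1)c^*}\prod_{0<\ell''\le\ell}\delta_{\ell''}^{c^*}$ and, for all $\ell'\in[\ell]$, $\varepsilon'_{\ell'}\le\frac{\eta_\ell\delta_{\ell'}}{72k(k+1)\Delta^2}\prod_{\ell'<\ell''\le\ell}\delta_{\ell''}^{c^*}$;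 (VE2),(VE4) for all $r\in[k]$, $0\le h\le h^*-1$: $\min\{\varepsilon_{\ell,r,h+1},2^{-k}\}\ge2^{2^{k+6}}k^3\big(\varepsilon_{\ell,r,h}^{1/16}+((4k+1)\eta_{\ell-1})^{1/32}\big)\delta_\ell^{-2^{k+1}}$; (VE3) $\varepsilon_{\ell,r+1,h^*}\le\varepsilon_{\ell,r,0}$ for $r\in[k-1]$. GPE. Let density $k$-graphs $\mathcal D^{(0)},\dots,\mathcal D^{(k)}$ on $V(H)$ be given, with weights $d^{(\ell)}(f)\in[0,1]$ for $\ell\ge1$ and $d^{(\ell)}(f)=1$ for $f\notin H$. $\mathcal D^{(\ell)}_\phi$ is obtained from $\mathcal D^{(\ell)}$ by successively taking links of all $x\in\mathrm{Dom}\,\phi$, so $d^{(\ell)}_\phi(e)=\prod_{f\subseteq V(H):\,e\subseteq f,\,f\setminus e\subseteq\mathrm{Dom}\,\phi}d^{(\ell)}(f)$. Given a valid ensemble, $\phi$ with $\mathcal C^{(0)},\dots,\mathcal C^{(k)}$ is a $k$-GPE (good partial embedding) if: (GPE1) $\mathcal C^{(0)}$ is an $(\eta_0,c^* )$-THC graph with density graph $\mathcal D^{(0)}_\phi$; (GPE2) for each $1\le\ell'\le k$ and $\emptyset\ne e\subseteq V(H)\setminus\mathrm{Dom}\,\phi$, $\widetilde{\mathcal C}^{(\ell')}(e)$ is $(\varepsilon_{\ell',|e|,\pi_\phi(e)},d^{(\ell')}_\phi(e))$-regular w.r.t. $\overline{\mathcal C}^{(\ell'-1)}(e)$ (this is automatic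 for $e\notin H$, where both graphs coincide and the density is $1$, so it is a condition only for $e\in H$); (GPE3) for each such $\ell'$ and $e$, $\delta_{\ell'}\le\prod_{f\subseteq V(H):\,e\subseteq f}d^{(\ell')}(f)$. *)

theory Defs
  imports Complex_Main "HOL-Library.FuncSet" "HOL-Library.Disjoint_Sets"
begin

section \<open>Complexes\<close>

text \<open>
  A complex is given by its vertex set and its set of edges; a vertex need not form an edge
  on its own.
\<close>

definition k_complex :: "nat \<Rightarrow> 'b set \<Rightarrow> 'b set set \<Rightarrow> bool" where
  "k_complex k W R \<longleftrightarrow>
     finite W \<and> {} \<in> R \<and>
     (\<forall>e\<in>R. e \<subseteq> W \<and> card e \<le> k) \<and>
     (\<forall>e\<in>R. \<forall>e'\<subseteq>e. e' \<in> R)"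

definition max_degree :: "'b set \<Rightarrow> 'b set set \<Rightarrow> nat" where
  "max_degree W R = Max (insert 0 ((\<lambda>v. card {e\<in>R. v \<in> e}) ` W))"

definition induced_edges :: "'b set set \<Rightarrow> 'b set \<Rightarrow> 'b set set" where
  "induced_edges R U = {e\<in>R. e \<subseteq> U}"

definition vertex_degeneracy :: "'v::linorder set \<Rightarrow> 'v set set \<Rightarrow> nat" where
  "vertex_degeneracy W R =
     Max ((\<lambda>e. card {x\<in>W. (\<forall>y\<in>e. x \<le> y) \<and>
                         (\<exists>e'\<subseteq>e. e' \<noteq> {} \<and> insert x e' \<in> R)}) ` R)"

text \<open>A \<open>J\<close>-partite complex; \<open>\<pi>\<close> sends each vertex to the index of its part.\<close>

definition partite_complex ::
  "nat \<Rightarrow> 'j set \<Rightarrow> ('b \<Rightarrow> 'j) \<Rightarrow> 'b set \<Rightarrow> 'b set set \<Rightarrow> bool" where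
  "partite_complex k J \<pi> W R \<longleftrightarrow>
     k_complex k W R \<and> \<pi> ` W \<subseteq> J \<and> (\<forall>e\<in>R. inj_on \<pi> e)"

definition oct_vertices :: "'j set \<Rightarrow> ('j \<Rightarrow> nat) \<Rightarrow> ('j \<times> nat) set" where
  "oct_vertices J a = {(j, i). j \<in> J \<and> i < a j}"

definition oct_edges :: "'j set \<Rightarrow> ('j \<Rightarrow> nat) \<Rightarrow> ('j \<times> nat) set set" where
  "oct_edges J a = {e. e \<subseteq> oct_vertices J a \<and> inj_on fst e}"


section \<open>Weighted hypergraphs\<close>

text \<open>
  A weight function is total on sets, but only its values on subsets of the intended
  vertex set matter.
\<close>

definition k_graph :: "nat \<Rightarrow> 'a set \<Rightarrow> ('a set \<Rightarrow> real) \<Rightarrow> bool" where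
  "k_graph k S g \<longleftrightarrow> (\<forall>e\<subseteq>S. 0 \<le> g e \<and> (k + 1 \<le> card e \<longrightarrow> g e = 1))"

text \<open>Parts are nonempty, so that uniformly random partite maps exist.\<close>

definition partition_parts :: "'j set \<Rightarrow> ('j \<Rightarrow> 'a set) \<Rightarrow> bool" where
  "partition_parts J V \<longleftrightarrow>
     finite J \<and> (\<forall>j\<in>J. finite (V j) \<and> V j \<noteq> {}) \<and> disjoint_family_on V J"

definition crossing :: "('j \<Rightarrow> 'a set) \<Rightarrow> 'j set \<Rightarrow> 'a set set" where
  "crossing V f = {e. e \<subseteq> (\<Union>j\<in>f. V j) \<and> (\<forall>j\<in>f. card (e \<inter> V j) = 1)}"

definition hom_density ::
  "('a set \<Rightarrow> real) \<Rightarrow> ('j \<Rightarrow> 'a set) \<Rightarrow> ('b \<Rightarrow> 'j) \<Rightarrow> 'b set \<Rightarrow> 'b set set \<Rightarrow> real" where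
  "hom_density g V \<pi> W R =
     (\<Sum>\<psi>\<in>(\<Pi>\<^sub>E w\<in>W. V (\<pi> w)). \<Prod>e\<in>R. g (\<psi> ` e)) / real (card (\<Pi>\<^sub>E w\<in>W. V (\<pi> w)))"

text \<open>
  The quotient \<open>\<D>(R) / d(\<emptyset>)\<close>, understood as the product over the nonempty edges, so that
  it also makes sense when \<open>d(\<emptyset>) = 0\<close>.
\<close>

definition density_quotient ::
  "('j set \<Rightarrow> real) \<Rightarrow> ('b \<Rightarrow> 'j) \<Rightarrow> 'b set set \<Rightarrow> real" where
  "density_quotient d \<pi> R = (\<Prod>e\<in>R - {{}}. d (\<pi> ` e))"

definition link :: "('a set \<Rightarrow> real) \<Rightarrow> 'a \<Rightarrow> 'a set \<Rightarrow> real" where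
  "link g v e = g e * g (insert v e)"

definition part_norm :: "('a set \<Rightarrow> real) \<Rightarrow> 'a set \<Rightarrow> 'a set \<Rightarrow> real" where
  "part_norm g Vj U = (\<Sum>v\<in>Vj. if v \<in> U then g {v} else 0) / real (card Vj)"


section \<open>Regularity\<close>

definition regular_wrt ::
  "'j set \<Rightarrow> ('j \<Rightarrow> 'a set) \<Rightarrow> real \<Rightarrow> real \<Rightarrow> ('a set \<Rightarrow> real) \<Rightarrow> ('a set \<Rightarrow> real) \<Rightarrow> bool" where
  "regular_wrt J V \<epsilon> d g \<gamma> \<longleftrightarrow>
     (\<forall>f\<subset>J. \<forall>s\<in>crossing V f. g s = \<gamma> s) \<and>
     (\<forall>s\<in>crossing V J. g s \<le> \<gamma> s) \<and>
     (let oct = (\<lambda>h n. hom_density h V fst (oct_vertices J (\<lambda>_. n)) (oct_edges J (\<lambda>_. n)))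
      in (d - \<epsilon>) * oct \<gamma> 1 \<le> oct g 1 \<and> oct g 1 \<le> (d + \<epsilon>) * oct \<gamma> 1 \<and>
         oct g 2 \<le> (d ^ (2 ^ card J) + \<epsilon>) * oct \<gamma> 2)"


section \<open>THC graphs\<close>

text \<open>
  Up to isomorphism, the vertices of a finite \<open>J\<close>-partite complex are pairs \<open>(j, i)\<close> with
  \<open>j\<close> the index of the part, so it suffices to let \<open>R\<close> range over complexes on such pairs.
\<close>

definition thc_count ::
  "nat \<Rightarrow> real \<Rightarrow> nat \<Rightarrow> ('j \<Rightarrow> 'a set) \<Rightarrow> 'j set \<Rightarrow> ('a set \<Rightarrow> real) \<Rightarrow> ('j set \<Rightarrow> real) \<Rightarrow> bool" where
  "thc_count k \<eta> c V J \<gamma> p \<longleftrightarrow>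
     (\<forall>(W :: ('j \<times> nat) set) R.
        partite_complex k J fst W R \<and> (\<forall>j\<in>J. card {w\<in>W. fst w = j} \<le> 4) \<and> card W \<le> c \<longrightarrow>
          (1 - real (card W) * \<eta>) * (\<gamma> {} * density_quotient p fst R)
            \<le> hom_density \<gamma> V fst W R \<and>
          hom_density \<gamma> V fst W R
            \<le> (1 + real (card W) * \<eta>) * (\<gamma> {} * density_quotient p fst R))"

text \<open>The index set loses its first element at each recursive call, so the recursion is well-founded.\<close>

inductive thc_graph ::
  "nat \<Rightarrow> real \<Rightarrow> nat \<Rightarrow> ('j::linorder \<Rightarrow> 'a set) \<Rightarrow> 'j set \<Rightarrow> ('a set \<Rightarrow> real) \<Rightarrow> ('j set \<Rightarrow> real) \<Rightarrow> bool"
  for k :: nat and \<eta> :: real and c :: nat and V :: "'j::linorder \<Rightarrow> 'a set" where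
  "thc_count k \<eta> c V J \<gamma> p \<Longrightarrow>
   (2 \<le> card J \<longrightarrow>
     (\<exists>V'\<subseteq>V (Min J).
        part_norm \<gamma> (V (Min J)) V' \<ge> (1 - \<eta>) * part_norm \<gamma> (V (Min J)) (V (Min J)) \<and>
        (\<forall>v\<in>V'. thc_graph k \<eta> c V (J - {Min J}) (link \<gamma> v) (link p (Min J))))) \<Longrightarrow>
   thc_graph k \<eta> c V J \<gamma> p"


section \<open>Stacks of candidate graphs\<close>

text \<open>
  Nothing below depends on the values of \<open>\<phi>\<close>, only on its domain; no condition on the values
  is imposed.
\<close>

definition partial_embedding :: "'v::linorder set \<Rightarrow> ('v \<rightharpoonup> 'a) \<Rightarrow> bool" where
  "partial_embedding VH \<phi> \<longleftrightarrow>
     dom \<phi> \<subseteq> VH \<and> (\<forall>x\<in>dom \<phi>. \<forall>y\<in>VH. y < x \<longrightarrow> y \<in> dom \<phi>)"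

definition candidate_stack ::
  "nat \<Rightarrow> 'v set \<Rightarrow> 'v set set \<Rightarrow> ('v \<rightharpoonup> 'a) \<Rightarrow> ('v \<Rightarrow> 'a set) \<Rightarrow> (nat \<Rightarrow> 'a set \<Rightarrow> real) \<Rightarrow> bool" where
  "candidate_stack k VH H \<phi> V C \<longleftrightarrow>
     partition_parts (VH - dom \<phi>) V \<and>
     (\<forall>l\<le>k. k_graph k (\<Union>x\<in>VH - dom \<phi>. V x) (C l)) \<and>
     (\<forall>l\<in>{1..k}. \<forall>e\<subseteq>(\<Union>x\<in>VH - dom \<phi>. V x). C l e \<le> C (l - 1) e) \<and>
     (\<forall>l\<le>k. \<forall>f\<subseteq>VH - dom \<phi>. f \<notin> H \<longrightarrow> (\<forall>e\<in>crossing V f. C l e = 1))"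

definition replace_top ::
  "('v \<Rightarrow> 'a set) \<Rightarrow> 'v set \<Rightarrow> ('a set \<Rightarrow> real) \<Rightarrow> ('a set \<Rightarrow> real) \<Rightarrow> 'a set \<Rightarrow> real" where
  "replace_top V e g' g = (\<lambda>s. if s \<in> crossing V e then g' s else g s)"

definition hits :: "'v set set \<Rightarrow> ('v \<rightharpoonup> 'a) \<Rightarrow> 'v set \<Rightarrow> nat" where
  "hits H \<phi> e = card {x \<in> dom \<phi>. \<exists>e'\<subseteq>e. e' \<noteq> {} \<and> insert x e' \<in> H}"

definition density_family ::
  "nat \<Rightarrow> 'v set \<Rightarrow> 'v set set \<Rightarrow> (nat \<Rightarrow> 'v set \<Rightarrow> real) \<Rightarrow> bool" where
  "density_family k VH H D \<longleftrightarrow>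
     (\<forall>l\<le>k. k_graph k VH (D l)) \<and>
     (\<forall>l\<in>{1..k}. \<forall>f\<subseteq>VH. D l f \<in> {0..1}) \<and>
     (\<forall>l\<le>k. \<forall>f\<subseteq>VH. f \<notin> H \<longrightarrow> D l f = 1)"

definition density_after ::
  "'v set \<Rightarrow> ('v \<rightharpoonup> 'a) \<Rightarrow> ('v set \<Rightarrow> real) \<Rightarrow> 'v set \<Rightarrow> real" where
  "density_after VH \<phi> d e = (\<Prod>f\<in>{f. f \<subseteq> VH \<and> e \<subseteq> f \<and> f - e \<subseteq> dom \<phi>}. d f)"

lemma fold_link:
  assumes "distinct xs"
  shows "fold (\<lambda>x g. link g x) xs d e = (\<Prod>A\<in>Pow (set xs). d (e \<union> A))"
  using assms
proof (induction xs arbitrary: d)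
  case Nil
  then show ?case by simp
next
  case (Cons x xs)
  have inj: "inj_on (insert x) (Pow (set xs))"
    using Cons.prems by (auto simp: inj_on_def)
  have disj: "Pow (set xs) \<inter> insert x ` Pow (set xs) = {}"
    using Cons.prems by auto
  have "fold (\<lambda>x g. link g x) (x # xs) d e
      = (\<Prod>A\<in>Pow (set xs). d (e \<union> A) * d (insert x (e \<union> A)))"
    using Cons.IH[of "link d x"] Cons.prems by (simp, simp add: link_def)
  also have "\<dots> = (\<Prod>A\<in>Pow (set xs). d (e \<union> A)) * (\<Prod>A\<in>insert x ` Pow (set xs). d (e \<union> A))"
    by (simp add: prod.distrib prod.reindex[OF inj] o_def)
  also have "\<dots> = (\<Prod>A\<in>Pow (set xs) \<union> insert x ` Pow (set xs). d (e \<union> A))"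
    by (rule prod.union_disjoint[symmetric]) (use disj in auto)
  finally show ?case by (simp add: Pow_insert)
qed

lemma density_after_eq_iterated_link:
  assumes "distinct xs" "set xs = dom \<phi>" "dom \<phi> \<subseteq> VH" "e \<subseteq> VH - dom \<phi>"
  shows "density_after VH \<phi> d e = fold (\<lambda>x g. link g x) xs d e"
proof -
  have "{f. f \<subseteq> VH \<and> e \<subseteq> f \<and> f - e \<subseteq> dom \<phi>} = (\<union>) e ` Pow (dom \<phi>)"
  proof (intro equalityI subsetI)
    fix f assume "f \<in> {f. f \<subseteq> VH \<and> e \<subseteq> f \<and> f - e \<subseteq> dom \<phi>}"
    then have "f = e \<union> (f - e)" "f - e \<in> Pow (dom \<phi>)" by auto
    then show "f \<in> (\<union>) e ` Pow (dom \<phi>)" by blast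
  qed (use assms in auto)
  moreover have "inj_on ((\<union>) e) (Pow (dom \<phi>))"
    using assms(4) by (auto simp: inj_on_def)
  ultimately show ?thesis
    by (simp add: density_after_def fold_link[OF assms(1)] assms(2) prod.reindex)
qed


section \<open>Ensembles of parameters and good partial embeddings\<close>

text \<open>The parameters are \<open>\<delta> l\<close> for \<open>1 \<le> l \<le> k\<close>, \<open>\<eta> l\<close> for \<open>0 \<le> l \<le> k\<close>, and \<open>\<epsilon> l r h\<close>
  for \<open>1 \<le> l, r \<le> k\<close> and \<open>0 \<le> h \<le> hs\<close>.\<close>

definition eps_max :: "nat \<Rightarrow> nat \<Rightarrow> (nat \<Rightarrow> nat \<Rightarrow> nat \<Rightarrow> real) \<Rightarrow> nat \<Rightarrow> real" where
  "eps_max k hs \<epsilon> l = Max ((\<lambda>(r, h). \<epsilon> l r h) ` ({1..k} \<times> {0..hs}))"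

definition valid_ensemble ::
  "nat \<Rightarrow> nat \<Rightarrow> nat \<Rightarrow> nat \<Rightarrow> (nat \<Rightarrow> real) \<Rightarrow> (nat \<Rightarrow> real) \<Rightarrow> (nat \<Rightarrow> nat \<Rightarrow> nat \<Rightarrow> real) \<Rightarrow> bool" where
  "valid_ensemble k cs hs \<Delta> \<delta> \<eta> \<epsilon> \<longleftrightarrow>
     (\<forall>l\<in>{1..k}. \<delta> l \<in> {0<..<1}) \<and>
     (\<forall>l\<in>{0..k}. \<eta> l \<in> {0<..<1}) \<and>
     (\<forall>l\<in>{1..k}. \<forall>r\<in>{1..k}. \<forall>h\<in>{0..hs}. \<epsilon> l r h \<in> {0<..<1}) \<and>
     (\<forall>l\<in>{1..k}.
        \<eta> 0 \<le> \<eta> l / (72 * (real k + 1) * real cs) * (\<Prod>i\<in>{0<..l}. \<delta> i ^ cs) \<and>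
        (\<forall>l'\<in>{1..l}.
           eps_max k hs \<epsilon> l' \<le> \<eta> l * \<delta> l' / (72 * real k * (real k + 1) * (real \<Delta>)\<^sup>2)
                                 * (\<Prod>i\<in>{l'<..l}. \<delta> i ^ cs)) \<and>
        (\<forall>r\<in>{1..k}. \<forall>h<hs.
           min (\<epsilon> l r (h + 1)) (1 / 2 ^ k)
             \<ge> 2 ^ (2 ^ (k + 6)) * real k ^ 3
                 * (\<epsilon> l r h powr (1 / 16) + ((4 * real k + 1) * \<eta> (l - 1)) powr (1 / 32))
                 / \<delta> l ^ (2 ^ (k + 1))) \<and>
        (\<forall>r\<in>{1..k - 1}. \<epsilon> l (r + 1) hs \<le> \<epsilon> l r 0))"

text \<open>
  Regularity is demanded only for edges of \<open>H\<close>: for other sets it holds automatically, and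
  \<open>\<epsilon> l (card e) (hits H \<phi> e)\<close> need not be one of the parameters.
\<close>

definition good_partial_embedding ::
  "nat \<Rightarrow> nat \<Rightarrow> (nat \<Rightarrow> real) \<Rightarrow> (nat \<Rightarrow> real) \<Rightarrow> (nat \<Rightarrow> nat \<Rightarrow> nat \<Rightarrow> real) \<Rightarrow>
   'v::linorder set \<Rightarrow> 'v set set \<Rightarrow> (nat \<Rightarrow> 'v set \<Rightarrow> real) \<Rightarrow>
   ('v \<rightharpoonup> 'a) \<Rightarrow> ('v \<Rightarrow> 'a set) \<Rightarrow> (nat \<Rightarrow> 'a set \<Rightarrow> real) \<Rightarrow> bool" where
  "good_partial_embedding k cs \<delta> \<eta> \<epsilon> VH H D \<phi> V C \<longleftrightarrow>
     thc_graph k (\<eta> 0) cs V (VH - dom \<phi>) (C 0) (density_after VH \<phi> (D 0)) \<and>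
     (\<forall>l\<in>{1..k}. \<forall>e\<in>H. e \<noteq> {} \<and> e \<subseteq> VH - dom \<phi> \<longrightarrow>
        regular_wrt e V (\<epsilon> l (card e) (hits H \<phi> e)) (density_after VH \<phi> (D l) e)
          (replace_top V e (C l) (C (l - 1))) (C (l - 1))) \<and>
     (\<forall>l\<in>{1..k}. \<forall>e\<subseteq>VH - dom \<phi>. e \<noteq> {} \<longrightarrow>
        \<delta> l \<le> (\<Prod>f\<in>{f. f \<subseteq> VH \<and> e \<subseteq> f}. D l f))"

end

theory Submission
  imports Defs
begin

text \<open>
  Divide the weights of the \<open>l\<close>-th candidate graph by the densities accumulated up to level \<open>l\<close>. Level by
  level, every small complex with at most four vertices per part then has count close to \<open>1\<close>: for
  \<open>l = 0\<close> this is the THC property, and passing from \<open>l - 1\<close> to \<open>l\<close> multiplies the weights by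
  relative weights in \<open>[0, 1]\<close>. To count with these, delete vertices one at a time. Cauchy--Schwarz bounds
  the cost of deleting a vertex by the variance of its link, an expectation in which that vertex has just two
  copies; after treating each part in this way only octahedra remain, where regularity applies.

  The same counts, applied to two copies of an octahedron coned off by one further vertex \<open>v\<close>, show that the
  octahedron counts in the link of \<open>v\<close> have small variance over \<open>v\<close>. Hence all but a tiny
  weight of the vertices \<open>v\<close> inherit regularity with a slightly larger error. When the first unembedded vertex
  \<open>x\<close> is embedded only the at most \<open>\<Delta>\<^sup>2\<close> edges hit by \<open>x\<close> matter, so the
  bad vertices at all levels weigh at most an \<open>\<eta> k\<close> fraction of what is expected, and the bound follows by
  induction on the number of unembedded vertices.
\<close>

section \<open>Averages over partite maps\<close>

text \<open>The obstacle is that normalised weights are unbounded: dividing by small densities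
  leaves no pointwise control, so upper bounds come only from counts at the level below. Four copies
  per part are just enough for this. In \<open>remove_vertex\<close> one squared link meets another
  squared link, and in \<open>link_variance\<close> an octahedron with two vertices per part occurs
  twice. Counts are needed only on at most \<open>k + 1\<close> parts, an edge together with the
  vertex being embedded. They are derived afresh from regularity whenever a vertex is embedded, so
  counting errors are not passed on. Only the regularity error of an edge grows, and only when the
  edge is hit, which happens at most \<open>\<Delta>'\<close> times. Cauchy--Schwarz costs a square
  root per part, once in comparing octahedra and once more in eliminating parts, so an error turns
  into a root of order about \<open>4 ^ (k + 1)\<close>. The \<open>4 * k + 1\<close> steps of (VE2)
  kept in reserve provide the power \<open>16 ^ (4 * k + 1)\<close>, which outweighs this root, a
  factor \<open>\<delta> l\<close> for each of up to \<open>2 ^ (4 * (k + 1))\<close> edges, and all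
  numerical constants.\<close>

definition avg :: "'b set \<Rightarrow> ('b \<Rightarrow> 'a set) \<Rightarrow> (('b \<Rightarrow> 'a) \<Rightarrow> real) \<Rightarrow> real" where
  "avg W Y f = (\<Sum>\<psi>\<in>PiE W Y. f \<psi>) / real (card (PiE W Y))"

lemma hom_density_eq_avg:
  "hom_density g V \<pi> W R = avg W (\<lambda>w. V (\<pi> w)) (\<lambda>\<psi>. \<Prod>e\<in>R. g (\<psi> ` e))"
  by (simp add: hom_density_def avg_def)

text \<open>Guards against the value 0 that an average over no maps would take.\<close>

definition nefin :: "'b set \<Rightarrow> ('b \<Rightarrow> 'a set) \<Rightarrow> bool" where
  "nefin W Y \<longleftrightarrow> finite W \<and> (\<forall>w\<in>W. finite (Y w) \<and> Y w \<noteq> {})"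

lemma nefin_subset: "nefin W Y \<Longrightarrow> A \<subseteq> W \<Longrightarrow> nefin A Y"
  by (auto simp: nefin_def intro: finite_subset)

lemma nefin_card_pos: "nefin W Y \<Longrightarrow> 0 < card (PiE W Y)"
  by (auto simp: nefin_def card_gt_0_iff PiE_eq_empty_iff intro!: finite_PiE)

lemma avg_cong: "(\<And>\<psi>. \<psi> \<in> PiE W Y \<Longrightarrow> f \<psi> = g \<psi>) \<Longrightarrow> avg W Y f = avg W Y g"
  by (simp add: avg_def)

lemma avg_add: "avg W Y (\<lambda>\<psi>. f \<psi> + g \<psi>) = avg W Y f + avg W Y g"
  by (simp add: avg_def sum.distrib add_divide_distrib)

lemma avg_diff: "avg W Y (\<lambda>\<psi>. f \<psi> - g \<psi>) = avg W Y f - avg W Y g"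
  by (simp add: avg_def sum_subtractf diff_divide_distrib)

lemma avg_cmult: "avg W Y (\<lambda>\<psi>. c * f \<psi>) = c * avg W Y f"
  by (simp add: avg_def sum_distrib_left)

lemma avg_const: "nefin W Y \<Longrightarrow> avg W Y (\<lambda>\<psi>. c) = c"
  using nefin_card_pos[of W Y] by (simp add: avg_def)

lemma avg_mono: "(\<And>\<psi>. \<psi> \<in> PiE W Y \<Longrightarrow> f \<psi> \<le> g \<psi>) \<Longrightarrow> avg W Y f \<le> avg W Y g"
  by (simp add: avg_def divide_right_mono sum_mono)

lemma avg_nonneg: "(\<And>\<psi>. \<psi> \<in> PiE W Y \<Longrightarrow> 0 \<le> f \<psi>) \<Longrightarrow> 0 \<le> avg W Y f"
  by (simp add: avg_def sum_nonneg)

lemma avg_sum: "avg W Y (\<lambda>\<psi>. \<Sum>i\<in>I. f i \<psi>) = (\<Sum>i\<in>I. avg W Y (f i))"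
proof -
  have "(\<Sum>\<psi>\<in>PiE W Y. \<Sum>i\<in>I. f i \<psi>) = (\<Sum>i\<in>I. \<Sum>\<psi>\<in>PiE W Y. f i \<psi>)"
    by (rule sum.swap)
  then show ?thesis by (simp add: avg_def sum_divide_distrib)
qed

lemma avg_abs_le: "\<bar>avg W Y f\<bar> \<le> avg W Y (\<lambda>\<psi>. \<bar>f \<psi>\<bar>)"
proof -
  have "\<bar>\<Sum>\<psi>\<in>PiE W Y. f \<psi>\<bar> \<le> (\<Sum>\<psi>\<in>PiE W Y. \<bar>f \<psi>\<bar>)" by (rule sum_abs)
  then show ?thesis by (simp add: avg_def abs_divide divide_right_mono)
qed

lemma avg_empty [simp]: "avg {} Y f = f (\<lambda>x. undefined)"
  by (simp add: avg_def)

text \<open>Fubini: a map on \<open>A \<union> B\<close> is a pair of maps, glued by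
  \<open>override_on\<close>. Both maps are extensional, so the gluing is a bijection and the
  normalising cardinalities multiply.\<close>

lemma avg_Un:
  assumes "nefin A Y" "nefin B Y" "A \<inter> B = {}"
  shows "avg (A \<union> B) Y f = avg A Y (\<lambda>a. avg B Y (\<lambda>b. f (override_on a b B)))"
proof -
  let ?h = "\<lambda>p. override_on (fst p) (snd p) B"
  have bij: "bij_betw ?h (PiE A Y \<times> PiE B Y) (PiE (A \<union> B) Y)"
  proof (rule bij_betw_byWitness[where f' = "\<lambda>\<psi>. (restrict \<psi> A, restrict \<psi> B)"])
    show "\<forall>a\<in>PiE A Y \<times> PiE B Y. (restrict (?h a) A, restrict (?h a) B) = a"
    proof
      fix p assume p: "p \<in> PiE A Y \<times> PiE B Y"
      have "restrict (?h p) A = fst p"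
        using p assms(3) by (intro ext) (auto simp: override_on_def restrict_def PiE_def extensional_def)
      moreover have "restrict (?h p) B = snd p"
        using p assms(3) by (intro ext) (auto simp: override_on_def restrict_def PiE_def extensional_def)
      ultimately show "(restrict (?h p) A, restrict (?h p) B) = p" by simp
    qed
    show "\<forall>a'\<in>PiE (A \<union> B) Y. ?h (restrict a' A, restrict a' B) = a'"
      by (auto simp: override_on_def restrict_def PiE_def extensional_def fun_eq_iff)
    show "?h ` (PiE A Y \<times> PiE B Y) \<subseteq> PiE (A \<union> B) Y"
      using assms(3) by (auto simp: override_on_def PiE_def extensional_def Pi_def)
    show "(\<lambda>\<psi>. (restrict \<psi> A, restrict \<psi> B)) ` PiE (A \<union> B) Y \<subseteq> PiE A Y \<times> PiE B Y"
      by auto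
  qed
  have "(\<Sum>\<psi>\<in>PiE (A \<union> B) Y. f \<psi>) = (\<Sum>p\<in>PiE A Y \<times> PiE B Y. f (?h p))"
    by (rule sum.reindex_bij_betw[OF bij, symmetric])
  also have "\<dots> = (\<Sum>a\<in>PiE A Y. \<Sum>b\<in>PiE B Y. f (override_on a b B))"
    by (simp add: sum.cartesian_product case_prod_beta)
  finally have 1: "(\<Sum>\<psi>\<in>PiE (A \<union> B) Y. f \<psi>) = (\<Sum>a\<in>PiE A Y. \<Sum>b\<in>PiE B Y. f (override_on a b B))" .
  have "card (PiE (A \<union> B) Y) = card (PiE A Y) * card (PiE B Y)"
    using bij_betw_same_card[OF bij] by (simp add: card_cartesian_product)
  then show ?thesis using 1
    by (simp add: avg_def sum_divide_distrib[symmetric] mult.commute)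
qed

lemma avg_singleton:
  shows "avg {w} Y f = (\<Sum>v\<in>Y w. f ((\<lambda>x. undefined)(w := v))) / real (card (Y w))"
proof -
  have bij: "bij_betw (\<lambda>v. (\<lambda>x. undefined)(w := v)) (Y w) (PiE {w} Y)"
    by (rule bij_betw_byWitness[where f' = "\<lambda>\<psi>. \<psi> w"])
       (auto simp: PiE_def extensional_def fun_eq_iff)
  show ?thesis
    unfolding avg_def using sum.reindex_bij_betw[OF bij, of f] bij_betw_same_card[OF bij] by simp
qed

lemma avg_split_coord:
  assumes "nefin W Y" "w \<in> W"
  shows "avg W Y f = avg (W - {w}) Y (\<lambda>\<psi>. (\<Sum>v\<in>Y w. f (\<psi>(w := v))) / real (card (Y w)))"
proof -
  have "avg W Y f = avg ((W - {w}) \<union> {w}) Y f" using assms(2) by (simp add: insert_absorb)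
  also have "\<dots> = avg (W - {w}) Y (\<lambda>a. avg {w} Y (\<lambda>b. f (override_on a b {w})))"
    by (rule avg_Un) (use assms in \<open>auto intro: nefin_subset\<close>)
  also have "\<dots> = avg (W - {w}) Y (\<lambda>\<psi>. (\<Sum>v\<in>Y w. f (\<psi>(w := v))) / real (card (Y w)))"
  proof -
    have "override_on a ((\<lambda>x. undefined)(w := v)) {w} = a(w := v)" for a :: "'a \<Rightarrow> 'b" and v
      by (auto simp: override_on_def)
    then show ?thesis by (simp add: avg_singleton)
  qed
  finally show ?thesis .
qed

text \<open>Resampling the coordinate \<open>w\<close> keeps the domain \<open>W\<close>, so
  coordinates can be averaged out one after another under the same average.\<close>

lemma avg_average_coord:
  assumes "nefin W Y" "w \<in> W"
  shows "avg W Y f = avg W Y (\<lambda>\<psi>. (\<Sum>v\<in>Y w. f (\<psi>(w := v))) / real (card (Y w)))"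
proof -
  have c: "0 < card (Y w)" using assms by (auto simp: nefin_def card_gt_0_iff)
  show ?thesis
    by (subst (1 2) avg_split_coord[OF assms]) (use c in simp)
qed

text \<open>The first argument of \<open>h\<close> marks the only place where the coordinate
  \<open>w\<close> matters; there it is replaced by its conditional mean.\<close>

lemma avg_pull_coord:
  assumes "nefin W Y" "w \<in> W"
    and "\<And>\<psi> v. g (\<psi>(w := v)) = g \<psi>"
    and "\<And>\<psi> v v'. h v' (\<psi>(w := v)) = h v' \<psi>"
  shows "avg W Y (\<lambda>\<psi>. g \<psi> * h (\<psi> w) \<psi>)
       = avg W Y (\<lambda>\<psi>. g \<psi> * ((\<Sum>v\<in>Y w. h v \<psi>) / real (card (Y w))))"
proof -
  have "avg W Y (\<lambda>\<psi>. g \<psi> * h (\<psi> w) \<psi>)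
      = avg W Y (\<lambda>\<psi>. (\<Sum>v\<in>Y w. g (\<psi>(w := v)) * h ((\<psi>(w := v)) w) (\<psi>(w := v))) / real (card (Y w)))"
    by (rule avg_average_coord[OF assms(1,2)])
  then show ?thesis by (simp add: assms(3,4) sum_distrib_left)
qed

lemma avg_marginal:
  assumes "nefin W Y" "A \<subseteq> W"
    and "\<And>\<psi> \<psi>'. (\<And>w. w \<in> A \<Longrightarrow> \<psi> w = \<psi>' w) \<Longrightarrow> f \<psi> = f \<psi>'"
  shows "avg W Y f = avg A Y f"
proof -
  have "avg W Y f = avg (A \<union> (W - A)) Y f" using assms(2) by (simp add: Un_absorb1)
  also have "\<dots> = avg A Y (\<lambda>a. avg (W - A) Y (\<lambda>b. f (override_on a b (W - A))))"
    by (rule avg_Un) (use assms in \<open>auto intro: nefin_subset\<close>)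
  also have "\<dots> = avg A Y (\<lambda>a. avg (W - A) Y (\<lambda>b. f a))"
    by (intro avg_cong assms(3)) (auto simp: override_on_def)
  also have "\<dots> = avg A Y f"
    using avg_const[OF nefin_subset[OF assms(1), of "W - A"]] by simp
  finally show ?thesis .
qed

lemma avg_reindex:
  assumes "bij_betw \<sigma> A B" "\<And>w. w \<in> A \<Longrightarrow> Y (\<sigma> w) = Y w"
  shows "avg B Y f = avg A Y (\<lambda>\<psi>. f (\<lambda>w. if w \<in> B then \<psi> (inv_into A \<sigma> w) else undefined))"
proof -
  let ?h = "\<lambda>\<psi> w. if w \<in> B then \<psi> (inv_into A \<sigma> w) else undefined"
  have inj: "inj_on \<sigma> A" and im: "\<sigma> ` A = B" using assms(1) by (auto simp: bij_betw_def)
  have iB: "w \<in> B \<Longrightarrow> inv_into A \<sigma> w \<in> A" "w \<in> B \<Longrightarrow> \<sigma> (inv_into A \<sigma> w) = w" for w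
    using im by (auto intro: inv_into_into f_inv_into_f)
  have bij: "bij_betw ?h (PiE A Y) (PiE B Y)"
  proof (rule bij_betw_byWitness[where f' = "\<lambda>\<psi> w. if w \<in> A then \<psi> (\<sigma> w) else undefined"])
    show "\<forall>a\<in>PiE A Y. (\<lambda>w. if w \<in> A then ?h a (\<sigma> w) else undefined) = a"
      using im inj by (auto simp: fun_eq_iff PiE_def extensional_def)
    show "\<forall>a'\<in>PiE B Y. ?h (\<lambda>w. if w \<in> A then a' (\<sigma> w) else undefined) = a'"
      using iB by (auto simp: fun_eq_iff PiE_def extensional_def)
    have "\<And>a w. a \<in> PiE A Y \<Longrightarrow> w \<in> B \<Longrightarrow> a (inv_into A \<sigma> w) \<in> Y w"
      using iB assms(2) by (metis PiE_mem)
    then show "?h ` PiE A Y \<subseteq> PiE B Y" by (auto simp: PiE_def extensional_def)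
    show "(\<lambda>\<psi> w. if w \<in> A then \<psi> (\<sigma> w) else undefined) ` PiE B Y \<subseteq> PiE A Y"
      using im by (auto simp: PiE_def extensional_def assms(2)[symmetric])
  qed
  show ?thesis
    unfolding avg_def using sum.reindex_bij_betw[OF bij, of f] bij_betw_same_card[OF bij] by simp
qed

text \<open>The double sum of \<open>(a x * b y - a y * b x)\<^sup>2\<close>, where \<open>a\<close>
  and \<open>b\<close> absorb \<open>sqrt (G x)\<close>, is twice the difference of the two sides
  (Lagrange's identity).\<close>

lemma sum_Cauchy_Schwarz_weighted:
  fixes G f g :: "'c \<Rightarrow> real"
  assumes "\<And>x. x \<in> A \<Longrightarrow> 0 \<le> G x"
  shows "(\<Sum>x\<in>A. G x * f x * g x)\<^sup>2 \<le> (\<Sum>x\<in>A. G x * (f x)\<^sup>2) * (\<Sum>x\<in>A. G x * (g x)\<^sup>2)"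
proof -
  let ?a = "\<lambda>x. sqrt (G x) * f x" and ?b = "\<lambda>x. sqrt (G x) * g x"
  let ?P = "\<Sum>x\<in>A. (?a x)\<^sup>2" and ?Q = "\<Sum>x\<in>A. (?b x)\<^sup>2" and ?S = "\<Sum>x\<in>A. ?a x * ?b x"
  have "0 \<le> (\<Sum>x\<in>A. \<Sum>y\<in>A. (?a x * ?b y - ?a y * ?b x)\<^sup>2)"
    by (intro sum_nonneg) simp
  also have "\<dots> = (\<Sum>x\<in>A. \<Sum>y\<in>A. (?a x)\<^sup>2 * (?b y)\<^sup>2 + (?a y)\<^sup>2 * (?b x)\<^sup>2 - 2 * ((?a x * ?b x) * (?a y * ?b y)))"
    by (intro sum.cong refl) (simp add: power2_diff power_mult_distrib algebra_simps)
  also have "\<dots> = ?P * ?Q + ?P * ?Q - 2 * (?S * ?S)"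
  proof -
    have 1: "(\<Sum>x\<in>A. \<Sum>y\<in>A. (?a x)\<^sup>2 * (?b y)\<^sup>2) = ?P * ?Q" by (simp add: sum_product)
    have 2: "(\<Sum>x\<in>A. \<Sum>y\<in>A. (?a y)\<^sup>2 * (?b x)\<^sup>2) = ?P * ?Q"
      by (subst sum.swap) (simp add: sum_product)
    have 3: "(\<Sum>x\<in>A. \<Sum>y\<in>A. 2 * ((?a x * ?b x) * (?a y * ?b y))) = 2 * (?S * ?S)"
      unfolding sum_product by (simp only: sum_distrib_left)
    show ?thesis by (simp only: sum.distrib sum_subtractf 1 2 3)
  qed
  finally have "?S\<^sup>2 \<le> ?P * ?Q" by (simp add: power2_eq_square)
  moreover have "?S = (\<Sum>x\<in>A. G x * f x * g x)"
    by (intro sum.cong refl) (use assms in \<open>simp add: algebra_simps power2_eq_square flip: real_sqrt_mult\<close>)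
  moreover have "?P = (\<Sum>x\<in>A. G x * (f x)\<^sup>2)" "?Q = (\<Sum>x\<in>A. G x * (g x)\<^sup>2)"
    using assms by (simp_all add: power_mult_distrib)
  ultimately show ?thesis by simp
qed

lemma avg_Cauchy_Schwarz:
  assumes "\<And>\<psi>. \<psi> \<in> PiE W Y \<Longrightarrow> 0 \<le> G \<psi>"
  shows "(avg W Y (\<lambda>\<psi>. G \<psi> * f \<psi> * g \<psi>))\<^sup>2
       \<le> avg W Y (\<lambda>\<psi>. G \<psi> * (f \<psi>)\<^sup>2) * avg W Y (\<lambda>\<psi>. G \<psi> * (g \<psi>)\<^sup>2)"
  using sum_Cauchy_Schwarz_weighted[of "PiE W Y" G f g, OF assms]
  by (simp add: avg_def power_divide power2_eq_square divide_right_mono)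

section \<open>Complexes with at most four vertices per part\<close>

text \<open>The vertex \<open>(j, i)\<close> is the \<open>i\<close>-th of four copies of part \<open>j\<close>; a complex need not use all of
  them. Weights take the index set of an edge as a separate argument, so that they can be normalised by densities.\<close>

definition cross :: "'j set \<Rightarrow> ('j \<times> nat) set set" where
  "cross J = {e. e \<subseteq> J \<times> {..<4} \<and> inj_on fst e}"

definition cpx :: "'j set \<Rightarrow> ('j \<times> nat) set set \<Rightarrow> bool" where
  "cpx J R \<longleftrightarrow> R \<subseteq> cross J \<and> (\<forall>e\<in>R. \<forall>e'\<subseteq>e. e' \<in> R)"

definition away :: "'j \<Rightarrow> ('j \<times> nat) set set" where
  "away j = {e. j \<notin> fst ` e}"

text \<open>\<open>RZ\<close> collects the edges avoiding part \<open>j\<close>, and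
  \<open>L i\<close> is the link of copy \<open>i\<close> of \<open>j\<close>. Taking
  \<open>L i\<close> empty deletes that copy, while the sample space keeps all four.\<close>

definition ext :: "'j \<Rightarrow> ('j \<times> nat) set set \<Rightarrow> (nat \<Rightarrow> ('j \<times> nat) set set) \<Rightarrow> ('j \<times> nat) set set" where
  "ext j RZ L = RZ \<union> (\<Union>i<4. insert (j, i) ` L i)"

definition wprod :: "('j set \<Rightarrow> 'a set \<Rightarrow> real) \<Rightarrow> ('j \<times> nat) set set \<Rightarrow> ('j \<times> nat \<Rightarrow> 'a) \<Rightarrow> real" where
  "wprod g R \<psi> = (\<Prod>e\<in>R. g (fst ` e) (\<psi> ` e))"

text \<open>Edges in \<open>R\<close> carry the majorant \<open>\<nu>\<close>, those in
  \<open>T\<close> the relative weight \<open>\<theta>\<close> on top of it. The average always runs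
  over four copies of every part; copies outside the complex integrate out.\<close>

definition cnt :: "'j set \<Rightarrow> ('j \<Rightarrow> 'a set) \<Rightarrow> ('j set \<Rightarrow> 'a set \<Rightarrow> real) \<Rightarrow> ('j set \<Rightarrow> 'a set \<Rightarrow> real) \<Rightarrow>
    ('j \<times> nat) set set \<Rightarrow> ('j \<times> nat) set set \<Rightarrow> real" where
  "cnt J V \<nu> \<theta> R T = avg (J \<times> {..<4}) (\<lambda>w. V (fst w)) (\<lambda>\<psi>. wprod \<nu> R \<psi> * wprod \<theta> T \<psi>)"

text \<open>The conditional expectation, given the other vertices, of the factors at one copy of
  part \<open>j\<close>. The number of the copy does not enter, since the copies are identically
  distributed.\<close>

definition lnk :: "('j \<Rightarrow> 'a set) \<Rightarrow> ('j set \<Rightarrow> 'a set \<Rightarrow> real) \<Rightarrow> ('j set \<Rightarrow> 'a set \<Rightarrow> real) \<Rightarrow> 'j \<Rightarrow>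
    ('j \<times> nat) set set \<Rightarrow> ('j \<times> nat) set set \<Rightarrow> ('j \<times> nat \<Rightarrow> 'a) \<Rightarrow> real" where
  "lnk V \<nu> \<theta> j L L' \<psi> = (\<Sum>v\<in>V j. (\<Prod>t\<in>L. \<nu> (insert j (fst ` t)) (insert v (\<psi> ` t))) *
      (\<Prod>t\<in>L'. \<theta> (insert j (fst ` t)) (insert v (\<psi> ` t)))) / real (card (V j))"

lemma finite_cross: "finite J \<Longrightarrow> finite (cross J)"
  by (rule finite_subset[of _ "Pow (J \<times> {..<4})"]) (auto simp: cross_def)

lemma finite_of_cross: "finite J \<Longrightarrow> R \<subseteq> cross J \<Longrightarrow> finite R"
  using finite_cross finite_subset by blast

lemma away_notin: "t \<in> away j \<Longrightarrow> (j, i) \<notin> t"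
  by (force simp: away_def)

lemma prod_ext:
  assumes "finite RZ" "\<And>i. i < 4 \<Longrightarrow> finite (L i)" "RZ \<subseteq> away j" "\<And>i. i < 4 \<Longrightarrow> L i \<subseteq> away j"
  shows "(\<Prod>e\<in>ext j RZ L. h e) = (\<Prod>e\<in>RZ. h e) * (\<Prod>i<4::nat. \<Prod>t\<in>L i. h (insert (j, i) t))"
proof -
  have notin: "(j, i) \<notin> t" if "t \<in> L i'" "i' < 4" for t i i'
    by (rule away_notin[OF subsetD[OF assms(4)[OF that(2)] that(1)]])
  have inj: "inj_on (insert (j, i)) (L i)" if "i < 4" for i
    by (rule inj_onI) (simp add: insert_ident notin that)
  have "(\<Prod>e\<in>ext j RZ L. h e) = (\<Prod>e\<in>RZ. h e) * (\<Prod>e\<in>(\<Union>i<4. insert (j, i) ` L i). h e)"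
    unfolding ext_def
    by (rule prod.union_disjoint) (use assms in \<open>auto dest: away_notin\<close>)
  also have "(\<Prod>e\<in>(\<Union>i<4. insert (j, i) ` L i). h e) = (\<Prod>i<4. \<Prod>e\<in>insert (j, i) ` L i. h e)"
  proof (rule prod.UNION_disjoint)
    show "\<forall>i\<in>{..<4}. \<forall>i'\<in>{..<4}. i \<noteq> i' \<longrightarrow> insert (j, i) ` L i \<inter> insert (j, i') ` L i' = {}"
    proof (intro ballI impI equals0I)
      fix i i' e assume i: "i \<in> {..<4::nat}" "i' \<in> {..<4::nat}" "i \<noteq> i'"
        and "e \<in> insert (j, i) ` L i \<inter> insert (j, i') ` L i'"
      then obtain t where "t \<in> L i'" "e = insert (j, i') t" "(j, i) \<in> e" by blast
      then show False using notin[of t i' i] i by auto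
    qed
  qed (use assms in auto)
  also have "\<dots> = (\<Prod>i<4. \<Prod>t\<in>L i. h (insert (j, i) t))"
    by (rule prod.cong) (simp_all add: prod.reindex[OF inj])
  finally show ?thesis .
qed

text \<open>An edge is injective on indices, so it contains at most one copy of \<open>j\<close>,
  and removing that copy leaves a member of its link.\<close>

lemma ext_decomp:
  assumes "R \<subseteq> cross J"
  shows "ext j {e\<in>R. j \<notin> fst ` e} (\<lambda>i. {t. j \<notin> fst ` t \<and> insert (j, i) t \<in> R}) = R" (is "?E = R")
proof
  show "?E \<subseteq> R" by (auto simp: ext_def)
  show "R \<subseteq> ?E"
  proof
    fix e assume e: "e \<in> R"
    show "e \<in> ?E"
    proof (cases "j \<in> fst ` e")
      case True
      then obtain i where i: "(j, i) \<in> e" by auto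
      have "i < 4" "inj_on fst e" using e i assms by (auto simp: cross_def)
      then have "i' = i" if "(j, i') \<in> e" for i' using inj_onD[of fst e "(j, i)" "(j, i')"] i that by simp
      then have "j \<notin> fst ` (e - {(j, i)})" by auto
      moreover have "insert (j, i) (e - {(j, i)}) = e" using i by auto
      ultimately have "e - {(j, i)} \<in> {t. j \<notin> fst ` t \<and> insert (j, i) t \<in> R}" "e = insert (j, i) (e - {(j, i)})"
        using e by simp_all
      then show ?thesis using \<open>i < 4\<close> unfolding ext_def by blast
    qed (use e in \<open>simp add: ext_def\<close>)
  qed
qed

lemma ext_cpx:
  assumes "cpx J RZ" "RZ \<subseteq> away j" "j \<in> J"
    and "\<And>i. i < 4 \<Longrightarrow> L i \<subseteq> RZ" "\<And>i e e'. i < 4 \<Longrightarrow> e \<in> L i \<Longrightarrow> e' \<subseteq> e \<Longrightarrow> e' \<in> L i"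
  shows "cpx J (ext j RZ L)"
  unfolding cpx_def
proof (intro conjI subsetI ballI allI impI)
  fix e assume "e \<in> ext j RZ L"
  then consider "e \<in> RZ" | i t where "i < 4" "t \<in> L i" "e = insert (j, i) t" by (auto simp: ext_def)
  then show "e \<in> cross J"
  proof cases
    case 2
    then have t: "t \<in> cross J" "j \<notin> fst ` t" using assms(1,2) assms(4)[of i] by (auto simp: cpx_def away_def)
    then show ?thesis using 2 assms(3) by (auto simp: cross_def)
  qed (use assms(1) in \<open>auto simp: cpx_def\<close>)
next
  fix e e' assume "e \<in> ext j RZ L" and e': "e' \<subseteq> e"
  then consider "e \<in> RZ" | i t where "i < 4" "t \<in> L i" "e = insert (j, i) t" by (auto simp: ext_def)
  then show "e' \<in> ext j RZ L"
  proof cases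
    case 1 then show ?thesis using assms(1) e' by (auto simp: cpx_def ext_def)
  next
    case 2
    have t': "e' - {(j, i)} \<in> L i" by (rule assms(5)[OF 2(1,2)]) (use 2 e' in auto)
    show ?thesis
    proof (cases "(j, i) \<in> e'")
      case True
      then have "e' = insert (j, i) (e' - {(j, i)})" by auto
      then show ?thesis using t' 2(1) unfolding ext_def by blast
    next
      case False
      then have "e' \<in> RZ" using t' assms(4)[OF 2(1)] by auto
      then show ?thesis by (simp add: ext_def)
    qed
  qed
qed

lemma wprod_upd:
  assumes "R \<subseteq> away j"
  shows "wprod g R (\<psi>((j, i) := v)) = wprod g R \<psi>"
proof -
  have "(\<psi>((j, i) := v)) ` e = \<psi> ` e" if "e \<in> R" for e
    using away_notin[of e j i] assms that by (auto simp: fun_upd_image)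
  then show ?thesis by (simp add: wprod_def)
qed

lemma link_prod_upd:
  assumes "L \<subseteq> away j"
  shows "(\<Prod>t\<in>L. g (insert j (fst ` t)) (insert v (\<psi>((j, i) := v') ` t)))
       = (\<Prod>t\<in>L. g (insert j (fst ` t)) (insert v (\<psi> ` t)))"
proof -
  have "(\<psi>((j, i) := v')) ` e = \<psi> ` e" if "e \<in> L" for e
    using away_notin[of e j i] assms that by (auto simp: fun_upd_image)
  then show ?thesis by simp
qed

lemma lnk_upd:
  assumes "L \<subseteq> away j" "L' \<subseteq> away j"
  shows "lnk V \<nu> \<theta> j L L' (\<psi>((j, i) := v)) = lnk V \<nu> \<theta> j L L' \<psi>"
  by (simp only: lnk_def link_prod_upd[OF assms(1)] link_prod_upd[OF assms(2)])

text \<open>Given the images of the other parts, the four copies of part \<open>j\<close> are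
  independent, because no edge contains two of them. The expectation therefore factors into four
  conditional means.\<close>

lemma cnt_ext:
  fixes V :: "'j \<Rightarrow> 'a set"
  assumes fin: "finite J" "\<And>j. j \<in> J \<Longrightarrow> finite (V j) \<and> V j \<noteq> {}" and j: "j \<in> J"
    and RZ: "RZ \<subseteq> cross J \<inter> away j" and L: "\<And>i. i < 4 \<Longrightarrow> L i \<subseteq> cross J \<inter> away j"
    and TZ: "TZ \<subseteq> cross J \<inter> away j" and L': "\<And>i. i < 4 \<Longrightarrow> L' i \<subseteq> cross J \<inter> away j"
  shows "cnt J V \<nu> \<theta> (ext j RZ L) (ext j TZ L')
       = avg (J \<times> {..<4}) (\<lambda>w. V (fst w))
           (\<lambda>\<psi>. wprod \<nu> RZ \<psi> * wprod \<theta> TZ \<psi> * (\<Prod>i<4::nat. lnk V \<nu> \<theta> j (L i) (L' i) \<psi>))"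
proof -
  let ?W = "J \<times> {..<4::nat}" and ?Y = "\<lambda>w. V (fst w)"
  define h where "h i v \<psi> = (\<Prod>t\<in>L i. \<nu> (insert j (fst ` t)) (insert v (\<psi> ` t))) *
      (\<Prod>t\<in>L' i. \<theta> (insert j (fst ` t)) (insert v (\<psi> ` t)))" for i v \<psi>
  define G where "G \<psi> = wprod \<nu> RZ \<psi> * wprod \<theta> TZ \<psi>" for \<psi>
  have nef: "nefin ?W ?Y" using fin by (auto simp: nefin_def)
  have fins: "finite RZ" "finite TZ" "\<And>i. i < 4 \<Longrightarrow> finite (L i)" "\<And>i. i < 4 \<Longrightarrow> finite (L' i)"
    using RZ TZ L L' finite_of_cross[OF fin(1)] by (meson le_infE)+
  have w1: "wprod \<nu> (ext j RZ L) \<psi> = wprod \<nu> RZ \<psi> * (\<Prod>i<4::nat. \<Prod>t\<in>L i. \<nu> (insert j (fst ` t)) (insert (\<psi> (j, i)) (\<psi> ` t)))" for \<psi>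
    unfolding wprod_def by (subst prod_ext) (use fins RZ L in auto)
  have w2: "wprod \<theta> (ext j TZ L') \<psi> = wprod \<theta> TZ \<psi> * (\<Prod>i<4::nat. \<Prod>t\<in>L' i. \<theta> (insert j (fst ` t)) (insert (\<psi> (j, i)) (\<psi> ` t)))" for \<psi>
    unfolding wprod_def by (subst prod_ext) (use fins TZ L' in auto)
  have start: "cnt J V \<nu> \<theta> (ext j RZ L) (ext j TZ L') = avg ?W ?Y (\<lambda>\<psi>. G \<psi> * (\<Prod>i<4::nat. h i (\<psi> (j, i)) \<psi>))"
    unfolding cnt_def w1 w2 G_def h_def by (simp only: prod.distrib mult_ac)
  have hupd: "h i v (\<psi>((j, i') := v')) = h i v \<psi>" if "i < 4" for i i' v v' \<psi>
    unfolding h_def using L[OF that] L'[OF that]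
    by (intro arg_cong2[where f = "(*)"] link_prod_upd) auto
  have Gupd: "G (\<psi>((j, i') := v')) = G \<psi>" for i' v' \<psi>
    unfolding G_def using RZ TZ by (simp add: wprod_upd)
  have hl: "lnk V \<nu> \<theta> j (L i) (L' i) \<psi> = (\<Sum>v\<in>V j. h i v \<psi>) / real (card (V j))" for i \<psi>
    by (simp add: lnk_def h_def)
  \<comment> \<open>Hybrid argument: copies below \<open>n\<close> have already been replaced by
    their conditional means, the others are still sampled.\<close>
  have step: "avg ?W ?Y (\<lambda>\<psi>. G \<psi> * (\<Prod>i<n. lnk V \<nu> \<theta> j (L i) (L' i) \<psi>) * (\<Prod>i\<in>{n..<4::nat}. h i (\<psi> (j, i)) \<psi>))
     = avg ?W ?Y (\<lambda>\<psi>. G \<psi> * (\<Prod>i<4::nat. h i (\<psi> (j, i)) \<psi>))" if "n \<le> 4" for n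
    using that
  proof (induction n)
    case 0
    then show ?case by (simp add: lessThan_atLeast0)
  next
    case (Suc n)
    let ?g = "\<lambda>\<psi>. G \<psi> * (\<Prod>i<n. lnk V \<nu> \<theta> j (L i) (L' i) \<psi>) * (\<Prod>i\<in>{Suc n..<4::nat}. h i (\<psi> (j, i)) \<psi>)"
    have n4: "n < 4" using Suc.prems by simp
    have gupd: "?g (\<psi>((j, n) := v)) = ?g \<psi>" for \<psi> v
    proof -
      have "(\<Prod>i<n. lnk V \<nu> \<theta> j (L i) (L' i) (\<psi>((j, n) := v))) = (\<Prod>i<n. lnk V \<nu> \<theta> j (L i) (L' i) \<psi>)"
      proof (rule prod.cong[OF refl])
        fix i assume "i \<in> {..<n}"
        then have "i < 4" using n4 by simp
        then show "lnk V \<nu> \<theta> j (L i) (L' i) (\<psi>((j, n) := v)) = lnk V \<nu> \<theta> j (L i) (L' i) \<psi>"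
          using L[of i] L'[of i] by (simp add: lnk_upd)
      qed
      moreover have "(\<Prod>i\<in>{Suc n..<4::nat}. h i ((\<psi>((j, n) := v)) (j, i)) (\<psi>((j, n) := v))) = (\<Prod>i\<in>{Suc n..<4::nat}. h i (\<psi> (j, i)) \<psi>)"
        by (rule prod.cong[OF refl]) (simp add: hupd)
      ultimately show ?thesis by (simp only: Gupd)
    qed
    have "avg ?W ?Y (\<lambda>\<psi>. G \<psi> * (\<Prod>i<Suc n. lnk V \<nu> \<theta> j (L i) (L' i) \<psi>) * (\<Prod>i\<in>{Suc n..<4::nat}. h i (\<psi> (j, i)) \<psi>))
        = avg ?W ?Y (\<lambda>\<psi>. ?g \<psi> * ((\<Sum>v\<in>?Y (j, n). h n v \<psi>) / real (card (?Y (j, n)))))"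
      by (simp add: hl algebra_simps)
    also have "\<dots> = avg ?W ?Y (\<lambda>\<psi>. ?g \<psi> * h n (\<psi> (j, n)) \<psi>)"
    proof (rule avg_pull_coord[symmetric])
      show "nefin ?W ?Y" by (rule nef)
      show "(j, n) \<in> ?W" using j n4 by simp
      show "?g (\<psi>((j, n) := v)) = ?g \<psi>" for \<psi> v by (rule gupd)
      show "h n v' (\<psi>((j, n) := v)) = h n v' \<psi>" for \<psi> v v' by (rule hupd[OF n4])
    qed
    also have "\<dots> = avg ?W ?Y (\<lambda>\<psi>. G \<psi> * (\<Prod>i<n. lnk V \<nu> \<theta> j (L i) (L' i) \<psi>) * (\<Prod>i\<in>{n..<4::nat}. h i (\<psi> (j, i)) \<psi>))"
      by (simp add: prod.atLeast_Suc_lessThan[OF n4] mult_ac)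
    finally show ?case using Suc by simp
  qed
  show ?thesis unfolding start using step[of 4] by (simp add: G_def)
qed

section \<open>Counting with bounded relative weights\<close>

text \<open>The assumption on counts plays the part of a linear forms condition:
  \<open>\<nu>\<close> is an unbounded majorant, known only through the counts of complexes with
  four copies per part.\<close>

locale pseudorandom =
  fixes J :: "'j set" and V :: "'j \<Rightarrow> 'a set" and \<nu> :: "'j set \<Rightarrow> 'a set \<Rightarrow> real" and \<beta> :: real
  assumes finite_J: "finite J"
    and V: "\<And>j. j \<in> J \<Longrightarrow> finite (V j) \<and> V j \<noteq> {}"
    and \<nu>_nonneg: "\<And>f s. s \<subseteq> (\<Union>j\<in>J. V j) \<Longrightarrow> 0 \<le> \<nu> f s"
    and \<beta>: "0 \<le> \<beta>" "\<beta> \<le> 1"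
    and counts: "\<And>R. cpx J R \<Longrightarrow> \<bar>cnt J V \<nu> \<nu> R {} - 1\<bar> \<le> \<beta>"
begin

abbreviation "Y \<equiv> (\<lambda>w::'j \<times> nat. V (fst w))"
abbreviation "W \<equiv> J \<times> {..<4::nat}"
abbreviation "E \<equiv> avg W Y"

definition relative :: "('j set \<Rightarrow> 'a set \<Rightarrow> real) \<Rightarrow> bool" where
  "relative \<theta> \<longleftrightarrow> (\<forall>f s. s \<subseteq> (\<Union>j\<in>J. V j) \<longrightarrow> 0 \<le> \<theta> f s \<and> \<theta> f s \<le> 1)"

lemma nefin_W: "nefin W Y"
  using finite_J V by (auto simp: nefin_def)

lemma cnt_empty: "cnt J V \<nu> \<theta> R {} = cnt J V \<nu> \<nu> R {}"
  by (simp add: cnt_def wprod_def)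

lemma counts': "cpx J R \<Longrightarrow> \<bar>cnt J V \<nu> \<theta> R {} - 1\<bar> \<le> \<beta>"
  unfolding cnt_empty[of \<theta>] by (rule counts)

lemma image_cross: "\<psi> \<in> PiE W Y \<Longrightarrow> e \<in> cross J \<Longrightarrow> \<psi> ` e \<subseteq> (\<Union>j\<in>J. V j)"
proof
  fix x assume "\<psi> \<in> PiE W Y" "e \<in> cross J" "x \<in> \<psi> ` e"
  then obtain w where "w \<in> e" "x = \<psi> w" "w \<in> W" by (auto simp: cross_def)
  then show "x \<in> (\<Union>j\<in>J. V j)" using PiE_mem[OF \<open>\<psi> \<in> PiE W Y\<close>, of w] by auto
qed

lemma relativeD:
  assumes "relative \<theta>" "s \<subseteq> (\<Union>j\<in>J. V j)"
  shows "0 \<le> \<theta> f s" "\<theta> f s \<le> 1"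
  using assms by (auto simp: relative_def)

lemma wprod_\<nu>_nonneg: "R \<subseteq> cross J \<Longrightarrow> \<psi> \<in> PiE W Y \<Longrightarrow> 0 \<le> wprod \<nu> R \<psi>"
  unfolding wprod_def by (intro prod_nonneg ballI \<nu>_nonneg image_cross) auto

lemma wprod_\<theta>_bounds:
  assumes "relative \<theta>" "R \<subseteq> cross J" "\<psi> \<in> PiE W Y"
  shows "0 \<le> wprod \<theta> R \<psi>" "wprod \<theta> R \<psi> \<le> 1"
proof -
  have "0 \<le> \<theta> (fst ` e) (\<psi> ` e) \<and> \<theta> (fst ` e) (\<psi> ` e) \<le> 1" if "e \<in> R" for e
    using relativeD[OF assms(1) image_cross[OF assms(3) subsetD[OF assms(2) that]]] by simp
  then show "0 \<le> wprod \<theta> R \<psi>" "wprod \<theta> R \<psi> \<le> 1"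
    unfolding wprod_def by (auto intro: prod_nonneg prod_le_1)
qed

lemma lnk_bounds:
  assumes "relative \<theta>" "L \<subseteq> cross J" "L' \<subseteq> cross J" "\<psi> \<in> PiE W Y" "j \<in> J"
  shows "0 \<le> lnk V \<nu> \<theta> j L L' \<psi>" "lnk V \<nu> \<theta> j L L' \<psi> \<le> lnk V \<nu> \<theta> j L {} \<psi>"
proof -
  let ?n = "\<lambda>v. \<Prod>t\<in>L. \<nu> (insert j (fst ` t)) (insert v (\<psi> ` t))"
  let ?t = "\<lambda>v. \<Prod>t\<in>L'. \<theta> (insert j (fst ` t)) (insert v (\<psi> ` t))"
  have sub: "insert v (\<psi> ` t) \<subseteq> (\<Union>j\<in>J. V j)" if "v \<in> V j" "t \<in> cross J" for v t
    using image_cross[OF assms(4) that(2)] that(1) assms(5) by auto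
  have n: "0 \<le> ?n v" if "v \<in> V j" for v
    using that assms(2) by (intro prod_nonneg ballI \<nu>_nonneg sub) auto
  have th: "0 \<le> \<theta> (insert j (fst ` t)) (insert v (\<psi> ` t)) \<and> \<theta> (insert j (fst ` t)) (insert v (\<psi> ` t)) \<le> 1"
    if "v \<in> V j" "t \<in> L'" for v t
    using relativeD[OF assms(1) sub[OF that(1) subsetD[OF assms(3) that(2)]]] by simp
  have t: "0 \<le> ?t v \<and> ?t v \<le> 1" if "v \<in> V j" for v
    using th[OF that] by (auto intro: prod_nonneg prod_le_1)
  show "0 \<le> lnk V \<nu> \<theta> j L L' \<psi>"
    unfolding lnk_def using n t by (intro divide_nonneg_nonneg sum_nonneg) auto
  show "lnk V \<nu> \<theta> j L L' \<psi> \<le> lnk V \<nu> \<theta> j L {} \<psi>"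
    unfolding lnk_def using n t by (intro divide_right_mono sum_mono) (auto intro!: mult_left_le)
qed

lemma lnk_trivial: "j \<in> J \<Longrightarrow> lnk V \<nu> \<theta> j {} {} \<psi> = 1"
  using V[of j] by (simp add: lnk_def)

definition downclosed_in :: "('j \<times> nat) set set \<Rightarrow> ('j \<times> nat) set set \<Rightarrow> bool" where
  "downclosed_in R L \<longleftrightarrow> L \<subseteq> R \<and> (\<forall>e\<in>L. \<forall>e'\<subseteq>e. e' \<in> L)"

text \<open>Joint moments of two links are counts: the copies below \<open>a\<close> carry
  \<open>A\<close>, the \<open>b\<close> copies from 2 on carry \<open>B\<close>, and a copy with
  empty link contributes the factor 1.\<close>

lemma lnk_moments:
  assumes "cpx J RZ" "RZ \<subseteq> away j" "j \<in> J" "downclosed_in RZ A" "downclosed_in RZ B" "a \<le> 2" "b \<le> 2"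
  shows "\<bar>E (\<lambda>\<psi>. wprod \<nu> RZ \<psi> * (lnk V \<nu> \<theta> j A {} \<psi> ^ a * lnk V \<nu> \<theta> j B {} \<psi> ^ b)) - 1\<bar> \<le> \<beta>"
proof -
  let ?L = "\<lambda>i::nat. if i < a then A else if 2 \<le> i \<and> i < 2 + b then B else {}"
  have RZ: "RZ \<subseteq> cross J" using assms(1) by (simp add: cpx_def)
  have "cpx J (ext j RZ ?L)"
    by (rule ext_cpx) (use assms in \<open>auto simp: downclosed_in_def split: if_splits\<close>)
  then have c: "\<bar>cnt J V \<nu> \<theta> (ext j RZ ?L) (ext j {} (\<lambda>_. {})) - 1\<bar> \<le> \<beta>"
    using counts'[of "ext j RZ ?L" \<theta>] by (simp add: ext_def)
  have "cnt J V \<nu> \<theta> (ext j RZ ?L) (ext j {} (\<lambda>_. {}))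
      = E (\<lambda>\<psi>. wprod \<nu> RZ \<psi> * wprod \<theta> {} \<psi> * (\<Prod>i<4::nat. lnk V \<nu> \<theta> j (?L i) {} \<psi>))"
    by (rule cnt_ext) (use finite_J V RZ assms in \<open>auto simp: downclosed_in_def\<close>)
  moreover have "(\<Prod>i<4::nat. lnk V \<nu> \<theta> j (?L i) {} \<psi>) = lnk V \<nu> \<theta> j A {} \<psi> ^ a * lnk V \<nu> \<theta> j B {} \<psi> ^ b" for \<psi>
  proof -
    have "a = 0 \<or> a = 1 \<or> a = 2" "b = 0 \<or> b = 1 \<or> b = 2" using assms(6,7) by auto
    then show ?thesis
      by (elim disjE) (simp_all add: eval_nat_numeral lnk_trivial assms(3))
  qed
  ultimately show ?thesis using c by (simp add: wprod_def)
qed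

text \<open>The error is the expectation of \<open>f - a\<close>, where \<open>f\<close> is the link of copy \<open>p\<close>, times the links
  of the other three copies. Cauchy--Schwarz with one of those beside \<open>f - a\<close> and two on the far side needs
  moments of order at most four, which four copies provide.\<close>

lemma remove_vertex:
  assumes \<theta>: "relative \<theta>" and RZ: "cpx J RZ" "RZ \<subseteq> away j" and j: "j \<in> J"
    and L: "\<And>i. i < 4 \<Longrightarrow> downclosed_in RZ (L i)" and L': "\<And>i. i < 4 \<Longrightarrow> L' i \<subseteq> L i"
    and TZ: "TZ \<subseteq> RZ" and p: "p < 4" and a: "0 \<le> a" "a \<le> 1"
  shows "\<bar>cnt J V \<nu> \<theta> (ext j RZ L) (ext j TZ L')
      - a * cnt J V \<nu> \<theta> (ext j RZ (L(p := {}))) (ext j TZ (L'(p := {})))\<bar>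
    \<le> sqrt (8 * E (\<lambda>\<psi>. wprod \<nu> RZ \<psi> * (lnk V \<nu> \<theta> j (L p) (L' p) \<psi> - a)\<^sup>2) + 128 * \<beta>)"
proof -
  let ?G = "wprod \<nu> RZ" and ?T = "wprod \<theta> TZ"
  let ?F = "\<lambda>i. lnk V \<nu> \<theta> j (L i) (L' i)" and ?H = "\<lambda>i. lnk V \<nu> \<theta> j (L i) {}"
  have RZc: "RZ \<subseteq> cross J" using RZ(1) by (simp add: cpx_def)
  have Lc: "L i \<subseteq> cross J" "L i \<subseteq> away j" "L' i \<subseteq> cross J" "L' i \<subseteq> away j" if "i < 4" for i
    using L[OF that] L'[OF that] RZc RZ(2) by (auto simp: downclosed_in_def)
  obtain q r s where qrs: "{..<4} = {p, q, r, s}" "p \<noteq> q" "p \<noteq> r" "p \<noteq> s" "q \<noteq> r" "q \<noteq> s" "r \<noteq> (s::nat)"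
    "q < 4" "r < 4" "s < 4"
  proof -
    have four: "{..<4} = {0, 1, 2, 3::nat}" by auto
    consider "p = 0" | "p = 1" | "p = 2" | "p = 3" using p by linarith
    then show thesis
    proof cases
      case 1 then show thesis using that[of 1 2 3] four by simp
    next
      case 2 then show thesis using that[of 0 2 3] four by (simp add: insert_commute)
    next
      case 3 then show thesis using that[of 0 1 3] four by (simp add: insert_commute)
    next
      case 4 then show thesis using that[of 0 1 2] four by (simp add: insert_commute)
    qed
  qed
  have prod4: "(\<Prod>i<4. x i) = x p * x q * x r * x s" for x :: "nat \<Rightarrow> real"
    using qrs by simp
  have c1: "cnt J V \<nu> \<theta> (ext j RZ L) (ext j TZ L') = E (\<lambda>\<psi>. ?G \<psi> * ?T \<psi> * (?F p \<psi> * ?F q \<psi> * ?F r \<psi> * ?F s \<psi>))"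
    by (subst prod4[symmetric, of "\<lambda>i. ?F i _"], rule cnt_ext) (use finite_J V j Lc TZ RZc RZ(2) in auto)
  have c2: "cnt J V \<nu> \<theta> (ext j RZ (L(p := {}))) (ext j TZ (L'(p := {})))
      = E (\<lambda>\<psi>. ?G \<psi> * ?T \<psi> * (\<Prod>i<4::nat. lnk V \<nu> \<theta> j ((L(p := {})) i) ((L'(p := {})) i) \<psi>))"
    by (rule cnt_ext) (use finite_J V j Lc TZ RZc RZ(2) in \<open>auto split: if_splits\<close>)
  have c2': "\<dots> = E (\<lambda>\<psi>. ?G \<psi> * ?T \<psi> * (?F q \<psi> * ?F r \<psi> * ?F s \<psi>))"
    unfolding prod4 using qrs by (simp add: lnk_trivial[OF j])
  let ?D = "E (\<lambda>\<psi>. ?G \<psi> * (?F p \<psi> - a)\<^sup>2)"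
  let ?f = "\<lambda>\<psi>. \<bar>?F p \<psi> - a\<bar> * ?H q \<psi>" and ?g = "\<lambda>\<psi>. ?H r \<psi> * ?H s \<psi>"
  have G0: "0 \<le> ?G \<psi>" if "\<psi> \<in> PiE W Y" for \<psi> using wprod_\<nu>_nonneg[OF RZc that] .
  have Fb: "0 \<le> ?F i \<psi>" "?F i \<psi> \<le> ?H i \<psi>" if "\<psi> \<in> PiE W Y" "i < 4" for i \<psi>
    using lnk_bounds[OF \<theta> Lc(1,3)[OF that(2)] that(1) j] by auto
  have "\<bar>cnt J V \<nu> \<theta> (ext j RZ L) (ext j TZ L') - a * cnt J V \<nu> \<theta> (ext j RZ (L(p := {}))) (ext j TZ (L'(p := {})))\<bar>
     = \<bar>E (\<lambda>\<psi>. ?G \<psi> * ?T \<psi> * ((?F p \<psi> - a) * ?F q \<psi> * ?F r \<psi> * ?F s \<psi>))\<bar>"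
    unfolding c1 c2 c2' avg_cmult[symmetric] avg_diff[symmetric] by (simp add: algebra_simps)
  also have "\<dots> \<le> E (\<lambda>\<psi>. \<bar>?G \<psi> * ?T \<psi> * ((?F p \<psi> - a) * ?F q \<psi> * ?F r \<psi> * ?F s \<psi>)\<bar>)"
    by (rule avg_abs_le)
  also have "\<dots> \<le> E (\<lambda>\<psi>. ?G \<psi> * ?f \<psi> * ?g \<psi>)"
  proof (rule avg_mono)
    fix \<psi> assume \<psi>: "\<psi> \<in> PiE W Y"
    have T: "0 \<le> ?T \<psi>" "?T \<psi> \<le> 1" using wprod_\<theta>_bounds[OF \<theta> _ \<psi>] TZ RZc by auto
    have "\<bar>?G \<psi> * ?T \<psi> * ((?F p \<psi> - a) * ?F q \<psi> * ?F r \<psi> * ?F s \<psi>)\<bar>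
        = (?G \<psi> * \<bar>?F p \<psi> - a\<bar>) * (?T \<psi> * (?F q \<psi> * (?F r \<psi> * ?F s \<psi>)))"
      using G0[OF \<psi>] T Fb[OF \<psi>] qrs by (simp add: abs_mult mult_ac)
    also have "\<dots> \<le> (?G \<psi> * \<bar>?F p \<psi> - a\<bar>) * (1 * (?H q \<psi> * (?H r \<psi> * ?H s \<psi>)))"
      using G0[OF \<psi>] T Fb[OF \<psi> qrs(8)] Fb[OF \<psi> qrs(9)] Fb[OF \<psi> qrs(10)]
      by (intro mult_left_mono mult_mono) (auto intro!: mult_nonneg_nonneg order_trans[of 0 "?F _ _" "?H _ _"])
    finally show "\<bar>?G \<psi> * ?T \<psi> * ((?F p \<psi> - a) * ?F q \<psi> * ?F r \<psi> * ?F s \<psi>)\<bar> \<le> ?G \<psi> * ?f \<psi> * ?g \<psi>"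
      by (simp add: mult_ac)
  qed
  also have "\<dots> \<le> sqrt (8 * ?D + 128 * \<beta>)"
  proof (rule real_le_rsqrt)
    have D0: "0 \<le> ?D" by (rule avg_nonneg) (simp add: G0)
    have "(E (\<lambda>\<psi>. ?G \<psi> * ?f \<psi> * ?g \<psi>))\<^sup>2 \<le> E (\<lambda>\<psi>. ?G \<psi> * (?f \<psi>)\<^sup>2) * E (\<lambda>\<psi>. ?G \<psi> * (?g \<psi>)\<^sup>2)"
      by (rule avg_Cauchy_Schwarz) (rule G0)
    \<comment> \<open>The second factor is the moment of order two in both links on the far side,
      hence at most \<open>1 + \<beta>\<close>.\<close>
    also have "\<dots> \<le> (4 * ?D + 64 * \<beta>) * 2"
    proof (rule mult_mono)
      let ?m = "\<lambda>c d. E (\<lambda>\<psi>. ?G \<psi> * (?H p \<psi> ^ c * ?H q \<psi> ^ d))"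
      have m: "\<bar>?m c d - 1\<bar> \<le> \<beta>" if "c \<le> 2" "d \<le> 2" for c d
        by (rule lnk_moments) (use RZ j L[OF p] L[OF qrs(8)] that in auto)
      have "E (\<lambda>\<psi>. ?G \<psi> * (?f \<psi>)\<^sup>2) \<le> E (\<lambda>\<psi>. 4 * (?G \<psi> * (?F p \<psi> - a)\<^sup>2) + 4 * (?G \<psi> * ((?H p \<psi> + 1)\<^sup>2 * (?H q \<psi> - 1)\<^sup>2)))"
      proof (rule avg_mono)
        fix \<psi> assume \<psi>: "\<psi> \<in> PiE W Y"
        define F P Q where "F = ?F p \<psi>" and "P = ?H p \<psi>" and "Q = ?H q \<psi>"
        have FPQ: "0 \<le> F" "F \<le> P" "0 \<le> Q"
          using Fb[OF \<psi> p] Fb[OF \<psi> qrs(8)] by (auto simp: F_def P_def Q_def)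
        \<comment> \<open>The unbounded factor \<open>Q\<^sup>2\<close> has to go. Where
          \<open>Q \<le> 2\<close> this costs a factor 4; elsewhere
          \<open>Q \<le> 2 * (Q - 1)\<close>, and the term is charged to a moment of
          \<open>Q - 1\<close>, which is small.\<close>
        have "(F - a)\<^sup>2 * Q\<^sup>2 \<le> 4 * (F - a)\<^sup>2 + 4 * ((P + 1)\<^sup>2 * (Q - 1)\<^sup>2)"
        proof (cases "Q \<le> 2")
          case True
          then have "Q\<^sup>2 \<le> 2\<^sup>2" using FPQ by (intro power_mono) auto
          then have "(F - a)\<^sup>2 * Q\<^sup>2 \<le> (F - a)\<^sup>2 * 4" by (intro mult_left_mono) auto
          moreover have "0 \<le> (P + 1)\<^sup>2 * (Q - 1)\<^sup>2" by simp
          ultimately show ?thesis by linarith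
        next
          case False
          have "(F - a)\<^sup>2 \<le> (P + 1)\<^sup>2" using FPQ a by (intro abs_le_square_iff[THEN iffD1]) auto
          moreover have "Q\<^sup>2 \<le> (2 * (Q - 1))\<^sup>2" using False by (intro power_mono) auto
          ultimately have "(F - a)\<^sup>2 * Q\<^sup>2 \<le> (P + 1)\<^sup>2 * (2 * (Q - 1))\<^sup>2" by (intro mult_mono) auto
          moreover have "(P + 1)\<^sup>2 * (2 * (Q - 1))\<^sup>2 = 4 * ((P + 1)\<^sup>2 * (Q - 1)\<^sup>2)"
            by (simp only: power_mult_distrib) simp
          moreover have "0 \<le> (F - a)\<^sup>2" by simp
          ultimately show ?thesis by linarith
        qed
        then have "?G \<psi> * ((F - a)\<^sup>2 * Q\<^sup>2) \<le> ?G \<psi> * (4 * (F - a)\<^sup>2 + 4 * ((P + 1)\<^sup>2 * (Q - 1)\<^sup>2))"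
          using G0[OF \<psi>] by (rule mult_left_mono)
        then show "?G \<psi> * (?f \<psi>)\<^sup>2 \<le> 4 * (?G \<psi> * (?F p \<psi> - a)\<^sup>2) + 4 * (?G \<psi> * ((?H p \<psi> + 1)\<^sup>2 * (?H q \<psi> - 1)\<^sup>2))"
          by (simp add: F_def P_def Q_def power_mult_distrib algebra_simps)
      qed
      also have "\<dots> = 4 * ?D + 4 * E (\<lambda>\<psi>. ?G \<psi> * ((?H p \<psi> + 1)\<^sup>2 * (?H q \<psi> - 1)\<^sup>2))"
        by (simp add: avg_add avg_cmult)
      \<comment> \<open>All moments are within \<open>\<beta>\<close> of 1. The signed coefficients
        sum to \<open>(1 + 1)\<^sup>2 * (1 - 1)\<^sup>2 = 0\<close> and their absolute values to
        \<open>4 * 4 = 16\<close>, so only \<open>16 * \<beta>\<close> is left.\<close>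
      also have "E (\<lambda>\<psi>. ?G \<psi> * ((?H p \<psi> + 1)\<^sup>2 * (?H q \<psi> - 1)\<^sup>2))
          = ?m 2 2 - 2 * ?m 2 1 + ?m 2 0 + 2 * ?m 1 2 - 4 * ?m 1 1 + 2 * ?m 1 0 + ?m 0 2 - 2 * ?m 0 1 + ?m 0 0"
        unfolding avg_cmult[symmetric] avg_diff[symmetric] avg_add[symmetric]
        by (rule avg_cong) (simp add: power2_eq_square algebra_simps)
      also have "\<dots> \<le> 16 * \<beta>"
        using m[of 2 2] m[of 2 1] m[of 2 0] m[of 1 2] m[of 1 1] m[of 1 0] m[of 0 2] m[of 0 1] m[of 0 0]
        unfolding abs_le_iff by simp
      finally show "E (\<lambda>\<psi>. ?G \<psi> * (?f \<psi>)\<^sup>2) \<le> 4 * ?D + 64 * \<beta>" by simp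
      have "\<bar>E (\<lambda>\<psi>. ?G \<psi> * (?H r \<psi> ^ 2 * ?H s \<psi> ^ 2)) - 1\<bar> \<le> \<beta>"
        by (rule lnk_moments) (use RZ j L[OF qrs(9)] L[OF qrs(10)] in auto)
      then show "E (\<lambda>\<psi>. ?G \<psi> * (?g \<psi>)\<^sup>2) \<le> 2" using \<beta> by (simp add: power_mult_distrib)
      show "0 \<le> 4 * ?D + 64 * \<beta>" using D0 \<beta> by simp
      show "0 \<le> E (\<lambda>\<psi>. ?G \<psi> * (?g \<psi>)\<^sup>2)" by (rule avg_nonneg) (simp add: G0)
    qed
    finally show "(E (\<lambda>\<psi>. ?G \<psi> * ?f \<psi> * ?g \<psi>))\<^sup>2 \<le> 8 * ?D + 128 * \<beta>" by simp
  qed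
  finally show ?thesis .
qed

end

section \<open>Reduction of counts to octahedra\<close>

definition trans_edges :: "'j set \<Rightarrow> ('j \<Rightarrow> nat) \<Rightarrow> ('j \<times> nat) set set" where
  "trans_edges P u = {e \<in> oct_edges P u. fst ` e = P}"

text \<open>The parts in \<open>P\<close> have been brought to octahedral form, with \<open>u j\<close> copies of part \<open>j\<close>.\<close>

definition processed :: "'j set \<Rightarrow> ('j \<Rightarrow> nat) \<Rightarrow> ('j \<times> nat) set set \<Rightarrow> ('j \<times> nat) set set \<Rightarrow> bool" where
  "processed P u R T \<longleftrightarrow> (\<forall>j\<in>P. u j = 1 \<or> u j = 2) \<and>
     (\<forall>e\<in>T. P \<subseteq> fst ` e) \<and>
     (\<forall>e\<in>T. \<forall>s\<in>trans_edges P u. s \<union> {w\<in>e. fst w \<notin> P} \<in> T) \<and>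
     (\<forall>e\<in>R. \<forall>w\<in>e. fst w \<in> P \<longrightarrow> snd w < u (fst w))"

definition dprod :: "('j set \<Rightarrow> real) \<Rightarrow> ('j \<times> nat) set set \<Rightarrow> real" where
  "dprod d T = (\<Prod>e\<in>T. d (fst ` e))"

lemma dprod_bounds:
  assumes "\<And>f. 0 \<le> d f \<and> d f \<le> 1"
  shows "0 \<le> dprod d T" "dprod d T \<le> 1"
  unfolding dprod_def using assms by (auto intro: prod_nonneg prod_le_1)

lemma dprod_ext:
  assumes "finite TZ" "\<And>i. i < 4 \<Longrightarrow> finite (L i)" "TZ \<subseteq> away j" "\<And>i. i < 4 \<Longrightarrow> L i \<subseteq> away j"
  shows "dprod d (ext j TZ L) = dprod d TZ * (\<Prod>i<4::nat. \<Prod>t\<in>L i. d (insert j (fst ` t)))"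
  unfolding dprod_def by (subst prod_ext[OF assms]) simp_all

lemma trans_edges_insertE:
  assumes "s \<in> trans_edges (insert j P) u" "j \<notin> P"
  obtains i s' where "i < u j" "s' \<in> trans_edges P u" "s = insert (j, i) s'"
proof -
  have s: "s \<subseteq> oct_vertices (insert j P) u" "inj_on fst s" "fst ` s = insert j P"
    using assms(1) by (auto simp: trans_edges_def oct_edges_def)
  then obtain i where i: "(j, i) \<in> s" by force
  have uniq: "fst w \<noteq> j" if "w \<in> s - {(j, i)}" for w
    using inj_onD[OF s(2), of w "(j, i)"] i that by auto
  have "s - {(j, i)} \<subseteq> oct_vertices P u"
  proof
    fix w assume w: "w \<in> s - {(j, i)}"
    then show "w \<in> oct_vertices P u"
      using uniq[OF w] s(1) by (cases w) (auto simp: oct_vertices_def)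
  qed
  moreover have "inj_on fst (s - {(j, i)})" using s(2) by (auto intro: inj_on_subset)
  moreover have "fst ` (s - {(j, i)}) = P"
  proof
    show "fst ` (s - {(j, i)}) \<subseteq> P" using uniq s(3) by blast
    show "P \<subseteq> fst ` (s - {(j, i)})"
    proof
      fix x assume x: "x \<in> P"
      then have "x \<in> fst ` s" using s(3) by simp
      then obtain w where "w \<in> s" "fst w = x" by auto
      then show "x \<in> fst ` (s - {(j, i)})" using x assms(2) by (intro image_eqI[of _ _ w]) auto
    qed
  qed
  ultimately have "s - {(j, i)} \<in> trans_edges P u" by (simp add: trans_edges_def oct_edges_def)
  moreover have "i < u j" using s(1) i by (auto simp: oct_vertices_def)
  moreover have "s = insert (j, i) (s - {(j, i)})" using i by auto
  ultimately show thesis using that by blast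
qed

lemma trans_edges_cong:
  assumes "\<And>j. j \<in> P \<Longrightarrow> u j = u' j"
  shows "trans_edges P u = trans_edges P u'"
proof -
  have "oct_vertices P u = oct_vertices P u'" using assms by (auto simp: oct_vertices_def)
  then show ?thesis by (simp add: trans_edges_def oct_edges_def)
qed

lemma oct_edge_extends:
  assumes "e \<in> oct_edges P u" "\<And>j. j \<in> P \<Longrightarrow> 0 < u j"
  obtains s where "s \<in> trans_edges P u" "e \<subseteq> s"
proof
  let ?s = "e \<union> (\<lambda>j. (j, 0)) ` (P - fst ` e)"
  have e: "e \<subseteq> oct_vertices P u" "inj_on fst e" using assms(1) by (auto simp: oct_edges_def)
  have "inj_on fst ?s"
  proof (rule inj_onI)
    fix x y assume "x \<in> ?s" "y \<in> ?s" "fst x = fst y"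
    then show "x = y" using inj_onD[OF e(2), of x y] by (auto simp: image_iff)
  qed
  moreover have "?s \<subseteq> oct_vertices P u" using e(1) assms(2) by (auto simp: oct_vertices_def)
  moreover have "fst ` ?s = P"
  proof -
    have "fst ` e \<subseteq> P" using e(1) by (auto simp: oct_vertices_def)
    then show ?thesis by (auto simp: image_Un image_image)
  qed
  ultimately show "?s \<in> trans_edges P u" by (simp add: trans_edges_def oct_edges_def)
qed auto

context pseudorandom
begin

text \<open>Vertices in parts outside \<open>P\<close> are deleted one at a time. The variance of
  the link of a deleted vertex needs its first two moments, which are counts with one or two
  identical copies of that link; there part \<open>j\<close> is in octahedral form as well, so
  \<open>IH\<close> applies with \<open>insert j P\<close>. As the variance is at most
  \<open>4 * e1\<close> and \<open>\<beta> \<le> e1\<close>, the bound of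
  \<open>remove_vertex\<close> has \<open>8 * 4 + 128 = 160\<close> times \<open>e1\<close> under
  the root.\<close>

lemma count_step:
  assumes \<theta>: "relative \<theta>" and d: "\<And>f. 0 \<le> d f \<and> d f \<le> 1"
    and base: "\<And>P u. P \<subseteq> J \<Longrightarrow> P \<noteq> {} \<Longrightarrow> (\<forall>j\<in>P. u j = 1 \<or> u j = 2) \<Longrightarrow>
       \<bar>cnt J V \<nu> \<theta> (oct_edges P u) (trans_edges P u) - dprod d (trans_edges P u)\<bar> \<le> e0"
    and e0: "\<beta> \<le> e0" "e0 \<le> e1" and P: "P \<subseteq> J"
    and IH: "\<And>j u R T. j \<in> J - P \<Longrightarrow> cpx J R \<Longrightarrow> T \<subseteq> R \<Longrightarrow> {} \<notin> T \<Longrightarrow> processed (insert j P) u R T \<Longrightarrow>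
       \<bar>cnt J V \<nu> \<theta> R T - dprod d T\<bar> \<le> e1"
    and "cpx J R" "T \<subseteq> R" "{} \<notin> T" "processed P u R T"
  shows "\<bar>cnt J V \<nu> \<theta> R T - dprod d T\<bar> \<le> e0 + real (card {w\<in>\<Union>R. fst w \<notin> P}) * sqrt (160 * e1)"
  using assms(8-11)
proof (induction "card {w\<in>\<Union>R. fst w \<notin> P}" arbitrary: R T)
  case 0
  note R = \<open>cpx J R\<close> and T = \<open>T \<subseteq> R\<close> \<open>{} \<notin> T\<close> and pr = \<open>processed P u R T\<close>
  have Rc: "R \<subseteq> cross J" using R by (simp add: cpx_def)
  have fin: "finite (\<Union>R)"
    by (rule finite_subset[of _ W]) (use Rc finite_J in \<open>auto simp: cross_def\<close>)
  have X: "fst w \<in> P" if "e \<in> R" "w \<in> e" for e w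
  proof -
    have "finite {w\<in>\<Union>R. fst w \<notin> P}" by (rule finite_subset[OF _ fin]) auto
    then have "{w\<in>\<Union>R. fst w \<notin> P} = {}" using 0(1) by simp
    then show ?thesis using that by blast
  qed
  have u: "u j = 1 \<or> u j = 2" if "j \<in> P" for j using pr that by (auto simp: processed_def)
  \<comment> \<open>If \<open>T\<close> has an edge, closure under exchanging its part in
    \<open>P\<close> puts every top edge of the octahedron into \<open>T\<close>, and down-closure
    then puts the whole octahedron into \<open>R\<close>. Otherwise only a count of
    \<open>\<nu>\<close> is left.\<close>
  show ?case
  proof (cases "T = {}")
    case True
    then show ?thesis using counts'[OF R, of \<theta>] e0 0(1)[symmetric] by (simp add: dprod_def)
  next
    case False
    then obtain e where e: "e \<in> T" "e \<noteq> {}" using T by blast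
    have Roct: "R \<subseteq> oct_edges P u"
    proof
      fix e' assume e': "e' \<in> R"
      then have "inj_on fst e'" using Rc by (auto simp: cross_def)
      moreover have "e' \<subseteq> oct_vertices P u"
      proof
        fix w assume w: "w \<in> e'"
        then have "fst w \<in> P" "snd w < u (fst w)" using X[OF e' w] e' pr by (auto simp: processed_def)
        then show "w \<in> oct_vertices P u" by (cases w) (simp add: oct_vertices_def)
      qed
      ultimately show "e' \<in> oct_edges P u" by (simp add: oct_edges_def)
    qed
    have Ttr: "T = trans_edges P u"
    proof
      show "T \<subseteq> trans_edges P u"
      proof
        fix e' assume e': "e' \<in> T"
        then have "P \<subseteq> fst ` e'" using pr by (simp add: processed_def)
        moreover have "fst ` e' \<subseteq> P" using X[of e'] e' T by auto
        ultimately show "e' \<in> trans_edges P u" using Roct e' T by (auto simp: trans_edges_def)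
      qed
      have Z: "{w\<in>e. fst w \<notin> P} = {}" using X[of e] e T by auto
      have all: "\<forall>s\<in>trans_edges P u. s \<union> {w\<in>e. fst w \<notin> P} \<in> T"
        using pr e(1) unfolding processed_def by simp
      show "trans_edges P u \<subseteq> T" using all unfolding Z by auto
    qed
    have "oct_edges P u \<subseteq> R"
    proof
      fix e' assume "e' \<in> oct_edges P u"
      moreover have "0 < u j" if "j \<in> P" for j using u[OF that] by auto
      ultimately obtain s where "s \<in> trans_edges P u" "e' \<subseteq> s" by (rule oct_edge_extends)
      then show "e' \<in> R" using R T Ttr by (auto simp: cpx_def)
    qed
    then have "R = oct_edges P u" using Roct by simp
    moreover have "P \<noteq> {}" using e X[of e] T by auto
    ultimately show ?thesis
      using base[of P u] P u e0 0(1)[symmetric] unfolding Ttr by simp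
  qed
next
  case (Suc m)
  note R = \<open>cpx J R\<close> and T = \<open>T \<subseteq> R\<close> \<open>{} \<notin> T\<close> and pr = \<open>processed P u R T\<close>
  have Rc: "R \<subseteq> cross J" and Tc: "T \<subseteq> cross J" using R T by (auto simp: cpx_def)
  have fin: "finite (\<Union>R)"
    by (rule finite_subset[of _ W]) (use Rc finite_J in \<open>auto simp: cross_def\<close>)
  have Rd: "e' \<in> R" if "e \<in> R" "e' \<subseteq> e" for e e' using R that by (auto simp: cpx_def)
  have "{w\<in>\<Union>R. fst w \<notin> P} \<noteq> {}" using Suc(2) by (metis card.empty nat.distinct(1))
  then obtain j i where ji: "(j, i) \<in> \<Union>R" "j \<notin> P" by auto
  then have jJ: "j \<in> J" and i4: "i < 4" using Rc by (auto simp: cross_def)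
  define RZ L where "RZ = {e\<in>R. j \<notin> fst ` e}" and "L = (\<lambda>i'. {t. j \<notin> fst ` t \<and> insert (j, i') t \<in> R})"
  define TZ L' where "TZ = {e\<in>T. j \<notin> fst ` e}" and "L' = (\<lambda>i'. {t. j \<notin> fst ` t \<and> insert (j, i') t \<in> T})"
  have R_eq: "ext j RZ L = R" and T_eq: "ext j TZ L' = T"
    unfolding RZ_def L_def TZ_def L'_def by (rule ext_decomp[OF Rc], rule ext_decomp[OF Tc])
  have RZ: "cpx J RZ" "RZ \<subseteq> away j"
    using R unfolding cpx_def RZ_def away_def by (auto simp: image_iff)
  have L: "downclosed_in RZ (L i')" for i'
    unfolding downclosed_in_def
  proof (intro conjI subsetI ballI allI impI)
    fix t assume t: "t \<in> L i'"
    then show "t \<in> RZ" unfolding L_def RZ_def using Rd[of "insert (j, i') t" t] by auto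
    fix t' assume t': "t' \<subseteq> t"
    show "t' \<in> L i'"
      unfolding L_def using t Rd[of "insert (j, i') t" "insert (j, i') t'"] t' by (auto simp: L_def)
  qed
  have L': "L' i' \<subseteq> L i'" for i' using T by (auto simp: L_def L'_def)
  have Lsub: "L i' \<subseteq> cross J" "L i' \<subseteq> away j" "L' i' \<subseteq> cross J" "L' i' \<subseteq> away j" for i'
    using L[of i'] L'[of i'] RZ by (auto simp: downclosed_in_def cpx_def)
  have TZ: "TZ \<subseteq> RZ" using T by (auto simp: TZ_def RZ_def)
  have fins: "finite (L' i')" "finite TZ" for i'
    using finite_of_cross[OF finite_J] Lsub TZ RZ by (auto simp: cpx_def)
  \<comment> \<open>The expected link of \<open>(j, i)\<close>: the product of the densities of the
    edges of \<open>T\<close> at this vertex.\<close>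
  define a where "a = (\<Prod>t\<in>L' i. d (insert j (fst ` t)))"
  have a: "0 \<le> a" "a \<le> 1" unfolding a_def using d by (auto intro: prod_nonneg prod_le_1)
  define R1 T1 where "R1 = {e\<in>R. (j, i) \<notin> e}" and "T1 = {e\<in>T. (j, i) \<notin> e}"
  have upd: "{t. j \<notin> fst ` t \<and> insert (j, i') t \<in> {e\<in>S. (j, i) \<notin> e}} =
     ((\<lambda>i'. {t. j \<notin> fst ` t \<and> insert (j, i') t \<in> S})(i := {})) i'" for i' and S :: "('j \<times> nat) set set"
    by (auto simp: image_iff)
  have zer: "{e \<in> {e\<in>S. (j, i) \<notin> e}. j \<notin> fst ` e} = {e\<in>S. j \<notin> fst ` e}" for S :: "('j \<times> nat) set set"
    by (auto simp: image_iff)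
  have R1_eq: "ext j RZ (L(i := {})) = R1"
    using ext_decomp[of R1 J j] Rc unfolding R1_def upd zer RZ_def L_def by blast
  have T1_eq: "ext j TZ (L'(i := {})) = T1"
    using ext_decomp[of T1 J j] Tc unfolding T1_def upd zer TZ_def L'_def by blast
  have R1: "cpx J R1" using R by (auto simp: cpx_def R1_def)
  have T1: "T1 \<subseteq> R1" "{} \<notin> T1" using T by (auto simp: T1_def R1_def)
  have pr1: "processed P u R1 T1"
    unfolding processed_def
  proof (intro conjI ballI impI)
    fix e s assume es: "e \<in> T1" "s \<in> trans_edges P u"
    then have "(j, i) \<notin> s" using ji(2) by (force simp: trans_edges_def)
    then show "s \<union> {w\<in>e. fst w \<notin> P} \<in> T1" using es pr by (auto simp: processed_def T1_def)
  qed (use pr in \<open>auto simp: processed_def T1_def R1_def\<close>)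
  have "{w\<in>\<Union>R. fst w \<notin> P} = insert (j, i) {w\<in>\<Union>R1. fst w \<notin> P}"
  proof (rule equalityI; rule subsetI)
    fix w assume w: "w \<in> {w\<in>\<Union>R. fst w \<notin> P}"
    show "w \<in> insert (j, i) {w\<in>\<Union>R1. fst w \<notin> P}"
    proof (cases "w = (j, i)")
      case False
      obtain e where "e \<in> R" "w \<in> e" using w by auto
      then have "{w} \<in> R1" using Rd[of e "{w}"] False by (auto simp: R1_def)
      then show ?thesis using w by auto
    qed simp
  qed (use ji in \<open>auto simp: R1_def\<close>)
  moreover have "(j, i) \<notin> {w\<in>\<Union>R1. fst w \<notin> P}" by (auto simp: R1_def)
  moreover have "finite {w\<in>\<Union>R1. fst w \<notin> P}"
    by (rule finite_subset[OF _ fin]) (auto simp: R1_def)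
  ultimately have card1: "m = card {w\<in>\<Union>R1. fst w \<notin> P}" using Suc(2) by simp
  have IH1: "\<bar>cnt J V \<nu> \<theta> R1 T1 - dprod d T1\<bar> \<le> e0 + real m * sqrt (160 * e1)"
    using Suc(1)[OF card1 R1 T1 pr1] card1 by simp
  have dT: "dprod d T = a * dprod d T1"
  proof -
    have "dprod d T = dprod d TZ * (\<Prod>i<4::nat. \<Prod>t\<in>L' i. d (insert j (fst ` t)))"
      unfolding T_eq[symmetric] by (rule dprod_ext) (use fins TZ RZ Lsub in auto)
    moreover have "dprod d T1 = dprod d TZ * (\<Prod>i'<4::nat. \<Prod>t\<in>(L'(i := {})) i'. d (insert j (fst ` t)))"
      unfolding T1_eq[symmetric] by (rule dprod_ext) (use fins TZ RZ Lsub in auto)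
    moreover have "(\<Prod>i<4::nat. \<Prod>t\<in>L' i. d (insert j (fst ` t))) = a * (\<Prod>i'\<in>{..<4} - {i}. \<Prod>t\<in>L' i'. d (insert j (fst ` t)))"
      unfolding a_def by (rule prod.remove) (use i4 in auto)
    moreover have "(\<Prod>i'<4::nat. \<Prod>t\<in>(L'(i := {})) i'. d (insert j (fst ` t)))
        = (\<Prod>i'\<in>{..<4} - {i}. \<Prod>t\<in>L' i'. d (insert j (fst ` t)))"
      by (subst prod.remove[of _ i]) (use i4 in auto)
    ultimately show ?thesis by simp
  qed
  let ?F = "lnk V \<nu> \<theta> j (L i) (L' i)"
  \<comment> \<open>The copies below \<open>n\<close> all receive the link of copy \<open>i\<close>,
    the others an empty link. Part \<open>j\<close> thereby has \<open>n\<close> interchangeable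
    copies, as \<open>processed\<close> demands for \<open>insert j P\<close>.\<close>
  have mom: "\<bar>E (\<lambda>\<psi>. wprod \<nu> RZ \<psi> * ?F \<psi> ^ n) - a ^ n\<bar> \<le> e1" if "n = 1 \<or> n = 2" for n
  proof -
    let ?M = "\<lambda>i'::nat. if i' < n then L i else {}" and ?M' = "\<lambda>i'::nat. if i' < n then L' i else {}"
    have eq: "E (\<lambda>\<psi>. wprod \<nu> RZ \<psi> * ?F \<psi> ^ n) = cnt J V \<nu> \<theta> (ext j RZ ?M) (ext j {} ?M')"
    proof -
      have "(\<Prod>i'<4::nat. lnk V \<nu> \<theta> j (?M i') (?M' i') \<psi>) = ?F \<psi> ^ n" for \<psi>
        using that by (elim disjE) (simp_all add: eval_nat_numeral lnk_trivial jJ)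
      moreover have "cnt J V \<nu> \<theta> (ext j RZ ?M) (ext j {} ?M')
          = E (\<lambda>\<psi>. wprod \<nu> RZ \<psi> * wprod \<theta> {} \<psi> * (\<Prod>i'<4::nat. lnk V \<nu> \<theta> j (?M i') (?M' i') \<psi>))"
        by (rule cnt_ext) (use finite_J V jJ RZ Lsub in \<open>auto simp: cpx_def\<close>)
      ultimately show ?thesis by (simp add: wprod_def)
    qed
    have dn: "dprod d (ext j {} ?M') = a ^ n"
      by (subst dprod_ext) (use fins Lsub that in \<open>auto simp: dprod_def eval_nat_numeral a_def\<close>)
    have "\<bar>cnt J V \<nu> \<theta> (ext j RZ ?M) (ext j {} ?M') - dprod d (ext j {} ?M')\<bar> \<le> e1"
    proof (rule IH[of j _ _ "u(j := n)"])
      show "j \<in> J - P" using jJ ji by simp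
      show "cpx J (ext j RZ ?M)"
        by (rule ext_cpx) (use RZ jJ L[of i] in \<open>auto simp: downclosed_in_def split: if_splits\<close>)
      have "?M' i' \<subseteq> ?M i'" for i' using L'[of i] by auto
      then show "ext j {} ?M' \<subseteq> ext j RZ ?M" unfolding ext_def by blast
      show "{} \<notin> ext j {} ?M'" by (auto simp: ext_def)
      show "processed (insert j P) (u(j := n)) (ext j RZ ?M) (ext j {} ?M')"
        unfolding processed_def
      proof (intro conjI ballI impI)
        show "(u(j := n)) j' = 1 \<or> (u(j := n)) j' = 2" if "j' \<in> insert j P" for j'
          using that \<open>n = 1 \<or> n = 2\<close> pr by (auto simp: processed_def)
      next
        fix e assume "e \<in> ext j {} ?M'"
        then obtain i' t where it: "i' < n" "t \<in> L' i" "e = insert (j, i') t"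
          by (auto simp: ext_def split: if_splits)
        have tT: "insert (j, i) t \<in> T" "j \<notin> fst ` t" using it(2) by (auto simp: L'_def)
        show "insert j P \<subseteq> fst ` e"
        proof -
          have "P \<subseteq> fst ` insert (j, i) t" using pr tT(1) unfolding processed_def by blast
          then show ?thesis unfolding it(3) by auto
        qed
        fix s assume s: "s \<in> trans_edges (insert j P) (u(j := n))"
        obtain i'' s' where s': "i'' < (u(j := n)) j" "s' \<in> trans_edges P (u(j := n))" "s = insert (j, i'') s'"
          by (rule trans_edges_insertE[OF s ji(2)])
        have s'P: "s' \<in> trans_edges P u"
        proof -
          have "trans_edges P u = trans_edges P (u(j := n))" by (rule trans_edges_cong) (use ji(2) in auto)
          then show ?thesis using s'(2) by simp
        qed
        let ?t' = "{w\<in>t. fst w \<notin> P}"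
        have "s' \<union> {w\<in>insert (j, i) t. fst w \<notin> P} \<in> T"
          using pr tT(1) s'P by (auto simp: processed_def)
        moreover have "s' \<union> {w\<in>insert (j, i) t. fst w \<notin> P} = insert (j, i) (s' \<union> ?t')" using ji(2) by auto
        moreover have "j \<notin> fst ` (s' \<union> ?t')"
          using tT(2) s'P ji(2) by (auto simp: trans_edges_def image_iff)
        ultimately have "s' \<union> ?t' \<in> L' i" by (simp add: L'_def)
        moreover have "s \<union> {w\<in>e. fst w \<notin> insert j P} = insert (j, i'') (s' \<union> ?t')"
          using tT(2) unfolding s'(3) it(3) by (auto simp: image_iff)
        moreover have "i'' < n" "i'' < 4" using s'(1) \<open>n = 1 \<or> n = 2\<close> by auto
        ultimately show "s \<union> {w\<in>e. fst w \<notin> insert j P} \<in> ext j {} ?M'"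
          unfolding ext_def by auto
      next
        fix e w assume e: "e \<in> ext j RZ ?M" and w: "w \<in> e" "fst w \<in> insert j P"
        have prR: "snd w < u (fst w)" if "e \<in> R" "w \<in> e" "fst w \<in> P" for e
          using pr that by (auto simp: processed_def)
        consider "e \<in> RZ" | i' t where "i' < n" "t \<in> L i" "e = insert (j, i') t"
          using e by (auto simp: ext_def split: if_splits)
        then show "snd w < (u(j := n)) (fst w)"
        proof cases
          case 1
          then have "fst w \<noteq> j" using w(1) by (auto simp: RZ_def)
          then show ?thesis using prR[of e] 1 w by (auto simp: RZ_def)
        next
          case 2
          show ?thesis
          proof (cases "w = (j, i')")
            case False
            then have wt: "w \<in> t" using w(1) 2(3) by simp
            then have "fst w \<noteq> j" using 2(2) by (auto simp: L_def)
            then show ?thesis using prR[of "insert (j, i) t"] 2(2) wt w(2) by (auto simp: L_def)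
          qed (use 2 in simp)
        qed
      qed
    qed
    then show ?thesis by (simp add: eq dn)
  qed
  have e1: "0 \<le> e1" "\<beta> \<le> e1" using e0 \<beta> by auto
  have D: "E (\<lambda>\<psi>. wprod \<nu> RZ \<psi> * (?F \<psi> - a)\<^sup>2) \<le> 4 * e1"
  proof -
    have EG: "\<bar>E (wprod \<nu> RZ) - 1\<bar> \<le> e1"
      using counts'[OF RZ(1), of \<theta>] e1 by (simp add: cnt_def wprod_def[of \<theta> "{}"])
    \<comment> \<open>The variance expands into moments equal to \<open>a\<^sup>2\<close>,
      \<open>a\<close> and 1 up to \<open>e1\<close>; the main terms cancel and
      \<open>(1 + a)\<^sup>2 * e1\<close> remains.\<close>
    have "E (\<lambda>\<psi>. wprod \<nu> RZ \<psi> * (?F \<psi> - a)\<^sup>2)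
       = E (\<lambda>\<psi>. wprod \<nu> RZ \<psi> * ?F \<psi> ^ 2) - 2 * a * E (\<lambda>\<psi>. wprod \<nu> RZ \<psi> * ?F \<psi> ^ 1) + a\<^sup>2 * E (wprod \<nu> RZ)"
      unfolding avg_cmult[symmetric] avg_diff[symmetric] avg_add[symmetric]
      by (rule avg_cong) (simp add: power2_eq_square algebra_simps)
    also have "\<dots> \<le> (a\<^sup>2 + e1) - 2 * a * (a - e1) + a\<^sup>2 * (1 + e1)"
      using mom[of 1] mom[of 2] EG a
      by (intro add_mono diff_mono mult_left_mono) (auto simp: abs_le_iff)
    also have "\<dots> = e1 * (1 + 2 * a + a\<^sup>2)" by (simp add: power2_eq_square algebra_simps)
    also have "\<dots> \<le> e1 * 4"
      using a e1 power_le_one[of a 2] by (intro mult_left_mono) auto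
    finally show ?thesis by simp
  qed
  have "\<bar>cnt J V \<nu> \<theta> R T - a * cnt J V \<nu> \<theta> R1 T1\<bar> \<le> sqrt (8 * E (\<lambda>\<psi>. wprod \<nu> RZ \<psi> * (?F \<psi> - a)\<^sup>2) + 128 * \<beta>)"
    unfolding R_eq[symmetric] T_eq[symmetric] R1_eq[symmetric] T1_eq[symmetric]
    by (rule remove_vertex[OF \<theta> RZ jJ L L' TZ i4 a])
  also have "\<dots> \<le> sqrt (160 * e1)" using D e1 by simp
  finally have le1: "\<bar>cnt J V \<nu> \<theta> R T - a * cnt J V \<nu> \<theta> R1 T1\<bar> \<le> sqrt (160 * e1)" .
  have "\<bar>cnt J V \<nu> \<theta> R T - dprod d T\<bar> \<le> sqrt (160 * e1) + a * \<bar>cnt J V \<nu> \<theta> R1 T1 - dprod d T1\<bar>"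
  proof -
    have "cnt J V \<nu> \<theta> R T - dprod d T = (cnt J V \<nu> \<theta> R T - a * cnt J V \<nu> \<theta> R1 T1) + a * (cnt J V \<nu> \<theta> R1 T1 - dprod d T1)"
      unfolding dT by (simp add: algebra_simps)
    moreover have "\<bar>a * (cnt J V \<nu> \<theta> R1 T1 - dprod d T1)\<bar> = a * \<bar>cnt J V \<nu> \<theta> R1 T1 - dprod d T1\<bar>"
      using a by (simp add: abs_mult)
    ultimately show ?thesis using le1 by linarith
  qed
  also have "a * \<bar>cnt J V \<nu> \<theta> R1 T1 - dprod d T1\<bar> \<le> 1 * \<bar>cnt J V \<nu> \<theta> R1 T1 - dprod d T1\<bar>"
    using a by (intro mult_right_mono) auto
  finally show ?case using IH1 Suc(2)[symmetric] by (simp add: algebra_simps)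
qed

end

section \<open>Octahedra built up one part at a time\<close>

lemma oct_edges_subset_cross:
  assumes "P \<subseteq> J" "\<And>j. j \<in> P \<Longrightarrow> u j \<le> 4"
  shows "oct_edges P u \<subseteq> cross J"
proof
  fix e assume e: "e \<in> oct_edges P u"
  have "w \<in> J \<times> {..<4}" if "w \<in> e" for w
    using e that assms by (fastforce simp: oct_edges_def oct_vertices_def)
  then show "e \<in> cross J" using e by (auto simp: cross_def oct_edges_def)
qed

lemma oct_edges_cpx: "P \<subseteq> J \<Longrightarrow> (\<And>j. j \<in> P \<Longrightarrow> u j \<le> 4) \<Longrightarrow> cpx J (oct_edges P u)"
  unfolding cpx_def using oct_edges_subset_cross[of P J u]
  by (auto simp: oct_edges_def intro: inj_on_subset)

lemma oct_edges_away: "j \<notin> P \<Longrightarrow> oct_edges P u \<subseteq> away j"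
  by (auto simp: oct_edges_def oct_vertices_def away_def)

lemma oct_edges_cong: "(\<And>j. j \<in> P \<Longrightarrow> u j = u' j) \<Longrightarrow> oct_edges P u = oct_edges P u'"
proof -
  assume "\<And>j. j \<in> P \<Longrightarrow> u j = u' j"
  then have "oct_vertices P u = oct_vertices P u'" by (auto simp: oct_vertices_def)
  then show ?thesis by (simp add: oct_edges_def)
qed

lemma oct_edges_upd: "j \<notin> P \<Longrightarrow> oct_edges P (u(j := n)) = oct_edges P u"
  by (rule oct_edges_cong) auto

lemma trans_edges_upd: "j \<notin> P \<Longrightarrow> trans_edges P (u(j := n)) = trans_edges P u"
  by (simp add: trans_edges_def oct_edges_upd)

lemma insert_oct_edge:
  assumes "e \<in> oct_edges P u" "j \<notin> P" "i < u j"
  shows "insert (j, i) e \<in> oct_edges (insert j P) u"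
proof -
  have "j \<notin> fst ` e" using assms(1,2) by (auto simp: oct_edges_def oct_vertices_def)
  then show ?thesis using assms by (auto simp: oct_edges_def oct_vertices_def)
qed

lemma oct_edges_insert:
  assumes "j \<notin> P" "n \<le> 4"
  shows "oct_edges (insert j P) (u(j := n)) = ext j (oct_edges P u) (\<lambda>i. if i < n then oct_edges P u else {})"
    (is "?A = ?B")
proof
  show "?B \<subseteq> ?A"
  proof
    fix e assume "e \<in> ?B"
    then consider "e \<in> oct_edges P u" | i t where "i < n" "t \<in> oct_edges P u" "e = insert (j, i) t"
      by (auto simp: ext_def split: if_splits)
    then show "e \<in> ?A"
    proof cases
      case 1
      then have "e \<in> oct_edges P (u(j := n))" by (simp add: oct_edges_upd assms(1))
      then show ?thesis by (auto simp: oct_edges_def oct_vertices_def)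
    next
      case 2
      then show ?thesis using insert_oct_edge[of t P "u(j := n)" j i] assms(1) by (simp add: oct_edges_upd)
    qed
  qed
  show "?A \<subseteq> ?B"
  proof
    fix e assume e: "e \<in> ?A"
    then have e1: "e \<subseteq> oct_vertices (insert j P) (u(j := n))" "inj_on fst e" by (auto simp: oct_edges_def)
    show "e \<in> ?B"
    proof (cases "j \<in> fst ` e")
      case False
      then have "e \<in> oct_edges P (u(j := n))" using e1 by (force simp: oct_edges_def oct_vertices_def)
      then show ?thesis using assms(1) by (simp add: oct_edges_upd ext_def)
    next
      case True
      then obtain i where i: "(j, i) \<in> e" by auto
      then have "i < n" using e1 by (auto simp: oct_vertices_def)
      have ne: "fst w \<noteq> j" if "w \<in> e - {(j, i)}" for w using inj_onD[OF e1(2), of w "(j, i)"] i that by auto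
      have "e - {(j, i)} \<subseteq> oct_vertices P u"
      proof
        fix w assume w: "w \<in> e - {(j, i)}"
        show "w \<in> oct_vertices P u" using e1(1) w ne[OF w] by (cases w) (auto simp: oct_vertices_def)
      qed
      then have "e - {(j, i)} \<in> oct_edges P u" using e1(2) by (auto simp: oct_edges_def intro: inj_on_subset)
      moreover have "e = insert (j, i) (e - {(j, i)})" using i by auto
      ultimately have "e \<in> insert (j, i) ` oct_edges P u" by (rule rev_image_eqI)
      then show ?thesis using \<open>i < n\<close> assms(2) unfolding ext_def by force
    qed
  qed
qed

lemma trans_edges_insert:
  assumes "j \<notin> P" "n \<le> 4"
  shows "trans_edges (insert j P) (u(j := n)) = ext j {} (\<lambda>i. if i < n then trans_edges P u else {})"
    (is "?A = ?B")
proof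
  show "?B \<subseteq> ?A"
  proof
    fix e assume "e \<in> ?B"
    then obtain i t where it: "i < n" "t \<in> trans_edges P u" "e = insert (j, i) t"
      by (auto simp: ext_def split: if_splits)
    then show "e \<in> ?A" using insert_oct_edge[of t P "u(j := n)" j i] assms(1)
      by (auto simp: trans_edges_def oct_edges_upd)
  qed
  show "?A \<subseteq> ?B"
  proof
    fix e assume e: "e \<in> ?A"
    obtain i t where it: "i < (u(j := n)) j" "t \<in> trans_edges P (u(j := n))" "e = insert (j, i) t"
      by (rule trans_edges_insertE[OF e assms(1)])
    then have "i < n" "t \<in> trans_edges P u" using assms(1) by (simp_all add: trans_edges_upd)
    then have "e \<in> insert (j, i) ` (if i < n then trans_edges P u else {})" using it(3) by simp
    then show "e \<in> ?B" using \<open>i < n\<close> assms(2) unfolding ext_def by (intro UnI2 UN_I[of i]) auto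
  qed
qed

lemma card_trans_edges:
  assumes "finite P" "\<And>j. j \<in> P \<Longrightarrow> u j \<le> 4"
  shows "card (trans_edges P u) = (\<Prod>j\<in>P. u j)"
  using assms
proof (induction P)
  case empty
  have "trans_edges {} u = {{}}" by (auto simp: trans_edges_def oct_edges_def oct_vertices_def)
  then show ?case by simp
next
  case (insert j P)
  have aw: "trans_edges P u \<subseteq> away j"
    using oct_edges_away[OF insert(2), of u] by (auto simp: trans_edges_def)
  have tr: "trans_edges (insert j P) u = ext j {} (\<lambda>i. if i < u j then trans_edges P u else {})"
    using trans_edges_insert[OF insert(2), of "u j" u] insert.prems by simp
  have inj: "inj_on (\<lambda>(i, t). insert (j, i) t) ({..<u j} \<times> trans_edges P u)"
  proof (rule inj_onI)
    fix p p' assume p: "p \<in> {..<u j} \<times> trans_edges P u" "p' \<in> {..<u j} \<times> trans_edges P u"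
      and "(case p of (i, t) \<Rightarrow> insert (j, i) t) = (case p' of (i, t) \<Rightarrow> insert (j, i) t)"
    then have eq: "insert (j, fst p) (snd p) = insert (j, fst p') (snd p')" by (simp add: case_prod_beta)
    have n: "(j, i) \<notin> snd p" "(j, i) \<notin> snd p'" for i using p aw away_notin by (metis mem_Times_iff subsetD)+
    then have "fst p = fst p'" using eq by (metis insertE insertI1 prod.inject)
    then show "p = p'" using eq n by (metis insert_ident prod.expand)
  qed
  have "trans_edges (insert j P) u = (\<lambda>(i, t). insert (j, i) t) ` ({..<u j} \<times> trans_edges P u)"
    unfolding tr using insert.prems[of j] by (force simp: ext_def split: if_splits)
  then have "card (trans_edges (insert j P) u) = u j * card (trans_edges P u)"
    using card_image[OF inj] by (simp add: card_cartesian_product)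
  then show ?case using insert by simp
qed

section \<open>Octahedra with one or two vertices in each part\<close>

lemma dprod_trans_edges: "dprod d (trans_edges P u) = d P ^ card (trans_edges P u)"
proof -
  have "dprod d (trans_edges P u) = (\<Prod>e\<in>trans_edges P u. d P)"
    unfolding dprod_def by (rule prod.cong) (auto simp: trans_edges_def)
  then show ?thesis by simp
qed

text \<open>One step from two copies of a part back to one. With \<open>c\<close> the count for a
  single copy and \<open>x\<close> that for two, Cauchy--Schwarz gives the first premise, and an
  excess \<open>4 * s\<^sup>2\<close> over \<open>a\<^sup>2\<close> turns into the excess
  \<open>4 * s\<close> over \<open>a\<close>.\<close>

lemma upper_step:
  fixes a c s \<beta> :: real
  assumes "c\<^sup>2 \<le> (1 + \<beta>) * x" "x \<le> a\<^sup>2 + 4 * s\<^sup>2" "\<beta> \<le> s\<^sup>2" "0 \<le> \<beta>" "\<beta> \<le> 1" "0 \<le> a" "a \<le> 1" "0 \<le> s"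
  shows "c \<le> a + 4 * s"
proof -
  have "c\<^sup>2 \<le> (1 + \<beta>) * (a\<^sup>2 + 4 * s\<^sup>2)"
    using assms(1) mult_left_mono[OF assms(2), of "1 + \<beta>"] assms(4) by linarith
  also have "\<dots> = a\<^sup>2 + 4 * s\<^sup>2 + \<beta> * a\<^sup>2 + 4 * (\<beta> * s\<^sup>2)" by (simp add: algebra_simps)
  also have "\<dots> \<le> a\<^sup>2 + 4 * s\<^sup>2 + s\<^sup>2 + 4 * s\<^sup>2"
  proof -
    have "\<beta> * a\<^sup>2 \<le> \<beta> * 1" by (rule mult_left_mono) (use assms power_le_one[of a 2] in auto)
    moreover have "\<beta> * s\<^sup>2 \<le> 1 * s\<^sup>2" by (rule mult_right_mono) (use assms in auto)
    ultimately show ?thesis using assms(3) by linarith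
  qed
  also have "\<dots> \<le> (a + 4 * s)\<^sup>2"
    using mult_nonneg_nonneg[OF assms(6,8)] by (simp add: power2_eq_square algebra_simps)
  finally show ?thesis using assms by (intro power2_le_imp_le[of c "a + 4 * s"]) auto
qed

text \<open>The opposite direction: a lower bound for one copy becomes one for two, at the price of
  doubling the error. For \<open>a \<le> x\<close> the left-hand side is not positive, so nothing
  has to be shown.\<close>

lemma lower_step:
  fixes a c x \<beta> :: real
  assumes "c\<^sup>2 \<le> (1 + \<beta>) * y" "a - x \<le> c" "\<beta> \<le> x\<^sup>2" "0 \<le> \<beta>" "0 \<le> a" "a \<le> 1" "0 \<le> x" "0 \<le> y"
  shows "a\<^sup>2 - 2 * x \<le> y"
proof (cases "a \<le> x")
  case True
  have "a\<^sup>2 \<le> a * 1" unfolding power2_eq_square by (rule mult_left_mono) (use assms in auto)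
  then show ?thesis using True assms by linarith
next
  case False
  have "(a - x)\<^sup>2 \<le> c\<^sup>2" by (rule power_mono) (use False assms in auto)
  then have 1: "(a - x)\<^sup>2 \<le> (1 + \<beta>) * y" using assms(1) by linarith
  show ?thesis
  proof (rule ccontr)
    assume "\<not> ?thesis"
    then have y: "y < a\<^sup>2 - 2 * x" by simp
    have "a\<^sup>2 \<le> 1" using power_le_one[of a 2] assms by simp
    then have "y \<le> 1" using y assms by linarith
    then have "\<beta> * y \<le> \<beta> * 1" using assms by (intro mult_left_mono) auto
    then have "(a - x)\<^sup>2 \<le> y + x\<^sup>2" using 1 assms(3) by (simp add: algebra_simps)
    then have "a\<^sup>2 - 2 * (a * x) \<le> y" by (simp add: power2_eq_square algebra_simps)
    moreover have "a * x \<le> 1 * x" using assms by (intro mult_right_mono) auto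
    ultimately show False using y by linarith
  qed
qed

context pseudorandom
begin

abbreviation c_oct :: "('j set \<Rightarrow> 'a set \<Rightarrow> real) \<Rightarrow> 'j set \<Rightarrow> ('j \<Rightarrow> nat) \<Rightarrow> real" where
  "c_oct \<theta> P u \<equiv> cnt J V \<nu> \<theta> (oct_edges P u) (trans_edges P u)"

lemma c_oct_nonneg:
  assumes "relative \<theta>" "P \<subseteq> J" "\<And>j. j \<in> P \<Longrightarrow> u j \<le> 4"
  shows "0 \<le> c_oct \<theta> P u"
proof -
  have c: "oct_edges P u \<subseteq> cross J" using oct_edges_subset_cross assms(2,3) by blast
  then have "trans_edges P u \<subseteq> cross J" by (auto simp: trans_edges_def)
  then show ?thesis unfolding cnt_def
    using wprod_\<nu>_nonneg[OF c] wprod_\<theta>_bounds(1)[OF assms(1)] by (intro avg_nonneg mult_nonneg_nonneg) auto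
qed

text \<open>The count with \<open>n\<close> copies of part \<open>j\<close> is the
  \<open>n\<close>-th moment of one link under a measure of total mass at most
  \<open>1 + \<beta>\<close>; Cauchy--Schwarz compares the first moment with the second.\<close>

lemma c_oct_double:
  assumes "relative \<theta>" "P \<subseteq> J" "j \<in> P" "\<And>j. j \<in> P \<Longrightarrow> u j \<le> 4"
  shows "(c_oct \<theta> P (u(j := 1)))\<^sup>2 \<le> (1 + \<beta>) * c_oct \<theta> P (u(j := 2))"
proof -
  let ?P = "P - {j}"
  let ?G = "wprod \<nu> (oct_edges ?P u)" and ?F = "lnk V \<nu> \<theta> j (oct_edges ?P u) (trans_edges ?P u)"
  have jJ: "j \<in> J" using assms by auto
  have cp: "cpx J (oct_edges ?P u)" by (rule oct_edges_cpx) (use assms in auto)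
  then have cr: "oct_edges ?P u \<subseteq> cross J" by (simp add: cpx_def)
  have aw: "oct_edges ?P u \<subseteq> away j" by (rule oct_edges_away) simp
  have tr: "trans_edges ?P u \<subseteq> oct_edges ?P u" by (auto simp: trans_edges_def)
  have c: "c_oct \<theta> P (u(j := n)) = E (\<lambda>\<psi>. ?G \<psi> * ?F \<psi> ^ n)" if "n = 1 \<or> n = 2" for n
  proof -
    let ?L = "\<lambda>i. if i < n then oct_edges ?P u else {}" and ?L' = "\<lambda>i. if i < n then trans_edges ?P u else {}"
    have n4: "n \<le> 4" using that by auto
    have "insert j ?P = P" using assms(3) by auto
    then have "c_oct \<theta> P (u(j := n)) = cnt J V \<nu> \<theta> (ext j (oct_edges ?P u) ?L) (ext j {} ?L')"
      using oct_edges_insert[of j ?P n u] trans_edges_insert[of j ?P n u] n4 by simp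
    also have "\<dots> = E (\<lambda>\<psi>. ?G \<psi> * wprod \<theta> {} \<psi> * (\<Prod>i<4::nat. lnk V \<nu> \<theta> j (?L i) (?L' i) \<psi>))"
      by (rule cnt_ext) (use finite_J V jJ cr aw tr in auto)
    also have "\<dots> = E (\<lambda>\<psi>. ?G \<psi> * ?F \<psi> ^ n)"
    proof -
      have "(\<Prod>i<4::nat. lnk V \<nu> \<theta> j (?L i) (?L' i) \<psi>) = ?F \<psi> ^ n" for \<psi>
        using that by (elim disjE) (simp_all add: eval_nat_numeral lnk_trivial jJ)
      then show ?thesis by (simp add: wprod_def[of \<theta> "{}"])
    qed
    finally show ?thesis .
  qed
  have "(E (\<lambda>\<psi>. ?G \<psi> * ?F \<psi> * 1))\<^sup>2 \<le> E (\<lambda>\<psi>. ?G \<psi> * (?F \<psi>)\<^sup>2) * E (\<lambda>\<psi>. ?G \<psi> * 1\<^sup>2)"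
    by (rule avg_Cauchy_Schwarz) (rule wprod_\<nu>_nonneg[OF cr])
  also have "\<dots> = c_oct \<theta> P (u(j := 2)) * E ?G" by (simp add: c)
  also have "\<dots> \<le> c_oct \<theta> P (u(j := 2)) * (1 + \<beta>)"
  proof (rule mult_left_mono)
    show "E ?G \<le> 1 + \<beta>"
      using counts'[OF cp, of \<theta>] by (simp add: cnt_def wprod_def[of \<theta> "{}"] abs_le_iff)
    show "0 \<le> c_oct \<theta> P (u(j := 2))" by (rule c_oct_nonneg) (use assms in auto)
  qed
  finally show ?thesis using c[of 1] by (simp add: mult.commute)
qed

text \<open>Regularity controls only the octahedra with one vertex in every part or two in every
  part, and the mixed ones are squeezed in between. Upper bounds descend from the largest octahedron
  and lose a square root per part; lower bounds ascend from the smallest and lose a factor 2 per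
  part. Hence the errors are required at the scale \<open>q ^ (2 ^ card J)\<close>.\<close>

lemma oct_counts:
  fixes q :: real
  assumes \<theta>: "relative \<theta>" and d: "\<And>f. 0 \<le> d f \<and> d f \<le> 1" and P: "P \<subseteq> J" "P \<noteq> {}"
    and u: "\<And>j. j \<in> P \<Longrightarrow> u j = 1 \<or> u j = 2"
    and reg: "\<bar>c_oct \<theta> P (\<lambda>_. 1) - d P\<bar> \<le> \<epsilon>" "c_oct \<theta> P (\<lambda>_. 2) \<le> d P ^ (2 ^ card P) + \<epsilon>"
    and q: "0 \<le> q" "q \<le> 1" "\<epsilon> \<le> q ^ (2 ^ card J)" "\<beta> \<le> q ^ (2 ^ card J)"
  shows "\<bar>c_oct \<theta> P u - dprod d (trans_edges P u)\<bar> \<le> 2 ^ (card J + 2) * q"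
proof -
  have finP: "finite P" using P finite_J finite_subset by blast
  have cardP: "card P \<le> card J" using P finite_J by (simp add: card_mono)
  have qmono: "q ^ (2 ^ m) \<le> q ^ (2 ^ n)" if "n \<le> m" for m n :: nat
    by (rule power_decreasing) (use q that in auto)
  have dp: "dprod d (trans_edges P (u(j := 2))) = (dprod d (trans_edges P (u(j := 1))))\<^sup>2"
    if "j \<in> P" "\<And>j. j \<in> P \<Longrightarrow> u j = 1 \<or> u j = 2" for u j
  proof -
    have le: "(u(j := n)) j' \<le> 4" if "j' \<in> P" "n \<le> 4" for n j'
      using \<open>\<And>j. j \<in> P \<Longrightarrow> u j = 1 \<or> u j = 2\<close>[OF that(1)] that by auto
    have "(\<Prod>j'\<in>P. (u(j := n)) j') = n * (\<Prod>j'\<in>P - {j}. u j')" for n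
      using prod.remove[OF finP that(1), of "u(j := n)"] by simp
    then have "card (trans_edges P (u(j := n))) = n * (\<Prod>j'\<in>P - {j}. u j')" if "n \<le> 4" for n
      using card_trans_edges[OF finP, of "u(j := n)"] le that by simp
    then show ?thesis by (simp add: dprod_trans_edges power_mult[symmetric] mult.commute)
  qed
  \<comment> \<open>With \<open>m\<close> parts reduced to a single copy, \<open>m\<close> square
    roots have been taken, starting from the exponent \<open>2 ^ card P\<close>.\<close>
  have up: "c_oct \<theta> P u \<le> dprod d (trans_edges P u) + 4 * q ^ (2 ^ (card P - m))"
    if "m = card {j\<in>P. u j = 1}" "\<And>j. j \<in> P \<Longrightarrow> u j = 1 \<or> u j = 2" for m u
    using that
  proof (induction m arbitrary: u)
    case 0
    have "{j\<in>P. u j = 1} = {}" using 0(1) finP by simp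
    then have u2: "u j = 2" if "j \<in> P" for j using 0(2)[OF that] that by auto
    have "c_oct \<theta> P u = c_oct \<theta> P (\<lambda>_. 2)"
    proof -
      have "oct_edges P u = oct_edges P (\<lambda>_. 2)" by (rule oct_edges_cong) (rule u2)
      moreover have "trans_edges P u = trans_edges P (\<lambda>_. 2)" by (rule trans_edges_cong) (rule u2)
      ultimately show ?thesis by (simp only:)
    qed
    moreover have "dprod d (trans_edges P u) = d P ^ (2 ^ card P)"
      using card_trans_edges[OF finP, of u] u2 by (simp add: dprod_trans_edges)
    moreover have "\<epsilon> \<le> 4 * q ^ (2 ^ card P)"
      using q(3) qmono[OF cardP] zero_le_power[OF q(1), of "2 ^ card P"] by linarith
    ultimately show ?case using reg(2) by simp
  next
    case (Suc m)
    have "{j\<in>P. u j = 1} \<noteq> {}" using Suc.prems(1) by (metis card.empty nat.distinct(1))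
    then obtain j where j: "j \<in> P" "u j = 1" by blast
    define u' where "u' = u(j := 2)"
    have "{j\<in>P. u j = 1} = insert j {j\<in>P. u' j = 1}" using j by (auto simp: u'_def)
    moreover have "j \<notin> {j\<in>P. u' j = 1}" by (simp add: u'_def)
    ultimately have m: "m = card {j\<in>P. u' j = 1}" using Suc.prems(1) finP by simp
    have u': "u' j' = 1 \<or> u' j' = 2" if "j' \<in> P" for j' using Suc.prems(2)[OF that] by (simp add: u'_def)
    have uu: "u(j := 1) = u" using j by auto
    have dpu: "dprod d (trans_edges P u') = (dprod d (trans_edges P u))\<^sup>2"
      using dp[of j u, OF j(1) Suc.prems(2)] unfolding uu u'_def .
    have mP: "Suc m \<le> card P" using Suc.prems(1) card_mono[OF finP, of "{j\<in>P. u j = 1}"] by auto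
    show ?case
    proof (rule upper_step)
      have u4: "u j' \<le> 4" if "j' \<in> P" for j' using Suc.prems(2)[OF that] by auto
      show "(c_oct \<theta> P u)\<^sup>2 \<le> (1 + \<beta>) * c_oct \<theta> P u'"
        using c_oct_double[OF \<theta> P(1) j(1), of u] u4 unfolding uu u'_def by simp
      have "q ^ (2 ^ (card P - m)) = (q ^ (2 ^ (card P - Suc m)))\<^sup>2"
      proof -
        have "card P - m = Suc (card P - Suc m)" using mP by simp
        then show ?thesis by (simp add: power_mult[symmetric] mult.commute)
      qed
      then show "c_oct \<theta> P u' \<le> (dprod d (trans_edges P u))\<^sup>2 + 4 * (q ^ (2 ^ (card P - Suc m)))\<^sup>2"
        using Suc.IH[OF m u'] dpu by simp
      have "(q ^ (2 ^ (card P - Suc m)))\<^sup>2 = q ^ (2 ^ Suc (card P - Suc m))" by (simp add: power_mult[symmetric] mult.commute)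
      then show "\<beta> \<le> (q ^ (2 ^ (card P - Suc m)))\<^sup>2"
      proof -
        have "Suc (card P - Suc m) \<le> card J" using mP cardP by linarith
        then show ?thesis using q(4) qmono[of "Suc (card P - Suc m)" "card J"] \<open>(q ^ (2 ^ (card P - Suc m)))\<^sup>2 = _\<close> by linarith
      qed
    qed (use \<beta> q dprod_bounds[OF d] in auto)
  qed
  have lo: "dprod d (trans_edges P u) - 2 ^ (m + 2) * q \<le> c_oct \<theta> P u"
    if "m = card {j\<in>P. u j = 2}" "\<And>j. j \<in> P \<Longrightarrow> u j = 1 \<or> u j = 2" for m u
    using that
  proof (induction m arbitrary: u)
    case 0
    have "{j\<in>P. u j = 2} = {}" using 0(1) finP by simp
    then have u1: "u j = 1" if "j \<in> P" for j using 0(2)[OF that] that by auto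
    have "c_oct \<theta> P u = c_oct \<theta> P (\<lambda>_. 1)"
    proof -
      have "oct_edges P u = oct_edges P (\<lambda>_. 1)" by (rule oct_edges_cong) (rule u1)
      moreover have "trans_edges P u = trans_edges P (\<lambda>_. 1)" by (rule trans_edges_cong) (rule u1)
      ultimately show ?thesis by (simp only:)
    qed
    moreover have "dprod d (trans_edges P u) = d P"
    proof -
      have "card (trans_edges P u) = (\<Prod>j\<in>P. u j)" by (rule card_trans_edges[OF finP]) (simp add: u1)
      also have "\<dots> = 1" by (rule prod.neutral) (simp add: u1)
      finally show ?thesis by (simp add: dprod_trans_edges)
    qed
    moreover have "\<epsilon> \<le> 4 * q"
    proof -
      have "q ^ (2 ^ card J) \<le> q" using qmono[of 0 "card J"] by simp
      then show ?thesis using q by linarith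
    qed
    moreover have "card {j\<in>P. u j = 2} = 0" using 0(1) by simp
    ultimately show ?case using reg(1) by (simp add: abs_le_iff)
  next
    case (Suc m)
    have "{j\<in>P. u j = 2} \<noteq> {}" using Suc.prems(1) by (metis card.empty nat.distinct(1))
    then obtain j where j: "j \<in> P" "u j = 2" by blast
    define u' where "u' = u(j := 1)"
    have "{j\<in>P. u j = 2} = insert j {j\<in>P. u' j = 2}" using j by (auto simp: u'_def)
    moreover have "j \<notin> {j\<in>P. u' j = 2}" by (simp add: u'_def)
    ultimately have m: "m = card {j\<in>P. u' j = 2}" using Suc.prems(1) finP by simp
    have u': "u' j' = 1 \<or> u' j' = 2" if "j' \<in> P" for j' using Suc.prems(2)[OF that] by (simp add: u'_def)
    have uu: "u(j := 2) = u" using j by auto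
    have u4: "u j' \<le> 4" if "j' \<in> P" for j' using Suc.prems(2)[OF that] by auto
    have "(dprod d (trans_edges P u'))\<^sup>2 - 2 * (2 ^ (m + 2) * q) \<le> c_oct \<theta> P u"
    proof (rule lower_step)
      show "(c_oct \<theta> P u')\<^sup>2 \<le> (1 + \<beta>) * c_oct \<theta> P u"
        using c_oct_double[OF \<theta> P(1) j(1), of u] u4 unfolding uu u'_def by simp
      show "dprod d (trans_edges P u') - 2 ^ (m + 2) * q \<le> c_oct \<theta> P u'" by (rule Suc.IH[OF m u'])
      have "card J \<noteq> 0" using P finite_J by auto
      then have "q ^ (2 ^ card J) \<le> q ^ 2" using qmono[of 1 "card J"] by simp
      moreover have "q ^ 2 \<le> (2 ^ (m + 2) * q)\<^sup>2"
      proof (rule power_mono)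
        have "(1::real) \<le> 2 ^ (m + 2)" by (rule one_le_power) simp
        then have "1 * q \<le> 2 ^ (m + 2) * q" using q(1) by (rule mult_right_mono)
        then show "q \<le> 2 ^ (m + 2) * q" by simp
      qed (rule q(1))
      ultimately show "\<beta> \<le> (2 ^ (m + 2) * q)\<^sup>2" using q(4) by linarith
      show "0 \<le> c_oct \<theta> P u" by (rule c_oct_nonneg[OF \<theta> P(1)]) (rule u4)
    qed (use \<beta> q dprod_bounds[OF d] in auto)
    moreover have "dprod d (trans_edges P u) = (dprod d (trans_edges P u'))\<^sup>2"
      using dp[of j u, OF j(1) Suc.prems(2)] unfolding u'_def uu .
    ultimately show ?case by simp
  qed
  have "4 * q ^ (2 ^ (card P - card {j\<in>P. u j = 1})) \<le> 4 * q"
    using qmono[of 0 "card P - card {j\<in>P. u j = 1}"] by simp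
  also have "\<dots> \<le> 2 ^ (card J + 2) * q" using q by (intro mult_right_mono) (auto simp: power_add)
  finally have 1: "c_oct \<theta> P u \<le> dprod d (trans_edges P u) + 2 ^ (card J + 2) * q"
    using up[where u = u, OF refl u] by linarith
  have "card {j\<in>P. u j = 2} \<le> card J"
    using cardP card_mono[OF finP, of "{j\<in>P. u j = 2}"] by auto
  then have "(2::real) ^ (card {j\<in>P. u j = 2} + 2) * q \<le> 2 ^ (card J + 2) * q"
    using q by (intro mult_right_mono power_increasing) auto
  then show ?thesis using 1 lo[where u = u, OF refl u] by (simp add: abs_le_iff)
qed

text \<open>Every part not yet in octahedral form halves the exponent of \<open>t\<close>. With
  \<open>K = 52 * card J + 1\<close> the factor \<open>K\<^sup>2\<close> reproduces itself: each of
  at most \<open>4 * card J\<close> vertices costs at most \<open>13 * K\<close>, as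
  \<open>sqrt 160 \<le> 13\<close>, and \<open>1 + 52 * card J * K \<le> K\<^sup>2\<close>.\<close>

lemma count_iterate:
  fixes t :: real
  assumes \<theta>: "relative \<theta>" and d: "\<And>f. 0 \<le> d f \<and> d f \<le> 1"
    and base: "\<And>P u. P \<subseteq> J \<Longrightarrow> P \<noteq> {} \<Longrightarrow> (\<forall>j\<in>P. u j = 1 \<or> u j = 2) \<Longrightarrow>
       \<bar>c_oct \<theta> P u - dprod d (trans_edges P u)\<bar> \<le> e0"
    and e0: "\<beta> \<le> e0" "e0 \<le> t ^ (2 ^ card J)" and t: "0 \<le> t" "t \<le> 1"
    and "P \<subseteq> J" "n = card (J - P)" "cpx J R" "T \<subseteq> R" "{} \<notin> T" "processed P u R T"
  shows "\<bar>cnt J V \<nu> \<theta> R T - dprod d T\<bar> \<le> (52 * real (card J) + 1)\<^sup>2 * t ^ (2 ^ (card J - n))"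
  using assms(8-)
proof (induction n arbitrary: P R T u)
  case 0
  then have P: "P = J" using finite_J by auto
  have none: "{w\<in>\<Union>R. fst w \<notin> P} = {}" using 0(3) unfolding P by (auto simp: cpx_def cross_def)
  have "\<bar>cnt J V \<nu> \<theta> R T - dprod d T\<bar> \<le> e0 + real (card {w\<in>\<Union>R. fst w \<notin> P}) * sqrt (160 * e0)"
    by (rule count_step[OF \<theta> d base e0(1) order_refl 0(1) _ 0(3-6)]) (use P in auto)
  also have "\<dots> = e0" unfolding none by simp
  also have "\<dots> \<le> 1 * t ^ (2 ^ card J)" using e0 by simp
  also have "\<dots> \<le> (52 * real (card J) + 1)\<^sup>2 * t ^ (2 ^ card J)"
    using t by (intro mult_right_mono one_le_power) auto
  finally show ?case by simp
next
  case (Suc n)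
  let ?N = "card J" and ?K = "52 * real (card J) + 1"
  let ?e1 = "?K\<^sup>2 * t ^ (2 ^ (?N - n))" and ?s = "t ^ (2 ^ (?N - Suc n))"
  have nN: "Suc n \<le> ?N" using Suc.prems(2) card_mono[OF finite_J, of "J - P"] by auto
  have K1: "1 \<le> ?K" by simp
  have tp: "t ^ (2 ^ ?N) \<le> t ^ (2 ^ m)" if "m \<le> ?N" for m
    by (rule power_decreasing) (use t that in auto)
  have e01: "e0 \<le> ?e1"
  proof -
    have "e0 \<le> 1 * t ^ (2 ^ (?N - n))" using e0(2) tp[of "?N - n"] by simp
    also have "\<dots> \<le> ?e1" using t K1 by (intro mult_right_mono one_le_power) auto
    finally show ?thesis .
  qed
  have step: "\<bar>cnt J V \<nu> \<theta> R T - dprod d T\<bar> \<le> e0 + real (card {w\<in>\<Union>R. fst w \<notin> P}) * sqrt (160 * ?e1)"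
  proof (rule count_step[OF \<theta> d base e0(1) e01 Suc.prems(1) _ Suc.prems(3-6)])
    fix j u R T assume "j \<in> J - P" "cpx J R" "T \<subseteq> R" "{} \<notin> T" "processed (insert j P) u R T"
    moreover have "n = card (J - insert j P)"
    proof -
      have "J - insert j P = (J - P) - {j}" by auto
      then show ?thesis using \<open>j \<in> J - P\<close> Suc.prems(2) by (simp add: card_Diff_singleton)
    qed
    ultimately show "\<bar>cnt J V \<nu> \<theta> R T - dprod d T\<bar> \<le> ?e1"
      using Suc.IH[of "insert j P" R T u] Suc.prems(1) by simp
  qed
  have "{w\<in>\<Union>R. fst w \<notin> P} \<subseteq> (J - P) \<times> {..<4}"
    using Suc.prems(3) by (auto simp: cpx_def cross_def)
  then have "card {w\<in>\<Union>R. fst w \<notin> P} \<le> card ((J - P) \<times> {..<4::nat})"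
    using finite_J by (intro card_mono) auto
  also have "\<dots> \<le> 4 * ?N" using Suc.prems(2) nN by (simp add: card_cartesian_product)
  finally have cX: "real (card {w\<in>\<Union>R. fst w \<notin> P}) \<le> 4 * real ?N" by linarith
  have "sqrt (160 * ?e1) \<le> 13 * ?K * ?s"
  proof (rule real_le_lsqrt)
    have "?N - n = Suc (?N - Suc n)" using nN by simp
    then have "?s\<^sup>2 = t ^ (2 ^ (?N - n))" by (simp add: power_mult[symmetric] mult.commute)
    moreover have "(13 * ?K * ?s)\<^sup>2 = 169 * (?K\<^sup>2 * ?s\<^sup>2)" by (simp only: power_mult_distrib) simp
    ultimately have "(13 * ?K * ?s)\<^sup>2 = 169 * ?e1" by (simp only:)
    moreover have "0 \<le> ?e1" using t by simp
    ultimately show "160 * ?e1 \<le> (13 * ?K * ?s)\<^sup>2" by linarith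
  qed (use t in auto)
  then have "real (card {w\<in>\<Union>R. fst w \<notin> P}) * sqrt (160 * ?e1) \<le> (4 * real ?N) * (13 * ?K * ?s)"
    using cX t by (intro mult_mono) auto
  moreover have "e0 \<le> ?s" using e0(2) tp[of "?N - Suc n"] by simp
  ultimately have "\<bar>cnt J V \<nu> \<theta> R T - dprod d T\<bar> \<le> ?s * (1 + 52 * real ?N * ?K)"
    using step by (simp add: algebra_simps)
  also have "\<dots> \<le> ?s * ?K\<^sup>2"
    using t by (intro mult_left_mono) (auto simp: power2_eq_square algebra_simps)
  finally show ?case by (simp add: mult.commute)
qed

theorem counting:
  fixes t q :: real
  assumes \<theta>: "relative \<theta>" and d: "\<And>f. 0 \<le> d f \<and> d f \<le> 1"
    and reg: "\<And>f. f \<subseteq> J \<Longrightarrow> f \<noteq> {} \<Longrightarrow> \<bar>c_oct \<theta> f (\<lambda>_. 1) - d f\<bar> \<le> \<epsilon> \<and> c_oct \<theta> f (\<lambda>_. 2) \<le> d f ^ (2 ^ card f) + \<epsilon>"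
    and t: "0 \<le> t" "t \<le> 1" "\<epsilon> \<le> (t ^ (2 ^ card J) / 2 ^ (card J + 2)) ^ (2 ^ card J)"
      "\<beta> \<le> (t ^ (2 ^ card J) / 2 ^ (card J + 2)) ^ (2 ^ card J)"
    and R: "cpx J R" "T \<subseteq> R" "{} \<notin> T"
  shows "\<bar>cnt J V \<nu> \<theta> R T - dprod d T\<bar> \<le> (52 * real (card J) + 1)\<^sup>2 * t"
proof -
  let ?N = "card J"
  \<comment> \<open>Chosen so that the error \<open>2 ^ (?N + 2) * q\<close> of the octahedra equals
    \<open>t ^ (2 ^ ?N)\<close>, the error from which the elimination of all parts starts.\<close>
  define q where "q = t ^ (2 ^ ?N) / 2 ^ (?N + 2)"
  have tt: "t ^ (2 ^ ?N) \<le> 1" "0 \<le> t ^ (2 ^ ?N)" using t by (auto intro: power_le_one)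
  have "(1::real) \<le> 2 ^ (?N + 2)" by (rule one_le_power) simp
  then have q: "0 \<le> q" "q \<le> 1" using tt by (auto simp: q_def divide_le_eq)
  have qe: "2 ^ (?N + 2) * q = t ^ (2 ^ ?N)" by (simp add: q_def)
  have qq: "q ^ (2 ^ ?N) \<le> q ^ 1" by (rule power_decreasing) (use q in auto)
  have "\<beta> \<le> q" using t(4) qq by (simp add: q_def)
  also have "\<dots> \<le> t ^ (2 ^ ?N)" unfolding qe[symmetric] using q \<open>1 \<le> 2 ^ (?N + 2)\<close> by (simp add: mult_le_cancel_right1)
  finally have b: "\<beta> \<le> t ^ (2 ^ ?N)" .
  have "\<bar>cnt J V \<nu> \<theta> R T - dprod d T\<bar> \<le> (52 * real ?N + 1)\<^sup>2 * t ^ (2 ^ (?N - card (J - {})))"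
  proof (rule count_iterate[OF \<theta> d _ b order_refl t(1,2) _ refl R, where u = "\<lambda>_. 1"])
    fix P u assume P: "P \<subseteq> J" "P \<noteq> {}" "\<forall>j\<in>P. u j = 1 \<or> u j = (2::nat)"
    have "\<bar>c_oct \<theta> P u - dprod d (trans_edges P u)\<bar> \<le> 2 ^ (?N + 2) * q"
      by (rule oct_counts[OF \<theta> d P(1,2), where \<epsilon> = \<epsilon>])
         (use P(3) reg[OF P(1,2)] q t(3,4) in \<open>auto simp: q_def\<close>)
    then show "\<bar>c_oct \<theta> P u - dprod d (trans_edges P u)\<bar> \<le> t ^ (2 ^ ?N)" unfolding qe .
  next
    have tr: "trans_edges {} (\<lambda>_. 1) = {{}}" by (auto simp: trans_edges_def oct_edges_def oct_vertices_def)
    show "processed {} (\<lambda>_. 1) R T" unfolding processed_def tr by simp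
  qed simp
  then show ?thesis by simp
qed

end

section \<open>Inheritance of regularity to links\<close>

text \<open>Moves the copies \<open>0..<n\<close> to \<open>n..<2 * n\<close>, so that two octahedra
  with at most two vertices per part fit side by side into four copies.\<close>

definition shift :: "nat \<Rightarrow> ('j \<times> nat) \<Rightarrow> ('j \<times> nat)" where
  "shift n w = (fst w, snd w + n)"

lemma inj_shift: "inj (shift n)"
  by (auto simp: inj_on_def shift_def prod_eq_iff)

lemma fst_shift [simp]: "fst ` shift n ` t = fst ` t"
  by (simp add: shift_def image_image)

lemma wprod_cong: "(\<And>e. e \<in> R \<Longrightarrow> \<psi> ` e = \<psi>' ` e) \<Longrightarrow> wprod g R \<psi> = wprod g R \<psi>'"
  by (simp add: wprod_def)

lemma wprod_union: "finite A \<Longrightarrow> finite B \<Longrightarrow> A \<inter> B = {} \<Longrightarrow> wprod g (A \<union> B) \<psi> = wprod g A \<psi> * wprod g B \<psi>"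
  unfolding wprod_def by (rule prod.union_disjoint)

text \<open>Disjoint blocks of coordinates are independent, and the shifted block has the same
  distribution, so it repeats the first factor. The empty edge must be excluded, as it would belong
  to both blocks.\<close>

lemma avg_two_blocks:
  fixes Y :: "'j \<times> nat \<Rightarrow> 'a set" and g h :: "'j set \<Rightarrow> 'a set \<Rightarrow> real"
  assumes S: "nefin S0 Y" "\<And>w. Y (shift n w) = Y w" "S0 \<inter> shift n ` S0 = {}"
    and A: "A \<subseteq> Pow S0 - {{}}" and B: "B \<subseteq> Pow S0 - {{}}"
  shows "avg (S0 \<union> shift n ` S0) Y (\<lambda>\<xi>. wprod g (A \<union> (`) (shift n) ` A) \<xi> * wprod h (B \<union> (`) (shift n) ` B) \<xi>)
       = (avg S0 Y (\<lambda>\<xi>. wprod g A \<xi> * wprod h B \<xi>))\<^sup>2"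
proof -
  let ?\<sigma> = "shift n" and ?S1 = "shift n ` S0"
  have fin0: "finite S0" using S(1) by (simp add: nefin_def)
  have nef1: "nefin ?S1 Y" using S(1,2) by (auto simp: nefin_def)
  have bij: "bij_betw ?\<sigma> S0 ?S1" using inj_on_subset[OF inj_shift[of n]] by (simp add: bij_betw_def)
  have split: "wprod f (C \<union> (`) ?\<sigma> ` C) (override_on a b ?S1) = wprod f C a * wprod f ((`) ?\<sigma> ` C) b"
    if C: "C \<subseteq> Pow S0 - {{}}" for f C a b
  proof -
    have fC: "finite C" using C fin0 by (meson Diff_subset finite_Pow_iff finite_subset)
    have "C \<inter> (`) ?\<sigma> ` C = {}"
    proof (rule equals0I)
      fix t assume t: "t \<in> C \<inter> (`) ?\<sigma> ` C"
      then have "t \<noteq> {}" "t \<subseteq> S0" using C by auto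
      moreover have "t \<subseteq> ?S1" using t C by blast
      ultimately show False using S(3) by blast
    qed
    then have "wprod f (C \<union> (`) ?\<sigma> ` C) (override_on a b ?S1) =
        wprod f C (override_on a b ?S1) * wprod f ((`) ?\<sigma> ` C) (override_on a b ?S1)"
      using fC by (simp add: wprod_union)
    moreover have "wprod f C (override_on a b ?S1) = wprod f C a"
    proof (rule wprod_cong)
      fix e assume "e \<in> C"
      then have e: "e \<subseteq> S0" using C by auto
      show "override_on a b ?S1 ` e = a ` e"
      proof (rule image_cong[OF refl])
        fix w assume "w \<in> e"
        then have "w \<notin> ?S1" using e S(3) by auto
        then show "override_on a b ?S1 w = a w" by (simp add: override_on_def)
      qed
    qed
    moreover have "wprod f ((`) ?\<sigma> ` C) (override_on a b ?S1) = wprod f ((`) ?\<sigma> ` C) b"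
    proof (rule wprod_cong)
      fix e assume "e \<in> (`) ?\<sigma> ` C"
      then have e: "e \<subseteq> ?S1" using C by auto
      show "override_on a b ?S1 ` e = b ` e"
        by (rule image_cong[OF refl]) (use e in \<open>auto simp: override_on_def\<close>)
    qed
    ultimately show ?thesis by simp
  qed
  have tr: "wprod f ((`) ?\<sigma> ` C) (\<lambda>w. if w \<in> ?S1 then \<psi> (inv_into S0 ?\<sigma> w) else undefined) = wprod f C \<psi>"
    if C: "C \<subseteq> Pow S0 - {{}}" for f C \<psi>
  proof -
    let ?b = "\<lambda>w. if w \<in> ?S1 then \<psi> (inv_into S0 ?\<sigma> w) else undefined"
    have im: "?b ` ?\<sigma> ` e = \<psi> ` e" if "e \<in> C" for e
    proof -
      have "?b (?\<sigma> w) = \<psi> w" if "w \<in> e" for w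
      proof -
        have "w \<in> S0" using that \<open>e \<in> C\<close> C by auto
        then show ?thesis using inv_into_f_f[OF bij_betw_imp_inj_on[OF bij], of w] by simp
      qed
      then have "(\<lambda>w. ?b (?\<sigma> w)) ` e = \<psi> ` e" by (rule image_cong[OF refl])
      then show ?thesis by (simp only: image_image)
    qed
    have "inj_on ((`) ?\<sigma>) C" using inj_image_eq_iff[OF inj_shift[of n]] by (auto simp: inj_on_def)
    then have "wprod f ((`) ?\<sigma> ` C) ?b = (\<Prod>e\<in>C. f (fst ` ?\<sigma> ` e) (?b ` ?\<sigma> ` e))"
      by (simp add: wprod_def prod.reindex)
    also have "\<dots> = (\<Prod>e\<in>C. f (fst ` e) (\<psi> ` e))"
      by (rule prod.cong[OF refl]) (simp only: im fst_shift)
    finally show ?thesis by (simp add: wprod_def)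
  qed
  have "avg (S0 \<union> ?S1) Y (\<lambda>\<xi>. wprod g (A \<union> (`) ?\<sigma> ` A) \<xi> * wprod h (B \<union> (`) ?\<sigma> ` B) \<xi>)
      = avg S0 Y (\<lambda>a. avg ?S1 Y (\<lambda>b. (wprod g A a * wprod h B a) * (wprod g ((`) ?\<sigma> ` A) b * wprod h ((`) ?\<sigma> ` B) b)))"
    unfolding avg_Un[OF S(1) nef1 S(3)] split[OF A] split[OF B] by (simp only: mult_ac)
  also have "\<dots> = avg S0 Y (\<lambda>a. avg ?S1 Y (\<lambda>b. wprod g ((`) ?\<sigma> ` A) b * wprod h ((`) ?\<sigma> ` B) b) * (wprod g A a * wprod h B a))"
    by (simp only: avg_cmult mult.commute)
  also have "\<dots> = avg ?S1 Y (\<lambda>b. wprod g ((`) ?\<sigma> ` A) b * wprod h ((`) ?\<sigma> ` B) b) * avg S0 Y (\<lambda>\<xi>. wprod g A \<xi> * wprod h B \<xi>)"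
    by (rule avg_cmult)
  also have "avg ?S1 Y (\<lambda>b. wprod g ((`) ?\<sigma> ` A) b * wprod h ((`) ?\<sigma> ` B) b) = avg S0 Y (\<lambda>\<xi>. wprod g A \<xi> * wprod h B \<xi>)"
    unfolding avg_reindex[of _ _ _ Y, OF bij S(2)] tr[OF A] tr[OF B] ..
  finally show ?thesis by (simp add: power2_eq_square)
qed

section \<open>Counts in the link of a random vertex\<close>

definition glink :: "'j \<Rightarrow> 'a \<Rightarrow> ('j set \<Rightarrow> 'a set \<Rightarrow> real) \<Rightarrow> 'j set \<Rightarrow> 'a set \<Rightarrow> real" where
  "glink x v g f s = g f s * g (insert x f) (insert v s)"

text \<open>The empty edge is left out: in the link of \<open>v\<close> it would carry the weight of
  \<open>v\<close> itself, which serves as the measure on \<open>V x\<close> instead.\<close>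

definition oct_link :: "('j \<Rightarrow> 'a set) \<Rightarrow> 'j set \<Rightarrow> ('j set \<Rightarrow> 'a set \<Rightarrow> real) \<Rightarrow> ('j set \<Rightarrow> 'a set \<Rightarrow> real) \<Rightarrow> nat \<Rightarrow> real" where
  "oct_link V e g h n = avg (e \<times> {..<n}) (\<lambda>w. V (fst w))
     (\<lambda>\<xi>. wprod g (oct_edges e (\<lambda>_. n) - {{}}) \<xi> * wprod h (trans_edges e (\<lambda>_. n)) \<xi>)"

text \<open>The link pattern of a cone: copy 0 of the new part is joined to all of \<open>A\<close>,
  and the other copies are absent.\<close>

definition first_only :: "'c set \<Rightarrow> nat \<Rightarrow> 'c set" where
  "first_only A i = (if i = 0 then A else {})"

context pseudorandom
begin

text \<open>Conditioning on the image \<open>v\<close> of the apex \<open>(x, 0)\<close> turns an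
  edge and its extension by the apex into one edge of the link of \<open>v\<close>. The single
  factor \<open>\<nu> {x} {v}\<close> comes from the edge consisting of the apex alone.\<close>

lemma cnt_cone:
  assumes x: "x \<in> J" "x \<notin> e" and e: "e \<subseteq> J" and S: "S \<subseteq> e \<times> {..<4}"
    and RZ: "RZ \<subseteq> cross J" "{} \<in> RZ" "\<And>t. t \<in> RZ \<Longrightarrow> t \<subseteq> S" and TZ: "TZ \<subseteq> RZ"
    and empty: "\<And>s. \<nu> {} s = 1"
  shows "cnt J V \<nu> \<theta> (ext x RZ (first_only RZ)) (ext x TZ (first_only TZ))
     = (\<Sum>v\<in>V x. \<nu> {x} {v} * avg S Y (\<lambda>\<xi>. wprod (glink x v \<nu>) (RZ - {{}}) \<xi> * wprod (glink x v \<theta>) TZ \<xi>)) / real (card (V x))"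
proof -
  have aw: "RZ \<subseteq> away x" "TZ \<subseteq> away x" using RZ(3) S x(2) TZ unfolding away_def by fastforce+
  have fin: "finite RZ" "finite TZ" using finite_of_cross[OF finite_J] RZ(1) TZ by blast+
  let ?w = "(x, 0::nat)"
  have wW: "?w \<in> W" using x by simp
  have first: "wprod g (ext x C (first_only C)) \<psi> = wprod g C \<psi> * (\<Prod>t\<in>C. g (insert x (fst ` t)) (insert (\<psi> ?w) (\<psi> ` t)))"
    if "C \<subseteq> away x" "finite C" for g C \<psi>
  proof -
    have "wprod g (ext x C (first_only C)) \<psi> = wprod g C \<psi> * (\<Prod>i<4::nat. \<Prod>t\<in>first_only C i. g (fst ` insert (x, i) t) (\<psi> ` insert (x, i) t))"
      unfolding wprod_def by (rule prod_ext) (use that in \<open>auto simp: first_only_def\<close>)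
    also have "(\<Prod>i<4::nat. \<Prod>t\<in>first_only C i. g (fst ` insert (x, i) t) (\<psi> ` insert (x, i) t)) = (\<Prod>t\<in>C. g (insert x (fst ` t)) (insert (\<psi> ?w) (\<psi> ` t)))"
      by (subst prod.remove[of _ 0]) (simp_all add: first_only_def)
    finally show ?thesis .
  qed
  define F where "F v \<psi> = (wprod \<nu> RZ \<psi> * (\<Prod>t\<in>RZ. \<nu> (insert x (fst ` t)) (insert v (\<psi> ` t)))) *
     (wprod \<theta> TZ \<psi> * (\<Prod>t\<in>TZ. \<theta> (insert x (fst ` t)) (insert v (\<psi> ` t))))" for v \<psi>
  have upd: "F v' (\<psi>(?w := v)) = F v' \<psi>" for v v' \<psi>
    unfolding F_def wprod_upd[OF aw(1)] wprod_upd[OF aw(2)] link_prod_upd[OF aw(1)] link_prod_upd[OF aw(2)] ..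
  have local: "F v \<psi> = F v \<psi>'" if "\<And>w. w \<in> S \<Longrightarrow> \<psi> w = \<psi>' w" for v \<psi> \<psi>'
  proof -
    have im: "\<psi> ` t = \<psi>' ` t" if "t \<in> RZ" for t
      using RZ(3)[OF that] \<open>\<And>w. w \<in> S \<Longrightarrow> \<psi> w = \<psi>' w\<close> by (intro image_cong) auto
    have imT: "\<psi> ` t = \<psi>' ` t" if "t \<in> TZ" for t using im TZ that by auto
    have "(\<Prod>t\<in>RZ. \<nu> (insert x (fst ` t)) (insert v (\<psi> ` t))) = (\<Prod>t\<in>RZ. \<nu> (insert x (fst ` t)) (insert v (\<psi>' ` t)))"
      by (rule prod.cong[OF refl]) (simp only: im)
    moreover have "(\<Prod>t\<in>TZ. \<theta> (insert x (fst ` t)) (insert v (\<psi> ` t))) = (\<Prod>t\<in>TZ. \<theta> (insert x (fst ` t)) (insert v (\<psi>' ` t)))"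
      by (rule prod.cong[OF refl]) (simp only: imT)
    moreover have "wprod \<nu> RZ \<psi> = wprod \<nu> RZ \<psi>'" by (rule wprod_cong) (rule im)
    moreover have "wprod \<theta> TZ \<psi> = wprod \<theta> TZ \<psi>'" by (rule wprod_cong) (rule imT)
    ultimately show ?thesis by (simp only: F_def)
  qed
  have Fval: "F v \<psi> = \<nu> {x} {v} * (wprod (glink x v \<nu>) (RZ - {{}}) \<psi> * wprod (glink x v \<theta>) TZ \<psi>)" for v \<psi>
  proof -
    have "wprod \<nu> RZ \<psi> * (\<Prod>t\<in>RZ. \<nu> (insert x (fst ` t)) (insert v (\<psi> ` t))) = wprod (glink x v \<nu>) RZ \<psi>"
      by (simp only: wprod_def glink_def prod.distrib)
    also have "\<dots> = glink x v \<nu> {} {} * wprod (glink x v \<nu>) (RZ - {{}}) \<psi>"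
      unfolding wprod_def by (subst prod.remove[OF fin(1) RZ(2)]) simp
    finally show ?thesis by (simp add: F_def empty glink_def wprod_def prod.distrib)
  qed
  have sub: "S \<subseteq> W - {?w}" using S e x by auto
  have "cnt J V \<nu> \<theta> (ext x RZ (first_only RZ)) (ext x TZ (first_only TZ)) = E (\<lambda>\<psi>. F (\<psi> ?w) \<psi>)"
    unfolding cnt_def first[OF aw(1) fin(1)] first[OF aw(2) fin(2)] F_def ..
  also have "\<dots> = avg (W - {?w}) Y (\<lambda>\<psi>. (\<Sum>v\<in>V x. F v \<psi>) / real (card (V x)))"
    by (subst avg_split_coord[OF nefin_W wW]) (simp add: upd)
  also have "\<dots> = (\<Sum>v\<in>V x. avg (W - {?w}) Y (F v)) / real (card (V x))"
    unfolding avg_sum[symmetric] by (simp add: avg_def sum_divide_distrib mult.commute)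
  also have "\<dots> = (\<Sum>v\<in>V x. avg S Y (F v)) / real (card (V x))"
  proof -
    have "avg (W - {?w}) Y (F v) = avg S Y (F v)" for v
      by (rule avg_marginal[OF nefin_subset[OF nefin_W] sub]) (auto intro: local)
    then show ?thesis by simp
  qed
  finally show ?thesis unfolding Fval avg_cmult .
qed

text \<open>Deleting the apex costs a factor \<open>d'\<close> for each edge of \<open>TZ\<close>.
  In the moments of its link all edges weighted by \<open>\<theta>\<close> use the whole of
  \<open>J\<close>, so \<open>H\<close> suffices; the weights \<open>\<theta>\<close> on
  \<open>TZ\<close> itself stay in the remaining count and need only be bounded by 1.\<close>

lemma cone_count:
  assumes \<theta>: "relative \<theta>" and x: "x \<in> J" and d': "0 \<le> d'" "d' \<le> 1"
    and H: "\<And>R T. cpx J R \<Longrightarrow> T \<subseteq> R \<Longrightarrow> (\<And>t. t \<in> T \<Longrightarrow> fst ` t = J) \<Longrightarrow> \<bar>cnt J V \<nu> \<theta> R T - d' ^ card T\<bar> \<le> e1"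
    and e1: "\<beta> \<le> e1"
    and RZ: "cpx J RZ" "RZ \<subseteq> away x" and TZ: "TZ \<subseteq> RZ" "\<And>t. t \<in> TZ \<Longrightarrow> insert x (fst ` t) = J"
  shows "\<bar>cnt J V \<nu> \<theta> (ext x RZ (first_only RZ)) (ext x TZ (first_only TZ)) - d' ^ card TZ * cnt J V \<nu> \<theta> RZ TZ\<bar> \<le> sqrt (160 * e1)"
proof -
  let ?F = "lnk V \<nu> \<theta> x RZ TZ" and ?a = "d' ^ card TZ"
  have a: "0 \<le> ?a" "?a \<le> 1" using d' by (auto intro: power_le_one)
  have e1': "0 \<le> e1" using \<beta> e1 by linarith
  have RZc: "RZ \<subseteq> cross J" using RZ by (simp add: cpx_def)
  have fin: "finite TZ" using finite_of_cross[OF finite_J] RZc TZ by blast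
  have mom: "\<bar>E (\<lambda>\<psi>. wprod \<nu> RZ \<psi> * ?F \<psi> ^ n) - ?a ^ n\<bar> \<le> e1" if "n = 1 \<or> n = 2" for n
  proof -
    let ?M = "\<lambda>i'::nat. if i' < n then RZ else {}" and ?M' = "\<lambda>i'::nat. if i' < n then TZ else {}"
    have eq: "E (\<lambda>\<psi>. wprod \<nu> RZ \<psi> * ?F \<psi> ^ n) = cnt J V \<nu> \<theta> (ext x RZ ?M) (ext x {} ?M')"
    proof -
      have "(\<Prod>i'<4::nat. lnk V \<nu> \<theta> x (?M i') (?M' i') \<psi>) = ?F \<psi> ^ n" for \<psi>
        using that by (elim disjE) (simp_all add: eval_nat_numeral lnk_trivial x)
      moreover have "cnt J V \<nu> \<theta> (ext x RZ ?M) (ext x {} ?M')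
          = E (\<lambda>\<psi>. wprod \<nu> RZ \<psi> * wprod \<theta> {} \<psi> * (\<Prod>i'<4::nat. lnk V \<nu> \<theta> x (?M i') (?M' i') \<psi>))"
        by (rule cnt_ext) (use finite_J V x RZ TZ in \<open>auto simp: cpx_def\<close>)
      ultimately show ?thesis by (simp add: wprod_def[of \<theta> "{}"])
    qed
    have "card (ext x {} ?M') = n * card TZ"
    proof -
      \<comment> \<open>The cardinality is read off from \<open>prod_ext\<close>: a product with
        constant factor 2 determines the number of its factors.\<close>
      have "(2::real) ^ card (ext x {} ?M') = (\<Prod>e\<in>ext x {} ?M'. 2)" by simp
      also have "\<dots> = 2 ^ (n * card TZ)"
        by (subst prod_ext) (use fin TZ RZ that in \<open>auto simp: eval_nat_numeral power_add\<close>)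
      finally show ?thesis by simp
    qed
    then have dn: "d' ^ card (ext x {} ?M') = ?a ^ n" by (simp add: power_mult[symmetric] mult.commute)
    have "\<bar>cnt J V \<nu> \<theta> (ext x RZ ?M) (ext x {} ?M') - d' ^ card (ext x {} ?M')\<bar> \<le> e1"
    proof (rule H)
      show "cpx J (ext x RZ ?M)"
        by (rule ext_cpx) (use RZ x in \<open>auto simp: cpx_def split: if_splits\<close>)
      have "?M' i' \<subseteq> ?M i'" for i' using TZ by auto
      then show "ext x {} ?M' \<subseteq> ext x RZ ?M" unfolding ext_def by blast
      show "fst ` t = J" if t: "t \<in> ext x {} ?M'" for t
      proof -
        obtain i s where "s \<in> TZ" "t = insert (x, i) s" using t by (auto simp: ext_def split: if_splits)
        then show ?thesis using TZ(2)[of s] by simp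
      qed
    qed
    then show ?thesis by (simp add: eq dn)
  qed
  have D: "E (\<lambda>\<psi>. wprod \<nu> RZ \<psi> * (?F \<psi> - ?a)\<^sup>2) \<le> 4 * e1"
  proof -
    have EG: "\<bar>E (wprod \<nu> RZ) - 1\<bar> \<le> e1"
      using counts'[OF RZ(1), of \<theta>] e1 by (simp add: cnt_def wprod_def[of \<theta> "{}"])
    have "E (\<lambda>\<psi>. wprod \<nu> RZ \<psi> * (?F \<psi> - ?a)\<^sup>2)
       = E (\<lambda>\<psi>. wprod \<nu> RZ \<psi> * ?F \<psi> ^ 2) - 2 * ?a * E (\<lambda>\<psi>. wprod \<nu> RZ \<psi> * ?F \<psi> ^ 1) + ?a\<^sup>2 * E (wprod \<nu> RZ)"
      unfolding avg_cmult[symmetric] avg_diff[symmetric] avg_add[symmetric]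
      by (rule avg_cong) (simp add: power2_eq_square algebra_simps)
    also have "\<dots> \<le> (?a\<^sup>2 + e1) - 2 * ?a * (?a - e1) + ?a\<^sup>2 * (1 + e1)"
      using mom[of 1] mom[of 2] EG a
      by (intro add_mono diff_mono mult_left_mono) (auto simp: abs_le_iff)
    also have "\<dots> = e1 * (1 + 2 * ?a + ?a\<^sup>2)" by (simp add: power2_eq_square algebra_simps)
    also have "\<dots> \<le> e1 * 4"
      using a e1' power_le_one[of ?a 2] by (intro mult_left_mono) auto
    finally show ?thesis by simp
  qed
  \<comment> \<open>Deleting the only copy in use leaves no link at all, so the cone collapses to
    its base.\<close>
  have fo: "(first_only C)(0 := {}) = (\<lambda>_. {})" for C :: "('j \<times> nat) set set"
    by (rule ext) (simp add: first_only_def)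
  have "\<bar>cnt J V \<nu> \<theta> (ext x RZ (first_only RZ)) (ext x TZ (first_only TZ))
      - ?a * cnt J V \<nu> \<theta> (ext x RZ ((first_only RZ)(0 := {}))) (ext x TZ ((first_only TZ)(0 := {})))\<bar>
     \<le> sqrt (8 * E (\<lambda>\<psi>. wprod \<nu> RZ \<psi> * (lnk V \<nu> \<theta> x (first_only RZ 0) (first_only TZ 0) \<psi> - ?a)\<^sup>2) + 128 * \<beta>)"
    by (rule remove_vertex[OF \<theta> RZ x _ _ TZ(1) _ a])
       (use TZ RZ in \<open>auto simp: first_only_def downclosed_in_def cpx_def\<close>)
  then have "\<bar>cnt J V \<nu> \<theta> (ext x RZ (first_only RZ)) (ext x TZ (first_only TZ)) - ?a * cnt J V \<nu> \<theta> RZ TZ\<bar>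
     \<le> sqrt (8 * E (\<lambda>\<psi>. wprod \<nu> RZ \<psi> * (?F \<psi> - ?a)\<^sup>2) + 128 * \<beta>)"
    unfolding fo by (simp add: first_only_def ext_def)
  also have "\<dots> \<le> sqrt (160 * e1)" using D e1 by simp
  finally show ?thesis .
qed

lemma cnt_local:
  assumes "S \<subseteq> W" "\<And>t. t \<in> R \<Longrightarrow> t \<subseteq> S" "T \<subseteq> R"
  shows "cnt J V \<nu> \<theta> R T = avg S Y (\<lambda>\<psi>. wprod \<nu> R \<psi> * wprod \<theta> T \<psi>)"
  unfolding cnt_def
proof (rule avg_marginal[OF nefin_W assms(1)])
  fix \<psi> \<psi>' :: "'j \<times> nat \<Rightarrow> 'a" assume eq: "\<And>w. w \<in> S \<Longrightarrow> \<psi> w = \<psi>' w"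
  have im: "\<psi> ` t = \<psi>' ` t" if "t \<in> R" for t
    using assms(2)[OF that] eq by (intro image_cong) auto
  have "wprod \<nu> R \<psi> = wprod \<nu> R \<psi>'" by (rule wprod_cong) (rule im)
  moreover have "wprod \<theta> T \<psi> = wprod \<theta> T \<psi>'" by (rule wprod_cong) (use im assms(3) in auto)
  ultimately show "wprod \<nu> R \<psi> * wprod \<theta> T \<psi> = wprod \<nu> R \<psi>' * wprod \<theta> T \<psi>'" by simp
qed

lemma c_oct_eq_oct_link:
  assumes e: "e \<subseteq> J" and n: "n \<le> 4" and empty: "\<And>s. \<nu> {} s = 1"
  shows "c_oct \<theta> e (\<lambda>_. n) = oct_link V e \<nu> \<theta> n"
proof -
  let ?O = "oct_edges e (\<lambda>_. n)" and ?B = "trans_edges e (\<lambda>_. n)"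
  have OS: "t \<subseteq> e \<times> {..<n}" if "t \<in> ?O" for t using that by (auto simp: oct_edges_def oct_vertices_def)
  have O0: "{} \<in> ?O" by (simp add: oct_edges_def)
  have BO: "?B \<subseteq> ?O" by (auto simp: trans_edges_def)
  have "?O \<subseteq> cross J" by (rule oct_edges_subset_cross) (use e n in auto)
  then have fin: "finite ?O" by (rule finite_of_cross[OF finite_J])
  have SW: "e \<times> {..<n} \<subseteq> W" using e n by auto
  have "c_oct \<theta> e (\<lambda>_. n) = avg (e \<times> {..<n}) Y (\<lambda>\<psi>. wprod \<nu> ?O \<psi> * wprod \<theta> ?B \<psi>)"
    by (rule cnt_local[OF SW _ BO]) (rule OS)
  moreover have "wprod \<nu> ?O \<psi> = wprod \<nu> (?O - {{}}) \<psi>" for \<psi>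
    unfolding wprod_def by (subst prod.remove[OF fin O0]) (simp add: empty)
  ultimately show ?thesis by (simp add: oct_link_def)
qed

text \<open>The apex over one octahedron gives the mean of the count in a random link, and the same
  apex over two disjoint octahedra gives the second moment. The base count of the two octahedra is
  exactly \<open>c\<^sup>2\<close> by independence, so mean and second moment are close to
  \<open>a * c\<close> and \<open>(a * c)\<^sup>2\<close>.\<close>

lemma link_variance:
  assumes \<theta>: "relative \<theta>" and J: "J = insert x e" "x \<notin> e" "e \<noteq> {}" and d': "0 \<le> d'" "d' \<le> 1"
    and H: "\<And>R T. cpx J R \<Longrightarrow> T \<subseteq> R \<Longrightarrow> (\<And>t. t \<in> T \<Longrightarrow> fst ` t = J) \<Longrightarrow> \<bar>cnt J V \<nu> \<theta> R T - d' ^ card T\<bar> \<le> e1"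
    and e1: "\<beta> \<le> e1" and empty: "\<And>s. \<nu> {} s = 1" and n: "n = 1 \<or> n = 2"
  shows "(\<Sum>v\<in>V x. \<nu> {x} {v} * (oct_link V e (glink x v \<nu>) (glink x v \<theta>) n
           - d' ^ (n ^ card e) * c_oct \<theta> e (\<lambda>_. n))\<^sup>2) / real (card (V x)) \<le> 5 * sqrt (160 * e1) + 4 * e1"
proof -
  let ?O = "oct_edges e (\<lambda>_. n)" and ?B = "trans_edges e (\<lambda>_. n)" and ?Z = "e \<times> {..<n}"
  let ?A = "?O - {{}}" and ?sh = "(`) (shift n) :: ('j \<times> nat) set \<Rightarrow> _"
  let ?O2 = "?O \<union> ?sh ` ?O" and ?B2 = "?B \<union> ?sh ` ?B" and ?S = "?Z \<union> shift n ` ?Z"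
  let ?Q = "\<lambda>v. oct_link V e (glink x v \<nu>) (glink x v \<theta>) n"
  define c where "c = c_oct \<theta> e (\<lambda>_. n)"
  define a where "a = d' ^ card ?B"
  have x: "x \<in> J" and eJ: "e \<subseteq> J" using J by auto
  have n4: "n \<le> 4" "2 * n \<le> 4" "0 < n" using n by auto
  have fine: "finite e" using finite_J eJ finite_subset by blast
  have OS: "t \<subseteq> ?Z" if "t \<in> ?O" for t using that by (auto simp: oct_edges_def oct_vertices_def)
  have O0: "{} \<in> ?O" by (simp add: oct_edges_def)
  have BO: "?B \<subseteq> ?O" by (auto simp: trans_edges_def)
  have Bn: "{} \<notin> ?B" using J(3) by (auto simp: trans_edges_def)
  have cO: "cpx J ?O" by (rule oct_edges_cpx) (use eJ n4 in auto)
  have shS: "shift n ` ?Z \<subseteq> e \<times> {n..<2 * n}"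
  proof
    fix w assume "w \<in> shift n ` ?Z"
    then obtain p where p: "p \<in> ?Z" "w = shift n p" by blast
    obtain j i where "p = (j, i)" by (cases p)
    then have ji: "j \<in> e" "i < n" "w = (j, i + n)" using p by (simp_all add: shift_def)
    then have "i + n \<in> {n..<2 * n}" by simp
    then show "w \<in> e \<times> {n..<2 * n}" using ji by blast
  qed
  have "?Z \<subseteq> e \<times> {..<4}" "e \<times> {n..<2 * n} \<subseteq> e \<times> {..<4}" using n4 by auto
  then have SW: "?S \<subseteq> e \<times> {..<4}" using shS by blast
  have shJ: "shift n ` ?Z \<subseteq> J \<times> {..<4}"
  proof -
    have "e \<times> {..<4::nat} \<subseteq> J \<times> {..<4}" using eJ by auto
    then show ?thesis using SW by (meson Un_subset_iff subset_trans)
  qed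
  have BO2: "t \<in> ?O \<or> (\<exists>s\<in>?O. t = shift n ` s)" if "t \<in> ?O2" for t using that by auto
  have Od: "t' \<in> ?O" if "t \<in> ?O" "t' \<subseteq> t" for t t' using cO that unfolding cpx_def by auto
  have cO2: "cpx J ?O2"
    unfolding cpx_def
  proof (intro conjI subsetI ballI allI impI)
    fix t assume t2: "t \<in> ?O2"
    consider "t \<in> ?O" | s where "s \<in> ?O" "t = shift n ` s" using BO2[OF t2] by blast
    then show "t \<in> cross J"
    proof cases
      case 2
      have "t \<subseteq> shift n ` ?Z" using OS[OF 2(1)] 2(2) by auto
      moreover have "inj_on fst t"
        using 2 by (auto simp: oct_edges_def inj_on_def shift_def)
      ultimately show ?thesis using subset_trans[OF _ shJ] unfolding cross_def by simp
    qed (use cO in \<open>auto simp: cpx_def\<close>)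
    fix t' assume t': "t' \<subseteq> t"
    consider "t \<in> ?O" | s where "s \<in> ?O" "t = shift n ` s" using BO2[OF t2] by blast
    then show "t' \<in> ?O2"
    proof cases
      case 1 then show ?thesis using Od[OF 1 t'] by simp
    next
      case 2
      have "t' \<subseteq> shift n ` s" using t' 2(2) by simp
      then obtain s' where s': "s' \<subseteq> s" "t' = shift n ` s'" by (rule subset_imageE)
      have "s' \<in> ?O" by (rule Od[OF 2(1) s'(1)])
      then show ?thesis using s'(2) by simp
    qed
  qed
  have aw: "?O \<subseteq> away x" "?O2 \<subseteq> away x"
  proof -
    show 1: "?O \<subseteq> away x" by (rule oct_edges_away[OF J(2)])
    show "?O2 \<subseteq> away x"
    proof
      fix t assume "t \<in> ?O2"
      then obtain s where "s \<in> ?O" "fst ` t = fst ` s" using BO2[of t] by (metis fst_shift)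
      then show "t \<in> away x" using 1 unfolding away_def by auto
    qed
  qed
  have O2S: "t \<subseteq> ?S" if "t \<in> ?O2" for t using that OS by blast
  have Ac: "?A \<subseteq> Pow ?Z - {{}}" "?B \<subseteq> Pow ?Z - {{}}" using OS BO Bn by blast+
  have A2: "?O2 - {{}} = ?A \<union> ?sh ` ?A" by auto
  have nef0: "nefin ?Z Y" by (rule nefin_subset[OF nefin_W]) (use eJ n4 in auto)
  have dis: "?Z \<inter> shift n ` ?Z = {}" using shS by auto
  have Ysh: "Y (shift n w) = Y w" for w by (simp add: shift_def)
  have M1: "cnt J V \<nu> \<theta> (ext x ?O (first_only ?O)) (ext x ?B (first_only ?B)) = (\<Sum>v\<in>V x. \<nu> {x} {v} * ?Q v) / real (card (V x))"
    unfolding oct_link_def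
    by (rule cnt_cone[OF x J(2) eJ]) (use OS O0 BO cO n4 empty in \<open>auto simp: cpx_def\<close>)
  have B2: "?B2 \<subseteq> ?O2" using BO by blast
  have M2: "cnt J V \<nu> \<theta> (ext x ?O2 (first_only ?O2)) (ext x ?B2 (first_only ?B2)) = (\<Sum>v\<in>V x. \<nu> {x} {v} * (?Q v)\<^sup>2) / real (card (V x))"
    unfolding oct_link_def avg_two_blocks[OF nef0 Ysh dis Ac, symmetric] A2[symmetric]
    by (rule cnt_cone[OF x J(2) eJ SW _ _ O2S B2 empty]) (use cO2 O0 in \<open>auto simp: cpx_def\<close>)
  have "e \<times> {..<4::nat} \<subseteq> W" using eJ by auto
  then have SWW: "?S \<subseteq> W" using SW by (rule subset_trans[rotated])
  have strip: "wprod \<nu> C \<psi> = wprod \<nu> (C - {{}}) \<psi>" if "finite C" "{} \<in> C" for C \<psi>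
    unfolding wprod_def by (subst prod.remove[OF that]) (simp add: empty)
  have crO: "?O \<subseteq> cross J" "?O2 \<subseteq> cross J"
    using conjunct1[OF cO[unfolded cpx_def]] conjunct1[OF cO2[unfolded cpx_def]] by simp_all
  have finO: "finite ?O" "finite ?O2" by (rule finite_of_cross[OF finite_J crO(1)], rule finite_of_cross[OF finite_J crO(2)])
  have c1: "c = avg ?Z Y (\<lambda>\<psi>. wprod \<nu> ?A \<psi> * wprod \<theta> ?B \<psi>)"
    unfolding c_def oct_link_def[symmetric] by (rule c_oct_eq_oct_link[OF eJ n4(1) empty])
  have O02: "{} \<in> ?O2" using O0 by simp
  have c2: "cnt J V \<nu> \<theta> ?O2 ?B2 = c\<^sup>2"
  proof -
    have "cnt J V \<nu> \<theta> ?O2 ?B2 = avg ?S Y (\<lambda>\<psi>. wprod \<nu> ?O2 \<psi> * wprod \<theta> ?B2 \<psi>)"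
      by (rule cnt_local[OF SWW _ B2]) (rule O2S)
    also have "\<dots> = c\<^sup>2"
      unfolding strip[OF finO(2) O02] A2 c1 by (rule avg_two_blocks[OF nef0 Ysh dis Ac])
    finally show ?thesis .
  qed
  have cardB: "card ?B = n ^ card e"
    using card_trans_edges[OF fine, of "\<lambda>_. n"] n4 by simp
  have cardB2: "card ?B2 = 2 * card ?B"
  proof -
    have "finite ?B" by (rule finite_subset[OF BO finO(1)])
    moreover have "?B \<inter> ?sh ` ?B = {}"
    proof (rule equals0I)
      fix t assume "t \<in> ?B \<inter> ?sh ` ?B"
      then obtain s where s: "t \<in> ?B" "s \<in> ?B" "t = shift n ` s" by blast
      have "t \<subseteq> ?Z" by (rule OS[OF subsetD[OF BO s(1)]])
      moreover have "t \<subseteq> shift n ` ?Z" unfolding s(3) by (rule image_mono[OF OS[OF subsetD[OF BO s(2)]]])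
      ultimately have "t = {}" using dis by auto
      then show False using s(1) Bn by simp
    qed
    moreover have "card (?sh ` ?B) = card ?B"
      using inj_image_eq_iff[OF inj_shift[of n]] by (intro card_image) (auto simp: inj_on_def)
    ultimately show ?thesis by (simp add: card_Un_disjoint)
  qed
  define s where "s = sqrt (160 * e1)"
  have e10: "0 \<le> e1" using \<beta> e1 by linarith
  have s0: "0 \<le> s" using e10 by (simp add: s_def)
  have tB: "insert x (fst ` t) = J" if "t \<in> ?B2" for t
  proof -
    have "fst ` s = e" if "s \<in> ?B" for s using that by (simp add: trans_edges_def)
    then have "fst ` t = e" using that by (elim UnE imageE) (simp_all only: fst_shift)
    then show ?thesis using J(1) by simp
  qed
  have m1: "\<bar>(\<Sum>v\<in>V x. \<nu> {x} {v} * ?Q v) / real (card (V x)) - a * c\<bar> \<le> s"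
    unfolding M1[symmetric] a_def c_def s_def
    by (rule cone_count[OF \<theta> x d' H e1 cO aw(1) BO]) (use tB in auto)
  have m2: "\<bar>(\<Sum>v\<in>V x. \<nu> {x} {v} * (?Q v)\<^sup>2) / real (card (V x)) - a\<^sup>2 * c\<^sup>2\<bar> \<le> s"
  proof -
    have "a\<^sup>2 = d' ^ card ?B2" by (simp add: a_def cardB2 power_mult[symmetric] mult.commute)
    then show ?thesis
      using cone_count[OF \<theta> x d' H e1 cO2 aw(2) B2 tB] unfolding M2 c2 s_def by simp
  qed
  \<comment> \<open>The total mass of the measure on \<open>V x\<close>: an apex over the empty edge
    alone.\<close>
  have m0: "\<bar>(\<Sum>v\<in>V x. \<nu> {x} {v}) / real (card (V x)) - 1\<bar> \<le> \<beta>"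
  proof -
    have cp: "cpx J {{}}" by (simp add: cpx_def cross_def)
    have "cpx J (ext x {{}} (first_only {{}}))"
      by (rule ext_cpx[OF cp]) (use x in \<open>auto simp: first_only_def away_def split: if_splits\<close>)
    moreover have "cnt J V \<nu> \<theta> (ext x {{}} (first_only {{}})) (ext x {} (first_only {}))
        = (\<Sum>v\<in>V x. \<nu> {x} {v} * avg {} Y (\<lambda>\<xi>. wprod (glink x v \<nu>) ({{}} - {{}}) \<xi> * wprod (glink x v \<theta>) {} \<xi>)) / real (card (V x))"
      by (rule cnt_cone[OF x J(2) eJ]) (use empty cp in \<open>auto simp: cpx_def\<close>)
    moreover have "ext x {} (first_only {}) = {}" by (auto simp: ext_def first_only_def)
    ultimately show ?thesis using counts'[of "ext x {{}} (first_only {{}})" \<theta>] by (simp add: wprod_def)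
  qed
  have a01: "0 \<le> a" "a \<le> 1" unfolding a_def using d' by (auto intro: power_le_one)
  have c02: "0 \<le> c" "c \<le> 2"
  proof -
    show "0 \<le> c" unfolding c_def by (rule c_oct_nonneg[OF \<theta> eJ]) (use n4 in auto)
    have "c \<le> cnt J V \<nu> \<theta> ?O {}"
      unfolding c_def cnt_def
    proof (rule avg_mono)
      fix \<psi> assume \<psi>: "\<psi> \<in> PiE W Y"
      have "wprod \<nu> ?O \<psi> * wprod \<theta> ?B \<psi> \<le> wprod \<nu> ?O \<psi> * 1"
        using wprod_\<nu>_nonneg[OF _ \<psi>] wprod_\<theta>_bounds(2)[OF \<theta> _ \<psi>] cO BO
        by (intro mult_left_mono) (auto simp: cpx_def)
      then show "wprod \<nu> ?O \<psi> * wprod \<theta> ?B \<psi> \<le> wprod \<nu> ?O \<psi> * wprod \<theta> {} \<psi>" by (simp add: wprod_def[of \<theta> "{}"])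
    qed
    then show "c \<le> 2" using counts'[OF cO, of \<theta>] \<beta> by (simp add: abs_le_iff)
  qed
  define y where "y = a * c"
  have y: "0 \<le> y" "y \<le> 2"
  proof -
    show "0 \<le> y" using a01 c02 by (simp add: y_def)
    have "a * c \<le> 1 * 2" by (rule mult_mono) (use a01 c02 in auto)
    then show "y \<le> 2" by (simp add: y_def)
  qed
  have "(\<Sum>v\<in>V x. \<nu> {x} {v} * (?Q v - y)\<^sup>2) / real (card (V x))
     = (\<Sum>v\<in>V x. \<nu> {x} {v} * (?Q v)\<^sup>2) / real (card (V x)) - 2 * y * ((\<Sum>v\<in>V x. \<nu> {x} {v} * ?Q v) / real (card (V x)))
       + y\<^sup>2 * ((\<Sum>v\<in>V x. \<nu> {x} {v}) / real (card (V x)))"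
  proof -
    have "(\<Sum>v\<in>V x. \<nu> {x} {v} * (?Q v - y)\<^sup>2) = (\<Sum>v\<in>V x. \<nu> {x} {v} * (?Q v)\<^sup>2) - 2 * y * (\<Sum>v\<in>V x. \<nu> {x} {v} * ?Q v)
       + y\<^sup>2 * (\<Sum>v\<in>V x. \<nu> {x} {v})"
      unfolding sum_distrib_left sum_subtractf[symmetric] sum.distrib[symmetric]
      by (rule sum.cong) (simp_all add: power2_eq_square algebra_simps)
    then show ?thesis by (simp add: add_divide_distrib diff_divide_distrib)
  qed
  \<comment> \<open>The moments of order 2, 1 and 0 have errors \<open>s\<close>, \<open>s\<close>
    and \<open>\<beta>\<close>. The main terms cancel, and \<open>y \<le> 2\<close> bounds the
    rest.\<close>
  also have "\<dots> \<le> (y\<^sup>2 + s) - 2 * y * (y - s) + y\<^sup>2 * (1 + \<beta>)"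
    using m1 m2 m0 y by (intro add_mono diff_mono mult_left_mono) (auto simp: abs_le_iff y_def power_mult_distrib)
  also have "\<dots> = s + 2 * (y * s) + y\<^sup>2 * \<beta>" by (simp add: power2_eq_square algebra_simps)
  also have "\<dots> \<le> s + 2 * (2 * s) + 2\<^sup>2 * e1"
    using y s0 \<beta> e1 by (intro add_mono mult_left_mono mult_mono power_mono) auto
  finally show ?thesis using s0 by (simp add: y_def a_def c_def s_def cardB)
qed

text \<open>Chebyshev's inequality. The four squared deviations, for one and two vertices per part
  and with or without \<open>\<theta>\<close>, are added up in \<open>S\<close>, so that one
  exceptional set serves all of them; this is the origin of the factor 4.\<close>

lemma link_counts:
  assumes \<theta>: "relative \<theta>" and J: "J = insert x e" "x \<notin> e" "e \<noteq> {}" and d': "0 \<le> d'" "d' \<le> 1"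
    and H: "\<And>R T. cpx J R \<Longrightarrow> T \<subseteq> R \<Longrightarrow> (\<And>t. t \<in> T \<Longrightarrow> fst ` t = J) \<Longrightarrow> \<bar>cnt J V \<nu> \<theta> R T - d' ^ card T\<bar> \<le> e1"
    and e1: "\<beta> \<le> e1" and empty: "\<And>s. \<nu> {} s = 1" and \<tau>: "0 < \<tau>"
  obtains Bad where "Bad \<subseteq> V x"
    "(\<Sum>v\<in>Bad. \<nu> {x} {v}) / real (card (V x)) \<le> 4 * (5 * sqrt (160 * e1) + 4 * e1) / \<tau>\<^sup>2"
    "\<And>v n. v \<in> V x - Bad \<Longrightarrow> n = 1 \<or> n = 2 \<Longrightarrow>
       \<bar>oct_link V e (glink x v \<nu>) (glink x v \<theta>) n - d' ^ (n ^ card e) * c_oct \<theta> e (\<lambda>_. n)\<bar> \<le> \<tau> \<and>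
       \<bar>oct_link V e (glink x v \<nu>) (glink x v (\<lambda>_ _. 1)) n - c_oct (\<lambda>_ _. 1) e (\<lambda>_. n)\<bar> \<le> \<tau>"
proof -
  let ?f = "\<lambda>n v. oct_link V e (glink x v \<nu>) (glink x v \<theta>) n - d' ^ (n ^ card e) * c_oct \<theta> e (\<lambda>_. n)"
  let ?g = "\<lambda>n v. oct_link V e (glink x v \<nu>) (glink x v (\<lambda>_ _. 1)) n - c_oct (\<lambda>_ _. 1) e (\<lambda>_. n)"
  let ?V = "5 * sqrt (160 * e1) + 4 * e1"
  define S where "S v = (?f 1 v)\<^sup>2 + (?f 2 v)\<^sup>2 + (?g 1 v)\<^sup>2 + (?g 2 v)\<^sup>2" for v
  define Bad where "Bad = {v\<in>V x. \<tau>\<^sup>2 < S v}"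
  have x: "x \<in> J" using J by simp
  have r1: "relative (\<lambda>_ _. 1)" by (simp add: relative_def)
  have H1: "\<bar>cnt J V \<nu> (\<lambda>_ _. 1) R T - 1 ^ card T\<bar> \<le> e1" if "cpx J R" for R T
    using counts'[OF that, of "\<lambda>_ _. 1"] e1 by (simp add: cnt_def wprod_def)
  have g: "(\<Sum>v\<in>V x. \<nu> {x} {v} * (?g n v)\<^sup>2) / real (card (V x)) \<le> ?V" if "n = 1 \<or> n = 2" for n
    using link_variance[OF r1 J, of 1 e1 n] H1 e1 empty that by simp
  have f: "(\<Sum>v\<in>V x. \<nu> {x} {v} * (?f n v)\<^sup>2) / real (card (V x)) \<le> ?V" if "n = 1 \<or> n = 2" for n
    by (rule link_variance[OF \<theta> J d' H e1 empty that])
  have \<nu>0: "0 \<le> \<nu> {x} {v}" if "v \<in> V x" for v by (rule \<nu>_nonneg) (use that x in auto)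
  have "\<tau>\<^sup>2 * (\<Sum>v\<in>Bad. \<nu> {x} {v}) = (\<Sum>v\<in>Bad. \<nu> {x} {v} * \<tau>\<^sup>2)" by (simp add: sum_distrib_left mult.commute)
  also have "\<dots> \<le> (\<Sum>v\<in>Bad. \<nu> {x} {v} * S v)"
    by (intro sum_mono mult_left_mono) (auto simp: Bad_def \<nu>0)
  also have "\<dots> \<le> (\<Sum>v\<in>V x. \<nu> {x} {v} * S v)"
    using V[OF x] by (intro sum_mono2) (auto simp: Bad_def S_def intro!: mult_nonneg_nonneg add_nonneg_nonneg \<nu>0)
  finally have "\<tau>\<^sup>2 * (\<Sum>v\<in>Bad. \<nu> {x} {v}) / real (card (V x)) \<le> (\<Sum>v\<in>V x. \<nu> {x} {v} * S v) / real (card (V x))"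
    by (rule divide_right_mono) simp
  also have "\<dots> = (\<Sum>v\<in>V x. \<nu> {x} {v} * (?f 1 v)\<^sup>2) / real (card (V x)) + (\<Sum>v\<in>V x. \<nu> {x} {v} * (?f 2 v)\<^sup>2) / real (card (V x))
      + (\<Sum>v\<in>V x. \<nu> {x} {v} * (?g 1 v)\<^sup>2) / real (card (V x)) + (\<Sum>v\<in>V x. \<nu> {x} {v} * (?g 2 v)\<^sup>2) / real (card (V x))"
    unfolding S_def by (simp only: distrib_left sum.distrib add_divide_distrib)
  also have "\<dots> \<le> 4 * ?V"
  proof -
    have sum4: "a + b + c + d \<le> 4 * K" if "a \<le> K" "b \<le> K" "c \<le> K" "d \<le> K" for a b c d K :: real
      using that by linarith
    show ?thesis
      by (rule sum4[OF f[OF disjI1[OF refl]] f[OF disjI2[OF refl]] g[OF disjI1[OF refl]] g[OF disjI2[OF refl]]])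
  qed
  finally have "(\<Sum>v\<in>Bad. \<nu> {x} {v}) / real (card (V x)) \<le> 4 * ?V / \<tau>\<^sup>2"
    using \<tau> by (simp add: pos_le_divide_eq mult.commute)
  moreover have "\<bar>?f n v\<bar> \<le> \<tau> \<and> \<bar>?g n v\<bar> \<le> \<tau>" if "v \<in> V x - Bad" "n = 1 \<or> n = 2" for v n
  proof -
    have "S v \<le> \<tau>\<^sup>2" using that by (auto simp: Bad_def)
    moreover have "(?f n v)\<^sup>2 \<le> S v \<and> (?g n v)\<^sup>2 \<le> S v"
    proof -
      have le4: "a \<le> a + b + c + d" "b \<le> a + b + c + d" "c \<le> a + b + c + d" "d \<le> a + b + c + d"
        if "0 \<le> a" "0 \<le> b" "0 \<le> c" "0 \<le> d" for a b c d :: real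
        using that by linarith+
      note le4 = le4[OF zero_le_power2 zero_le_power2 zero_le_power2 zero_le_power2]
      show ?thesis using that(2)
      proof
        assume "n = 1"
        then show ?thesis unfolding S_def by (simp only:) (intro conjI le4)
      next
        assume "n = 2"
        then show ?thesis unfolding S_def by (simp only:) (intro conjI le4)
      qed
    qed
    ultimately have "(?f n v)\<^sup>2 \<le> \<tau>\<^sup>2 \<and> (?g n v)\<^sup>2 \<le> \<tau>\<^sup>2" by linarith
    then show ?thesis unfolding abs_le_square_iff[symmetric] using \<tau> by simp
  qed
  moreover have "Bad \<subseteq> V x" by (auto simp: Bad_def)
  ultimately show thesis using that by blast
qed

end

section \<open>Weighted hypergraphs as relative weights\<close>

lemma image_crossing:
  assumes \<psi>: "\<And>w. w \<in> t \<Longrightarrow> \<psi> w \<in> V (\<pi> w)" and t: "inj_on \<pi> t" and dis: "disjoint_family_on V J" "\<pi> ` t \<subseteq> J"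
  shows "\<psi> ` t \<in> crossing V (\<pi> ` t)"
  unfolding crossing_def
proof (intro CollectI conjI ballI)
  show "\<psi> ` t \<subseteq> (\<Union>j\<in>\<pi> ` t. V j)" using \<psi> by blast
  fix j assume "j \<in> \<pi> ` t"
  then obtain w where w: "w \<in> t" "\<pi> w = j" by auto
  have "\<psi> ` t \<inter> V j = {\<psi> w}"
  proof
    show "{\<psi> w} \<subseteq> \<psi> ` t \<inter> V j" using w \<psi>[of w] by auto
    show "\<psi> ` t \<inter> V j \<subseteq> {\<psi> w}"
    proof
      fix y assume "y \<in> \<psi> ` t \<inter> V j"
      then obtain w' where w': "w' \<in> t" "y = \<psi> w'" "\<psi> w' \<in> V j" by auto
      then have "\<psi> w' \<in> V (\<pi> w') \<inter> V j" using \<psi> by auto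
      then have "\<pi> w' = j" using dis w w' unfolding disjoint_family_on_def by blast
      then have "w' = w" using inj_onD[OF t, of w' w] w w' by simp
      then show "y \<in> {\<psi> w}" using w' by simp
    qed
  qed
  then show "card (\<psi> ` t \<inter> V j) = 1" by simp
qed

lemma insert_crossing:
  assumes s: "s \<in> crossing V f" and v: "v \<in> V x" and x: "x \<notin> f"
    and dis: "disjoint_family_on V J" "insert x f \<subseteq> J"
  shows "insert v s \<in> crossing V (insert x f)"
  unfolding crossing_def
proof (intro CollectI conjI ballI)
  have sf: "s \<subseteq> (\<Union>j\<in>f. V j)" using s by (simp add: crossing_def)
  show "insert v s \<subseteq> (\<Union>j\<in>insert x f. V j)" using sf v by auto
  have dj: "V i \<inter> V j = {}" if "i \<in> insert x f" "j \<in> insert x f" "i \<noteq> j" for i j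
    using dis that unfolding disjoint_family_on_def by blast
  fix j assume j: "j \<in> insert x f"
  show "card (insert v s \<inter> V j) = 1"
  proof (cases "j = x")
    case True
    have "s \<inter> V x = {}" using sf dj[of _ x] x by auto
    then have "insert v s \<inter> V j = {v}" using v True by auto
    then show ?thesis by simp
  next
    case False
    then have "v \<notin> V j" using dj[of x j] j v by auto
    then have "insert v s \<inter> V j = s \<inter> V j" by auto
    then show ?thesis using s j False by (auto simp: crossing_def)
  qed
qed

lemma crossing_empty: "crossing V {} = {{}}"
  by (auto simp: crossing_def)

text \<open>The densities \<open>\<kappa>\<close> and the weight of the empty edge come out as a
  factor independent of \<open>h\<close>. Graphs that differ only on their top edges share this
  factor, so regularity becomes a comparison of values of \<open>oct_link\<close>.\<close>

lemma oct_hom_density: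
  fixes \<kappa> :: "'j set \<Rightarrow> real"
  assumes e: "finite e" "e \<noteq> {}" "e \<subseteq> J" and dis: "disjoint_family_on V J"
    and low: "\<And>f s. f \<subset> e \<Longrightarrow> f \<noteq> {} \<Longrightarrow> s \<in> crossing V f \<Longrightarrow> g s = \<kappa> f * G f s"
    and top: "\<And>s. s \<in> crossing V e \<Longrightarrow> g s = \<kappa> e * G e s * h e s"
  shows "hom_density g V fst (oct_vertices e (\<lambda>_. n)) (oct_edges e (\<lambda>_. n))
       = g {} * (\<Prod>t\<in>oct_edges e (\<lambda>_. n) - {{}}. \<kappa> (fst ` t)) * oct_link V e G h n"
proof -
  let ?O = "oct_edges e (\<lambda>_. n)" and ?B = "trans_edges e (\<lambda>_. n)"
  have ov: "oct_vertices e (\<lambda>_. n) = e \<times> {..<n}" by (auto simp: oct_vertices_def)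
  have fin: "finite ?O"
    by (rule finite_subset[of _ "Pow (e \<times> {..<n})"]) (use e in \<open>auto simp: oct_edges_def ov\<close>)
  have O0: "{} \<in> ?O" by (simp add: oct_edges_def)
  have B: "?B = {t\<in>?O - {{}}. fst ` t = e}" using e(2) by (auto simp: trans_edges_def)
  have pt: "(\<Prod>t\<in>?O. g (\<psi> ` t)) = (g {} * (\<Prod>t\<in>?O - {{}}. \<kappa> (fst ` t))) * (wprod G (?O - {{}}) \<psi> * wprod h ?B \<psi>)"
    if \<psi>: "\<psi> \<in> PiE (e \<times> {..<n}) (\<lambda>w. V (fst w))" for \<psi>
  proof -
    have val: "g (\<psi> ` t) = \<kappa> (fst ` t) * (G (fst ` t) (\<psi> ` t) * (if fst ` t = e then h (fst ` t) (\<psi> ` t) else 1))"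
      if t: "t \<in> ?O - {{}}" for t
    proof -
      have t': "t \<subseteq> e \<times> {..<n}" "inj_on fst t" "t \<noteq> {}" using t by (auto simp: oct_edges_def ov)
      then have ft: "fst ` t \<subseteq> e" "fst ` t \<noteq> {}" by auto
      have "\<psi> w \<in> V (fst w)" if "w \<in> t" for w using PiE_mem[OF \<psi>, of w] t'(1) that by auto
      then have cr: "\<psi> ` t \<in> crossing V (fst ` t)"
        by (rule image_crossing[OF _ t'(2) dis]) (use ft e in auto)
      show ?thesis
      proof (cases "fst ` t = e")
        case True
        then show ?thesis using top[of "\<psi> ` t"] cr by simp
      next
        case False
        then show ?thesis using low[OF _ ft(2) cr] ft(1) by auto
      qed
    qed
    have "(\<Prod>t\<in>?O. g (\<psi> ` t)) = g {} * (\<Prod>t\<in>?O - {{}}. g (\<psi> ` t))"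
      by (subst prod.remove[OF fin O0]) simp
    also have "(\<Prod>t\<in>?O - {{}}. g (\<psi> ` t)) = (\<Prod>t\<in>?O - {{}}. \<kappa> (fst ` t) * (G (fst ` t) (\<psi> ` t) * (if fst ` t = e then h (fst ` t) (\<psi> ` t) else 1)))"
      by (rule prod.cong[OF refl]) (rule val)
    also have "\<dots> = (\<Prod>t\<in>?O - {{}}. \<kappa> (fst ` t)) * (wprod G (?O - {{}}) \<psi> * (\<Prod>t\<in>?O - {{}}. if fst ` t = e then h (fst ` t) (\<psi> ` t) else 1))"
      by (simp only: prod.distrib wprod_def)
    also have "(\<Prod>t\<in>?O - {{}}. if fst ` t = e then h (fst ` t) (\<psi> ` t) else 1) = wprod h ?B \<psi>"
      unfolding B wprod_def using fin by (intro prod.inter_filter[symmetric]) simp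
    finally show ?thesis by (simp only: mult.assoc)
  qed
  show ?thesis
    unfolding hom_density_eq_avg ov oct_link_def avg_cmult[symmetric]
    by (rule avg_cong) (rule pt)
qed

text \<open>Positivity of \<open>C l {}\<close> and of the densities at level 0 makes the
  normalisation legitimate. Where it fails, the claimed lower bound is 0, and
  \<open>gpe_count\<close> settles that case before this locale is entered.\<close>

locale stage =
  fixes k :: nat and VH :: "'v::linorder set" and H :: "'v set set" and \<phi> :: "'v \<rightharpoonup> 'a"
    and V :: "'v \<Rightarrow> 'a set" and C :: "nat \<Rightarrow> 'a set \<Rightarrow> real" and D :: "nat \<Rightarrow> 'v set \<Rightarrow> real"
    and \<delta> :: "nat \<Rightarrow> real"
  assumes kc: "k_complex k VH H"
    and cstack: "candidate_stack k VH H \<phi> V C"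
    and dfam: "density_family k VH H D"
    and d0_pos: "\<And>f. f \<in> H \<Longrightarrow> f \<noteq> {} \<Longrightarrow> f \<subseteq> VH - dom \<phi> \<Longrightarrow> 0 < density_after VH \<phi> (D 0) f"
    and \<delta>: "\<And>l. l \<in> {1..k} \<Longrightarrow> 0 < \<delta> l \<and> \<delta> l < 1"
    and gpe3: "\<And>l e. l \<in> {1..k} \<Longrightarrow> e \<subseteq> VH - dom \<phi> \<Longrightarrow> e \<noteq> {} \<Longrightarrow> \<delta> l \<le> (\<Prod>f\<in>{f. f \<subseteq> VH \<and> e \<subseteq> f}. D l f)"
    and C0_pos: "\<And>l. l \<le> k \<Longrightarrow> 0 < C l {}"
begin

definition "U = VH - dom \<phi>"

definition dens :: "nat \<Rightarrow> 'v set \<Rightarrow> real" where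
  "dens l f = density_after VH \<phi> (D l) f"

definition pdens :: "nat \<Rightarrow> 'v set \<Rightarrow> real" where
  "pdens l f = (\<Prod>i\<in>{0..l}. dens i f)"

text \<open>The empty edge gets weight 1: its true weight is a common factor of all counts and is
  not compared with a density.\<close>

definition nrm :: "nat \<Rightarrow> 'v set \<Rightarrow> 'a set \<Rightarrow> real" where
  "nrm l f s = (if f = {} then 1 else C l s / pdens l f)"

text \<open>The junk value \<open>0 / 0 = 0\<close> in \<open>rel\<close> is harmless: \<open>C l\<close> vanishes wherever \<open>C (l - 1)\<close> does.\<close>

definition rel :: "nat \<Rightarrow> 'v set \<Rightarrow> 'a set \<Rightarrow> real" where
  "rel l f s = (if f = {} then 1 else C l s / C (l - 1) s)"

text \<open>At most \<open>k + 1\<close> parts occur: an edge has up to \<open>k\<close> indices,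
  and inheritance adds the vertex being embedded.\<close>

definition good_counts :: "nat \<Rightarrow> real \<Rightarrow> bool" where
  "good_counts l b \<longleftrightarrow> (\<forall>J R. J \<subseteq> U \<and> card J \<le> k + 1 \<and> cpx J R \<longrightarrow> \<bar>cnt J V (nrm l) (nrm l) R {} - 1\<bar> \<le> b)"

lemma fin_VH: "finite VH" and H_card: "\<And>f. f \<in> H \<Longrightarrow> card f \<le> k"
  and H_down: "\<And>f f'. f \<in> H \<Longrightarrow> f' \<subseteq> f \<Longrightarrow> f' \<in> H"
  using kc by (auto simp: k_complex_def)

lemma fin_U: "finite U"
  using fin_VH by (simp add: U_def)

lemma parts: "j \<in> U \<Longrightarrow> finite (V j) \<and> V j \<noteq> {}" and dis: "disjoint_family_on V U"
  using cstack unfolding candidate_stack_def partition_parts_def U_def by blast+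

lemma C_nonneg: "l \<le> k \<Longrightarrow> s \<subseteq> (\<Union>x\<in>U. V x) \<Longrightarrow> 0 \<le> C l s"
  using cstack by (auto simp: candidate_stack_def k_graph_def U_def)

lemma C_mono: "l \<in> {1..k} \<Longrightarrow> s \<subseteq> (\<Union>x\<in>U. V x) \<Longrightarrow> C l s \<le> C (l - 1) s"
  using cstack unfolding candidate_stack_def U_def by blast

lemma C_nonedge: "l \<le> k \<Longrightarrow> f \<subseteq> U \<Longrightarrow> f \<notin> H \<Longrightarrow> s \<in> crossing V f \<Longrightarrow> C l s = 1"
  using cstack unfolding candidate_stack_def U_def by blast

lemma D_nonneg: "l \<le> k \<Longrightarrow> f \<subseteq> VH \<Longrightarrow> 0 \<le> D l f"
  using dfam by (auto simp: density_family_def k_graph_def)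

lemma D_le1: "l \<in> {1..k} \<Longrightarrow> f \<subseteq> VH \<Longrightarrow> D l f \<le> 1"
  using dfam by (auto simp: density_family_def)

lemma D_nonedge: "l \<le> k \<Longrightarrow> f \<subseteq> VH \<Longrightarrow> f \<notin> H \<Longrightarrow> D l f = 1"
  using dfam by (auto simp: density_family_def)

lemma dens_nonneg: "l \<le> k \<Longrightarrow> 0 \<le> dens l f"
  unfolding dens_def density_after_def using D_nonneg by (intro prod_nonneg) auto

lemma dens_le1: "l \<in> {1..k} \<Longrightarrow> dens l f \<le> 1"
  unfolding dens_def density_after_def using D_nonneg D_le1 by (intro prod_le_1) auto

lemma dens_nonedge:
  assumes "l \<le> k" "f \<notin> H"
  shows "dens l f = 1"
  unfolding dens_def density_after_def
proof (rule prod.neutral, intro ballI)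
  fix g assume g: "g \<in> {fa. fa \<subseteq> VH \<and> f \<subseteq> fa \<and> fa - f \<subseteq> dom \<phi>}"
  then have "g \<notin> H" using H_down[of g f] assms(2) by auto
  then show "D l g = 1" using D_nonedge[of l g] assms(1) g by auto
qed

text \<open>(GPE3) bounds a product over all supersets of \<open>f\<close>. At levels from 1 on the
  factors are at most 1, so passing to the fewer factors in \<open>density_after\<close> can only
  enlarge it.\<close>

lemma dens_ge_\<delta>:
  assumes "l \<in> {1..k}" "f \<subseteq> U" "f \<noteq> {}"
  shows "\<delta> l \<le> dens l f"
proof -
  let ?A = "{g. g \<subseteq> VH \<and> f \<subseteq> g}" and ?B = "{g. g \<subseteq> VH \<and> f \<subseteq> g \<and> g - f \<subseteq> dom \<phi>}"
  have fin: "finite ?A" using fin_VH by simp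
  have "\<delta> l \<le> (\<Prod>g\<in>?A. D l g)" using gpe3 assms by (auto simp: U_def)
  also have "\<dots> = (\<Prod>g\<in>?A - ?B. D l g) * (\<Prod>g\<in>?B. D l g)"
    by (rule prod.subset_diff) (use fin in auto)
  also have "\<dots> \<le> 1 * (\<Prod>g\<in>?B. D l g)"
    using assms(1) D_nonneg D_le1 by (intro mult_right_mono prod_le_1 prod_nonneg) auto
  finally show ?thesis by (simp add: dens_def density_after_def)
qed

lemma dens_pos: "l \<le> k \<Longrightarrow> f \<subseteq> U \<Longrightarrow> f \<noteq> {} \<Longrightarrow> 0 < dens l f"
proof (cases "l = 0")
  case True
  assume "f \<subseteq> U" "f \<noteq> {}"
  then show ?thesis using True d0_pos[of f] dens_nonedge[of 0 f] by (cases "f \<in> H") (auto simp: dens_def U_def)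
next
  case False
  assume "l \<le> k" "f \<subseteq> U" "f \<noteq> {}"
  then show ?thesis using dens_ge_\<delta>[of l f] \<delta>[of l] False by auto
qed

lemma pdens_pos: "l \<le> k \<Longrightarrow> f \<subseteq> U \<Longrightarrow> f \<noteq> {} \<Longrightarrow> 0 < pdens l f"
  unfolding pdens_def by (intro prod_pos ballI dens_pos) auto

lemma pdens_nonneg: "l \<le> k \<Longrightarrow> 0 \<le> pdens l f"
  unfolding pdens_def by (intro prod_nonneg ballI dens_nonneg) auto

lemma pdens_step: "l \<in> {1..k} \<Longrightarrow> pdens l f = pdens (l - 1) f * dens l f"
  unfolding pdens_def by (cases l) auto

lemma nrm_empty: "nrm l {} s = 1"
  by (simp add: nrm_def)

lemma C_nrm: "l \<le> k \<Longrightarrow> f \<subseteq> U \<Longrightarrow> f \<noteq> {} \<Longrightarrow> C l s = pdens l f * nrm l f s"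
  using pdens_pos[of l f] by (simp add: nrm_def)

lemma C_rel:
  assumes "l \<in> {1..k}" "s \<subseteq> (\<Union>x\<in>U. V x)" "f \<noteq> {}"
  shows "C l s = C (l - 1) s * rel l f s"
  using C_mono[OF assms(1,2)] C_nonneg[of l s] assms by (cases "C (l - 1) s = 0") (auto simp: rel_def)

lemma crossing_sub: "f \<subseteq> U \<Longrightarrow> s \<in> crossing V f \<Longrightarrow> s \<subseteq> (\<Union>x\<in>U. V x)"
  using UN_mono[of f U V V] by (auto simp: crossing_def)

lemma pseudo:
  assumes "good_counts l b" "l \<le> k" "J \<subseteq> U" "card J \<le> k + 1" "0 \<le> b" "b \<le> 1"
  shows "pseudorandom J V (nrm l) b"
proof
  show fJ: "finite J" using assms(3) fin_U finite_subset by blast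
  show "finite (V j) \<and> V j \<noteq> {}" if "j \<in> J" for j using parts[of j] assms(3) that by blast
  show "0 \<le> nrm l f s" if "s \<subseteq> (\<Union>j\<in>J. V j)" for f s
  proof -
    have "s \<subseteq> (\<Union>x\<in>U. V x)" using that assms(3) by blast
    then show ?thesis using C_nonneg[OF assms(2)] pdens_nonneg[OF assms(2)] by (simp add: nrm_def)
  qed
  show "\<bar>cnt J V (nrm l) (nrm l) R {} - 1\<bar> \<le> b" if "cpx J R" for R
    using assms(1,3,4) that unfolding good_counts_def by blast
qed (use assms in auto)

lemma rel_relative:
  assumes "l \<in> {1..k}" "J \<subseteq> U"
    and "pseudorandom J V \<nu> b"
  shows "pseudorandom.relative J V (rel l)"
  unfolding pseudorandom.relative_def[OF assms(3)]
proof (intro allI impI)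
  fix f s assume "s \<subseteq> (\<Union>j\<in>J. V j)"
  then have s: "s \<subseteq> (\<Union>x\<in>U. V x)" using assms(2) by blast
  have "0 \<le> C l s" "C l s \<le> C (l - 1) s" using C_nonneg[OF _ s] C_mono[OF assms(1) s] assms(1) by auto
  then show "0 \<le> rel l f s \<and> rel l f s \<le> 1"
    by (auto simp: rel_def divide_le_eq_1 intro!: divide_nonneg_nonneg)
qed

text \<open>The THC condition speaks of \<open>k\<close>-complexes containing the empty edge,
  whereas \<open>R\<close> may have edges with \<open>k + 1\<close> vertices or lack the empty one.
  \<open>R'\<close> repairs both without changing the normalised product, because sets of more than
  \<open>k\<close> indices lie outside \<open>H\<close> and have weight and density 1. Four copies
  of at most \<open>k + 1\<close> parts account for the factor \<open>4 * (k + 1)\<close>.\<close>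

lemma thc_good_counts:
  assumes thc: "thc_count k \<eta> cs V U (C 0) q" and q: "\<And>f. f \<subseteq> U \<Longrightarrow> q f = dens 0 f"
    and cs: "4 * (k + 1) \<le> cs" and \<eta>: "0 \<le> \<eta>"
  shows "good_counts 0 (4 * (real k + 1) * \<eta>)"
  unfolding good_counts_def
proof (intro allI impI, elim conjE)
  fix J R assume J: "J \<subseteq> U" "card J \<le> k + 1" and R: "cpx J R"
  have fJ: "finite J" using J fin_U finite_subset by blast
  let ?W = "J \<times> {..<4::nat}" and ?Y = "\<lambda>w. V (fst w)"
  define R' where "R' = insert {} {e\<in>R. card e \<le> k}"
  have Rc: "e \<subseteq> ?W" "inj_on fst e" if "e \<in> R" for e using R that by (auto simp: cpx_def cross_def)
  have Rf: "finite R" using R finite_of_cross[OF fJ] by (auto simp: cpx_def)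
  have R'c: "e \<subseteq> ?W" "inj_on fst e" if "e \<in> R'" for e using Rc that by (auto simp: R'_def)
  have R'f: "finite R'" using Rf by (simp add: R'_def)
  have cW: "card ?W = 4 * card J" by (simp add: card_cartesian_product)
  have nef: "nefin ?W ?Y" using fJ parts J by (auto simp: nefin_def)
  have pc: "partite_complex k U fst ?W R'"
    unfolding partite_complex_def k_complex_def
  proof (intro conjI ballI allI impI)
    fix e e' assume e: "e \<in> R'" "e' \<subseteq> e"
    have "finite e" using R'c(1)[OF e(1)] fJ by (meson finite_SigmaI finite_lessThan finite_subset)
    then have "card e' \<le> card e" using e(2) by (rule card_mono)
    then show "e' \<in> R'" using e R by (auto simp: R'_def cpx_def)
  qed (use fJ J R'c in \<open>auto simp: R'_def\<close>)
  have part4: "\<forall>j\<in>U. card {w\<in>?W. fst w = j} \<le> 4"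
  proof
    fix j
    have "{w\<in>?W. fst w = j} \<subseteq> {j} \<times> {..<4}" by auto
    then have "card {w\<in>?W. fst w = j} \<le> card ({j} \<times> {..<4::nat})" by (intro card_mono) auto
    then show "card {w\<in>?W. fst w = j} \<le> 4" by (simp add: card_cartesian_product)
  qed
  have cs': "card ?W \<le> cs" using cW J(2) cs by simp
  let ?h = "hom_density (C 0) V fst ?W R'" and ?dq = "density_quotient q fst R'"
  have b1: "(1 - real (card ?W) * \<eta>) * (C 0 {} * ?dq) \<le> ?h" "?h \<le> (1 + real (card ?W) * \<eta>) * (C 0 {} * ?dq)"
    using thc pc part4 cs' unfolding thc_count_def by blast+
  have fst_U: "fst ` e \<subseteq> U" if "e \<in> R \<or> e \<in> R'" for e
  proof -
    have "e \<subseteq> ?W" using that Rc R'c by blast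
    then have "fst ` e \<subseteq> J" by auto
    then show ?thesis using J(1) by (rule subset_trans)
  qed
  have dq: "0 < ?dq"
    unfolding density_quotient_def
  proof (rule prod_pos)
    fix e assume e: "e \<in> R' - {{}}"
    then have "fst ` e \<subseteq> U" "fst ` e \<noteq> {}" using fst_U by auto
    then show "0 < q (fst ` e)" using q dens_pos[of 0 "fst ` e"] by simp
  qed
  have mem: "\<psi> ` e \<in> crossing V (fst ` e)" if "\<psi> \<in> PiE ?W ?Y" "e \<in> R \<or> e \<in> R'" for \<psi> e
  proof (rule image_crossing[OF _ _ dis])
    have "e \<subseteq> ?W" using that(2) Rc R'c by blast
    then show "\<psi> w \<in> V (fst w)" if "w \<in> e" for w using PiE_mem[OF \<open>\<psi> \<in> PiE ?W ?Y\<close>, of w] that by auto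
    show "inj_on fst e" using that(2) Rc(2) R'c(2) by blast
    show "fst ` e \<subseteq> U" by (rule fst_U[OF that(2)])
  qed
  have pt: "(\<Prod>e\<in>R'. C 0 (\<psi> ` e)) = (C 0 {} * ?dq) * wprod (nrm 0) R \<psi>" if \<psi>: "\<psi> \<in> PiE ?W ?Y" for \<psi>
  proof -
    have "(\<Prod>e\<in>R'. C 0 (\<psi> ` e)) = C 0 {} * (\<Prod>e\<in>R' - {{}}. C 0 (\<psi> ` e))"
      by (subst prod.remove[OF R'f, of "{}"]) (simp_all add: R'_def)
    also have "(\<Prod>e\<in>R' - {{}}. C 0 (\<psi> ` e)) = (\<Prod>e\<in>R' - {{}}. q (fst ` e) * nrm 0 (fst ` e) (\<psi> ` e))"
    proof (rule prod.cong[OF refl])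
      fix e assume e: "e \<in> R' - {{}}"
      then have f: "fst ` e \<subseteq> U" "fst ` e \<noteq> {}" using fst_U by auto
      show "C 0 (\<psi> ` e) = q (fst ` e) * nrm 0 (fst ` e) (\<psi> ` e)"
        using C_nrm[OF le0 f] q[OF f(1)] by (simp add: pdens_def)
    qed
    also have "\<dots> = ?dq * (\<Prod>e\<in>R' - {{}}. nrm 0 (fst ` e) (\<psi> ` e))"
      by (simp add: prod.distrib density_quotient_def)
    also have "(\<Prod>e\<in>R' - {{}}. nrm 0 (fst ` e) (\<psi> ` e)) = wprod (nrm 0) R \<psi>"
      unfolding wprod_def
    proof (rule prod.mono_neutral_left[OF Rf])
      show "R' - {{}} \<subseteq> R" by (auto simp: R'_def)
      show "\<forall>e\<in>R - (R' - {{}}). nrm 0 (fst ` e) (\<psi> ` e) = 1"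
      proof
        fix e assume e: "e \<in> R - (R' - {{}})"
        show "nrm 0 (fst ` e) (\<psi> ` e) = 1"
        proof (cases "e = {}")
          case False
          then have ck: "k + 1 \<le> card e" using e by (auto simp: R'_def)
          have "card (fst ` e) = card e" using card_image[OF Rc(2)[of e]] e by simp
          then have nH: "fst ` e \<notin> H" using H_card[of "fst ` e"] ck by auto
          have eR: "e \<in> R \<or> e \<in> R'" using e by simp
          have "C 0 (\<psi> ` e) = 1" by (rule C_nonedge[OF le0 fst_U[OF eR] nH mem[OF \<psi> eR]])
          then show ?thesis using dens_nonedge[OF le0 nH] by (simp add: nrm_def pdens_def)
        qed (simp add: nrm_empty)
      qed
    qed
    finally show ?thesis by (simp only: mult.assoc)
  qed
  have "?h = (C 0 {} * ?dq) * avg ?W ?Y (wprod (nrm 0) R)"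
    unfolding hom_density_eq_avg avg_cmult[symmetric] by (rule avg_cong) (rule pt)
  then have h: "?h = (C 0 {} * ?dq) * cnt J V (nrm 0) (nrm 0) R {}"
    by (simp add: cnt_def wprod_def[of "nrm 0" "{}"])
  have pos: "0 < C 0 {} * ?dq" using dq C0_pos[of 0] by simp
  have "1 - real (card ?W) * \<eta> \<le> cnt J V (nrm 0) (nrm 0) R {}" "cnt J V (nrm 0) (nrm 0) R {} \<le> 1 + real (card ?W) * \<eta>"
    using b1 pos unfolding h by (simp_all add: mult.commute[of "C 0 {} * ?dq"] mult_le_cancel_right)
  moreover have "real (card ?W) * \<eta> \<le> 4 * (real k + 1) * \<eta>"
    using cW J(2) \<eta> by (intro mult_right_mono) auto
  ultimately show "\<bar>cnt J V (nrm 0) (nrm 0) R {} - 1\<bar> \<le> 4 * (real k + 1) * \<eta>"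
    by (simp add: abs_le_iff)
qed

end

section \<open>Regularity as a comparison of octahedron counts, and the passage from one level to
  the next\<close>

lemma crossing_proper:
  assumes "s \<in> crossing V f" "f \<subset> e" "e \<subseteq> J" "disjoint_family_on V J"
  shows "s \<notin> crossing V e"
proof
  assume s: "s \<in> crossing V e"
  obtain j where j: "j \<in> e" "j \<notin> f" using assms(2) by blast
  have "V i \<inter> V j = {}" if "i \<in> f" for i
    by (rule disjoint_family_onD[OF assms(4)]) (use assms(2,3) j that in auto)
  moreover have "s \<subseteq> (\<Union>i\<in>f. V i)" using assms(1) by (simp add: crossing_def)
  ultimately have "s \<inter> V j = {}" by auto
  then show False using s j(1) unfolding crossing_def by auto
qed

lemma regular_of_oct_links:
  assumes reg: "regular_wrt e V \<epsilon> d g \<gamma>"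
    and g: "\<And>n. hom_density g V fst (oct_vertices e (\<lambda>_. n)) (oct_edges e (\<lambda>_. n)) = K n * c n"
    and \<gamma>: "\<And>n. hom_density \<gamma> V fst (oct_vertices e (\<lambda>_. n)) (oct_edges e (\<lambda>_. n)) = K n * u n"
    and K: "\<And>n. 0 < K n"
  shows "(d - \<epsilon>) * u 1 \<le> c 1 \<and> c 1 \<le> (d + \<epsilon>) * u 1 \<and> c 2 \<le> (d ^ (2 ^ card e) + \<epsilon>) * u (2::nat)"
proof -
  have "(d - \<epsilon>) * (K 1 * u 1) \<le> K 1 * c 1" "K 1 * c 1 \<le> (d + \<epsilon>) * (K 1 * u 1)"
    "K 2 * c 2 \<le> (d ^ (2 ^ card e) + \<epsilon>) * (K 2 * u 2)"
    using reg unfolding regular_wrt_def Let_def g \<gamma> by blast+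
  then have "K 1 * ((d - \<epsilon>) * u 1) \<le> K 1 * c 1" "K 1 * c 1 \<le> K 1 * ((d + \<epsilon>) * u 1)"
    "K 2 * c 2 \<le> K 2 * ((d ^ (2 ^ card e) + \<epsilon>) * u 2)"
    by (simp_all only: mult.left_commute)
  then show ?thesis using K[of 1] K[of 2] by (simp only: mult_le_cancel_left_pos)
qed

context stage
begin

lemma fin_sub: "e \<subseteq> U \<Longrightarrow> finite e"
  using fin_U finite_subset by blast

lemma pdens_prod_pos:
  assumes "l \<le> k" "e \<subseteq> U"
  shows "0 < (\<Prod>t\<in>oct_edges e u - {{}}. pdens l (fst ` t))"
proof (rule prod_pos)
  fix t assume t: "t \<in> oct_edges e u - {{}}"
  then have "fst ` t \<subseteq> e" "fst ` t \<noteq> {}" by (auto simp: oct_edges_def oct_vertices_def)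
  then show "0 < pdens l (fst ` t)" using pdens_pos assms by auto
qed

lemma hom_base:
  assumes l: "l \<le> k" and e: "e \<subseteq> U" "e \<noteq> {}"
  shows "hom_density (C l) V fst (oct_vertices e (\<lambda>_. n)) (oct_edges e (\<lambda>_. n))
    = C l {} * (\<Prod>t\<in>oct_edges e (\<lambda>_. n) - {{}}. pdens l (fst ` t)) * oct_link V e (nrm l) (\<lambda>_ _. 1) n"
proof (rule oct_hom_density[OF fin_sub[OF e(1)] e(2,1) dis])
  fix f s assume "f \<subset> e" "f \<noteq> {}"
  then show "C l s = pdens l f * nrm l f s" using C_nrm[OF l, of f s] e(1) by auto
next
  fix s show "C l s = pdens l e * nrm l e s * 1" using C_nrm[OF l e, of s] by simp
qed

lemma hom_top:
  assumes l: "l \<in> {1..k}" and e: "e \<subseteq> U" "e \<noteq> {}"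
  shows "hom_density (replace_top V e (C l) (C (l - 1))) V fst (oct_vertices e (\<lambda>_. n)) (oct_edges e (\<lambda>_. n))
    = C (l - 1) {} * (\<Prod>t\<in>oct_edges e (\<lambda>_. n) - {{}}. pdens (l - 1) (fst ` t)) * oct_link V e (nrm (l - 1)) (rel l) n"
proof -
  have l1: "l - 1 \<le> k" using l by auto
  have "replace_top V e (C l) (C (l - 1)) {} = C (l - 1) {}"
    using crossing_proper[of "{}" V "{}" e U] e dis by (auto simp: replace_top_def crossing_empty)
  moreover have "hom_density (replace_top V e (C l) (C (l - 1))) V fst (oct_vertices e (\<lambda>_. n)) (oct_edges e (\<lambda>_. n))
    = replace_top V e (C l) (C (l - 1)) {} * (\<Prod>t\<in>oct_edges e (\<lambda>_. n) - {{}}. pdens (l - 1) (fst ` t)) * oct_link V e (nrm (l - 1)) (rel l) n"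
  proof (rule oct_hom_density[OF fin_sub[OF e(1)] e(2,1) dis])
    fix f s assume f: "f \<subset> e" "f \<noteq> {}" "s \<in> crossing V f"
    then have "s \<notin> crossing V e" using crossing_proper[OF f(3,1) e(1) dis] by simp
    then show "replace_top V e (C l) (C (l - 1)) s = pdens (l - 1) f * nrm (l - 1) f s"
      using C_nrm[OF l1, of f s] f e by (auto simp: replace_top_def)
  next
    fix s assume s: "s \<in> crossing V e"
    then show "replace_top V e (C l) (C (l - 1)) s = pdens (l - 1) e * nrm (l - 1) e s * rel l e s"
      using C_rel[OF l crossing_sub[OF e(1) s] e(2)] C_nrm[OF l1 e, of s] by (simp add: replace_top_def)
  qed
  ultimately show ?thesis by simp
qed

lemma regular_links:
  assumes l: "l \<in> {1..k}" and e: "e \<subseteq> U" "e \<noteq> {}"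
    and reg: "regular_wrt e V \<epsilon> d (replace_top V e (C l) (C (l - 1))) (C (l - 1))"
  defines "u \<equiv> oct_link V e (nrm (l - 1)) (\<lambda>_ _. 1)" and "c \<equiv> oct_link V e (nrm (l - 1)) (rel l)"
  shows "(d - \<epsilon>) * u 1 \<le> c 1 \<and> c 1 \<le> (d + \<epsilon>) * u 1 \<and> c 2 \<le> (d ^ (2 ^ card e) + \<epsilon>) * u 2"
proof (rule regular_of_oct_links[OF reg])
  have l1: "l - 1 \<le> k" using l by auto
  let ?K = "\<lambda>n. C (l - 1) {} * (\<Prod>t\<in>oct_edges e (\<lambda>_. n) - {{}}. pdens (l - 1) (fst ` t))"
  show "hom_density (replace_top V e (C l) (C (l - 1))) V fst (oct_vertices e (\<lambda>_. n)) (oct_edges e (\<lambda>_. n)) = ?K n * c n" for n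
    unfolding c_def by (rule hom_top[OF l e])
  show "hom_density (C (l - 1)) V fst (oct_vertices e (\<lambda>_. n)) (oct_edges e (\<lambda>_. n)) = ?K n * u n" for n
    unfolding u_def by (rule hom_base[OF l1 e])
  show "0 < ?K n" for n using C0_pos[OF l1] pdens_prod_pos[OF l1 e(1)] by simp
qed

lemma oct_link_near_one:
  assumes "good_counts l b" "l \<le> k" "e \<subseteq> U" "e \<noteq> {}" "card e \<le> k + 1" "0 \<le> b" "b \<le> 1" "n \<le> 4"
  shows "\<bar>oct_link V e (nrm l) (\<lambda>_ _. 1) n - 1\<bar> \<le> b"
proof -
  interpret pseudorandom e V "nrm l" b by (rule pseudo) (use assms in auto)
  have "cnt e V (nrm l) (\<lambda>_ _. 1) (oct_edges e (\<lambda>_. n)) (trans_edges e (\<lambda>_. n)) = oct_link V e (nrm l) (\<lambda>_ _. 1) n"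
    by (rule c_oct_eq_oct_link[OF order_refl assms(8) nrm_empty])
  moreover have "\<bar>cnt e V (nrm l) (\<lambda>_ _. 1) (oct_edges e (\<lambda>_. n)) {} - 1\<bar> \<le> b"
    by (rule counts') (rule oct_edges_cpx; use assms in auto)
  ultimately show ?thesis by (simp add: cnt_def wprod_def)
qed

text \<open>Outside \<open>H\<close> all levels have weight 1 by convention, so the quotient
  \<open>rel l\<close> is \<open>1 / 1\<close> there.\<close>

lemma oct_link_nonedge:
  assumes l: "l \<in> {1..k}" and f: "f \<subseteq> U" "f \<notin> H"
  shows "oct_link V f G (rel l) n = oct_link V f G (\<lambda>_ _. 1) n"
  unfolding oct_link_def
proof (rule avg_cong)
  fix \<psi> assume \<psi>: "\<psi> \<in> PiE (f \<times> {..<n}) (\<lambda>w. V (fst w))"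
  have "rel l (fst ` t) (\<psi> ` t) = 1" if t: "t \<in> trans_edges f (\<lambda>_. n)" for t
  proof -
    have t': "t \<subseteq> f \<times> {..<n}" "inj_on fst t" "fst ` t = f"
      using t by (auto simp: trans_edges_def oct_edges_def oct_vertices_def)
    have "\<psi> ` t \<in> crossing V (fst ` t)"
    proof (rule image_crossing[OF _ t'(2) dis])
      show "\<psi> w \<in> V (fst w)" if "w \<in> t" for w using PiE_mem[OF \<psi>, of w] t'(1) that by auto
      show "fst ` t \<subseteq> U" using t'(3) f(1) by simp
    qed
    then have "C i (\<psi> ` t) = 1" if "i \<le> k" for i using C_nonedge[OF that f] t'(3) by simp
    then show ?thesis using l by (auto simp: rel_def)
  qed
  then have "wprod (rel l) (trans_edges f (\<lambda>_. n)) \<psi> = wprod (\<lambda>_ _. 1) (trans_edges f (\<lambda>_. n)) \<psi>"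
    by (simp add: wprod_def)
  then show "wprod G (oct_edges f (\<lambda>_. n) - {{}}) \<psi> * wprod (rel l) (trans_edges f (\<lambda>_. n)) \<psi>
      = wprod G (oct_edges f (\<lambda>_. n) - {{}}) \<psi> * wprod (\<lambda>_ _. 1) (trans_edges f (\<lambda>_. n)) \<psi>" by simp
qed

text \<open>(GPE2) compares with counts of the level below, which equal 1 only up to
  \<open>b\<close>. Replacing them by 1 changes the error from \<open>\<epsilon>\<close> to at most
  \<open>\<epsilon> + b + \<epsilon> * b\<close>. A set outside \<open>H\<close> has density 1 and
  the same weights on both levels.\<close>

lemma regularity_counts:
  assumes l: "l \<in> {1..k}" and gc: "good_counts (l - 1) b" "0 \<le> b" "b \<le> 1"
    and f: "f \<subseteq> U" "f \<noteq> {}" "card f \<le> k + 1" and \<epsilon>: "0 \<le> \<epsilon>" "\<epsilon> \<le> 1"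
    and reg: "f \<in> H \<Longrightarrow> regular_wrt f V \<epsilon> (dens l f) (replace_top V f (C l) (C (l - 1))) (C (l - 1))"
  shows "\<bar>oct_link V f (nrm (l - 1)) (rel l) 1 - dens l f\<bar> \<le> 2 * \<epsilon> + b \<and>
    oct_link V f (nrm (l - 1)) (rel l) 2 \<le> dens l f ^ (2 ^ card f) + (2 * \<epsilon> + b)"
proof -
  let ?c = "oct_link V f (nrm (l - 1)) (rel l)" and ?u = "oct_link V f (nrm (l - 1)) (\<lambda>_ _. 1)"
  have l1: "l - 1 \<le> k" using l by auto
  have u: "\<bar>?u n - 1\<bar> \<le> b" if "n \<le> 4" for n
    by (rule oct_link_near_one[OF gc(1) l1 f gc(2,3) that])
  have d: "0 \<le> dens l f" "dens l f \<le> 1" using dens_nonneg[of l f] dens_le1[OF l, of f] l by auto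
  show ?thesis
  proof (cases "f \<in> H")
    case True
    have r: "(dens l f - \<epsilon>) * ?u 1 \<le> ?c 1" "?c 1 \<le> (dens l f + \<epsilon>) * ?u 1" "?c 2 \<le> (dens l f ^ (2 ^ card f) + \<epsilon>) * ?u 2"
      using regular_links[OF l f(1,2) reg[OF True]] by auto
    have up: "(x + \<epsilon>) * ?u n \<le> x + (2 * \<epsilon> + b)" if "0 \<le> x" "x \<le> 1" "n \<le> 4" for x n
    proof -
      have "(x + \<epsilon>) * ?u n \<le> (x + \<epsilon>) * (1 + b)" using u[OF that(3)] that \<epsilon> by (intro mult_left_mono) auto
      also have "\<dots> = x + \<epsilon> + x * b + \<epsilon> * b" by (simp add: algebra_simps)
      also have "\<dots> \<le> x + \<epsilon> + 1 * b + \<epsilon> * 1" using that gc \<epsilon> by (intro add_mono mult_mono) auto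
      finally show ?thesis by simp
    qed
    have "dens l f - (2 * \<epsilon> + b) \<le> (dens l f - \<epsilon>) * ?u 1"
    proof (cases "dens l f \<le> \<epsilon>")
      case True
      have "(\<epsilon> - dens l f) * ?u 1 \<le> (\<epsilon> - dens l f) * 2" using u[of 1] gc True by (intro mult_left_mono) auto
      then show ?thesis using d gc by (simp add: algebra_simps)
    next
      case False
      have "(dens l f - \<epsilon>) * (1 - b) \<le> (dens l f - \<epsilon>) * ?u 1" using u[of 1] False by (intro mult_left_mono) auto
      moreover have "(dens l f - \<epsilon>) * b \<le> 1 * b" using d \<epsilon> gc by (intro mult_right_mono) auto
      ultimately show ?thesis using \<epsilon> by (simp add: algebra_simps)
    qed
    then have "dens l f - (2 * \<epsilon> + b) \<le> ?c 1" using r(1) by linarith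
    moreover have "?c 1 \<le> dens l f + (2 * \<epsilon> + b)" using r(2) up[OF d, of 1] by linarith
    moreover have "?c 2 \<le> dens l f ^ (2 ^ card f) + (2 * \<epsilon> + b)"
      using r(3) up[of "dens l f ^ (2 ^ card f)" 2] d by (simp add: power_le_one)
    ultimately show ?thesis by (simp add: abs_le_iff)
  next
    case False
    have "dens l f = 1" using dens_nonedge[OF _ False] l by simp
    moreover have "?c n = ?u n" for n by (rule oct_link_nonedge[OF l f(1) False])
    ultimately show ?thesis using u[of 1] u[of 2] \<epsilon> by (simp add: abs_le_iff)
  qed
qed

text \<open>Counting with \<open>rel l\<close> over level \<open>l - 1\<close> yields a product of
  densities, and dividing by this product yields the normalised count at level \<open>l\<close>. The
  divisor may be small: up to \<open>2 ^ (4 * (k + 1))\<close> edges live on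
  \<open>4 * (k + 1)\<close> vertices, each of density at least \<open>\<delta> l\<close>. This is
  why the bound on \<open>b'\<close> contains that power of \<open>\<delta> l\<close>.\<close>

lemma level_up:
  assumes l: "l \<in> {1..k}" and gc: "good_counts (l - 1) b" "0 \<le> b" "b \<le> 1" and \<epsilon>: "0 \<le> \<epsilon>" "\<epsilon> \<le> 1"
    and reg: "\<And>f. f \<in> H \<Longrightarrow> f \<noteq> {} \<Longrightarrow> f \<subseteq> U \<Longrightarrow> regular_wrt f V \<epsilon> (dens l f) (replace_top V f (C l) (C (l - 1))) (C (l - 1))"
    and t: "0 \<le> t" "t \<le> 1" "\<And>N. N \<le> k + 1 \<Longrightarrow> 2 * \<epsilon> + b \<le> (t ^ (2 ^ N) / 2 ^ (N + 2)) ^ (2 ^ N)"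
    and b': "(52 * (real k + 1) + 1)\<^sup>2 * t \<le> b' * \<delta> l ^ (2 ^ (4 * (k + 1)))"
  shows "good_counts l b'"
  unfolding good_counts_def
proof (intro allI impI, elim conjE)
  fix J R assume J: "J \<subseteq> U" "card J \<le> k + 1" and R: "cpx J R"
  have l1: "l - 1 \<le> k" and lk: "l \<le> k" using l by auto
  interpret pseudorandom J V "nrm (l - 1)" b by (rule pseudo[OF gc(1) l1 J gc(2,3)])
  define d where "d f = (if f \<subseteq> U \<and> f \<noteq> {} then dens l f else 1)" for f
  have d01: "0 \<le> d f \<and> d f \<le> 1" for f using dens_nonneg[OF lk, of f] dens_le1[OF l, of f] by (simp add: d_def)
  have \<theta>: "relative (rel l)" by (rule rel_relative[OF l J(1)]) unfold_locales
  let ?T = "R - {{}}"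
  have Rc: "R \<subseteq> cross J" using R by (simp add: cpx_def)
  have Rf: "finite R" using finite_of_cross[OF finite_J Rc] .
  have fJ: "card f \<le> k + 1" if "f \<subseteq> J" for f using card_mono[OF finite_J that] J(2) by linarith
  have "\<bar>cnt J V (nrm (l - 1)) (rel l) R ?T - dprod d ?T\<bar> \<le> (52 * real (card J) + 1)\<^sup>2 * t"
  proof (rule counting[OF \<theta> d01 _ t(1,2) t(3)[OF J(2)]])
    fix f assume f: "f \<subseteq> J" "f \<noteq> {}"
    have fU: "f \<subseteq> U" using f J by blast
    have "c_oct (rel l) f (\<lambda>_. n) = oct_link V f (nrm (l - 1)) (rel l) n" if "n \<le> 4" for n
      by (rule c_oct_eq_oct_link[OF f(1) that nrm_empty])
    moreover have "\<bar>oct_link V f (nrm (l - 1)) (rel l) 1 - dens l f\<bar> \<le> 2 * \<epsilon> + b \<and>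
        oct_link V f (nrm (l - 1)) (rel l) 2 \<le> dens l f ^ (2 ^ card f) + (2 * \<epsilon> + b)"
      by (rule regularity_counts[OF l gc fU f(2) fJ[OF f(1)] \<epsilon>]) (rule reg[OF _ f(2) fU])
    ultimately show "\<bar>c_oct (rel l) f (\<lambda>_. 1) - d f\<bar> \<le> 2 * \<epsilon> + b \<and> c_oct (rel l) f (\<lambda>_. 2) \<le> d f ^ 2 ^ card f + (2 * \<epsilon> + b)"
      using fU f(2) by (simp add: d_def)
  next
    show "b \<le> (t ^ 2 ^ card J / 2 ^ (card J + 2)) ^ 2 ^ card J" using t(3)[OF J(2)] \<epsilon> by linarith
  qed (use R in auto)
  also have "\<dots> \<le> (52 * (real k + 1) + 1)\<^sup>2 * t"
    using J(2) t(1) by (intro mult_right_mono power_mono) auto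
  finally have err: "\<bar>cnt J V (nrm (l - 1)) (rel l) R ?T - dprod d ?T\<bar> \<le> b' * \<delta> l ^ (2 ^ (4 * (k + 1)))"
    using b' by linarith
  have fU: "fst ` e \<subseteq> U" if "e \<in> R" for e using that Rc J(1) by (fastforce simp: cross_def)
  have dpos: "\<delta> l ^ (2 ^ (4 * (k + 1))) \<le> dprod d ?T"
  proof -
    have "card ?T \<le> card R" using Rf by (intro card_mono) auto
    also have "\<dots> \<le> card (Pow (J \<times> {..<4::nat}))"
      by (rule card_mono) (use finite_J Rc in \<open>auto simp: cross_def\<close>)
    also have "\<dots> = 2 ^ (4 * card J)" by (simp add: card_Pow finite_J card_cartesian_product mult.commute)
    also have "\<dots> \<le> 2 ^ (4 * (k + 1))" using J(2) by (intro power_increasing) auto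
    finally have "\<delta> l ^ (2 ^ (4 * (k + 1))) \<le> \<delta> l ^ card ?T"
      using \<delta>[OF l] by (intro power_decreasing) auto
    also have "\<dots> = (\<Prod>e\<in>?T. \<delta> l)" by simp
    also have "\<dots> \<le> (\<Prod>e\<in>?T. d (fst ` e))"
    proof (rule prod_mono)
      fix e assume "e \<in> ?T"
      then have "fst ` e \<subseteq> U" "fst ` e \<noteq> {}" using fU by auto
      then show "0 \<le> \<delta> l \<and> \<delta> l \<le> d (fst ` e)" using dens_ge_\<delta>[OF l] \<delta>[OF l] by (simp add: d_def)
    qed
    finally show ?thesis by (simp add: dprod_def)
  qed
  have pos: "0 < dprod d ?T" using dpos \<delta>[OF l] by (meson less_le_trans zero_less_power)
  have pt: "wprod (nrm (l - 1)) R \<psi> * wprod (rel l) ?T \<psi> = dprod d ?T * wprod (nrm l) R \<psi>" if \<psi>: "\<psi> \<in> PiE W Y" for \<psi>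
  proof -
    have strip: "wprod (nrm i) R \<psi> = wprod (nrm i) ?T \<psi>" for i
      unfolding wprod_def by (rule prod.mono_neutral_right[OF Rf]) (auto simp: nrm_empty)
    have "nrm (l - 1) (fst ` e) (\<psi> ` e) * rel l (fst ` e) (\<psi> ` e) = d (fst ` e) * nrm l (fst ` e) (\<psi> ` e)" if e: "e \<in> ?T" for e
    proof -
      let ?f = "fst ` e" and ?s = "\<psi> ` e"
      have f: "?f \<subseteq> U" "?f \<noteq> {}" using e fU by auto
      have "?s \<subseteq> (\<Union>j\<in>J. V j)" using image_cross[OF \<psi>, of e] e Rc by auto
      then have s: "?s \<subseteq> (\<Union>x\<in>U. V x)" using J(1) by blast
      have "pdens (l - 1) ?f * (nrm (l - 1) ?f ?s * rel l ?f ?s) = C (l - 1) ?s * rel l ?f ?s"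
        using C_nrm[OF l1 f, of ?s] by simp
      also have "\<dots> = C l ?s" using C_rel[OF l s f(2)] by simp
      also have "\<dots> = pdens (l - 1) ?f * (dens l ?f * nrm l ?f ?s)"
        using C_nrm[OF lk f, of ?s] pdens_step[OF l, of ?f] by simp
      finally show ?thesis using pdens_pos[OF l1 f] f by (simp add: d_def)
    qed
    then show ?thesis unfolding strip by (simp add: wprod_def dprod_def prod.distrib[symmetric])
  qed
  have "cnt J V (nrm (l - 1)) (rel l) R ?T = dprod d ?T * E (wprod (nrm l) R)"
    unfolding cnt_def avg_cmult[symmetric] by (rule avg_cong) (rule pt)
  also have "E (wprod (nrm l) R) = cnt J V (nrm l) (nrm l) R {}" by (simp add: cnt_def wprod_def[of "nrm l" "{}"])
  finally have eq: "cnt J V (nrm (l - 1)) (rel l) R ?T - dprod d ?T = dprod d ?T * (cnt J V (nrm l) (nrm l) R {} - 1)"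
    by (simp add: algebra_simps)
  have b'0: "0 \<le> b'"
  proof -
    have "0 \<le> b' * \<delta> l ^ (2 ^ (4 * (k + 1)))" using err by linarith
    moreover have "0 < \<delta> l ^ (2 ^ (4 * (k + 1)))" using \<delta>[OF l] by simp
    ultimately show ?thesis by (meson mult_neg_pos not_le)
  qed
  have "dprod d ?T * \<bar>cnt J V (nrm l) (nrm l) R {} - 1\<bar> \<le> b' * \<delta> l ^ (2 ^ (4 * (k + 1)))"
    using err pos unfolding eq by (simp add: abs_mult)
  also have "\<dots> \<le> dprod d ?T * b'" using mult_left_mono[OF dpos b'0] by (simp only: mult.commute)
  finally show "\<bar>cnt J V (nrm l) (nrm l) R {} - 1\<bar> \<le> b'" using pos by simp
qed

end

text \<open>The errors of \<open>Q\<close> and \<open>q\<close> contribute \<open>\<tau>\<close>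
  and, as \<open>X * X' + \<epsilon>' \<le> 2\<close>, another \<open>2 * \<tau>\<close>. Since
  \<open>u\<close> may be as small as 1/2, the gain \<open>(\<epsilon>' - \<epsilon>) * u\<close>
  covers these \<open>3 * \<tau>\<close> once the gap between the errors is
  \<open>6 * \<tau>\<close>.\<close>

lemma perturbed_upper:
  fixes u :: real
  assumes "\<bar>Q - X' * c\<bar> \<le> \<tau>" "\<bar>q - u\<bar> \<le> \<tau>" "c \<le> (X + \<epsilon>) * u" "1 / 2 \<le> u" "0 \<le> X" "X \<le> 1" "0 \<le> X'" "X' \<le> 1"
    "0 \<le> \<epsilon>" "\<epsilon> + 6 * \<tau> \<le> \<epsilon>'" "\<epsilon>' \<le> 1" "0 < \<tau>"
  shows "Q \<le> (X * X' + \<epsilon>') * q"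
proof -
  have "X' * c \<le> X' * ((X + \<epsilon>) * u)" using assms by (intro mult_left_mono) auto
  moreover have "X' * (\<epsilon> * u) \<le> 1 * (\<epsilon> * u)" using assms by (intro mult_right_mono) auto
  ultimately have 1: "Q \<le> X * X' * u + \<epsilon> * u + \<tau>" using assms(1) by (simp add: algebra_simps abs_le_iff)
  have XX: "0 \<le> X * X'" "X * X' \<le> 1" using assms by (auto intro: mult_le_one)
  have "(X * X' + \<epsilon>') * (u - \<tau>) \<le> (X * X' + \<epsilon>') * q"
    using assms XX by (intro mult_left_mono) (auto simp: abs_le_iff)
  moreover have "(X * X' + \<epsilon>') * \<tau> \<le> 2 * \<tau>" using XX assms by (intro mult_right_mono) auto
  moreover have "6 * \<tau> * (1 / 2) \<le> (\<epsilon>' - \<epsilon>) * u" using assms by (intro mult_mono) auto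
  ultimately show ?thesis using 1 by (simp add: algebra_simps)
qed

lemma perturbed_lower:
  fixes u :: real
  assumes "\<bar>Q - d' * c\<bar> \<le> \<tau>" "\<bar>q - u\<bar> \<le> \<tau>" "(d - \<epsilon>) * u \<le> c" "1 / 2 \<le> u" "0 \<le> d" "d \<le> 1" "0 \<le> d'" "d' \<le> 1"
    "0 \<le> \<epsilon>" "\<epsilon> + 6 * \<tau> \<le> \<epsilon>'" "\<epsilon>' \<le> 1" "0 < \<tau>"
  shows "(d * d' - \<epsilon>') * q \<le> Q"
proof -
  have "d' * ((d - \<epsilon>) * u) \<le> d' * c" using assms by (intro mult_left_mono) auto
  moreover have "d' * (\<epsilon> * u) \<le> 1 * (\<epsilon> * u)" using assms by (intro mult_right_mono) auto
  ultimately have 1: "d * d' * u - \<epsilon> * u - \<tau> \<le> Q" using assms(1) by (simp add: algebra_simps abs_le_iff)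
  have dd: "0 \<le> d * d'" "d * d' \<le> 1" using assms by (auto intro: mult_le_one)
  have "(d * d' - \<epsilon>') * (q - u) \<le> \<bar>(d * d' - \<epsilon>') * (q - u)\<bar>" by simp
  also have "\<dots> \<le> 1 * \<tau>" unfolding abs_mult
  proof (rule mult_mono)
    show "\<bar>d * d' - \<epsilon>'\<bar> \<le> 1" using dd assms by linarith
  qed (use assms in auto)
  finally have "(d * d' - \<epsilon>') * q \<le> (d * d' - \<epsilon>') * u + \<tau>" by (simp add: algebra_simps)
  moreover have "6 * \<tau> * (1 / 2) \<le> (\<epsilon>' - \<epsilon>) * u" using assms by (intro mult_mono) auto
  ultimately show ?thesis using 1 \<open>0 < \<tau>\<close> by (simp add: algebra_simps)
qed

context stage
begin

lemma link_hom:
  assumes l: "l \<le> k" and x: "x \<in> U" "x \<notin> e" and e: "e \<subseteq> U" "e \<noteq> {}" and v: "v \<in> V x"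
  shows "hom_density (link (C l) v) V fst (oct_vertices e (\<lambda>_. n)) (oct_edges e (\<lambda>_. n))
    = C l {} * C l {v} * (\<Prod>t\<in>oct_edges e (\<lambda>_. n) - {{}}. pdens l (fst ` t) * pdens l (insert x (fst ` t)))
      * oct_link V e (glink x v (nrm l)) (glink x v (\<lambda>_ _. 1)) n"
proof -
  have val: "link (C l) v s = pdens l f * pdens l (insert x f) * glink x v (nrm l) f s" if "f \<subseteq> e" "f \<noteq> {}" for f s
  proof -
    have "f \<subseteq> U" "insert x f \<subseteq> U" using that e x by auto
    then show ?thesis using C_nrm[OF l _ that(2), of s] C_nrm[OF l, of "insert x f" "insert v s"]
      by (simp add: link_def glink_def)
  qed
  have "hom_density (link (C l) v) V fst (oct_vertices e (\<lambda>_. n)) (oct_edges e (\<lambda>_. n))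
    = link (C l) v {} * (\<Prod>t\<in>oct_edges e (\<lambda>_. n) - {{}}. pdens l (fst ` t) * pdens l (insert x (fst ` t)))
      * oct_link V e (glink x v (nrm l)) (glink x v (\<lambda>_ _. 1)) n"
    by (rule oct_hom_density[OF fin_sub[OF e(1)] e(2,1) dis, where \<kappa> = "\<lambda>f. pdens l f * pdens l (insert x f)"])
       (use val e in \<open>simp_all add: glink_def[of x v "\<lambda>_ _. 1"] psubset_imp_subset\<close>)
  then show ?thesis by (simp add: link_def)
qed

lemma link_hom_top:
  assumes l: "l \<in> {1..k}" and x: "x \<in> U" "x \<notin> e" and e: "e \<subseteq> U" "e \<noteq> {}" and v: "v \<in> V x"
  shows "hom_density (replace_top V e (link (C l) v) (link (C (l - 1)) v)) V fst (oct_vertices e (\<lambda>_. n)) (oct_edges e (\<lambda>_. n))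
    = C (l - 1) {} * C (l - 1) {v} * (\<Prod>t\<in>oct_edges e (\<lambda>_. n) - {{}}. pdens (l - 1) (fst ` t) * pdens (l - 1) (insert x (fst ` t)))
      * oct_link V e (glink x v (nrm (l - 1))) (glink x v (rel l)) n"
proof -
  have l1: "l - 1 \<le> k" using l by auto
  let ?g = "replace_top V e (link (C l) v) (link (C (l - 1)) v)"
  have val: "link (C (l - 1)) v s = pdens (l - 1) f * pdens (l - 1) (insert x f) * glink x v (nrm (l - 1)) f s" if "f \<subseteq> e" "f \<noteq> {}" for f s
  proof -
    have "f \<subseteq> U" "insert x f \<subseteq> U" using that e x by auto
    then show ?thesis using C_nrm[OF l1 _ that(2), of s] C_nrm[OF l1, of "insert x f" "insert v s"]
      by (simp add: link_def glink_def)
  qed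
  have "hom_density ?g V fst (oct_vertices e (\<lambda>_. n)) (oct_edges e (\<lambda>_. n))
    = ?g {} * (\<Prod>t\<in>oct_edges e (\<lambda>_. n) - {{}}. pdens (l - 1) (fst ` t) * pdens (l - 1) (insert x (fst ` t)))
      * oct_link V e (glink x v (nrm (l - 1))) (glink x v (rel l)) n"
  proof (rule oct_hom_density[OF fin_sub[OF e(1)] e(2,1) dis, where \<kappa> = "\<lambda>f. pdens (l - 1) f * pdens (l - 1) (insert x f)"])
    fix f s assume f: "f \<subset> e" "f \<noteq> {}" "s \<in> crossing V f"
    then show "?g s = pdens (l - 1) f * pdens (l - 1) (insert x f) * glink x v (nrm (l - 1)) f s"
      using crossing_proper[OF f(3,1) e(1) dis] val[of f s] by (simp add: replace_top_def psubset_imp_subset)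
  next
    fix s assume s: "s \<in> crossing V e"
    have su: "s \<subseteq> (\<Union>x\<in>U. V x)" by (rule crossing_sub[OF e(1) s])
    then have "insert v s \<subseteq> (\<Union>x\<in>U. V x)" using v x by auto
    then have "link (C l) v s = link (C (l - 1)) v s * glink x v (rel l) e s"
      using C_rel[OF l su e(2)] C_rel[OF l, of "insert v s" "insert x e"] by (simp add: link_def glink_def)
    then show "?g s = pdens (l - 1) e * pdens (l - 1) (insert x e) * glink x v (nrm (l - 1)) e s * glink x v (rel l) e s"
      using s val[OF order_refl e(2), of s] by (simp add: replace_top_def)
  qed
  moreover have "?g {} = C (l - 1) {} * C (l - 1) {v}"
    using crossing_proper[of "{}" V "{}" e U] e dis by (auto simp: replace_top_def crossing_empty link_def)
  ultimately show ?thesis by simp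
qed

text \<open>The two regularity hypotheses enter differently. That of \<open>insert x e\<close>,
  whose error \<open>\<epsilon>2\<close> has to be tiny, makes the counts in links concentrate
  around a power of \<open>dens l (insert x e)\<close> times the counts over \<open>e\<close>. That
  of \<open>e\<close> is used only afterwards, to relate the latter to the density of
  \<open>e\<close>, so its error grows by no more than \<open>6 * \<tau>\<close>.\<close>

lemma inherit:
  assumes l: "l \<in> {1..k}" and gc: "good_counts (l - 1) b" "0 \<le> b" "b \<le> 1 / 2"
    and x: "x \<in> U" "x \<notin> e" and e: "e \<subseteq> U" "e \<noteq> {}" "e \<in> H"
    and reg: "regular_wrt e V \<epsilon> (dens l e) (replace_top V e (C l) (C (l - 1))) (C (l - 1))" and \<epsilon>: "0 \<le> \<epsilon>"
    and reg2: "insert x e \<in> H \<Longrightarrow> regular_wrt (insert x e) V \<epsilon>2 (dens l (insert x e)) (replace_top V (insert x e) (C l) (C (l - 1))) (C (l - 1))"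
    and \<epsilon>2: "0 \<le> \<epsilon>2" "\<epsilon>2 \<le> 1"
    and t: "0 \<le> t" "t \<le> 1" "\<And>N. N \<le> k + 1 \<Longrightarrow> 2 * \<epsilon>2 + b \<le> (t ^ (2 ^ N) / 2 ^ (N + 2)) ^ (2 ^ N)"
    and e1: "(52 * (real k + 1) + 1)\<^sup>2 * t \<le> e1" "b \<le> e1"
    and \<tau>: "0 < \<tau>" "\<epsilon> + 6 * \<tau> \<le> \<epsilon>'" "\<epsilon>' \<le> 1"
  obtains Bad where "Bad \<subseteq> V x"
    "(\<Sum>v\<in>Bad. C (l - 1) {v}) / real (card (V x)) \<le> 4 * (5 * sqrt (160 * e1) + 4 * e1) / \<tau>\<^sup>2 * pdens (l - 1) {x}"
    "\<And>v. v \<in> V x - Bad \<Longrightarrow> regular_wrt e V \<epsilon>' (dens l e * dens l (insert x e))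
        (replace_top V e (link (C l) v) (link (C (l - 1)) v)) (link (C (l - 1)) v)"
proof -
  define J where "J = insert x e"
  define \<nu> where "\<nu> = nrm (l - 1)"
  have l1: "l - 1 \<le> k" and lk: "l \<le> k" using l by auto
  have fe: "finite e" by (rule fin_sub[OF e(1)])
  have J: "J \<subseteq> U" "J \<noteq> {}" using x e by (auto simp: J_def)
  have ce: "card e \<le> k" by (rule H_card[OF e(3)])
  have cJ: "card J \<le> k + 1" using ce fe x by (simp add: J_def)
  have b1: "b \<le> 1" using gc by simp
  have pr: "pseudorandom J V \<nu> b" unfolding \<nu>_def by (rule pseudo[OF gc(1) l1 J(1) cJ gc(2) b1])
  interpret pseudorandom J V \<nu> b by (rule pr)
  have empty: "\<nu> {} s = 1" for s by (simp add: \<nu>_def nrm_empty)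
  have \<theta>: "relative (rel l)" by (rule rel_relative[OF l J(1) pr])
  define d' where "d' = dens l J"
  have d': "0 \<le> d'" "d' \<le> 1" using dens_nonneg[OF lk] dens_le1[OF l] by (auto simp: d'_def)
  have cf: "card f \<le> k + 1" if "f \<subseteq> J" for f using card_mono[OF finite_J that] cJ by linarith
  have H: "\<bar>cnt J V \<nu> (rel l) R T - d' ^ card T\<bar> \<le> e1"
    if R: "cpx J R" "T \<subseteq> R" "\<And>s. s \<in> T \<Longrightarrow> fst ` s = J" for R T
  proof -
    \<comment> \<open>Sets smaller than \<open>J\<close> come with no regularity of error
      \<open>\<epsilon>2\<close>, so their relative weights are reset to 1, where counts of
      \<open>\<nu>\<close> suffice. Nothing changes on \<open>T\<close>, whose edges all use the
      whole of \<open>J\<close>.\<close>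
    define \<theta>1 where "\<theta>1 f = (if f = J then rel l f else (\<lambda>_. 1))" for f
    define d where "d f = (if f = J then d' else 1)" for f
    have r1: "relative \<theta>1" using \<theta> by (auto simp: relative_def \<theta>1_def)
    have "\<bar>cnt J V \<nu> \<theta>1 R T - dprod d T\<bar> \<le> (52 * real (card J) + 1)\<^sup>2 * t"
    proof (rule counting[OF r1 _ _ t(1,2) t(3)[OF cJ]])
      show "0 \<le> d f \<and> d f \<le> 1" for f using d' by (simp add: d_def)
      show "b \<le> (t ^ 2 ^ card J / 2 ^ (card J + 2)) ^ 2 ^ card J" using t(3)[OF cJ] \<epsilon>2 by linarith
      show "{} \<notin> T" using R(3) J(2) by fastforce
      fix f assume f: "f \<subseteq> J" "f \<noteq> {}"
      have fU: "f \<subseteq> U" using f J by blast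
      have c: "c_oct \<theta>1 f (\<lambda>_. n) = oct_link V f \<nu> (if f = J then rel l else (\<lambda>_ _. 1)) n" if "n \<le> 4" for n
      proof -
        have "wprod \<theta>1 (trans_edges f (\<lambda>_. n)) \<psi> = wprod (if f = J then rel l else (\<lambda>_ _. 1)) (trans_edges f (\<lambda>_. n)) \<psi>" for \<psi>
          unfolding wprod_def by (rule prod.cong) (auto simp: trans_edges_def \<theta>1_def)
        then have "oct_link V f \<nu> \<theta>1 n = oct_link V f \<nu> (if f = J then rel l else (\<lambda>_ _. 1)) n" by (simp add: oct_link_def)
        then show ?thesis using c_oct_eq_oct_link[OF f(1) that empty, of \<theta>1] by simp
      qed
      show "\<bar>c_oct \<theta>1 f (\<lambda>_. 1) - d f\<bar> \<le> 2 * \<epsilon>2 + b \<and> c_oct \<theta>1 f (\<lambda>_. 2) \<le> d f ^ 2 ^ card f + (2 * \<epsilon>2 + b)"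
      proof (cases "f = J")
        case True
        then show ?thesis
          using regularity_counts[OF l gc(1,2) b1 fU f(2) cf[OF f(1)] \<epsilon>2] reg2 c[of 1] c[of 2] by (simp add: J_def d_def d'_def \<nu>_def)
      next
        case False
        have "\<bar>oct_link V f \<nu> (\<lambda>_ _. 1) n - 1\<bar> \<le> b" if "n \<le> 4" for n
          unfolding \<nu>_def by (rule oct_link_near_one[OF gc(1) l1 fU f(2) cf[OF f(1)] gc(2) b1 that])
        from this[of 1] this[of 2] show ?thesis using False c[of 1] c[of 2] \<epsilon>2 by (simp add: d_def abs_le_iff)
      qed
    qed (use R in auto)
    also have "\<dots> \<le> (52 * (real k + 1) + 1)\<^sup>2 * t"
      using cJ t(1) by (intro mult_right_mono power_mono) auto
    also have "\<dots> \<le> e1" by (rule e1(1))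
    also have "cnt J V \<nu> \<theta>1 R T = cnt J V \<nu> (rel l) R T"
    proof -
      have "wprod \<theta>1 T \<psi> = wprod (rel l) T \<psi>" for \<psi>
        unfolding wprod_def by (rule prod.cong) (auto simp: \<theta>1_def R(3))
      then show ?thesis by (simp add: cnt_def)
    qed
    also have "dprod d T = d' ^ card T"
    proof -
      have "dprod d T = (\<Prod>s\<in>T. d')" unfolding dprod_def by (rule prod.cong) (auto simp: d_def R(3))
      then show ?thesis by simp
    qed
    finally show ?thesis .
  qed
  obtain Bad where Bad: "Bad \<subseteq> V x"
    "(\<Sum>v\<in>Bad. \<nu> {x} {v}) / real (card (V x)) \<le> 4 * (5 * sqrt (160 * e1) + 4 * e1) / \<tau>\<^sup>2"
    "\<And>v n. v \<in> V x - Bad \<Longrightarrow> n = 1 \<or> n = 2 \<Longrightarrow>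
       \<bar>oct_link V e (glink x v \<nu>) (glink x v (rel l)) n - d' ^ (n ^ card e) * c_oct (rel l) e (\<lambda>_. n)\<bar> \<le> \<tau> \<and>
       \<bar>oct_link V e (glink x v \<nu>) (glink x v (\<lambda>_ _. 1)) n - c_oct (\<lambda>_ _. 1) e (\<lambda>_. n)\<bar> \<le> \<tau>"
  proof (rule link_counts[OF \<theta> J_def x(2) e(2) d' _ e1(2) empty \<tau>(1)])
    show "\<bar>cnt J V \<nu> (rel l) R T - d' ^ card T\<bar> \<le> e1"
      if "cpx J R" "T \<subseteq> R" "\<And>s. s \<in> T \<Longrightarrow> fst ` s = J" for R T by (rule H[OF that])
  qed (rule that; assumption)
  have eJ: "e \<subseteq> J" by (auto simp: J_def)
  have co: "c_oct \<theta> e (\<lambda>_. n) = oct_link V e \<nu> \<theta> n" if "n \<le> 4" for \<theta> n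
    by (rule c_oct_eq_oct_link[OF eJ that empty])
  show thesis
  proof (rule that[OF Bad(1)])
    have "(\<Sum>v\<in>Bad. C (l - 1) {v}) = pdens (l - 1) {x} * (\<Sum>v\<in>Bad. \<nu> {x} {v})"
      using C_nrm[OF l1, of "{x}"] x by (simp add: \<nu>_def sum_distrib_left)
    moreover have "0 < pdens (l - 1) {x}" using pdens_pos[OF l1, of "{x}"] x by simp
    then have "pdens (l - 1) {x} * ((\<Sum>v\<in>Bad. \<nu> {x} {v}) / real (card (V x)))
        \<le> pdens (l - 1) {x} * (4 * (5 * sqrt (160 * e1) + 4 * e1) / \<tau>\<^sup>2)"
      using Bad(2) by (intro mult_left_mono) auto
    ultimately show "(\<Sum>v\<in>Bad. C (l - 1) {v}) / real (card (V x)) \<le> 4 * (5 * sqrt (160 * e1) + 4 * e1) / \<tau>\<^sup>2 * pdens (l - 1) {x}"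
      by (simp only: times_divide_eq_right mult.commute)
  next
    fix v assume v: "v \<in> V x - Bad"
    let ?g = "replace_top V e (link (C l) v) (link (C (l - 1)) v)" and ?\<gamma> = "link (C (l - 1)) v"
    let ?d = "dens l e" and ?D = "dens l e * dens l (insert x e)"
    define q where "q = oct_link V e (glink x v \<nu>) (glink x v (\<lambda>_ _. 1))"
    define Q where "Q = oct_link V e (glink x v \<nu>) (glink x v (rel l))"
    define u where "u = oct_link V e \<nu> (\<lambda>_ _. 1)"
    define c where "c = oct_link V e \<nu> (rel l)"
    define K where "K n = C (l - 1) {} * C (l - 1) {v} * (\<Prod>t\<in>oct_edges e (\<lambda>_. n) - {{}}. pdens (l - 1) (fst ` t) * pdens (l - 1) (insert x (fst ` t)))" for n
    have vV: "v \<in> V x" using v by simp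
    have hg: "hom_density ?g V fst (oct_vertices e (\<lambda>_. n)) (oct_edges e (\<lambda>_. n)) = K n * Q n" for n
      unfolding K_def Q_def \<nu>_def by (rule link_hom_top[OF l x e(1,2) vV])
    have h\<gamma>: "hom_density ?\<gamma> V fst (oct_vertices e (\<lambda>_. n)) (oct_edges e (\<lambda>_. n)) = K n * q n" for n
      unfolding K_def q_def \<nu>_def by (rule link_hom[OF l1 x e(1,2) vV])
    \<comment> \<open>\<open>K n\<close> vanishes when \<open>C (l - 1) {v}\<close> does, so the
      inequalities below are multiplied by it and it is never cancelled.\<close>
    have "0 \<le> C (l - 1) {v}" using C_nonneg[OF l1, of "{v}"] vV x by auto
    then have K0: "0 \<le> K n" for n
      unfolding K_def using C0_pos[OF l1] pdens_nonneg[OF l1]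
      by (intro mult_nonneg_nonneg prod_nonneg) auto
    have Qn: "\<bar>Q n - d' ^ (n ^ card e) * c n\<bar> \<le> \<tau>" "\<bar>q n - u n\<bar> \<le> \<tau>" if "n = 1 \<or> n = 2" for n
      using Bad(3)[OF v that] co[of n] that by (auto simp: Q_def q_def u_def c_def)
    have un: "1 / 2 \<le> u n" if "n = 1 \<or> n = 2" for n
    proof -
      have "\<bar>u n - 1\<bar> \<le> b"
        unfolding u_def \<nu>_def by (rule oct_link_near_one[OF gc(1) l1 e(1,2) _ gc(2) b1]) (use ce that in auto)
      then show ?thesis using gc(3) by linarith
    qed
    have rl: "(?d - \<epsilon>) * u 1 \<le> c 1" "c 1 \<le> (?d + \<epsilon>) * u 1" "c 2 \<le> (?d ^ (2 ^ card e) + \<epsilon>) * u 2"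
      using regular_links[OF l e(1,2) reg] by (auto simp: u_def c_def \<nu>_def)
    have d01: "0 \<le> ?d" "?d \<le> 1" using dens_nonneg[OF lk] dens_le1[OF l] by auto
    have D: "?D = ?d * d'" by (simp add: d'_def J_def)
    have q1: "\<bar>Q 1 - d' * c 1\<bar> \<le> \<tau>" using Qn(1)[of 1] by simp
    have r1: "(?D - \<epsilon>') * q 1 \<le> Q 1" unfolding D
      by (rule perturbed_lower[OF q1 Qn(2) rl(1) un d01 d' \<epsilon> \<tau>(2,3,1)]) auto
    have r2: "Q 1 \<le> (?D + \<epsilon>') * q 1" unfolding D
      by (rule perturbed_upper[OF q1 Qn(2) rl(2) un d01 d' \<epsilon> \<tau>(2,3,1)]) auto
    have p01: "0 \<le> ?d ^ (2 ^ card e)" "?d ^ (2 ^ card e) \<le> 1" "0 \<le> d' ^ (2 ^ card e)" "d' ^ (2 ^ card e) \<le> 1"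
      using d01 d' by (auto intro: power_le_one)
    have r3: "Q 2 \<le> (?D ^ (2 ^ card e) + \<epsilon>') * q 2" unfolding D power_mult_distrib
      by (rule perturbed_upper[OF Qn(1) Qn(2) rl(3) un p01 \<epsilon> \<tau>(2,3,1)]) auto
    show "regular_wrt e V \<epsilon>' ?D ?g ?\<gamma>"
      unfolding regular_wrt_def Let_def hg h\<gamma>
    proof (intro conjI allI ballI impI)
      show "?g s = ?\<gamma> s" if "f \<subset> e" "s \<in> crossing V f" for f s
        using crossing_proper[OF that(2,1) e(1) dis] by (simp add: replace_top_def)
      show "?g s \<le> ?\<gamma> s" if s: "s \<in> crossing V e" for s
      proof -
        have su: "s \<subseteq> (\<Union>x\<in>U. V x)" by (rule crossing_sub[OF e(1) s])
        then have su2: "insert v s \<subseteq> (\<Union>x\<in>U. V x)" using vV x by auto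
        have "C l s * C l (insert v s) \<le> C (l - 1) s * C (l - 1) (insert v s)"
          by (rule mult_mono[OF C_mono[OF l su] C_mono[OF l su2] C_nonneg[OF l1 su] C_nonneg[OF lk su2]])
        then show ?thesis using s by (simp add: replace_top_def link_def)
      qed
      show "(?D - \<epsilon>') * (K 1 * q 1) \<le> K 1 * Q 1" using mult_left_mono[OF r1 K0[of 1]] by (simp only: mult.left_commute)
      show "K 1 * Q 1 \<le> (?D + \<epsilon>') * (K 1 * q 1)" using mult_left_mono[OF r2 K0[of 1]] by (simp only: mult.left_commute)
      show "K 2 * Q 2 \<le> (?D ^ 2 ^ card e + \<epsilon>') * (K 2 * q 2)" using mult_left_mono[OF r3 K0[of 2]] by (simp only: mult.left_commute)
    qed
  qed
qed

end

section \<open>The parameters\<close>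

lemma powr_root_power:
  fixes x :: real
  assumes "0 < x" "0 < n"
  shows "(x powr (1 / real n)) ^ n = x"
  using assms by (simp add: powr_realpow[symmetric] powr_powr)

text \<open>The reciprocal of the numerical factor in (VE2). It is small enough to absorb the
  constants below that depend on \<open>k\<close> alone.\<close>

definition a0 :: "nat \<Rightarrow> real" where
  "a0 k = 1 / 2 ^ (2 ^ (k + 6))"

lemma a0_bounds: "0 < a0 k" "a0 k \<le> 1 / 1000"
proof -
  show "0 < a0 k" by (simp add: a0_def)
  have "(2::real) ^ 10 \<le> 2 ^ (2 ^ (k + 6))"
  proof (rule power_increasing)
    have "(2::nat) ^ 6 \<le> 2 ^ (k + 6)" by (rule power_increasing) auto
    then show "10 \<le> (2::nat) ^ (k + 6)" by simp
  qed simp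
  then show "a0 k \<le> 1 / 1000" unfolding a0_def by (simp add: field_simps)
qed

text \<open>For \<open>t = \<Psi> ^ (2 ^ (4 * k + 6))\<close> the nested powers in
  \<open>counting\<close> amount to \<open>\<Psi> ^ A\<close> with
  \<open>A \<le> 2 ^ (6 * k + 8)\<close>. Another \<open>k + 7\<close> factors
  \<open>\<Psi> \<le> a0 k\<close> pay for the denominator \<open>2 ^ B\<close> and the factor 4,
  and \<open>16 ^ (4 * k + 1)\<close> exceeds all these exponents together.\<close>

lemma counting_numbers:
  fixes \<Psi> :: real
  assumes \<Psi>: "0 < \<Psi>" "\<Psi> \<le> a0 k" and k: "1 \<le> k" and N: "N \<le> k + 1"
  shows "4 * \<Psi> ^ (16 ^ (4 * k + 1)) \<le> ((\<Psi> ^ (2 ^ (4 * k + 6))) ^ (2 ^ N) / 2 ^ (N + 2)) ^ (2 ^ N)"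
proof -
  have \<Psi>1: "\<Psi> \<le> 1" using \<Psi> a0_bounds(2)[of k] by linarith
  define A where "A = (2::nat) ^ (4 * k + 6) * 2 ^ N * 2 ^ N"
  define B where "B = (N + 2) * 2 ^ N"
  have A: "A \<le> 2 ^ (6 * k + 8)"
  proof -
    have "A = 2 ^ (4 * k + 6 + N + N)" by (simp only: A_def power_add)
    also have "\<dots> \<le> 2 ^ (6 * k + 8)" using N by (intro power_increasing) auto
    finally show ?thesis .
  qed
  have B: "B + 2 \<le> 2 ^ (k + 6) * (k + 7)"
  proof -
    have "B \<le> (k + 3) * 2 ^ (k + 1)"
      unfolding B_def using N by (intro mult_mono power_increasing) auto
    moreover have "(2::nat) ^ (k + 1) \<le> 2 ^ (k + 6)" by (rule power_increasing) auto
    then have "(k + 3) * 2 ^ (k + 1) \<le> (k + 3) * 2 ^ (k + 6)" by (rule mult_left_mono) simp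
    moreover have "(1::nat) \<le> 2 ^ (k + 6)" by simp
    then have "2 \<le> 4 * (2::nat) ^ (k + 6)" by linarith
    ultimately have "B + 2 \<le> (k + 3) * 2 ^ (k + 6) + 4 * 2 ^ (k + 6)" by linarith
    also have "\<dots> = 2 ^ (k + 6) * (k + 7)" by (simp add: algebra_simps)
    finally show ?thesis .
  qed
  have big: "A + (k + 7) \<le> 16 ^ (4 * k + 1)"
  proof -
    have "k + 7 \<le> 2 ^ (k + 7)" using less_exp[of "k + 7"] by linarith
    also have "\<dots> \<le> 2 ^ (6 * k + 8)" by (rule power_increasing) auto
    finally have "A + (k + 7) \<le> 2 ^ (6 * k + 8) + 2 ^ (6 * k + 8)" using A by (rule add_mono[rotated])
    also have "\<dots> = 2 ^ (6 * k + 9)" by (simp add: power_add)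
    also have "\<dots> \<le> 2 ^ (4 * (4 * k + 1))" using k by (intro power_increasing) auto
    also have "\<dots> = 16 ^ (4 * k + 1)" by (simp only: power_mult) simp
    finally show ?thesis .
  qed
  have "\<Psi> ^ (16 ^ (4 * k + 1)) \<le> \<Psi> ^ (A + (k + 7))"
    using \<Psi> \<Psi>1 big by (intro power_decreasing) auto
  also have "\<dots> = \<Psi> ^ A * \<Psi> ^ (k + 7)" by (simp only: power_add)
  also have "\<dots> \<le> \<Psi> ^ A * (a0 k) ^ (k + 7)" using \<Psi> by (intro mult_left_mono power_mono) auto
  also have "(a0 k) ^ (k + 7) = 1 / 2 ^ (2 ^ (k + 6) * (k + 7))"
    by (simp only: a0_def power_divide power_one power_mult[symmetric])
  also have "\<Psi> ^ A * (1 / 2 ^ (2 ^ (k + 6) * (k + 7))) \<le> \<Psi> ^ A * (1 / 2 ^ (B + 2))"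
    using \<Psi> B by (intro mult_left_mono divide_left_mono power_increasing) auto
  finally have "4 * \<Psi> ^ (16 ^ (4 * k + 1)) \<le> \<Psi> ^ A / 2 ^ B" by (simp add: power_add)
  also have "\<dots> = ((\<Psi> ^ (2 ^ (4 * k + 6))) ^ (2 ^ N) / 2 ^ (N + 2)) ^ (2 ^ N)"
    by (simp only: A_def B_def power_divide power_mult[symmetric])
  finally show ?thesis .
qed

text \<open>Halving the exponent of \<open>\<Psi>\<close> frees at least one factor
  \<open>\<Psi> \<le> a0 k\<close>, and \<open>a0 k\<close> beats the constant of
  \<open>counting\<close>.\<close>

lemma counting_error:
  fixes \<Psi> :: real
  assumes \<Psi>: "0 < \<Psi>" "\<Psi> \<le> a0 k"
  shows "(52 * (real k + 1) + 1)\<^sup>2 * \<Psi> ^ (2 ^ (4 * k + 6)) \<le> \<Psi> ^ (2 ^ (4 * k + 5))"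
proof -
  have \<Psi>1: "\<Psi> \<le> 1" using \<Psi> a0_bounds(2)[of k] by linarith
  have "52 * (real k + 1) + 1 \<le> 2 ^ (k + 7)"
  proof -
    have "Suc k \<le> 2 ^ k" using less_exp[of k] by (rule Suc_leI)
    then have "real (Suc k) \<le> real (2 ^ k)" by (simp only: of_nat_le_iff)
    then have "real k + 1 \<le> 2 ^ k" by simp
    moreover have "(1::real) \<le> 2 ^ k" by simp
    moreover have "52 * r + 1 \<le> 128 * X" if "r \<le> X" "1 \<le> X" for r X :: real using that by argo
    ultimately have "52 * (real k + 1) + 1 \<le> 128 * 2 ^ k" by blast
    then show ?thesis by (simp add: power_add)
  qed
  then have "(52 * (real k + 1) + 1)\<^sup>2 \<le> (2 ^ (k + 7))\<^sup>2" by (intro power_mono) auto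
  also have "\<dots> = 2 ^ ((k + 7) * 2)" by (simp only: power_mult)
  also have "\<dots> \<le> 2 ^ (2 ^ (k + 6))"
  proof (rule power_increasing)
    have gen: "(k + 7) * 2 \<le> 64 * X" if "k < X" "1 \<le> X" for X
    proof -
      have "k * 2 + 14 \<le> 64 * X" using that by linarith
      then show ?thesis by simp
    qed
    have "(k + 7) * 2 \<le> 64 * 2 ^ k" by (rule gen[OF less_exp]) simp
    then show "(k + 7) * 2 \<le> 2 ^ (k + 6)" by (simp add: power_add)
  qed simp
  finally have K: "(52 * (real k + 1) + 1)\<^sup>2 \<le> 1 / a0 k" by (simp add: a0_def)
  have "(52 * (real k + 1) + 1)\<^sup>2 * \<Psi> \<le> 1 / a0 k * a0 k"
    using K \<Psi> a0_bounds(1)[of k] by (intro mult_mono) auto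
  then have KP: "(52 * (real k + 1) + 1)\<^sup>2 * \<Psi> \<le> 1" using a0_bounds(1)[of k] by simp
  have "\<Psi> ^ (2 ^ (4 * k + 6)) \<le> \<Psi> ^ (1 + 2 ^ (4 * k + 5))"
  proof (rule power_decreasing)
    have "(1::nat) \<le> 2 ^ (4 * k + 5)" by simp
    then show "1 + 2 ^ (4 * k + 5) \<le> (2::nat) ^ (4 * k + 6)" by (simp add: power_add)
  qed (use \<Psi> \<Psi>1 in auto)
  then have "(52 * (real k + 1) + 1)\<^sup>2 * \<Psi> ^ (2 ^ (4 * k + 6)) \<le> (52 * (real k + 1) + 1)\<^sup>2 * (\<Psi> * \<Psi> ^ (2 ^ (4 * k + 5)))"
    by (intro mult_left_mono) auto
  also have "\<dots> = ((52 * (real k + 1) + 1)\<^sup>2 * \<Psi>) * \<Psi> ^ (2 ^ (4 * k + 5))" by simp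
  also have "\<dots> \<le> 1 * \<Psi> ^ (2 ^ (4 * k + 5))" using KP \<Psi> by (intro mult_right_mono) auto
  finally show ?thesis by simp
qed

text \<open>For \<open>\<tau> = \<Psi>\<^sup>2\<close> and \<open>e1 = \<Psi> ^ 12\<close> the bound
  of \<open>link_counts\<close> has order \<open>\<Psi> ^ 6 / \<Psi> ^ 4\<close>. One of the two
  remaining factors \<open>\<Psi>\<close> absorbs the constant
  \<open>4 * (5 * 13 + 4) = 276\<close>.\<close>

lemma exceptional_measure:
  fixes \<Psi> :: real
  assumes \<Psi>: "0 < \<Psi>" "\<Psi> \<le> a0 k"
  shows "4 * (5 * sqrt (160 * \<Psi> ^ 12) + 4 * \<Psi> ^ 12) / (\<Psi>\<^sup>2)\<^sup>2 \<le> \<Psi>"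
proof -
  have \<Psi>1: "\<Psi> \<le> 1 / 1000" using \<Psi> a0_bounds(2)[of k] by linarith
  have "sqrt (160 * \<Psi> ^ 12) \<le> 13 * \<Psi> ^ 6"
  proof (rule real_le_lsqrt)
    have "(13 * \<Psi> ^ 6)\<^sup>2 = 169 * \<Psi> ^ 12" by (simp add: power_mult_distrib power_mult[symmetric])
    then show "160 * \<Psi> ^ 12 \<le> (13 * \<Psi> ^ 6)\<^sup>2" using \<Psi> by simp
  qed (use \<Psi> in auto)
  moreover have "\<Psi> ^ 12 \<le> \<Psi> ^ 6" using \<Psi> \<Psi>1 by (intro power_decreasing) auto
  moreover have "4 * (5 * s + 4 * p) \<le> 276 * z" if "s \<le> 13 * z" "p \<le> z" for s p z :: real
    using that by argo
  ultimately have "4 * (5 * sqrt (160 * \<Psi> ^ 12) + 4 * \<Psi> ^ 12) \<le> 276 * \<Psi> ^ 6" by blast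
  also have "\<dots> = (276 * \<Psi>) * (\<Psi> * (\<Psi>\<^sup>2)\<^sup>2)" by (simp add: power_mult[symmetric] power_numeral_reduce)
  also have "\<dots> \<le> 1 * (\<Psi> * (\<Psi>\<^sup>2)\<^sup>2)" using \<Psi> \<Psi>1 by (intro mult_right_mono) auto
  finally show ?thesis using \<Psi> by (simp add: pos_divide_le_eq)
qed

section \<open>Consequences of the validity conditions\<close>

locale ensemble =
  fixes k cs hs \<Delta> \<Delta>' :: nat and \<delta> \<eta> :: "nat \<Rightarrow> real" and \<epsilon> :: "nat \<Rightarrow> nat \<Rightarrow> nat \<Rightarrow> real"
  assumes k2: "2 \<le> k" and \<Delta>_pos: "0 < \<Delta>" and cs: "k * (4 * k + 1) \<le> cs"
    and hs: "k * (4 * k + 1) + k * \<Delta>' \<le> hs" and valid: "valid_ensemble k cs hs \<Delta> \<delta> \<eta> \<epsilon>"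
begin

abbreviation "sh \<equiv> 4 * k + 1"

lemma \<delta>_bounds: "l \<in> {1..k} \<Longrightarrow> 0 < \<delta> l \<and> \<delta> l < 1"
  using valid by (auto simp: valid_ensemble_def)

lemma \<eta>_bounds: "l \<le> k \<Longrightarrow> 0 < \<eta> l \<and> \<eta> l < 1"
  using valid by (auto simp: valid_ensemble_def)

lemma \<epsilon>_bounds: "l \<in> {1..k} \<Longrightarrow> r \<in> {1..k} \<Longrightarrow> h \<le> hs \<Longrightarrow> 0 < \<epsilon> l r h \<and> \<epsilon> l r h < 1"
  using valid by (auto simp: valid_ensemble_def)

text \<open>By \<open>k \<ge> 2\<close> two blocks of \<open>sh\<close> steps fit: one below the hit
  counts in use and one above the at most \<open>\<Delta>'\<close> hits.\<close>

lemma hs_room: "sh + sh + \<Delta>' \<le> hs"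
proof -
  have "2 * sh \<le> k * sh" using k2 by (rule mult_right_mono) simp
  moreover have "1 * \<Delta>' \<le> k * \<Delta>'" using k2 by (intro mult_right_mono) auto
  ultimately have "2 * sh + 1 * \<Delta>' \<le> k * sh + k * \<Delta>'" by (rule add_mono)
  then have "2 * sh + 1 * \<Delta>' \<le> hs" using hs by (rule order_trans)
  then show ?thesis by simp
qed

lemma cs_room: "4 * (k + 1) \<le> cs" "1 \<le> cs"
proof -
  have "2 * sh \<le> k * sh" using k2 by (rule mult_right_mono) simp
  then have "2 * sh \<le> cs" using cs by (rule order_trans)
  then show "4 * (k + 1) \<le> cs" "1 \<le> cs" using k2 by auto
qed

definition \<epsilon>max :: "nat \<Rightarrow> real" where "\<epsilon>max = eps_max k hs \<epsilon>"

lemma \<epsilon>_le_max: "r \<in> {1..k} \<Longrightarrow> h \<le> hs \<Longrightarrow> \<epsilon> l r h \<le> \<epsilon>max l"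
  unfolding \<epsilon>max_def eps_max_def by (rule Max_ge) auto

lemma ve1:
  assumes "l \<in> {1..k}"
  shows "\<eta> 0 \<le> \<eta> l / (72 * (real k + 1) * real cs) * (\<Prod>i\<in>{0<..l}. \<delta> i ^ cs)"
    and "l' \<in> {1..l} \<Longrightarrow> \<epsilon>max l' \<le> \<eta> l * \<delta> l' / (72 * real k * (real k + 1) * (real \<Delta>)\<^sup>2) * (\<Prod>i\<in>{l'<..l}. \<delta> i ^ cs)"
  using valid assms unfolding valid_ensemble_def \<epsilon>max_def by blast+

text \<open>In this unit (VE2) reads \<open>\<epsilon> l r h \<le> q l r (h + 1) ^ 16\<close>. The
  factors \<open>a0 k\<close> and \<open>\<delta> l\<close> inside it stay available for absorbing
  constants and densities.\<close>

definition q :: "nat \<Rightarrow> nat \<Rightarrow> nat \<Rightarrow> real" where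
  "q l r h = a0 k * \<delta> l * \<epsilon> l r h"

lemma a\<delta>: "l \<in> {1..k} \<Longrightarrow> 0 < a0 k * \<delta> l \<and> a0 k * \<delta> l \<le> a0 k \<and> a0 k * \<delta> l \<le> 1 / 1000"
proof -
  assume l: "l \<in> {1..k}"
  have "a0 k * \<delta> l \<le> a0 k * 1" using \<delta>_bounds[OF l] a0_bounds[of k] by (intro mult_left_mono) auto
  moreover have "0 < a0 k * \<delta> l" using \<delta>_bounds[OF l] a0_bounds(1)[of k] by simp
  ultimately show ?thesis using a0_bounds(2)[of k] by linarith
qed

lemma q_bounds:
  assumes "l \<in> {1..k}" "r \<in> {1..k}" "h \<le> hs"
  shows "0 < q l r h" "q l r h \<le> a0 k" "q l r h \<le> \<epsilon> l r h / 1000" "q l r h \<le> 1"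
proof -
  have e: "0 < \<epsilon> l r h" "\<epsilon> l r h < 1" using \<epsilon>_bounds[OF assms] by auto
  have a: "0 < a0 k * \<delta> l" "a0 k * \<delta> l \<le> a0 k" "a0 k * \<delta> l \<le> 1 / 1000" using a\<delta>[OF assms(1)] by auto
  show "0 < q l r h" using a e by (simp add: q_def)
  have "a0 k * \<delta> l * \<epsilon> l r h \<le> a0 k * 1" using a e a0_bounds(1)[of k] by (intro mult_mono) auto
  then show 1: "q l r h \<le> a0 k" by (simp add: q_def)
  have "a0 k * \<delta> l * \<epsilon> l r h \<le> 1 / 1000 * \<epsilon> l r h" using a e by (intro mult_right_mono) auto
  then show "q l r h \<le> \<epsilon> l r h / 1000" by (simp add: q_def)
  show "q l r h \<le> 1" using 1 a0_bounds(2)[of k] by linarith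
qed

text \<open>The factor \<open>real k ^ 3\<close> and all but one power of \<open>\<delta> l\<close>
  are given away, and the exponent 32 of the counting accuracy is lowered to 16, so that both
  quantities obey the same bound.\<close>

lemma ve24:
  assumes l: "l \<in> {1..k}" and r: "r \<in> {1..k}" and h: "h < hs"
  shows "\<epsilon> l r h \<le> q l r (h + 1) ^ 16" "(4 * real k + 1) * \<eta> (l - 1) \<le> q l r (h + 1) ^ 16"
proof -
  let ?x = "\<epsilon> l r h powr (1 / 16)" and ?y = "((4 * real k + 1) * \<eta> (l - 1)) powr (1 / 32)"
  let ?A = "(2::real) ^ (2 ^ (k + 6))" and ?d = "\<delta> l ^ (2 ^ (k + 1))"
  have V: "min (\<epsilon> l r (h + 1)) (1 / 2 ^ k) \<ge> ?A * real k ^ 3 * (?x + ?y) / ?d"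
    using valid l r h unfolding valid_ensemble_def by blast
  have e: "0 < \<epsilon> l r h" "0 < \<epsilon> l r (h + 1)" using \<epsilon>_bounds[OF l r] h by auto
  have "l - 1 \<le> k" using l by auto
  then have \<eta>: "0 < (4 * real k + 1) * \<eta> (l - 1)" using \<eta>_bounds[of "l - 1"] by (intro mult_pos_pos) auto
  have d: "0 < ?d" "?d \<le> \<delta> l"
  proof -
    show "0 < ?d" using \<delta>_bounds[OF l] by simp
    have "?d \<le> \<delta> l ^ 1" using \<delta>_bounds[OF l] by (intro power_decreasing) auto
    then show "?d \<le> \<delta> l" by simp
  qed
  have xy: "0 \<le> ?x" "0 \<le> ?y" by auto
  have "?A * (1 * (?x + ?y)) \<le> ?A * (real k ^ 3 * (?x + ?y))"
    using k2 xy by (intro mult_left_mono mult_right_mono one_le_power) auto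
  also have "\<dots> \<le> \<epsilon> l r (h + 1) * ?d" using V d(1) by (simp add: pos_divide_le_eq mult.assoc)
  also have "\<dots> \<le> \<epsilon> l r (h + 1) * \<delta> l" using d e by (intro mult_left_mono) auto
  finally have "?A * (?x + ?y) \<le> \<epsilon> l r (h + 1) * \<delta> l" by simp
  then have s: "?x + ?y \<le> q l r (h + 1)" by (simp add: q_def a0_def field_simps)
  have sx: "?x \<le> q l r (h + 1)" and sy: "?y \<le> q l r (h + 1)" using s xy by linarith+
  have q1: "0 < q l r (h + 1)" "q l r (h + 1) \<le> 1" using q_bounds[OF l r, of "h + 1"] h by auto
  have "\<epsilon> l r h = ?x ^ 16" using powr_root_power[OF e(1), of 16] by simp
  also have "\<dots> \<le> q l r (h + 1) ^ 16" by (rule power_mono[OF sx xy(1)])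
  finally show "\<epsilon> l r h \<le> q l r (h + 1) ^ 16" .
  have "(4 * real k + 1) * \<eta> (l - 1) = ?y ^ 32" using powr_root_power[OF \<eta>, of 32] by simp
  also have "\<dots> \<le> q l r (h + 1) ^ 32" by (rule power_mono[OF sy xy(2)])
  also have "\<dots> \<le> q l r (h + 1) ^ 16" using q1 by (intro power_decreasing) auto
  finally show "(4 * real k + 1) * \<eta> (l - 1) \<le> q l r (h + 1) ^ 16" .
qed

text \<open>(VE2) can be chained because \<open>q\<close> lies below \<open>\<epsilon>\<close>: each
  step of the hit count multiplies the exponent by 16.\<close>

lemma q_iter:
  assumes l: "l \<in> {1..k}" and r: "r \<in> {1..k}" and "h + j \<le> hs"
  shows "q l r h \<le> q l r (h + j) ^ (16 ^ j)"
  using assms(3)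
proof (induction j)
  case (Suc j)
  have q: "0 < q l r (h + j)" using q_bounds(1)[OF l r] Suc.prems by simp
  have "q l r (h + j) \<le> \<epsilon> l r (h + j)"
    using q_bounds(1,3)[OF l r, of "h + j"] Suc.prems by simp
  also have "\<dots> \<le> q l r (h + Suc j) ^ 16" using ve24(1)[OF l r, of "h + j"] Suc.prems by simp
  finally have "q l r (h + j) ^ (16 ^ j) \<le> (q l r (h + Suc j) ^ 16) ^ (16 ^ j)" using q by (intro power_mono) auto
  then have "q l r (h + j) ^ (16 ^ j) \<le> q l r (h + Suc j) ^ (16 ^ Suc j)" by (simp add: power_mult[symmetric])
  then show ?case using Suc by simp
qed simp

text \<open>The first step is a hypothesis on \<open>z\<close> alone, so one chain serves both the
  regularity parameters and the counting accuracy.\<close>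

lemma below_iter:
  assumes l: "l \<in> {1..k}" and r: "r \<in> {1..k}" and j: "h + j \<le> hs" "1 \<le> j" and z: "0 \<le> z" "z \<le> q l r (h + 1) ^ 16"
  shows "z \<le> q l r (h + j) ^ (16 ^ j)"
proof -
  have "q l r (h + 1) \<le> q l r (h + 1 + (j - 1)) ^ (16 ^ (j - 1))" by (rule q_iter[OF l r]) (use j in auto)
  then have "q l r (h + 1) ^ 16 \<le> (q l r (h + j) ^ (16 ^ (j - 1))) ^ 16"
    using q_bounds(1)[OF l r, of "h + 1"] j by (intro power_mono) auto
  also have "\<dots> = q l r (h + j) ^ (16 ^ (j - 1) * 16)" by (simp only: power_mult)
  also have "16 ^ (j - 1) * 16 = (16::nat) ^ j" using j(2) by (cases j) auto
  finally show ?thesis using z by linarith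
qed

lemma q_mono: "l \<in> {1..k} \<Longrightarrow> r \<in> {1..k} \<Longrightarrow> h \<le> h' \<Longrightarrow> h' \<le> hs \<Longrightarrow> q l r h \<le> q l r h'"
proof -
  assume l: "l \<in> {1..k}" and r: "r \<in> {1..k}" and h: "h \<le> h'" "h' \<le> hs"
  have "q l r h \<le> q l r h' ^ (16 ^ (h' - h))" using q_iter[OF l r, of h "h' - h"] h by simp
  also have "\<dots> \<le> q l r h' ^ 1" using q_bounds[OF l r h(2)] by (intro power_decreasing) auto
  finally show ?thesis by simp
qed

lemma \<epsilon>_mono: "l \<in> {1..k} \<Longrightarrow> r \<in> {1..k} \<Longrightarrow> h \<le> h' \<Longrightarrow> h' \<le> hs \<Longrightarrow> \<epsilon> l r h \<le> \<epsilon> l r h'"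
  using q_mono[of l r h h'] a\<delta>[of l] unfolding q_def by (meson mult_le_cancel_left_pos)

lemma power_16_mono:
  fixes x :: real
  assumes "0 < x" "x \<le> 1" "m \<le> n"
  shows "x ^ (16 ^ n) \<le> x ^ (16 ^ m)"
  using assms by (intro power_decreasing power_increasing) auto

text \<open>This is where (VE3) enters. For edges of size \<open>r + 1\<close> the climb to hit
  count \<open>hs\<close> takes at least \<open>sh\<close> steps and yields the power
  \<open>16 ^ sh\<close>. (VE3) compares the value at the top with that for size \<open>r\<close> at
  hit count 0, and monotonicity raises the latter to \<open>sh\<close>.\<close>

lemma \<epsilon>_next_tiny:
  assumes l: "l \<in> {1..k}" and r: "1 \<le> r" "r + 1 \<le> k" and h: "h \<le> \<Delta>'"
  shows "\<epsilon> l (r + 1) (sh + h) \<le> q l r sh ^ (16 ^ sh)"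
proof -
  have r': "r \<in> {1..k}" "r + 1 \<in> {1..k}" using r by auto
  let ?j = "hs - (sh + h)"
  have j: "sh \<le> ?j" "sh + h + ?j = hs" "1 \<le> ?j" using hs_room h by auto
  have "0 \<le> \<epsilon> l (r + 1) (sh + h)" using \<epsilon>_bounds[OF l r'(2), of "sh + h"] j by auto
  then have "\<epsilon> l (r + 1) (sh + h) \<le> q l (r + 1) (sh + h + ?j) ^ (16 ^ ?j)"
    using ve24(1)[OF l r'(2), of "sh + h"] j by (intro below_iter[OF l r'(2)]) auto
  also have "\<dots> \<le> q l (r + 1) hs ^ (16 ^ sh)"
    unfolding j(2) using q_bounds[OF l r'(2), of hs] j(1) by (intro power_16_mono) auto
  also have "\<dots> \<le> q l r sh ^ (16 ^ sh)"
  proof (rule power_mono)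
    have "r \<in> {1..k - 1}" using r by auto
    then have "\<epsilon> l (r + 1) hs \<le> \<epsilon> l r 0" using valid l unfolding valid_ensemble_def by blast
    also have "\<dots> \<le> \<epsilon> l r sh" by (rule \<epsilon>_mono[OF l r'(1)]) (use hs_room in auto)
    finally show "q l (r + 1) hs \<le> q l r sh" unfolding q_def using a\<delta>[OF l] by (intro mult_left_mono) auto
    show "0 \<le> q l (r + 1) hs" using q_bounds(1)[OF l r'(2), of hs] by simp
  qed
  finally show ?thesis .
qed

lemma \<eta>_tiny:
  assumes l: "l \<in> {1..k}" and r: "r \<in> {1..k}"
  shows "(4 * real k + 1) * \<eta> (l - 1) \<le> q l r sh ^ (16 ^ sh)"
proof -
  have "l - 1 \<le> k" using l by auto
  then have "0 \<le> (4 * real k + 1) * \<eta> (l - 1)" using \<eta>_bounds[of "l - 1"] by (intro mult_nonneg_nonneg) auto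
  moreover have "(4 * real k + 1) * \<eta> (l - 1) \<le> q l r (0 + 1) ^ 16" by (rule ve24(2)[OF l r]) (use hs_room in simp)
  ultimately have "(4 * real k + 1) * \<eta> (l - 1) \<le> q l r (0 + sh) ^ (16 ^ sh)"
    using hs_room by (intro below_iter[OF l r]) auto
  then show ?thesis by simp
qed

lemma \<epsilon>max_le_\<eta>: "l \<in> {1..k} \<Longrightarrow> \<epsilon>max l \<le> \<eta> l"
proof -
  assume l: "l \<in> {1..k}"
  have \<eta>0: "0 < \<eta> l" using \<eta>_bounds[of l] l by simp
  have D: "1 \<le> 72 * real k * (real k + 1) * (real \<Delta>)\<^sup>2"
  proof -
    have "1 * 1 * 1 * (1::real) \<le> 72 * real k * (real k + 1) * (real \<Delta>)\<^sup>2"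
      using k2 \<Delta>_pos by (intro mult_mono) auto
    then show ?thesis by simp
  qed
  have "\<epsilon>max l \<le> \<eta> l * \<delta> l / (72 * real k * (real k + 1) * (real \<Delta>)\<^sup>2)"
    using ve1(2)[OF l, of l] l by simp
  also have "\<dots> \<le> \<eta> l * \<delta> l / 1"
    using D \<eta>0 \<delta>_bounds[OF l] by (intro divide_left_mono) auto
  also have "\<dots> \<le> \<eta> l" using \<eta>0 \<delta>_bounds[OF l] by simp
  finally show ?thesis .
qed

text \<open>The analogue of \<open>q\<close> with \<open>\<eta> l\<close> in place of a regularity
  parameter: the unit for counting errors at level \<open>l\<close>, common to all edge
  sizes.\<close>

definition \<Psi>lev :: "nat \<Rightarrow> real" where "\<Psi>lev l = a0 k * \<delta> l * \<eta> l"

lemma \<Psi>lev_bounds: "l \<in> {1..k} \<Longrightarrow> 0 < \<Psi>lev l \<and> \<Psi>lev l \<le> a0 k"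
proof -
  assume l: "l \<in> {1..k}"
  have "a0 k * \<delta> l * \<eta> l \<le> a0 k * 1" using a\<delta>[OF l] \<eta>_bounds[of l] l a0_bounds(1)[of k] by (intro mult_mono) auto
  then show ?thesis using a\<delta>[OF l] \<eta>_bounds[of l] l by (simp add: \<Psi>lev_def)
qed

lemma q_le_\<Psi>lev:
  assumes l: "l \<in> {1..k}" and r: "r \<in> {1..k}" and h: "h \<le> hs"
  shows "q l r h \<le> \<Psi>lev l"
proof -
  have "\<epsilon> l r h \<le> \<eta> l" using \<epsilon>_le_max[OF r h, of l] \<epsilon>max_le_\<eta>[OF l] by simp
  then show ?thesis unfolding q_def \<Psi>lev_def using a\<delta>[OF l] by (intro mult_left_mono) auto
qed

text \<open>The upper block of \<open>sh\<close> steps, above the hit count \<open>sh + h\<close>,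
  is spent here.\<close>

lemma \<epsilon>_tiny:
  assumes l: "l \<in> {1..k}" and r: "r \<in> {1..k}" and h: "h \<le> \<Delta>'"
  shows "\<epsilon> l r (sh + h) \<le> \<Psi>lev l ^ (16 ^ sh)"
proof -
  have b: "sh + h + sh \<le> hs" using hs_room h by simp
  have "0 \<le> \<epsilon> l r (sh + h)" using \<epsilon>_bounds[OF l r, of "sh + h"] b by auto
  then have "\<epsilon> l r (sh + h) \<le> q l r (sh + h + sh) ^ (16 ^ sh)"
    using ve24(1)[OF l r, of "sh + h"] b by (intro below_iter[OF l r]) auto
  also have "\<dots> \<le> \<Psi>lev l ^ (16 ^ sh)"
    using q_le_\<Psi>lev[OF l r b] q_bounds(1)[OF l r b] by (intro power_mono) auto
  finally show ?thesis .
qed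

lemma \<eta>_tiny_lev:
  assumes l: "l \<in> {1..k}"
  shows "(4 * real k + 1) * \<eta> (l - 1) \<le> \<Psi>lev l ^ (16 ^ sh)"
proof -
  have r: "(1::nat) \<in> {1..k}" using k2 by simp
  have "sh \<le> hs" using hs_room by simp
  then have "q l 1 sh ^ (16 ^ sh) \<le> \<Psi>lev l ^ (16 ^ sh)"
    by (intro power_mono[OF q_le_\<Psi>lev[OF l r]] less_imp_le[OF q_bounds(1)[OF l r]])
  then show ?thesis using \<eta>_tiny[OF l r] by linarith
qed

text \<open>Each \<open>q\<close> involved is at most a thousandth of the right-hand side, and seven
  thousandths are needed.\<close>

lemma \<epsilon>_gap:
  assumes l: "l \<in> {1..k}" and r: "r \<in> {1..k}" and h: "h \<le> \<Delta>'"
  shows "\<epsilon> l r (sh + h) + 6 * (q l r sh)\<^sup>2 \<le> \<epsilon> l r (sh + h + 1)"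
proof -
  have b: "sh + h < hs" "sh + h + 1 \<le> hs" using hs_room h by auto
  let ?q = "q l r (sh + h + 1)"
  have q: "0 < ?q" "?q \<le> 1" "?q \<le> \<epsilon> l r (sh + h + 1) / 1000" using q_bounds[OF l r b(2)] by auto
  have "\<epsilon> l r (sh + h) \<le> ?q ^ 16" by (rule ve24(1)[OF l r b(1)])
  also have "\<dots> \<le> ?q ^ 1" using q by (intro power_decreasing) auto
  finally have 1: "\<epsilon> l r (sh + h) \<le> ?q" by simp
  have qs: "0 < q l r sh" "q l r sh \<le> ?q" "q l r sh \<le> 1"
    using q_bounds[OF l r, of sh] q_mono[OF l r, of sh "sh + h + 1"] b by auto
  have "(q l r sh)\<^sup>2 \<le> q l r sh * 1" unfolding power2_eq_square using qs by (intro mult_left_mono) auto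
  then show ?thesis using 1 qs q by linarith
qed

text \<open>Level 0 has the accuracy delivered by the THC condition. Higher levels aim at a quarter
  of \<open>\<eta> l\<close>, which at level \<open>k\<close> leaves the rest of
  \<open>\<eta> k\<close> for exceptional vertices.\<close>

definition acc :: "nat \<Rightarrow> real" where
  "acc l = (if l = 0 then 4 * (real k + 1) * \<eta> 0 else \<eta> l / 4)"

lemma acc_nonneg: "l \<le> k \<Longrightarrow> 0 \<le> acc l"
  using \<eta>_bounds[of l] by (auto simp: acc_def)

text \<open>The expression \<open>(4 * real k + 1) * \<eta> l\<close> is the one that
  \<open>ve24\<close> controls, so its bounds carry over to \<open>acc\<close>.\<close>

lemma acc_le: "l \<le> k \<Longrightarrow> acc l \<le> 2 * ((4 * real k + 1) * \<eta> l)"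
proof -
  assume "l \<le> k"
  then have \<eta>0: "0 < \<eta> l" using \<eta>_bounds by simp
  have "4 * (real k + 1) \<le> 2 * (4 * real k + 1)" using k2 by simp
  then have 1: "4 * (real k + 1) * \<eta> l \<le> 2 * (4 * real k + 1) * \<eta> l" using \<eta>0 by (intro mult_right_mono) auto
  have "1 / 4 * \<eta> l \<le> 4 * (real k + 1) * \<eta> l" using \<eta>0 by (intro mult_right_mono) auto
  moreover have "2 * (4 * real k + 1) * \<eta> l = 2 * ((4 * real k + 1) * \<eta> l)" by simp
  ultimately have "\<eta> l / 4 \<le> 2 * ((4 * real k + 1) * \<eta> l)" "4 * (real k + 1) * \<eta> l \<le> 2 * ((4 * real k + 1) * \<eta> l)"
    using 1 by linarith+
  then show ?thesis unfolding acc_def by (cases "l = 0") simp_all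
qed

lemma acc_tiny:
  assumes l: "l \<in> {1..k}"
  shows "r \<in> {1..k} \<Longrightarrow> acc (l - 1) \<le> 2 * q l r sh ^ (16 ^ sh)" "acc (l - 1) \<le> 2 * \<Psi>lev l ^ (16 ^ sh)"
proof -
  have a: "acc (l - 1) \<le> 2 * ((4 * real k + 1) * \<eta> (l - 1))" by (rule acc_le) (use l in auto)
  show "r \<in> {1..k} \<Longrightarrow> acc (l - 1) \<le> 2 * q l r sh ^ (16 ^ sh)" using a \<eta>_tiny[OF l, of r] by linarith
  show "acc (l - 1) \<le> 2 * \<Psi>lev l ^ (16 ^ sh)" using a \<eta>_tiny_lev[OF l] by linarith
qed

lemma power_tiny:
  fixes \<Psi> :: real
  assumes "0 < \<Psi>" "\<Psi> \<le> a0 k"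
  shows "2 * \<Psi> ^ (16 ^ sh) \<le> \<Psi> ^ 12" "\<Psi> ^ 12 \<le> 1 / 2" "\<Psi> ^ (2 ^ (4 * k + 5)) \<le> \<Psi> ^ 12"
proof -
  have \<Psi>1: "\<Psi> \<le> 1 / 1000" using assms a0_bounds(2)[of k] by linarith
  have "(16::nat) ^ 1 \<le> 16 ^ sh" by (rule power_increasing) auto
  moreover have "1 + 12 \<le> (16::nat) ^ 1" by simp
  ultimately have "1 + 12 \<le> (16::nat) ^ sh" by (rule order_trans[rotated])
  then have "\<Psi> ^ (16 ^ sh) \<le> \<Psi> ^ (1 + 12)" using assms \<Psi>1 by (intro power_decreasing) auto
  also have "\<dots> = \<Psi> * \<Psi> ^ 12" by (simp only: power_add power_one_right)
  also have "\<dots> \<le> 1 / 2 * \<Psi> ^ 12" using assms \<Psi>1 by (intro mult_right_mono) auto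
  finally show "2 * \<Psi> ^ (16 ^ sh) \<le> \<Psi> ^ 12" by simp
  have "\<Psi> ^ 12 \<le> \<Psi> ^ 1" using assms \<Psi>1 by (intro power_decreasing) auto
  then show "\<Psi> ^ 12 \<le> 1 / 2" using \<Psi>1 by simp
  have "(2::nat) ^ 5 \<le> 2 ^ (4 * k + 5)" by (rule power_increasing) auto
  then show "\<Psi> ^ (2 ^ (4 * k + 5)) \<le> \<Psi> ^ 12" using assms \<Psi>1 by (intro power_decreasing) auto
qed

lemma acc_half: "l \<in> {1..k} \<Longrightarrow> acc (l - 1) \<le> 1 / 2"
  using acc_tiny(2)[of l] \<Psi>lev_bounds[of l] power_tiny(1,2)[of "\<Psi>lev l"] by linarith

text \<open>Each factor of \<open>\<Psi>lev l\<close> has its own duty: \<open>a0 k\<close> yields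
  the 1/4, \<open>\<delta> l\<close> the power required by \<open>level_up\<close>, and
  \<open>\<eta> l\<close> the accuracy.\<close>

lemma level_error:
  assumes l: "l \<in> {1..k}"
  shows "(52 * (real k + 1) + 1)\<^sup>2 * \<Psi>lev l ^ (2 ^ (4 * k + 6)) \<le> acc l * \<delta> l ^ (2 ^ (4 * (k + 1)))"
proof -
  let ?M = "(2::nat) ^ (4 * k + 5)"
  have \<eta>: "0 < \<eta> l" "\<eta> l < 1" using \<eta>_bounds[of l] l by auto
  have d: "0 < \<delta> l" "\<delta> l < 1" using \<delta>_bounds[OF l] by auto
  have M1: "1 \<le> ?M" by simp
  have "(52 * (real k + 1) + 1)\<^sup>2 * \<Psi>lev l ^ (2 ^ (4 * k + 6)) \<le> \<Psi>lev l ^ ?M"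
    by (rule counting_error) (use \<Psi>lev_bounds[OF l] in auto)
  also have "\<dots> = a0 k ^ ?M * \<delta> l ^ ?M * \<eta> l ^ ?M" by (simp only: \<Psi>lev_def power_mult_distrib)
  also have "\<dots> \<le> (1 / 4) * \<delta> l ^ (2 ^ (4 * (k + 1))) * \<eta> l"
  proof (intro mult_mono)
    have "a0 k ^ ?M \<le> a0 k ^ 1" using a0_bounds[of k] M1 by (intro power_decreasing) auto
    then show "a0 k ^ ?M \<le> 1 / 4" using a0_bounds(2)[of k] by simp
    show "\<delta> l ^ ?M \<le> \<delta> l ^ (2 ^ (4 * (k + 1)))"
      using d by (intro power_decreasing power_increasing) auto
    have "\<eta> l ^ ?M \<le> \<eta> l ^ 1" using \<eta> M1 by (intro power_decreasing) auto
    then show "\<eta> l ^ ?M \<le> \<eta> l" by simp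
  qed (use d \<eta> in auto)
  finally show ?thesis using l by (simp add: acc_def mult_ac)
qed

end

section \<open>Embedding one vertex\<close>

lemma regular_mono:
  assumes "regular_wrt e V \<epsilon> d g \<gamma>" "\<epsilon> \<le> \<epsilon>'"
    and nn: "\<And>n. 0 \<le> hom_density \<gamma> V fst (oct_vertices e (\<lambda>_. n)) (oct_edges e (\<lambda>_. n))"
  shows "regular_wrt e V \<epsilon>' d g \<gamma>"
proof -
  let ?h = "\<lambda>h n. hom_density h V fst (oct_vertices e (\<lambda>_. n)) (oct_edges e (\<lambda>_. n))"
  have r: "(\<forall>f\<subset>e. \<forall>s\<in>crossing V f. g s = \<gamma> s)" "(\<forall>s\<in>crossing V e. g s \<le> \<gamma> s)"
    "(d - \<epsilon>) * ?h \<gamma> 1 \<le> ?h g 1" "?h g 1 \<le> (d + \<epsilon>) * ?h \<gamma> 1" "?h g 2 \<le> (d ^ (2 ^ card e) + \<epsilon>) * ?h \<gamma> 2"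
    using assms(1) unfolding regular_wrt_def Let_def by blast+
  have "(d - \<epsilon>') * ?h \<gamma> 1 \<le> (d - \<epsilon>) * ?h \<gamma> 1" "(d + \<epsilon>) * ?h \<gamma> 1 \<le> (d + \<epsilon>') * ?h \<gamma> 1"
    "(d ^ (2 ^ card e) + \<epsilon>) * ?h \<gamma> 2 \<le> (d ^ (2 ^ card e) + \<epsilon>') * ?h \<gamma> 2"
    using assms(2) nn by (auto intro: mult_right_mono)
  then have "(d - \<epsilon>') * ?h \<gamma> 1 \<le> ?h g 1" "?h g 1 \<le> (d + \<epsilon>') * ?h \<gamma> 1" "?h g 2 \<le> (d ^ (2 ^ card e) + \<epsilon>') * ?h \<gamma> 2"
    using r(3-5) by linarith+
  then show ?thesis unfolding regular_wrt_def Let_def using r(1,2) by blast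
qed

text \<open>The sets \<open>f\<close> split according to whether they contain \<open>x\<close>; this
  is one step of the iterated link.\<close>

lemma density_after_extend:
  assumes "finite VH" "x \<in> VH - dom \<phi>" "e \<subseteq> VH - dom \<phi>" "x \<notin> e"
  shows "density_after VH (\<phi>(x \<mapsto> v)) d e = density_after VH \<phi> d e * density_after VH \<phi> d (insert x e)"
proof -
  let ?A = "{f. f \<subseteq> VH \<and> e \<subseteq> f \<and> f - e \<subseteq> dom \<phi>}" and ?B = "{f. f \<subseteq> VH \<and> insert x e \<subseteq> f \<and> f - insert x e \<subseteq> dom \<phi>}"
  have "{f. f \<subseteq> VH \<and> e \<subseteq> f \<and> f - e \<subseteq> dom (\<phi>(x \<mapsto> v))} = ?A \<union> ?B"
  proof (intro equalityI subsetI)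
    fix f assume f: "f \<in> {f. f \<subseteq> VH \<and> e \<subseteq> f \<and> f - e \<subseteq> dom (\<phi>(x \<mapsto> v))}"
    show "f \<in> ?A \<union> ?B" using f by (cases "x \<in> f") (auto simp del: fun_upd_apply)
  next
    fix f assume "f \<in> ?A \<union> ?B"
    then show "f \<in> {f. f \<subseteq> VH \<and> e \<subseteq> f \<and> f - e \<subseteq> dom (\<phi>(x \<mapsto> v))}" by auto
  qed
  moreover have "?A \<inter> ?B = {}" using assms by auto
  moreover have "finite ?A" "finite ?B" using assms(1) by simp_all
  ultimately show ?thesis unfolding density_after_def by (simp add: prod.union_disjoint)
qed

locale setting = ensemble k cs hs \<Delta> \<Delta>' \<delta> \<eta> \<epsilon>
  for k cs hs \<Delta> \<Delta>' :: nat and \<delta> \<eta> :: "nat \<Rightarrow> real" and \<epsilon> :: "nat \<Rightarrow> nat \<Rightarrow> nat \<Rightarrow> real" +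
  fixes VH :: "'v::linorder set" and H :: "'v set set" and V :: "'v \<Rightarrow> 'a set" and D :: "nat \<Rightarrow> 'v set \<Rightarrow> real"
  assumes kcH: "k_complex k VH H" and maxdeg: "max_degree VH H = \<Delta>" and degen: "vertex_degeneracy VH H \<le> \<Delta>'"
    and densities: "density_family k VH H D"
begin

lemma finVH: "finite VH" and Hsub: "\<And>f. f \<in> H \<Longrightarrow> f \<subseteq> VH" and Hcard: "\<And>f. f \<in> H \<Longrightarrow> card f \<le> k"
  and Hdown: "\<And>f f'. f \<in> H \<Longrightarrow> f' \<subseteq> f \<Longrightarrow> f' \<in> H" and Hempty: "{} \<in> H"
  using kcH by (auto simp: k_complex_def)

lemma finH: "finite H"
  by (rule finite_subset[of _ "Pow VH"]) (use Hsub finVH in auto)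

text \<open>The regularity parameter is read off at hit count \<open>sh + hits\<close> instead of \<open>hits\<close>. The \<open>sh\<close> steps
  of (VE2) below it make the parameters of larger edges, which (VE3) places below \<open>\<epsilon> l r 0\<close>, negligible
  against the gap between consecutive hit counts.\<close>

definition gpe :: "('v \<rightharpoonup> 'a) \<Rightarrow> (nat \<Rightarrow> 'a set \<Rightarrow> real) \<Rightarrow> bool" where
  "gpe \<phi> C \<longleftrightarrow> partial_embedding VH \<phi> \<and> candidate_stack k VH H \<phi> V C \<and>
     (VH - dom \<phi> \<noteq> {} \<longrightarrow> (\<exists>p. thc_graph k (\<eta> 0) cs V (VH - dom \<phi>) (C 0) p \<and>
        (\<forall>f\<subseteq>VH - dom \<phi>. p f = density_after VH \<phi> (D 0) f))) \<and>
     (\<forall>l\<in>{1..k}. \<forall>e\<in>H. e \<noteq> {} \<and> e \<subseteq> VH - dom \<phi> \<longrightarrow>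
        regular_wrt e V (\<epsilon> l (card e) (sh + hits H \<phi> e)) (density_after VH \<phi> (D l) e)
          (replace_top V e (C l) (C (l - 1))) (C (l - 1))) \<and>
     (\<forall>l\<in>{1..k}. \<forall>e\<subseteq>VH - dom \<phi>. e \<noteq> {} \<longrightarrow> \<delta> l \<le> (\<Prod>f\<in>{f. f \<subseteq> VH \<and> e \<subseteq> f}. D l f))"

text \<open>As the domain is an initial segment, every embedded vertex precedes all of
  \<open>e\<close>, so the vertices hitting \<open>e\<close> are among those that the
  vertex-degeneracy counts.\<close>

lemma hits_le:
  assumes pe: "partial_embedding VH \<phi>" and e: "e \<in> H" "e \<subseteq> VH - dom \<phi>"
  shows "hits H \<phi> e \<le> \<Delta>'"
proof -
  let ?S = "\<lambda>e. {x\<in>VH. (\<forall>y\<in>e. x \<le> y) \<and> (\<exists>e'\<subseteq>e. e' \<noteq> {} \<and> insert x e' \<in> H)}"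
  have "hits H \<phi> e \<le> card (?S e)"
    unfolding hits_def
  proof (rule card_mono)
    show "finite (?S e)" using finVH by simp
    show "{x \<in> dom \<phi>. \<exists>e'\<subseteq>e. e' \<noteq> {} \<and> insert x e' \<in> H} \<subseteq> ?S e"
    proof
      fix x assume x: "x \<in> {x \<in> dom \<phi>. \<exists>e'\<subseteq>e. e' \<noteq> {} \<and> insert x e' \<in> H}"
      then have xd: "x \<in> dom \<phi>" by blast
      have "x \<le> y" if "y \<in> e" for y
      proof (rule ccontr)
        assume "\<not> x \<le> y"
        then have "y < x" by simp
        moreover have "y \<in> VH" "y \<notin> dom \<phi>" using e(2) that by auto
        ultimately show False using pe xd unfolding partial_embedding_def by blast
      qed
      moreover have "x \<in> VH" using pe xd unfolding partial_embedding_def by blast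
      ultimately show "x \<in> ?S e" using x by blast
    qed
  qed
  also have "card (?S e) \<le> vertex_degeneracy VH H"
    unfolding vertex_degeneracy_def by (rule Max_ge) (use finH e(1) in auto)
  finally show ?thesis using degen by simp
qed

lemma card_in: "e \<in> H \<Longrightarrow> e \<noteq> {} \<Longrightarrow> card e \<in> {1..k}"
  using Hcard[of e] Hsub[of e] finVH finite_subset[of e VH] by (auto simp: card_gt_0_iff Suc_le_eq)

lemma degree_le:
  assumes "x \<in> VH"
  shows "card {e\<in>H. x \<in> e} \<le> \<Delta>"
proof -
  have "card {e\<in>H. x \<in> e} \<le> Max (insert 0 ((\<lambda>v. card {e\<in>H. v \<in> e}) ` VH))"
    by (rule Max_ge) (use finVH assms in auto)
  then show ?thesis using maxdeg by (simp add: max_degree_def)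
qed

definition hit_edges :: "('v \<rightharpoonup> 'a) \<Rightarrow> 'v \<Rightarrow> 'v set set" where
  "hit_edges \<phi> x = {e\<in>H. e \<subseteq> VH - dom \<phi> - {x} \<and> (\<exists>e'\<subseteq>e. e' \<noteq> {} \<and> insert x e' \<in> H)}"

text \<open>A hit edge contains a neighbour of \<open>x\<close>, and \<open>x\<close> has at most \<open>\<Delta>\<close> neighbours.\<close>

lemma card_hit_edges:
  assumes x: "x \<in> VH"
  shows "card (hit_edges \<phi> x) \<le> \<Delta> * \<Delta>"
proof -
  let ?N = "{y\<in>VH. y \<noteq> x \<and> {x, y} \<in> H}"
  have "card ?N \<le> card {e\<in>H. x \<in> e}"
  proof (rule card_inj_on_le[of "\<lambda>y. {x, y}"])
    show "inj_on (\<lambda>y. {x, y}) ?N" by (auto simp: inj_on_def doubleton_eq_iff)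
    show "finite {e\<in>H. x \<in> e}" using finH by simp
  qed auto
  then have N: "card ?N \<le> \<Delta>" using degree_le[OF x] by linarith
  have "hit_edges \<phi> x \<subseteq> (\<Union>y\<in>?N. {e\<in>H. y \<in> e})"
  proof
    fix e assume "e \<in> hit_edges \<phi> x"
    then obtain e' where e: "e \<in> H" "e \<subseteq> VH - dom \<phi> - {x}" "e' \<subseteq> e" "e' \<noteq> {}" "insert x e' \<in> H"
      unfolding hit_edges_def by blast
    then obtain y where y: "y \<in> e'" by blast
    have "{x, y} \<in> H" by (rule Hdown[OF e(5)]) (use y in auto)
    then show "e \<in> (\<Union>y\<in>?N. {e\<in>H. y \<in> e})" using e y by blast
  qed
  then have "card (hit_edges \<phi> x) \<le> card (\<Union>y\<in>?N. {e\<in>H. y \<in> e})"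
    using finVH finH by (intro card_mono) auto
  also have "\<dots> \<le> (\<Sum>y\<in>?N. card {e\<in>H. y \<in> e})" by (rule card_UN_le) (use finVH in simp)
  also have "\<dots> \<le> (\<Sum>y\<in>?N. \<Delta>)" by (rule sum_mono) (use degree_le in simp)
  also have "\<dots> \<le> \<Delta> * \<Delta>" using N by simp
  finally show ?thesis .
qed

lemma hits_extend:
  assumes x: "x \<in> VH - dom \<phi>" and pe: "partial_embedding VH \<phi>"
  shows "hits H (\<phi>(x \<mapsto> v)) e = hits H \<phi> e + (if \<exists>e'\<subseteq>e. e' \<noteq> {} \<and> insert x e' \<in> H then 1 else 0)"
proof -
  let ?P = "\<lambda>x. \<exists>e'\<subseteq>e. e' \<noteq> {} \<and> insert x e' \<in> H"
  have "finite (dom \<phi>)" using pe finVH finite_subset unfolding partial_embedding_def by blast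
  then have fin: "finite {y \<in> dom \<phi>. ?P y}" by simp
  have dom: "dom (\<phi>(x \<mapsto> v)) = insert x (dom \<phi>)" by simp
  show ?thesis
  proof (cases "?P x")
    case True
    then have "{y \<in> dom (\<phi>(x \<mapsto> v)). ?P y} = insert x {y \<in> dom \<phi>. ?P y}" unfolding dom by blast
    moreover have "x \<notin> {y \<in> dom \<phi>. ?P y}" using x by blast
    ultimately show ?thesis unfolding hits_def using True fin by simp
  next
    case False
    then have "{y \<in> dom (\<phi>(x \<mapsto> v)). ?P y} = {y \<in> dom \<phi>. ?P y}" unfolding dom by blast
    then show ?thesis unfolding hits_def using False by simp
  qed
qed

text \<open>The convention for sets outside \<open>H\<close> survives because
  \<open>insert x f\<close> is outside \<open>H\<close> whenever \<open>f\<close> is.\<close>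

lemma candidate_stack_link:
  assumes cst: "candidate_stack k VH H \<phi> V C" and x: "x \<in> VH - dom \<phi>" and v: "v \<in> V x"
  shows "candidate_stack k VH H (\<phi>(x \<mapsto> v)) V (\<lambda>l. link (C l) v)"
proof -
  let ?U = "VH - dom \<phi>" and ?U' = "VH - dom (\<phi>(x \<mapsto> v))"
  let ?S = "\<Union>x\<in>?U. V x" and ?S' = "\<Union>x\<in>?U'. V x"
  have U': "?U' = ?U - {x}" by auto
  have pp: "partition_parts ?U V" and kg: "\<And>l. l \<le> k \<Longrightarrow> k_graph k ?S (C l)"
    and mono: "\<And>l e. l \<in> {1..k} \<Longrightarrow> e \<subseteq> ?S \<Longrightarrow> C l e \<le> C (l - 1) e"
    and one: "\<And>l f e. l \<le> k \<Longrightarrow> f \<subseteq> ?U \<Longrightarrow> f \<notin> H \<Longrightarrow> e \<in> crossing V f \<Longrightarrow> C l e = 1"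
    using cst unfolding candidate_stack_def by blast+
  have dis: "disjoint_family_on V ?U" using pp by (simp add: partition_parts_def)
  have sub: "e \<subseteq> ?S" "insert v e \<subseteq> ?S" if "e \<subseteq> ?S'" for e using that v x unfolding U' by auto
  have nn: "0 \<le> C l e" if "l \<le> k" "e \<subseteq> ?S" for l e using kg[OF that(1)] that(2) by (simp add: k_graph_def)
  have finS: "finite ?S" using pp unfolding partition_parts_def by auto
  show ?thesis
    unfolding candidate_stack_def
  proof (intro conjI allI ballI impI)
    show "partition_parts ?U' V"
      using pp unfolding partition_parts_def U' by (auto intro: disjoint_family_on_mono[of "?U - {x}"])
    show "k_graph k ?S' (link (C l) v)" if l: "l \<le> k" for l
      unfolding k_graph_def
    proof (intro allI impI conjI)
      fix e assume e: "e \<subseteq> ?S'"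
      show "0 \<le> link (C l) v e" unfolding link_def using nn[OF l] sub[OF e] by (intro mult_nonneg_nonneg) auto
      assume big: "k + 1 \<le> card e"
      have "finite (insert v e)" using sub(2)[OF e] finS by (rule finite_subset)
      then have "card e \<le> card (insert v e)" by (intro card_mono) auto
      then show "link (C l) v e = 1"
        using kg[OF l] sub[OF e] big unfolding k_graph_def link_def by simp
    qed
    show "link (C l) v e \<le> link (C (l - 1)) v e" if "l \<in> {1..k}" "e \<subseteq> ?S'" for l e
    proof -
      have "l \<le> k" "l - 1 \<le> k" using that(1) by auto
      then show ?thesis unfolding link_def
        using mono[OF that(1)] sub[OF that(2)] nn by (intro mult_mono) auto
    qed
    show "link (C l) v e = 1" if "l \<le> k" "f \<subseteq> ?U'" "f \<notin> H" "e \<in> crossing V f" for l f e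
    proof -
      have f: "f \<subseteq> ?U" "insert x f \<subseteq> ?U" "x \<notin> f" "insert x f \<notin> H" using that x Hdown[of "insert x f" f] unfolding U' by auto
      have "insert v e \<in> crossing V (insert x f)" by (rule insert_crossing[OF that(4) v f(3) dis f(2)])
      then show ?thesis unfolding link_def using one[OF that(1) f(1) that(3,4)] one[OF that(1) f(2,4)] by simp
    qed
  qed
qed

text \<open>For an unhit edge every weight \<open>C i (insert v s)\<close> with nonempty
  \<open>s\<close> is 1. Passing to the link thus only rescales the octahedron counts of both graphs
  by the common factor \<open>C (l - 1) {v}\<close>, and the error does not grow.\<close>

lemma regular_link_unhit:
  assumes cst: "candidate_stack k VH H \<phi> V C" and l: "l \<in> {1..k}" and x: "x \<in> VH - dom \<phi>" and v: "v \<in> V x"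
    and e: "e \<subseteq> VH - dom \<phi> - {x}" "e \<noteq> {}" and unhit: "\<And>e'. e' \<subseteq> e \<Longrightarrow> e' \<noteq> {} \<Longrightarrow> insert x e' \<notin> H"
    and reg: "regular_wrt e V \<epsilon>' d (replace_top V e (C l) (C (l - 1))) (C (l - 1))"
  shows "regular_wrt e V \<epsilon>' d (replace_top V e (link (C l) v) (link (C (l - 1)) v)) (link (C (l - 1)) v)"
proof -
  let ?U = "VH - dom \<phi>"
  have one: "\<And>l f e. l \<le> k \<Longrightarrow> f \<subseteq> ?U \<Longrightarrow> f \<notin> H \<Longrightarrow> e \<in> crossing V f \<Longrightarrow> C l e = 1"
    and dis: "disjoint_family_on V ?U" and nnk: "\<And>l. l \<le> k \<Longrightarrow> k_graph k (\<Union>x\<in>?U. V x) (C l)"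
    using cst unfolding candidate_stack_def partition_parts_def by blast+
  have l1: "l - 1 \<le> k" "l \<le> k" using l by auto
  have eU: "e \<subseteq> ?U" "finite e" using e finVH finite_subset[of e VH] by auto
  have same: "link (C i) v s = C i s" if "i \<le> k" "f \<subseteq> e" "f \<noteq> {}" "s \<in> crossing V f" for i f s
  proof -
    have f: "x \<notin> f" "insert x f \<subseteq> ?U" using that e x by auto
    have "insert v s \<in> crossing V (insert x f)" by (rule insert_crossing[OF that(4) v f(1) dis f(2)])
    then show ?thesis using one[OF that(1) f(2) unhit[OF that(2,3)]] by (simp add: link_def)
  qed
  let ?h = "\<lambda>g n. hom_density g V fst (oct_vertices e (\<lambda>_. n)) (oct_edges e (\<lambda>_. n))"
  have scale: "?h g' n = C (l - 1) {v} * ?h g n"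
    if g0: "g' {} = C (l - 1) {v} * g {}" and gs: "\<And>f s. f \<subseteq> e \<Longrightarrow> f \<noteq> {} \<Longrightarrow> s \<in> crossing V f \<Longrightarrow> g' s = g s" for g g' n
  proof -
    have a: "?h g' n = g' {} * (\<Prod>t\<in>oct_edges e (\<lambda>_. n) - {{}}. 1) * oct_link V e (\<lambda>_ s. g s) (\<lambda>_ _. 1) n"
    proof (rule oct_hom_density[OF eU(2) e(2) eU(1) dis, where \<kappa> = "\<lambda>_. 1"])
      show "g' s = 1 * g s" if "f \<subset> e" "f \<noteq> {}" "s \<in> crossing V f" for f s
        using gs[OF psubset_imp_subset[OF that(1)] that(2,3)] by simp
      show "g' s = 1 * g s * 1" if "s \<in> crossing V e" for s using gs[OF order_refl e(2) that] by simp
    qed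
    have b: "?h g n = g {} * (\<Prod>t\<in>oct_edges e (\<lambda>_. n) - {{}}. 1) * oct_link V e (\<lambda>_ s. g s) (\<lambda>_ _. 1) n"
      by (rule oct_hom_density[OF eU(2) e(2) eU(1) dis, where \<kappa> = "\<lambda>_. 1"]) auto
    show ?thesis unfolding a b g0 by simp
  qed
  have ne: "{} \<notin> crossing V e" using crossing_proper[of "{}" V "{}" e ?U] e eU dis by (auto simp: crossing_empty)
  have s1: "?h (link (C (l - 1)) v) n = C (l - 1) {v} * ?h (C (l - 1)) n" for n
    by (rule scale) (use same[OF l1(1)] in \<open>auto simp: link_def\<close>)
  have s2: "?h (replace_top V e (link (C l) v) (link (C (l - 1)) v)) n = C (l - 1) {v} * ?h (replace_top V e (C l) (C (l - 1))) n" for n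
  proof (rule scale)
    show "replace_top V e (link (C l) v) (link (C (l - 1)) v) {} = C (l - 1) {v} * replace_top V e (C l) (C (l - 1)) {}"
      using ne by (simp add: replace_top_def link_def)
    show "replace_top V e (link (C l) v) (link (C (l - 1)) v) s = replace_top V e (C l) (C (l - 1)) s"
      if "f \<subseteq> e" "f \<noteq> {}" "s \<in> crossing V f" for f s
      using same[OF l1(1) that] same[OF l1(2) order_refl e(2)] by (simp add: replace_top_def)
  qed
  have cv: "0 \<le> C (l - 1) {v}" using nnk[OF l1(1)] v x unfolding k_graph_def by blast
  have r: "(\<forall>f\<subset>e. \<forall>s\<in>crossing V f. replace_top V e (C l) (C (l - 1)) s = C (l - 1) s)"
    "\<And>s. s \<in> crossing V e \<Longrightarrow> replace_top V e (C l) (C (l - 1)) s \<le> C (l - 1) s"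
    "(d - \<epsilon>') * ?h (C (l - 1)) 1 \<le> ?h (replace_top V e (C l) (C (l - 1))) 1"
    "?h (replace_top V e (C l) (C (l - 1))) 1 \<le> (d + \<epsilon>') * ?h (C (l - 1)) 1"
    "?h (replace_top V e (C l) (C (l - 1))) 2 \<le> (d ^ (2 ^ card e) + \<epsilon>') * ?h (C (l - 1)) 2"
    using reg unfolding regular_wrt_def Let_def by blast+
  show ?thesis
    unfolding regular_wrt_def Let_def s1 s2
  proof (intro conjI allI ballI impI)
    show "replace_top V e (link (C l) v) (link (C (l - 1)) v) s = link (C (l - 1)) v s" if "f \<subset> e" "s \<in> crossing V f" for f s
      using crossing_proper[OF that(2,1) eU(1) dis] by (simp add: replace_top_def)
    show "replace_top V e (link (C l) v) (link (C (l - 1)) v) s \<le> link (C (l - 1)) v s" if "s \<in> crossing V e" for s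
      using r(2)[OF that] same[OF l1(1) order_refl e(2) that] same[OF l1(2) order_refl e(2) that] that by (simp add: replace_top_def)
    show "(d - \<epsilon>') * (C (l - 1) {v} * ?h (C (l - 1)) 1) \<le> C (l - 1) {v} * ?h (replace_top V e (C l) (C (l - 1))) 1"
      using mult_left_mono[OF r(3) cv] by (simp only: mult.left_commute)
    show "C (l - 1) {v} * ?h (replace_top V e (C l) (C (l - 1))) 1 \<le> (d + \<epsilon>') * (C (l - 1) {v} * ?h (C (l - 1)) 1)"
      using mult_left_mono[OF r(4) cv] by (simp only: mult.left_commute)
    show "C (l - 1) {v} * ?h (replace_top V e (C l) (C (l - 1))) 2 \<le> (d ^ 2 ^ card e + \<epsilon>') * (C (l - 1) {v} * ?h (C (l - 1)) 2)"
      using mult_left_mono[OF r(5) cv] by (simp only: mult.left_commute)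
  qed
qed

end

lemma image_upd_away: "x \<notin> e \<Longrightarrow> (\<psi>(x := v)) ` e = \<psi> ` e"
  by (auto simp: fun_upd_image)

lemma (in setting) hom_nonneg:
  assumes cst: "candidate_stack k VH H \<phi> V C" and l: "l \<le> k" and e: "\<pi> ` e \<subseteq> VH - dom \<phi>" "\<And>t. t \<in> R \<Longrightarrow> t \<subseteq> e"
  shows "0 \<le> hom_density (C l) V \<pi> e R"
  unfolding hom_density_eq_avg
proof (rule avg_nonneg, rule prod_nonneg)
  fix \<psi> t assume \<psi>: "\<psi> \<in> PiE e (\<lambda>w. V (\<pi> w))" and t: "t \<in> R"
  have "\<psi> ` t \<subseteq> (\<Union>x\<in>VH - dom \<phi>. V x)"
  proof
    fix y assume "y \<in> \<psi> ` t"
    then obtain w where w: "w \<in> e" "y = \<psi> w" using e(2)[OF t] by blast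
    then have "y \<in> V (\<pi> w)" using PiE_mem[OF \<psi> w(1)] by simp
    moreover have "\<pi> w \<in> VH - dom \<phi>" using e(1) w(1) by blast
    ultimately show "y \<in> (\<Union>x\<in>VH - dom \<phi>. V x)" by blast
  qed
  moreover have "k_graph k (\<Union>x\<in>VH - dom \<phi>. V x) (C l)" using cst l unfolding candidate_stack_def by blast
  ultimately show "0 \<le> C l (\<psi> ` t)" unfolding k_graph_def by blast
qed

section \<open>Good images for the first unembedded vertex\<close>

locale gpe_stage = setting k cs hs \<Delta> \<Delta>' \<delta> \<eta> \<epsilon> VH H V D + stage k VH H \<phi> V C D \<delta>
  for k cs hs \<Delta> \<Delta>' :: nat and \<delta> \<eta> :: "nat \<Rightarrow> real" and \<epsilon> :: "nat \<Rightarrow> nat \<Rightarrow> nat \<Rightarrow> real"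
    and VH :: "'v::linorder set" and H :: "'v set set" and V :: "'v \<Rightarrow> 'a set" and D :: "nat \<Rightarrow> 'v set \<Rightarrow> real"
    and \<phi> :: "'v \<rightharpoonup> 'a" and C :: "nat \<Rightarrow> 'a set \<Rightarrow> real" +
  assumes gpe: "gpe \<phi> C" and nonempty: "VH - dom \<phi> \<noteq> {}"
begin

lemma U_ne: "U \<noteq> {}"
  using nonempty by (simp add: U_def)

lemma gpe_partial: "partial_embedding VH \<phi>"
  using gpe by (simp add: gpe_def)

lemma gpe_thc: obtains p where "thc_graph k (\<eta> 0) cs V U (C 0) p" "\<And>f. f \<subseteq> U \<Longrightarrow> p f = dens 0 f"
  using gpe nonempty unfolding gpe_def U_def dens_def by blast

lemma gpe_regular:
  assumes "l \<in> {1..k}" "e \<in> H" "e \<noteq> {}" "e \<subseteq> U"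
  shows "regular_wrt e V (\<epsilon> l (card e) (sh + hits H \<phi> e)) (dens l e) (replace_top V e (C l) (C (l - 1))) (C (l - 1))"
  using gpe assms unfolding gpe_def U_def dens_def by blast

lemma gpe_hits: "e \<in> H \<Longrightarrow> e \<subseteq> U \<Longrightarrow> hits H \<phi> e \<le> \<Delta>'"
  by (rule hits_le[OF gpe_partial]) (auto simp: U_def)

lemma oct_hom_nonneg:
  assumes "l \<le> k" "e \<subseteq> U"
  shows "0 \<le> hom_density (C l) V fst (oct_vertices e u) (oct_edges e u)"
  by (rule hom_nonneg[OF cstack assms(1)]) (use assms(2) in \<open>auto simp: oct_vertices_def oct_edges_def U_def\<close>)

lemma regular_weaken:
  assumes "l \<in> {1..k}" "e \<in> H" "e \<noteq> {}" "e \<subseteq> U" "\<epsilon> l (card e) (sh + hits H \<phi> e) \<le> \<epsilon>'"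
  shows "regular_wrt e V \<epsilon>' (dens l e) (replace_top V e (C l) (C (l - 1))) (C (l - 1))"
  by (rule regular_mono[OF gpe_regular[OF assms(1-4)] assms(5)], rule oct_hom_nonneg) (use assms in auto)

text \<open>The induction over levels needs one error bound for all edges: by
  \<open>\<epsilon>_tiny\<close> their regularity errors lie below the same power of
  \<open>\<Psi>lev l\<close>, whatever their size and number of hits.\<close>

lemma all_good_counts: "l \<le> k \<Longrightarrow> good_counts l (acc l)"
proof (induction l)
  case 0
  obtain p where p: "thc_graph k (\<eta> 0) cs V U (C 0) p" "\<And>f. f \<subseteq> U \<Longrightarrow> p f = dens 0 f" by (rule gpe_thc) blast
  have "thc_count k (\<eta> 0) cs V U (C 0) p" using p(1) by (cases rule: thc_graph.cases) auto
  then have "good_counts 0 (4 * (real k + 1) * \<eta> 0)"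
    by (rule thc_good_counts[OF _ p(2) cs_room(1)]) (use \<eta>_bounds[of 0] in auto)
  then show ?case by (simp add: acc_def)
next
  case (Suc m)
  define l where "l = Suc m"
  have l: "l \<in> {1..k}" using Suc.prems by (simp add: l_def)
  have gc: "good_counts (l - 1) (acc (l - 1))" using Suc by (simp add: l_def)
  have a0: "0 \<le> acc (l - 1)" by (rule acc_nonneg) (use l in auto)
  have a1: "acc (l - 1) \<le> 1" using acc_half[OF l] by simp
  have \<Psi>: "0 < \<Psi>lev l" "\<Psi>lev l \<le> a0 k" using \<Psi>lev_bounds[OF l] by auto
  have \<Psi>1: "\<Psi>lev l \<le> 1" using \<Psi>(2) a0_bounds(2)[of k] by linarith
  let ?e = "\<Psi>lev l ^ (16 ^ sh)" and ?t = "\<Psi>lev l ^ (2 ^ (4 * k + 6))"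
  have "good_counts l (acc l)"
  proof (rule level_up[OF l gc a0 a1])
    show "0 \<le> ?e" "?e \<le> 1" using \<Psi> \<Psi>1 by (auto intro: power_le_one)
    show "0 \<le> ?t" "?t \<le> 1" using \<Psi> \<Psi>1 by (auto intro: power_le_one)
    show "regular_wrt f V ?e (dens l f) (replace_top V f (C l) (C (l - 1))) (C (l - 1))"
      if f: "f \<in> H" "f \<noteq> {}" "f \<subseteq> U" for f
      by (rule regular_weaken[OF l f]) (rule \<epsilon>_tiny[OF l card_in[OF f(1,2)] gpe_hits[OF f(1,3)]])
    show "2 * ?e + acc (l - 1) \<le> (?t ^ 2 ^ N / 2 ^ (N + 2)) ^ 2 ^ N" if N: "N \<le> k + 1" for N
    proof -
      have "2 * ?e + acc (l - 1) \<le> 4 * ?e" using acc_tiny(2)[OF l] by linarith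
      also have "\<dots> \<le> (?t ^ 2 ^ N / 2 ^ (N + 2)) ^ 2 ^ N"
        by (rule counting_numbers[OF \<Psi> _ N]) (use k2 in simp)
      finally show ?thesis .
    qed
    show "(52 * (real k + 1) + 1)\<^sup>2 * ?t \<le> acc l * \<delta> l ^ 2 ^ (4 * (k + 1))" by (rule level_error[OF l])
  qed
  then show ?case by (simp add: l_def)
qed

text \<open>The count of the complex with one vertex and the empty edge, with the normalisation
  undone.\<close>

lemma vertex_mass:
  assumes l: "l \<le> k" and x: "x \<in> U"
  shows "\<bar>(\<Sum>v\<in>V x. C l {v}) / real (card (V x)) - pdens l {x}\<bar> \<le> acc l * pdens l {x}"
proof -
  let ?R = "{{}, {(x, 0::nat)}}" and ?W = "{x} \<times> {..<4::nat}" and ?Y = "\<lambda>w::'v \<times> nat. V (fst w)"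
  have cp: "cpx {x} ?R" by (auto simp: cpx_def cross_def)
  have "\<bar>cnt {x} V (nrm l) (nrm l) ?R {} - 1\<bar> \<le> acc l"
    using all_good_counts[OF l] cp x unfolding good_counts_def by simp
  also have "cnt {x} V (nrm l) (nrm l) ?R {} = avg ?W ?Y (\<lambda>\<psi>. nrm l {x} {\<psi> (x, 0)})"
    unfolding cnt_def by (simp add: wprod_def nrm_empty)
  also have "\<dots> = avg {(x, 0)} ?Y (\<lambda>\<psi>. nrm l {x} {\<psi> (x, 0)})"
    by (rule avg_marginal) (use parts[OF x] in \<open>auto simp: nefin_def\<close>)
  also have "\<dots> = (\<Sum>v\<in>V x. nrm l {x} {v}) / real (card (V x))"
    by (simp add: avg_singleton)
  finally have b: "\<bar>(\<Sum>v\<in>V x. nrm l {x} {v}) / real (card (V x)) - 1\<bar> \<le> acc l" .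
  have p: "0 < pdens l {x}" using pdens_pos[OF l, of "{x}"] x by simp
  have "(\<Sum>v\<in>V x. C l {v}) / real (card (V x)) - pdens l {x} = pdens l {x} * ((\<Sum>v\<in>V x. nrm l {x} {v}) / real (card (V x)) - 1)"
    using C_nrm[OF l, of "{x}"] x by (simp add: sum_distrib_left right_diff_distrib)
  then have "\<bar>(\<Sum>v\<in>V x. C l {v}) / real (card (V x)) - pdens l {x}\<bar> = pdens l {x} * \<bar>(\<Sum>v\<in>V x. nrm l {x} {v}) / real (card (V x)) - 1\<bar>"
    using p by (simp add: abs_mult)
  also have "\<dots> \<le> pdens l {x} * acc l" using b p by (intro mult_left_mono) auto
  finally show ?thesis by (simp add: mult.commute)
qed

lemma vertex_sub: "x \<in> U \<Longrightarrow> v \<in> V x \<Longrightarrow> {v} \<subseteq> (\<Union>x\<in>U. V x)"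
  by auto

lemma vertex_nonneg: "l \<le> k \<Longrightarrow> x \<in> U \<Longrightarrow> v \<in> V x \<Longrightarrow> 0 \<le> C l {v}"
  by (rule C_nonneg[OF _ vertex_sub])

lemma C_anti:
  assumes "i \<le> j" "j \<le> k" "s \<subseteq> (\<Union>x\<in>U. V x)"
  shows "C j s \<le> C i s"
  using assms(1,2)
proof (induction j rule: dec_induct)
  case (step j)
  have "C (Suc j) s \<le> C j s" using C_mono[of "Suc j" s] step.prems assms(3) by simp
  then show ?case using step by simp
qed simp

text \<open>The exceptional set is measured with \<open>C (l - 1)\<close>, the majorant for level
  \<open>l\<close>. The base \<open>\<Psi>\<close> is \<open>q\<close> for the size of
  \<open>e\<close> at hit count \<open>sh\<close>: a high power of it bounds the error of
  \<open>insert x e\<close>, while \<open>\<tau> = \<Psi>\<^sup>2\<close> still fits into the gap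
  between consecutive hit counts of \<open>e\<close>.\<close>

lemma hit_bad:
  assumes l: "l \<in> {1..k}" and x: "x \<in> U" and e: "e \<in> hit_edges \<phi> x"
  obtains Bad where "Bad \<subseteq> V x" "(\<Sum>v\<in>Bad. C (l - 1) {v}) / real (card (V x)) \<le> \<epsilon>max l * pdens (l - 1) {x}"
    "\<And>v. v \<in> V x - Bad \<Longrightarrow> regular_wrt e V (\<epsilon> l (card e) (sh + hits H \<phi> e + 1)) (dens l e * dens l (insert x e))
        (replace_top V e (link (C l) v) (link (C (l - 1)) v)) (link (C (l - 1)) v)"
proof -
  obtain e' where e': "e' \<subseteq> e" "e' \<noteq> {}" and eH: "e \<in> H" and eU: "e \<subseteq> U" and xe: "x \<notin> e"
    using e unfolding hit_edges_def U_def by blast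
  have ene: "e \<noteq> {}" using e' by blast
  let ?r = "card e"
  have r: "?r \<in> {1..k}" by (rule card_in[OF eH ene])
  have h: "hits H \<phi> e \<le> \<Delta>'" by (rule gpe_hits[OF eH eU])
  have room: "sh \<le> hs" "sh + hits H \<phi> e + 1 \<le> hs" using hs_room h by auto
  define \<Psi> where "\<Psi> = q l ?r sh"
  have \<Psi>: "0 < \<Psi>" "\<Psi> \<le> a0 k" "\<Psi> \<le> 1" using q_bounds[OF l r room(1)] by (auto simp: \<Psi>_def)
  let ?e = "\<Psi> ^ (16 ^ sh)" and ?t = "\<Psi> ^ (2 ^ (4 * k + 6))"
  have l1: "l - 1 \<le> k" using l by auto
  have a0: "0 \<le> acc (l - 1)" by (rule acc_nonneg[OF l1])
  have at: "acc (l - 1) \<le> 2 * ?e" unfolding \<Psi>_def by (rule acc_tiny(1)[OF l r])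
  have fe: "finite e" by (rule fin_sub[OF eU])
  have reg2: "regular_wrt (insert x e) V ?e (dens l (insert x e)) (replace_top V (insert x e) (C l) (C (l - 1))) (C (l - 1))"
    if xH: "insert x e \<in> H"
  proof (rule regular_weaken[OF l xH])
    show "insert x e \<subseteq> U" using x eU by simp
    have c: "card (insert x e) = ?r + 1" using fe xe by simp
    have "?r + 1 \<le> k" using Hcard[OF xH] c by simp
    then show "\<epsilon> l (card (insert x e)) (sh + hits H \<phi> (insert x e)) \<le> ?e"
      unfolding c \<Psi>_def using r gpe_hits[OF xH \<open>insert x e \<subseteq> U\<close>] by (intro \<epsilon>_next_tiny[OF l]) auto
  qed simp
  have e0: "0 \<le> \<epsilon> l ?r (sh + hits H \<phi> e)" using \<epsilon>_bounds[OF l r, of "sh + hits H \<phi> e"] room by auto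
  have e1: "0 \<le> ?e" "?e \<le> 1" using \<Psi> by (auto intro: power_le_one)
  have t1: "0 \<le> ?t" "?t \<le> 1" using \<Psi> by (auto intro: power_le_one)
  have tN: "2 * ?e + acc (l - 1) \<le> (?t ^ 2 ^ N / 2 ^ (N + 2)) ^ 2 ^ N" if N: "N \<le> k + 1" for N
  proof -
    have "2 * ?e + acc (l - 1) \<le> 4 * ?e" using at by linarith
    also have "\<dots> \<le> (?t ^ 2 ^ N / 2 ^ (N + 2)) ^ 2 ^ N"
      by (rule counting_numbers[OF \<Psi>(1,2) _ N]) (use k2 in simp)
    finally show ?thesis .
  qed
  have err: "(52 * (real k + 1) + 1)\<^sup>2 * ?t \<le> \<Psi> ^ 12"
    using counting_error[OF \<Psi>(1,2)] power_tiny(3)[OF \<Psi>(1,2)] by linarith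
  have accb: "acc (l - 1) \<le> \<Psi> ^ 12" using at power_tiny(1)[OF \<Psi>(1,2)] by linarith
  have \<tau>: "0 < \<Psi>\<^sup>2" using \<Psi> by simp
  have gap: "\<epsilon> l ?r (sh + hits H \<phi> e) + 6 * \<Psi>\<^sup>2 \<le> \<epsilon> l ?r (sh + hits H \<phi> e + 1)"
    unfolding \<Psi>_def by (rule \<epsilon>_gap[OF l r h])
  have le1: "\<epsilon> l ?r (sh + hits H \<phi> e + 1) \<le> 1" using \<epsilon>_bounds[OF l r room(2)] by simp
  obtain Bad where Bad: "Bad \<subseteq> V x"
    "(\<Sum>v\<in>Bad. C (l - 1) {v}) / real (card (V x)) \<le> 4 * (5 * sqrt (160 * \<Psi> ^ 12) + 4 * \<Psi> ^ 12) / (\<Psi>\<^sup>2)\<^sup>2 * pdens (l - 1) {x}"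
    "\<And>v. v \<in> V x - Bad \<Longrightarrow> regular_wrt e V (\<epsilon> l ?r (sh + hits H \<phi> e + 1)) (dens l e * dens l (insert x e))
        (replace_top V e (link (C l) v) (link (C (l - 1)) v)) (link (C (l - 1)) v)"
    by (rule inherit[OF l all_good_counts[OF l1] a0 acc_half[OF l] x xe eU ene eH gpe_regular[OF l eH ene eU] e0
          reg2 e1 t1 tN err accb \<tau> gap le1]) (assumption | rule that)+
  show thesis
  proof (rule that[OF Bad(1) _ Bad(3)])
    have "4 * (5 * sqrt (160 * \<Psi> ^ 12) + 4 * \<Psi> ^ 12) / (\<Psi>\<^sup>2)\<^sup>2 \<le> \<Psi>" by (rule exceptional_measure[OF \<Psi>(1,2)])
    also have "\<Psi> \<le> \<epsilon> l ?r sh" using q_bounds(1,3)[OF l r room(1)] by (simp add: \<Psi>_def)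
    also have "\<dots> \<le> \<epsilon>max l" by (rule \<epsilon>_le_max[OF r room(1)])
    finally have "4 * (5 * sqrt (160 * \<Psi> ^ 12) + 4 * \<Psi> ^ 12) / (\<Psi>\<^sup>2)\<^sup>2 * pdens (l - 1) {x} \<le> \<epsilon>max l * pdens (l - 1) {x}"
      using pdens_nonneg[OF l1] by (rule mult_right_mono)
    then show "(\<Sum>v\<in>Bad. C (l - 1) {v}) / real (card (V x)) \<le> \<epsilon>max l * pdens (l - 1) {x}"
      using Bad(2) by linarith
  qed
qed

lemma thc_step:
  assumes x: "x = Min U"
  obtains V' where "V' \<subseteq> V x"
    "(\<Sum>v\<in>V x - V'. C 0 {v}) / real (card (V x)) \<le> \<eta> 0 * ((\<Sum>v\<in>V x. C 0 {v}) / real (card (V x)))"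
    "\<And>v. v \<in> V' \<Longrightarrow> U - {x} \<noteq> {} \<Longrightarrow> \<exists>p. thc_graph k (\<eta> 0) cs V (U - {x}) (link (C 0) v) p \<and>
        (\<forall>f\<subseteq>U - {x}. p f = dens 0 f * dens 0 (insert x f))"
proof -
  have xU: "x \<in> U" using Min_in[OF fin_U U_ne] x by simp
  obtain p where p: "thc_graph k (\<eta> 0) cs V U (C 0) p" "\<And>f. f \<subseteq> U \<Longrightarrow> p f = dens 0 f" by (rule gpe_thc) blast
  show thesis
  proof (cases "2 \<le> card U")
    \<comment> \<open>Only \<open>x\<close> is left: the THC recursion says nothing about links and
      nothing is asked of them, so all of \<open>V x\<close> is kept.\<close>
    case False
    have "U - {x} = {}"
    proof (rule ccontr)
      assume "U - {x} \<noteq> {}"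
      then have "0 < card (U - {x})" using fin_U by (simp add: card_gt_0_iff)
      then show False using False xU fin_U by simp
    qed
    moreover have "0 \<le> \<eta> 0 * ((\<Sum>v\<in>V x. C 0 {v}) / real (card (V x)))"
      using \<eta>_bounds[of 0] by (intro mult_nonneg_nonneg divide_nonneg_nonneg sum_nonneg vertex_nonneg[OF _ xU]) auto
    ultimately show thesis using that[of "V x"] by simp
  next
    case True
    have "\<exists>V'\<subseteq>V (Min U). part_norm (C 0) (V (Min U)) V' \<ge> (1 - \<eta> 0) * part_norm (C 0) (V (Min U)) (V (Min U)) \<and>
        (\<forall>v\<in>V'. thc_graph k (\<eta> 0) cs V (U - {Min U}) (link (C 0) v) (link p (Min U)))"
      using p(1) True by (cases rule: thc_graph.cases) auto
    then obtain V' where V': "V' \<subseteq> V x" "(1 - \<eta> 0) * part_norm (C 0) (V x) (V x) \<le> part_norm (C 0) (V x) V'"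
      "\<And>v. v \<in> V' \<Longrightarrow> thc_graph k (\<eta> 0) cs V (U - {x}) (link (C 0) v) (link p x)"
      unfolding x by blast
    have fV: "finite (V x)" using parts[OF xU] by simp
    have n1: "part_norm (C 0) (V x) (V x) = (\<Sum>v\<in>V x. C 0 {v}) / real (card (V x))" by (simp add: part_norm_def)
    have "(\<Sum>v\<in>V x. if v \<in> V' then C 0 {v} else 0) = (\<Sum>v\<in>V'. C 0 {v})"
      using sum.inter_restrict[OF fV, of "\<lambda>v. C 0 {v}" V'] V'(1) by (simp add: Int_absorb1)
    then have n2: "part_norm (C 0) (V x) V' = (\<Sum>v\<in>V'. C 0 {v}) / real (card (V x))" by (simp add: part_norm_def)
    have "(\<Sum>v\<in>V x - V'. C 0 {v}) = (\<Sum>v\<in>V x. C 0 {v}) - (\<Sum>v\<in>V'. C 0 {v})"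
      by (rule sum_diff[OF fV V'(1)])
    then have "(\<Sum>v\<in>V x - V'. C 0 {v}) / real (card (V x)) = part_norm (C 0) (V x) (V x) - part_norm (C 0) (V x) V'"
      unfolding n1 n2 by (simp add: diff_divide_distrib)
    also have "\<dots> \<le> \<eta> 0 * part_norm (C 0) (V x) (V x)" using V'(2) by (simp add: algebra_simps)
    finally have b: "(\<Sum>v\<in>V x - V'. C 0 {v}) / real (card (V x)) \<le> \<eta> 0 * ((\<Sum>v\<in>V x. C 0 {v}) / real (card (V x)))"
      unfolding n1 .
    show thesis
    proof (rule that[OF V'(1) b])
      fix v assume "v \<in> V'"
      then have "thc_graph k (\<eta> 0) cs V (U - {x}) (link (C 0) v) (link p x)" by (rule V'(3))
      moreover have "link p x f = dens 0 f * dens 0 (insert x f)" if "f \<subseteq> U - {x}" for f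
      proof -
        have "f \<subseteq> U" "insert x f \<subseteq> U" using that xU by auto
        then show ?thesis using p(2) by (simp add: link_def)
      qed
      ultimately show "\<exists>p. thc_graph k (\<eta> 0) cs V (U - {x}) (link (C 0) v) p \<and>
        (\<forall>f\<subseteq>U - {x}. p f = dens 0 f * dens 0 (insert x f))" by blast
    qed
  qed
qed

text \<open>Converts mass expected at level \<open>j\<close> into mass expected at level
  \<open>k\<close>, where the bad vertices are finally weighed; (VE1) supplies the product of the
  \<open>\<delta> i\<close>.\<close>

lemma pdens_ge:
  assumes "j \<le> k" "x \<in> U"
  shows "pdens j {x} * (\<Prod>i\<in>{j<..k}. \<delta> i) \<le> pdens k {x}"
proof -
  have un: "{0..k} = {0..j} \<union> {j<..k}" using assms(1) by auto
  have "pdens k {x} = pdens j {x} * (\<Prod>i\<in>{j<..k}. dens i {x})"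
    unfolding pdens_def un by (rule prod.union_disjoint) auto
  moreover have "(\<Prod>i\<in>{j<..k}. \<delta> i) \<le> (\<Prod>i\<in>{j<..k}. dens i {x})"
  proof (rule prod_mono)
    fix i assume "i \<in> {j<..k}"
    then have "i \<in> {1..k}" by auto
    then show "0 \<le> \<delta> i \<and> \<delta> i \<le> dens i {x}" using dens_ge_\<delta>[of i "{x}"] \<delta>_bounds[of i] assms(2) by auto
  qed
  ultimately show ?thesis using pdens_nonneg[OF assms(1)] by (simp add: mult_left_mono)
qed

lemma density_extend:
  assumes "x \<in> U" "e \<subseteq> U - {x}"
  shows "density_after VH (\<phi>(x \<mapsto> v)) (D l) e = dens l e * dens l (insert x e)"
  unfolding dens_def by (rule density_after_extend[OF fin_VH]) (use assms in \<open>auto simp: U_def\<close>)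

lemma dom_extend: "VH - dom (\<phi>(x \<mapsto> v)) = U - {x}"
  by (auto simp: U_def)

text \<open>Choosing \<open>x\<close> as the minimum keeps the domain an initial segment. A hit edge
  uses up one more step of its regularity parameters, an unhit edge none.\<close>

lemma gpe_extend:
  assumes x: "x = Min U" and v: "v \<in> V x"
    and thc: "U - {x} \<noteq> {} \<Longrightarrow> \<exists>p. thc_graph k (\<eta> 0) cs V (U - {x}) (link (C 0) v) p \<and>
        (\<forall>f\<subseteq>U - {x}. p f = dens 0 f * dens 0 (insert x f))"
    and reg: "\<And>l e. l \<in> {1..k} \<Longrightarrow> e \<in> hit_edges \<phi> x \<Longrightarrow>
        regular_wrt e V (\<epsilon> l (card e) (sh + hits H \<phi> e + 1)) (dens l e * dens l (insert x e))
        (replace_top V e (link (C l) v) (link (C (l - 1)) v)) (link (C (l - 1)) v)"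
  shows "gpe (\<phi>(x \<mapsto> v)) (\<lambda>l. link (C l) v)"
proof -
  have xU: "x \<in> U" using Min_in[OF fin_U U_ne] x by simp
  then have xV: "x \<in> VH - dom \<phi>" by (simp add: U_def)
  have pe: "partial_embedding VH (\<phi>(x \<mapsto> v))"
    unfolding partial_embedding_def
  proof (intro conjI ballI impI)
    show "dom (\<phi>(x \<mapsto> v)) \<subseteq> VH" using gpe_partial xV by (auto simp: partial_embedding_def)
    fix z y assume z: "z \<in> dom (\<phi>(x \<mapsto> v))" and y: "y \<in> VH" "y < z"
    show "y \<in> dom (\<phi>(x \<mapsto> v))"
    proof (cases "z = x")
      case True
      have "y \<notin> U"
      proof
        assume "y \<in> U"
        then have "x \<le> y" unfolding x using fin_U by (rule Min_le[rotated])
        then show False using y(2) True by simp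
      qed
      then show ?thesis using y(1) by (auto simp: U_def)
    next
      case False
      then have "z \<in> dom \<phi>" using z by simp
      then show ?thesis using gpe_partial y unfolding partial_embedding_def by auto
    qed
  qed
  have thc': "\<exists>p. thc_graph k (\<eta> 0) cs V (U - {x}) (link (C 0) v) p \<and> (\<forall>f\<subseteq>U - {x}. p f = density_after VH (\<phi>(x \<mapsto> v)) (D 0) f)"
    if "U - {x} \<noteq> {}"
    using thc[OF that] density_extend[OF xU] by simp
  have reg': "regular_wrt e V (\<epsilon> l (card e) (sh + hits H (\<phi>(x \<mapsto> v)) e)) (density_after VH (\<phi>(x \<mapsto> v)) (D l) e)
        (replace_top V e (link (C l) v) (link (C (l - 1)) v)) (link (C (l - 1)) v)"
    if l: "l \<in> {1..k}" and e: "e \<in> H" "e \<noteq> {}" "e \<subseteq> U - {x}" for l e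
  proof (cases "\<exists>e'\<subseteq>e. e' \<noteq> {} \<and> insert x e' \<in> H")
    case True
    then have "e \<in> hit_edges \<phi> x" using e by (auto simp: hit_edges_def U_def)
    moreover have "hits H (\<phi>(x \<mapsto> v)) e = hits H \<phi> e + 1" using hits_extend[OF xV gpe_partial, of v e] True by simp
    ultimately show ?thesis unfolding density_extend[OF xU e(3)] using reg[OF l, of e] by (simp add: add.assoc)
  next
    case False
    have eU: "e \<subseteq> U" "e \<subseteq> VH - dom \<phi> - {x}" using e(3) by (auto simp: U_def)
    have "insert x e \<notin> H" using False e(2) by blast
    then have "dens l (insert x e) = 1" using dens_nonedge[of l "insert x e"] l by simp
    moreover have "hits H (\<phi>(x \<mapsto> v)) e = hits H \<phi> e" using hits_extend[OF xV gpe_partial, of v e] False by simp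
    moreover have "regular_wrt e V (\<epsilon> l (card e) (sh + hits H \<phi> e)) (dens l e)
        (replace_top V e (link (C l) v) (link (C (l - 1)) v)) (link (C (l - 1)) v)"
      by (rule regular_link_unhit[OF cstack l xV v eU(2) e(2) _ gpe_regular[OF l e(1,2) eU(1)]]) (use False in blast)
    ultimately show ?thesis unfolding density_extend[OF xU e(3)] by simp
  qed
  have g3: "\<delta> l \<le> (\<Prod>f\<in>{f. f \<subseteq> VH \<and> e \<subseteq> f}. D l f)" if "l \<in> {1..k}" "e \<subseteq> U - {x}" "e \<noteq> {}" for l e
    by (rule gpe3) (use that in \<open>auto simp: U_def\<close>)
  show ?thesis
    unfolding gpe_def dom_extend
  proof (intro conjI)
    show "partial_embedding VH (\<phi>(x \<mapsto> v))" by (rule pe)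
    show "candidate_stack k VH H (\<phi>(x \<mapsto> v)) V (\<lambda>l. link (C l) v)" by (rule candidate_stack_link[OF cstack xV v])
  qed (intro impI ballI allI thc' reg' g3; (elim conjE)?; assumption)+
qed

lemma sum_indicator:
  fixes g :: "'c \<Rightarrow> real"
  assumes "finite A" "B \<subseteq> A"
  shows "(\<Sum>v\<in>A. if v \<in> B then g v else 0) = (\<Sum>v\<in>B. g v)"
  using sum.inter_restrict[OF assms(1), of g B] assms(2) by (simp add: Int_absorb1)

text \<open>The budget allows \<open>\<eta> k / 4\<close> for each of three losses, relative to
  \<open>pdens k {x}\<close>: the counting accuracy at level \<open>k\<close>, the vertices rejected
  by the THC condition, and the at most \<open>k * \<Delta>\<^sup>2\<close> exceptional sets of hit
  edges over all levels.\<close>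

lemma embed_vertex:
  assumes x: "x = Min U"
  obtains Good where "Good \<subseteq> V x" "(1 - \<eta> k) * pdens k {x} \<le> (\<Sum>v\<in>Good. C k {v}) / real (card (V x))"
    "\<And>v. v \<in> Good \<Longrightarrow> gpe (\<phi>(x \<mapsto> v)) (\<lambda>l. link (C l) v)"
proof -
  have xU: "x \<in> U" using Min_in[OF fin_U U_ne] x by simp
  have fV: "finite (V x)" using parts[OF xU] by simp
  have k1: "k \<in> {1..k}" using k2 by simp
  let ?c = "real (card (V x))" and ?E = "hit_edges \<phi> x" and ?p = "pdens k {x}"
  obtain V' where V': "V' \<subseteq> V x" "(\<Sum>v\<in>V x - V'. C 0 {v}) / ?c \<le> \<eta> 0 * ((\<Sum>v\<in>V x. C 0 {v}) / ?c)"
    "\<And>v. v \<in> V' \<Longrightarrow> U - {x} \<noteq> {} \<Longrightarrow> \<exists>p. thc_graph k (\<eta> 0) cs V (U - {x}) (link (C 0) v) p \<and>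
        (\<forall>f\<subseteq>U - {x}. p f = dens 0 f * dens 0 (insert x f))"
    by (rule thc_step[OF x]) (rule that; assumption)
  define P where "P l e Bad \<longleftrightarrow> Bad \<subseteq> V x \<and> (\<Sum>v\<in>Bad. C (l - 1) {v}) / ?c \<le> \<epsilon>max l * pdens (l - 1) {x} \<and>
    (\<forall>v\<in>V x - Bad. regular_wrt e V (\<epsilon> l (card e) (sh + hits H \<phi> e + 1)) (dens l e * dens l (insert x e))
        (replace_top V e (link (C l) v) (link (C (l - 1)) v)) (link (C (l - 1)) v))" for l e Bad
  define B where "B l e = (SOME Bad. P l e Bad)" for l e
  have B: "P l e (B l e)" if "l \<in> {1..k}" "e \<in> ?E" for l e
  proof -
    have "\<exists>Bad. P l e Bad" unfolding P_def by (rule hit_bad[OF that(1) xU that(2)]) blast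
    then show ?thesis unfolding B_def by (rule someI_ex)
  qed
  define Good where "Good = V' - (\<Union>l\<in>{1..k}. \<Union>e\<in>?E. B l e)"
  have GV: "Good \<subseteq> V x" using V'(1) by (auto simp: Good_def)
  have finE: "finite ?E" using finH by (simp add: hit_edges_def)
  have pk: "0 < ?p" using pdens_pos[of k "{x}"] xU by simp
  have \<eta>: "0 < \<eta> k" "\<eta> k < 1" using \<eta>_bounds[of k] by auto
  show thesis
  proof (rule that[OF GV])
    fix v assume v: "v \<in> Good"
    have vB: "v \<in> V x - B l e" if "l \<in> {1..k}" "e \<in> ?E" for l e using v GV that unfolding Good_def by blast
    show "gpe (\<phi>(x \<mapsto> v)) (\<lambda>l. link (C l) v)"
    proof (rule gpe_extend[OF x])
      show "v \<in> V x" using v GV by blast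
      show "\<exists>p. thc_graph k (\<eta> 0) cs V (U - {x}) (link (C 0) v) p \<and> (\<forall>f\<subseteq>U - {x}. p f = dens 0 f * dens 0 (insert x f))"
        if "U - {x} \<noteq> {}" by (rule V'(3)[OF _ that]) (use v in \<open>simp add: Good_def\<close>)
      show "regular_wrt e V (\<epsilon> l (card e) (sh + hits H \<phi> e + 1)) (dens l e * dens l (insert x e))
        (replace_top V e (link (C l) v) (link (C (l - 1)) v)) (link (C (l - 1)) v)" if "l \<in> {1..k}" "e \<in> ?E" for l e
        using B[OF that] vB[OF that] unfolding P_def by blast
    qed
  next
    have nn: "0 \<le> C l {v}" if "l \<le> k" "v \<in> V x" for l v by (rule vertex_nonneg[OF that(1) xU that(2)])
    have anti: "C k {v} \<le> C l {v}" if "l \<le> k" "v \<in> V x" for l v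
      by (rule C_anti[OF that(1) order_refl vertex_sub[OF xU that(2)]])
    let ?s = "\<lambda>v. \<Sum>l\<in>{1..k}. \<Sum>e\<in>?E. if v \<in> B l e then C (l - 1) {v} else 0"
    have inner0: "0 \<le> (if v \<in> B l e then C (l - 1) {v} else 0)" if "v \<in> V x" "l \<in> {1..k}" for v l e
      using nn[of "l - 1" v] that by auto
    \<comment> \<open>A rejected vertex is charged to the level at which it fails; this is
      legitimate because \<open>C k\<close> lies below all earlier levels.\<close>
    have pt: "C k {v} \<le> (if v \<in> Good then C k {v} else 0) + (if v \<in> V x - V' then C 0 {v} else 0) + ?s v" if v: "v \<in> V x" for v
    proof -
      have s0: "0 \<le> ?s v" by (intro sum_nonneg inner0[OF v])
      show ?thesis
      proof (cases "v \<in> Good")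
        case True then show ?thesis using s0 nn[of 0 v] v by simp
      next
        case False
        show ?thesis
        proof (cases "v \<in> V'")
          case False then show ?thesis using \<open>v \<notin> Good\<close> s0 anti[of 0 v] v by simp
        next
          case True
          then obtain l e where le: "l \<in> {1..k}" "e \<in> ?E" "v \<in> B l e" using \<open>v \<notin> Good\<close> unfolding Good_def by blast
          have l1: "l - 1 \<le> k" using le(1) by auto
          have "C k {v} \<le> (if v \<in> B l e then C (l - 1) {v} else 0)" using anti[OF l1 v] le(3) by simp
          also have "\<dots> \<le> (\<Sum>e\<in>?E. if v \<in> B l e then C (l - 1) {v} else 0)"
            by (rule member_le_sum[OF le(2) _ finE]) (use inner0[OF v le(1)] in auto)
          also have "\<dots> \<le> ?s v"
            by (rule member_le_sum[OF le(1)]) (use inner0[OF v] in \<open>auto intro: sum_nonneg\<close>)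
          finally show ?thesis using True \<open>v \<notin> Good\<close> by simp
        qed
      qed
    qed
    have "(\<Sum>v\<in>V x. C k {v}) \<le> (\<Sum>v\<in>V x. (if v \<in> Good then C k {v} else 0) + (if v \<in> V x - V' then C 0 {v} else 0) + ?s v)"
      by (rule sum_mono) (rule pt)
    also have "\<dots> = (\<Sum>v\<in>Good. C k {v}) + (\<Sum>v\<in>V x - V'. C 0 {v}) + (\<Sum>v\<in>V x. ?s v)"
      by (simp only: sum.distrib sum_indicator[OF fV GV] sum_indicator[OF fV Diff_subset])
    also have "(\<Sum>v\<in>V x. ?s v) = (\<Sum>l\<in>{1..k}. \<Sum>e\<in>?E. \<Sum>v\<in>V x. if v \<in> B l e then C (l - 1) {v} else 0)"
      by (subst sum.swap) (intro sum.cong refl sum.swap)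
    also have "\<dots> = (\<Sum>l\<in>{1..k}. \<Sum>e\<in>?E. \<Sum>v\<in>B l e. C (l - 1) {v})"
      by (intro sum.cong refl sum_indicator[OF fV]) (use B in \<open>auto simp: P_def\<close>)
    finally have "(\<Sum>v\<in>V x. C k {v}) / ?c \<le> ((\<Sum>v\<in>Good. C k {v}) + (\<Sum>v\<in>V x - V'. C 0 {v}) + (\<Sum>l\<in>{1..k}. \<Sum>e\<in>?E. \<Sum>v\<in>B l e. C (l - 1) {v})) / ?c"
      by (rule divide_right_mono) simp
    then have tot: "(\<Sum>v\<in>V x. C k {v}) / ?c \<le> (\<Sum>v\<in>Good. C k {v}) / ?c + (\<Sum>v\<in>V x - V'. C 0 {v}) / ?c
        + (\<Sum>l\<in>{1..k}. \<Sum>e\<in>?E. (\<Sum>v\<in>B l e. C (l - 1) {v}) / ?c)"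
      by (simp only: add_divide_distrib sum_divide_distrib)
    have t1: "(\<Sum>v\<in>V x - V'. C 0 {v}) / ?c \<le> \<eta> k / 4 * ?p"
    proof -
      have p0: "0 < pdens 0 {x}" using pdens_pos[of 0 "{x}"] xU by simp
      have "(\<Sum>v\<in>V x. C 0 {v}) / ?c \<le> pdens 0 {x} + acc 0 * pdens 0 {x}"
        using vertex_mass[OF _ xU, of 0] by (simp add: abs_le_iff)
      also have "\<dots> \<le> pdens 0 {x} + 1 * pdens 0 {x}"
        using acc_half[of 1] k2 p0 by (intro add_left_mono mult_right_mono) auto
      finally have m0: "(\<Sum>v\<in>V x. C 0 {v}) / ?c \<le> 2 * pdens 0 {x}" by simp
      have "(\<Prod>i\<in>{0<..k}. \<delta> i ^ cs) \<le> (\<Prod>i\<in>{0<..k}. \<delta> i)"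
      proof (rule prod_mono)
        fix i assume "i \<in> {0<..k}"
        then have d: "0 < \<delta> i" "\<delta> i < 1" using \<delta>_bounds[of i] by auto
        have "\<delta> i ^ cs \<le> \<delta> i ^ 1" using d cs_room(2) by (intro power_decreasing) auto
        then show "0 \<le> \<delta> i ^ cs \<and> \<delta> i ^ cs \<le> \<delta> i" using d by simp
      qed
      moreover have "\<eta> k / (72 * (real k + 1) * real cs) \<le> \<eta> k / 72"
      proof -
        have "1 * 1 \<le> (real k + 1) * real cs" using cs_room(2) by (intro mult_mono) auto
        then have "72 * 1 \<le> 72 * ((real k + 1) * real cs)" by (intro mult_left_mono) auto
        then have "72 \<le> 72 * (real k + 1) * real cs" by (simp only: mult.assoc mult_1_right)
        then show ?thesis using \<eta> by (intro divide_left_mono) auto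
      qed
      moreover have "0 \<le> (\<Prod>i\<in>{0<..k}. \<delta> i ^ cs)" using \<delta>_bounds by (intro prod_nonneg) (auto simp: less_imp_le)
      ultimately have "\<eta> k / (72 * (real k + 1) * real cs) * (\<Prod>i\<in>{0<..k}. \<delta> i ^ cs) \<le> \<eta> k / 72 * (\<Prod>i\<in>{0<..k}. \<delta> i)"
        using \<eta> by (intro mult_mono) auto
      then have \<eta>0: "\<eta> 0 \<le> \<eta> k / 72 * (\<Prod>i\<in>{0<..k}. \<delta> i)" using ve1(1)[OF k1] by linarith
      have "(\<Sum>v\<in>V x - V'. C 0 {v}) / ?c \<le> \<eta> 0 * (2 * pdens 0 {x})"
        using V'(2) m0 mult_left_mono[OF m0, of "\<eta> 0"] \<eta>_bounds[of 0] by linarith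
      also have "\<dots> \<le> \<eta> k / 72 * (\<Prod>i\<in>{0<..k}. \<delta> i) * (2 * pdens 0 {x})" using \<eta>0 p0 by (intro mult_right_mono) auto
      also have "\<dots> = \<eta> k / 36 * (pdens 0 {x} * (\<Prod>i\<in>{0<..k}. \<delta> i))" by simp
      also have "\<dots> \<le> \<eta> k / 36 * ?p" using pdens_ge[of 0 x] xU \<eta> by (intro mult_left_mono) auto
      also have "\<dots> \<le> \<eta> k / 4 * ?p" using \<eta> pk by (intro mult_right_mono) auto
      finally show ?thesis .
    qed
    have t2: "(\<Sum>l\<in>{1..k}. \<Sum>e\<in>?E. (\<Sum>v\<in>B l e. C (l - 1) {v}) / ?c) \<le> \<eta> k / 4 * ?p"
    proof -
      \<comment> \<open>A common bound for single exceptional sets. In (VE1) the factor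
        \<open>\<delta> l\<close> together with the product above \<open>l\<close> converts
        \<open>pdens (l - 1) {x}\<close> into \<open>pdens k {x}\<close>, and the denominator covers
        the number of sets.\<close>
      define \<sigma> where "\<sigma> = \<eta> k * ?p / (72 * real k * (real k + 1) * (real \<Delta>)\<^sup>2)"
      have \<sigma>0: "0 \<le> \<sigma>" unfolding \<sigma>_def using \<eta> pk by (intro divide_nonneg_nonneg mult_nonneg_nonneg) auto
      have one: "(\<Sum>v\<in>B l e. C (l - 1) {v}) / ?c \<le> \<sigma>" if l: "l \<in> {1..k}" and e: "e \<in> ?E" for l e
      proof -
        have l1: "l - 1 \<le> k" using l by auto
        let ?K = "72 * real k * (real k + 1) * (real \<Delta>)\<^sup>2"
        have dl: "0 < \<delta> l" using \<delta>_bounds[OF l] by simp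
        have "(\<Prod>i\<in>{l<..k}. \<delta> i ^ cs) \<le> (\<Prod>i\<in>{l<..k}. \<delta> i)"
        proof (rule prod_mono)
          fix i assume "i \<in> {l<..k}"
          then have d: "0 < \<delta> i" "\<delta> i < 1" using \<delta>_bounds[of i] by auto
          have "\<delta> i ^ cs \<le> \<delta> i ^ 1" using d cs_room(2) by (intro power_decreasing) auto
          then show "0 \<le> \<delta> i ^ cs \<and> \<delta> i ^ cs \<le> \<delta> i" using d by simp
        qed
        then have "\<eta> k * \<delta> l / ?K * (\<Prod>i\<in>{l<..k}. \<delta> i ^ cs) \<le> \<eta> k * \<delta> l / ?K * (\<Prod>i\<in>{l<..k}. \<delta> i)"
          using \<eta> dl by (intro mult_left_mono divide_nonneg_nonneg mult_nonneg_nonneg) auto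
        then have em: "\<epsilon>max l \<le> \<eta> k * \<delta> l / ?K * (\<Prod>i\<in>{l<..k}. \<delta> i)" using ve1(2)[OF k1, of l] l by auto
        have pr: "(\<Prod>i\<in>{l - 1<..k}. \<delta> i) = \<delta> l * (\<Prod>i\<in>{l<..k}. \<delta> i)"
        proof -
          have "{l - 1<..k} = insert l {l<..k}" using l by auto
          then show ?thesis by simp
        qed
        have "(\<Sum>v\<in>B l e. C (l - 1) {v}) / ?c \<le> \<epsilon>max l * pdens (l - 1) {x}" using B[OF l e] by (simp add: P_def)
        also have "\<dots> \<le> \<eta> k * \<delta> l / ?K * (\<Prod>i\<in>{l<..k}. \<delta> i) * pdens (l - 1) {x}"
          using em pdens_nonneg[OF l1] by (rule mult_right_mono)
        also have "\<dots> = \<eta> k / ?K * (pdens (l - 1) {x} * (\<Prod>i\<in>{l - 1<..k}. \<delta> i))" unfolding pr by simp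
        also have "\<dots> \<le> \<eta> k / ?K * ?p"
          using pdens_ge[OF l1 xU] \<eta> by (intro mult_left_mono divide_nonneg_nonneg mult_nonneg_nonneg) auto
        finally show ?thesis by (simp add: \<sigma>_def)
      qed
      have "(\<Sum>l\<in>{1..k}. \<Sum>e\<in>?E. (\<Sum>v\<in>B l e. C (l - 1) {v}) / ?c) \<le> (\<Sum>l\<in>{1..k}. \<Sum>e\<in>?E. \<sigma>)"
        by (intro sum_mono one)
      also have "\<dots> = real k * (real (card ?E) * \<sigma>)" by simp
      also have "\<dots> \<le> real k * ((real \<Delta>)\<^sup>2 * \<sigma>)"
      proof -
        have "card ?E \<le> \<Delta> * \<Delta>" by (rule card_hit_edges) (use xU in \<open>simp add: U_def\<close>)
        then have "real (card ?E) \<le> real (\<Delta> * \<Delta>)" by (simp only: of_nat_le_iff)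
        then have "real (card ?E) \<le> (real \<Delta>)\<^sup>2" by (simp add: power2_eq_square)
        then show ?thesis using \<sigma>0 by (intro mult_left_mono mult_right_mono) auto
      qed
      also have "\<dots> = \<eta> k * ?p / (72 * (real k + 1))"
      proof -
        have "a * (b * (X / (72 * a * c * b))) = X / (72 * c)" if "a \<noteq> 0" "b \<noteq> 0" for a b c X :: real
          using that by simp
        from this[of "real k" "(real \<Delta>)\<^sup>2"] show ?thesis unfolding \<sigma>_def using k2 \<Delta>_pos by simp
      qed
      also have "\<dots> \<le> \<eta> k * ?p / 4" using \<eta> pk by (intro divide_left_mono) auto
      finally show ?thesis by simp
    qed
    have t0: "(1 - \<eta> k / 4) * ?p \<le> (\<Sum>v\<in>V x. C k {v}) / ?c"
    proof -
      have "acc k = \<eta> k / 4" using k2 by (simp add: acc_def)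
      then show ?thesis using vertex_mass[OF order_refl xU] unfolding \<open>acc k = \<eta> k / 4\<close> left_diff_distrib by linarith
    qed
    have "(1 - \<eta> k) * ?p \<le> (1 - \<eta> k / 4) * ?p - \<eta> k / 4 * ?p - \<eta> k / 4 * ?p"
      using mult_nonneg_nonneg[OF less_imp_le[OF \<eta>(1)] less_imp_le[OF pk]] by (simp add: algebra_simps)
    then show "(1 - \<eta> k) * ?p \<le> (\<Sum>v\<in>Good. C k {v}) / ?c" using t0 t1 t2 tot by linarith
  qed
qed

end

section \<open>Recursion for the count when the first vertex is embedded\<close>

lemma induced_edges_remove:
  assumes down: "\<And>f f'. f \<in> H \<Longrightarrow> f' \<subseteq> f \<Longrightarrow> f' \<in> H" and fin: "finite H" and x: "x \<in> S"
    and one: "\<And>e. e \<in> induced_edges H (S - {x}) \<Longrightarrow> insert x e \<notin> H \<Longrightarrow> h (insert x e) = 1"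
  shows "(\<Prod>e\<in>induced_edges H S. h e) = (\<Prod>e\<in>induced_edges H (S - {x}). h e * h (insert x e :: 'v set) :: real)"
proof -
  let ?R = "induced_edges H (S - {x})"
  let ?N = "{e\<in>?R. insert x e \<in> H}"
  have fR: "finite ?R" using fin by (simp add: induced_edges_def)
  have "induced_edges H S = ?R \<union> insert x ` ?N"
  proof
    show "?R \<union> insert x ` ?N \<subseteq> induced_edges H S" using x by (auto simp: induced_edges_def)
    show "induced_edges H S \<subseteq> ?R \<union> insert x ` ?N"
    proof
      fix e assume e: "e \<in> induced_edges H S"
      show "e \<in> ?R \<union> insert x ` ?N"
      proof (cases "x \<in> e")
        case False
        then show ?thesis using e by (auto simp: induced_edges_def)
      next
        case True
        then have i: "insert x (e - {x}) = e" by auto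
        have "e - {x} \<in> H" using e down[of e "e - {x}"] by (auto simp: induced_edges_def)
        then have "e - {x} \<in> ?N" using e unfolding mem_Collect_eq i by (auto simp: induced_edges_def)
        then show ?thesis using i by blast
      qed
    qed
  qed
  moreover have "?R \<inter> insert x ` ?N = {}" by (auto simp: induced_edges_def)
  moreover have "inj_on (insert x) ?N"
  proof (rule inj_onI)
    fix a b assume "a \<in> ?N" "b \<in> ?N" "insert x a = insert x b"
    moreover have "x \<notin> a" "x \<notin> b" using calculation by (auto simp: induced_edges_def)
    ultimately show "a = b" by (metis insert_ident)
  qed
  ultimately have "(\<Prod>e\<in>induced_edges H S. h e) = (\<Prod>e\<in>?R. h e) * (\<Prod>e\<in>?N. h (insert x e))"
    using fR by (simp add: prod.union_disjoint prod.reindex)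
  \<comment> \<open>Edges whose extension by \<open>x\<close> is not in \<open>H\<close> contribute
    the factor 1, so the product may run over all of the smaller complex.\<close>
  also have "(\<Prod>e\<in>?N. h (insert x e)) = (\<Prod>e\<in>?R. h (insert x e))"
    by (rule prod.mono_neutral_left[OF fR]) (use one in auto)
  finally show ?thesis by (simp add: prod.distrib)
qed

context gpe_stage
begin

text \<open>With the image of \<open>x\<close> fixed as \<open>v\<close>, an edge avoiding
  \<open>x\<close> and its extension by \<open>x\<close> together carry one link weight. As every
  vertex is its own part, the index map is \<open>id\<close>.\<close>

lemma hom_recursion:
  assumes x: "x \<in> U"
  shows "hom_density (C k) V id U (induced_edges H U)
    = (\<Sum>v\<in>V x. hom_density (link (C k) v) V id (U - {x}) (induced_edges H (U - {x}))) / real (card (V x))"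
proof -
  let ?R = "induced_edges H (U - {x})"
  have nef: "nefin U V" using fin_U parts by (auto simp: nefin_def)
  have pt: "(\<Prod>e\<in>induced_edges H U. C k ((\<psi>(x := v)) ` e)) = (\<Prod>e\<in>?R. link (C k) v (\<psi> ` e))"
    if \<psi>: "\<psi> \<in> PiE (U - {x}) V" and v: "v \<in> V x" for \<psi> v
  proof -
    have "(\<Prod>e\<in>induced_edges H U. C k ((\<psi>(x := v)) ` e)) = (\<Prod>e\<in>?R. C k ((\<psi>(x := v)) ` e) * C k ((\<psi>(x := v)) ` insert x e))"
    proof (rule induced_edges_remove[OF Hdown finH x])
      fix e assume e: "e \<in> ?R" "insert x e \<notin> H"
      then have eU: "e \<subseteq> U" "x \<notin> e" "insert x e \<subseteq> U" using x by (auto simp: induced_edges_def)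
      have "\<psi> w \<in> V (id w)" if "w \<in> e" for w using PiE_mem[OF \<psi>, of w] eU that by auto
      then have "\<psi> ` e \<in> crossing V (id ` e)" by (rule image_crossing[OF _ _ dis]) (use eU in auto)
      then have "insert v (\<psi> ` e) \<in> crossing V (insert x e)" using insert_crossing[OF _ v eU(2) dis eU(3)] by simp
      moreover have "(\<psi>(x := v)) ` insert x e = insert v (\<psi> ` e)"
        unfolding image_insert image_upd_away[OF eU(2), of \<psi> v] by simp
      ultimately show "C k ((\<psi>(x := v)) ` insert x e) = 1"
        using C_nonedge[OF order_refl eU(3) e(2)] by simp
    qed
    also have "\<dots> = (\<Prod>e\<in>?R. link (C k) v (\<psi> ` e))"
    proof (rule prod.cong[OF refl])
      fix e assume "e \<in> ?R"
      then have "x \<notin> e" by (auto simp: induced_edges_def)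
      then show "C k ((\<psi>(x := v)) ` e) * C k ((\<psi>(x := v)) ` insert x e) = link (C k) v (\<psi> ` e)"
        unfolding link_def image_insert image_upd_away[OF \<open>x \<notin> e\<close>, of \<psi> v] by simp
    qed
    finally show ?thesis .
  qed
  have "hom_density (C k) V id U (induced_edges H U)
      = avg (U - {x}) V (\<lambda>\<psi>. (\<Sum>v\<in>V x. \<Prod>e\<in>induced_edges H U. C k ((\<psi>(x := v)) ` e)) / real (card (V x)))"
    unfolding hom_density_eq_avg id_apply by (rule avg_split_coord[OF nef x])
  also have "\<dots> = avg (U - {x}) V (\<lambda>\<psi>. (\<Sum>v\<in>V x. \<Prod>e\<in>?R. link (C k) v (\<psi> ` e)) / real (card (V x)))"
    by (intro avg_cong arg_cong2[where f = "(/)"] sum.cong refl pt)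
  also have "\<dots> = (\<Sum>v\<in>V x. avg (U - {x}) V (\<lambda>\<psi>. \<Prod>e\<in>?R. link (C k) v (\<psi> ` e))) / real (card (V x))"
    unfolding avg_sum[symmetric] by (simp add: avg_def sum_divide_distrib mult.commute)
  finally show ?thesis unfolding hom_density_eq_avg id_apply .
qed

text \<open>In the link, the edge \<open>{x}\<close> merges with the empty edge, which
  \<open>density_quotient\<close> omits; its densities therefore appear as the separate factor
  \<open>pdens k {x}\<close>.\<close>

lemma quotient_recursion:
  assumes x: "x \<in> U"
  shows "(\<Prod>l\<in>{0..k}. density_quotient (density_after VH \<phi> (D l)) id (induced_edges H U))
    = pdens k {x} * (\<Prod>l\<in>{0..k}. density_quotient (density_after VH (\<phi>(x \<mapsto> v)) (D l)) id (induced_edges H (U - {x})))"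
proof -
  let ?R = "induced_edges H (U - {x})"
  have fin: "finite ?R" "finite (induced_edges H U)" using finH by (auto simp: induced_edges_def)
  have e0: "{} \<in> ?R" "{} \<in> induced_edges H U" using Hempty by (auto simp: induced_edges_def)
  have "density_quotient (density_after VH \<phi> (D l)) id (induced_edges H U)
      = dens l {x} * density_quotient (density_after VH (\<phi>(x \<mapsto> v)) (D l)) id ?R" if l: "l \<in> {0..k}" for l
  proof -
    define h where "h e = (if e = {} then 1 else dens l e)" for e
    have "density_quotient (density_after VH \<phi> (D l)) id (induced_edges H U) = (\<Prod>e\<in>induced_edges H U - {{}}. h e)"
      unfolding density_quotient_def by (rule prod.cong) (auto simp: h_def dens_def)
    also have "\<dots> = (\<Prod>e\<in>induced_edges H U. h e)"
      using prod.remove[OF fin(2) e0(2), of h] by (simp add: h_def)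
    also have "\<dots> = (\<Prod>e\<in>?R. h e * h (insert x e))"
      by (rule induced_edges_remove[OF Hdown finH x]) (use dens_nonedge l in \<open>auto simp: h_def\<close>)
    also have "\<dots> = (h {} * h {x}) * (\<Prod>e\<in>?R - {{}}. h e * h (insert x e))"
      by (rule prod.remove[OF fin(1) e0(1)])
    also have "(\<Prod>e\<in>?R - {{}}. h e * h (insert x e)) = density_quotient (density_after VH (\<phi>(x \<mapsto> v)) (D l)) id ?R"
      unfolding density_quotient_def
    proof (rule prod.cong[OF refl])
      fix e assume "e \<in> ?R - {{}}"
      then have "e \<noteq> {}" "e \<subseteq> U - {x}" by (auto simp: induced_edges_def)
      then show "h e * h (insert x e) = density_after VH (\<phi>(x \<mapsto> v)) (D l) (id ` e)"
        by (simp add: h_def density_extend[OF x])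
    qed
    finally show ?thesis by (simp add: h_def id_def)
  qed
  then have "(\<Prod>l\<in>{0..k}. density_quotient (density_after VH \<phi> (D l)) id (induced_edges H U))
    = (\<Prod>l\<in>{0..k}. dens l {x} * density_quotient (density_after VH (\<phi>(x \<mapsto> v)) (D l)) id ?R)"
    by (intro prod.cong refl)
  then show ?thesis by (simp add: prod.distrib pdens_def)
qed

end

context setting
begin

lemma gpe_count:
  assumes "gpe \<phi> C" "card (VH - dom \<phi>) = r"
  shows "(1 - \<eta> k) ^ r * (C k {} * (\<Prod>l\<in>{0..k}. density_quotient (density_after VH \<phi> (D l)) id (induced_edges H (VH - dom \<phi>))))
    \<le> hom_density (C k) V id (VH - dom \<phi>) (induced_edges H (VH - dom \<phi>))"
  using assms
proof (induction r arbitrary: \<phi> C)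
  case 0
  then have e: "VH - dom \<phi> = {}" using finVH by simp
  have "induced_edges H {} = {{}}" using Hempty by (auto simp: induced_edges_def)
  then show ?case unfolding e hom_density_eq_avg by (simp add: density_quotient_def)
next
  case (Suc r)
  let ?U = "VH - dom \<phi>"
  let ?R = "induced_edges H ?U"
  let ?DQ = "\<Prod>l\<in>{0..k}. density_quotient (density_after VH \<phi> (D l)) id ?R"
  have cst: "candidate_stack k VH H \<phi> V C" using Suc.prems(1) by (simp add: gpe_def)
  have F0: "0 \<le> hom_density (C k) V id ?U ?R"
    by (rule hom_nonneg[OF cst order_refl]) (auto simp: induced_edges_def)
  have kg: "k_graph k (\<Union>x\<in>?U. V x) (C l)" if "l \<le> k" for l using cst that unfolding candidate_stack_def by blast
  have Ck: "0 \<le> C k {}" using kg[OF order_refl] by (simp add: k_graph_def)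
  have mono: "C l {} \<le> C (l - 1) {}" if "l \<in> {1..k}" for l using cst that unfolding candidate_stack_def by blast
  have \<eta>: "0 < \<eta> k" "\<eta> k < 1" using \<eta>_bounds[of k] by auto
  \<comment> \<open>If \<open>C k {}\<close> or one of the level 0 densities vanishes, the bound to
    be shown is 0. Otherwise the normalisation is available, and positivity of the other
    \<open>C l {}\<close> follows by monotonicity.\<close>
  consider "C k {} = 0" | f where "f \<in> H" "f \<noteq> {}" "f \<subseteq> ?U" "\<not> 0 < density_after VH \<phi> (D 0) f"
    | "0 < C k {}" "\<And>f. f \<in> H \<Longrightarrow> f \<noteq> {} \<Longrightarrow> f \<subseteq> ?U \<Longrightarrow> 0 < density_after VH \<phi> (D 0) f"
    using Ck by fastforce
  then show ?case
  proof cases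
    case 1
    then show ?thesis using F0 by (simp add: id_def)
  next
    case 2
    have "0 \<le> density_after VH \<phi> (D 0) f"
      using densities unfolding density_after_def density_family_def k_graph_def by (intro prod_nonneg) auto
    then have z: "density_after VH \<phi> (D 0) f = 0" using 2(4) by simp
    have "density_quotient (density_after VH \<phi> (D 0)) id ?R = 0"
      unfolding density_quotient_def
      by (rule prod_zero) (use finH 2 z in \<open>auto simp: induced_edges_def intro!: bexI[of _ f]\<close>)
    then have "?DQ = 0" by (intro prod_zero) auto
    then show ?thesis unfolding \<open>?DQ = 0\<close> using F0 by (simp only: mult_zero_right)
  next
    case 3
    have Cpos: "0 < C l {}" if "l \<le> k" for l
    proof -
      have "C k {} \<le> C l {}" using that
      proof (induction rule: inc_induct)
        case (step l)
        then show ?case using mono[of "Suc l"] by simp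
      qed simp
      then show ?thesis using 3(1) by linarith
    qed
    have ne: "?U \<noteq> {}" using Suc.prems(2) by (intro notI) simp
    interpret gpe_stage k cs hs \<Delta> \<Delta>' \<delta> \<eta> \<epsilon> VH H V D \<phi> C
    proof
      show "k_complex k VH H" by (rule kcH)
      show "candidate_stack k VH H \<phi> V C" by (rule cst)
      show "density_family k VH H D" by (rule densities)
      show "0 < density_after VH \<phi> (D 0) f" if "f \<in> H" "f \<noteq> {}" "f \<subseteq> VH - dom \<phi>" for f by (rule 3(2)[OF that])
      show "0 < \<delta> l \<and> \<delta> l < 1" if "l \<in> {1..k}" for l by (rule \<delta>_bounds[OF that])
      show "\<delta> l \<le> (\<Prod>f\<in>{f. f \<subseteq> VH \<and> e \<subseteq> f}. D l f)" if "l \<in> {1..k}" "e \<subseteq> VH - dom \<phi>" "e \<noteq> {}" for l e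
        using Suc.prems(1) that unfolding gpe_def by blast
      show "0 < C l {}" if "l \<le> k" for l by (rule Cpos[OF that])
      show "gpe \<phi> C" by (rule Suc.prems(1))
      show "VH - dom \<phi> \<noteq> {}" by (rule ne)
    qed
    define x where "x = Min U"
    have xU: "x \<in> U" unfolding x_def by (rule Min_in[OF fin_U U_ne])
    have fV: "finite (V x)" using parts[OF xU] by simp
    obtain Good where G: "Good \<subseteq> V x" "(1 - \<eta> k) * pdens k {x} \<le> (\<Sum>v\<in>Good. C k {v}) / real (card (V x))"
      "\<And>v. v \<in> Good \<Longrightarrow> gpe (\<phi>(x \<mapsto> v)) (\<lambda>l. link (C l) v)"
      by (rule embed_vertex[OF x_def]) (rule that; assumption)
    let ?R' = "induced_edges H (U - {x})"
    \<comment> \<open>The image of \<open>x\<close> is irrelevant to \<open>density_after\<close>,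
      which looks only at the domain; hence \<open>undefined\<close>.\<close>
    define Q where "Q = (\<Prod>l\<in>{0..k}. density_quotient (density_after VH (\<phi>(x \<mapsto> undefined)) (D l)) id ?R')"
    have Qv: "(\<Prod>l\<in>{0..k}. density_quotient (density_after VH (\<phi>(x \<mapsto> v)) (D l)) id ?R') = Q" for v
      unfolding Q_def density_after_def by simp
    have Q0: "0 \<le> Q"
      unfolding Q_def density_quotient_def density_after_def
      by (intro prod_nonneg ballI D_nonneg) auto
    have UU: "?U = U" by (simp add: U_def)
    have card': "card (VH - dom (\<phi>(x \<mapsto> v))) = r" for v
      unfolding dom_extend using Suc.prems(2) xU fin_U by (simp add: UU)
    have IH: "(1 - \<eta> k) ^ r * (C k {} * C k {v} * Q) \<le> hom_density (link (C k) v) V id (U - {x}) ?R'" if "v \<in> Good" for v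
      using Suc.IH[OF G(3)[OF that] card'] unfolding dom_extend Qv link_def[of "C k" v "{}"] .
    have nn: "0 \<le> hom_density (link (C k) v) V id (U - {x}) ?R'" if "v \<in> V x" for v
    proof -
      have xV: "x \<in> VH - dom \<phi>" using xU by (simp add: U_def)
      show ?thesis
        by (rule hom_nonneg[OF candidate_stack_link[OF cst xV that] order_refl, unfolded dom_extend])
           (auto simp: induced_edges_def)
    qed
    have "(1 - \<eta> k) ^ Suc r * (C k {} * ?DQ) = (1 - \<eta> k) ^ r * (C k {} * Q) * ((1 - \<eta> k) * pdens k {x})"
      using quotient_recursion[OF xU, of undefined] unfolding UU Qv by simp
    also have "\<dots> \<le> (1 - \<eta> k) ^ r * (C k {} * Q) * ((\<Sum>v\<in>Good. C k {v}) / real (card (V x)))"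
      using G(2) \<eta> Ck Q0 by (intro mult_left_mono mult_nonneg_nonneg) auto
    also have "\<dots> = (\<Sum>v\<in>Good. (1 - \<eta> k) ^ r * (C k {} * C k {v} * Q)) / real (card (V x))"
      by (simp add: sum_distrib_left mult_ac)
    also have "\<dots> \<le> (\<Sum>v\<in>Good. hom_density (link (C k) v) V id (U - {x}) ?R') / real (card (V x))"
      by (intro divide_right_mono sum_mono IH) auto
    \<comment> \<open>The rejected vertices are put back, their counts being nonnegative.\<close>
    also have "\<dots> \<le> (\<Sum>v\<in>V x. hom_density (link (C k) v) V id (U - {x}) ?R') / real (card (V x))"
      using fV G(1) nn by (intro divide_right_mono sum_mono2) auto
    also have "\<dots> = hom_density (C k) V id ?U ?R"
      unfolding UU by (rule hom_recursion[OF xU, symmetric])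
    finally show ?thesis .
  qed
qed

end

theorem lemma14:
  fixes k \<Delta> \<Delta>' cs hs :: nat
    and \<delta> \<eta> :: "nat \<Rightarrow> real" and \<epsilon> :: "nat \<Rightarrow> nat \<Rightarrow> nat \<Rightarrow> real"
    and VH :: "'v::linorder set" and H :: "'v set set" and \<phi> :: "'v \<rightharpoonup> 'a"
    and V :: "'v \<Rightarrow> 'a set"
    and C :: "nat \<Rightarrow> 'a set \<Rightarrow> real" and D :: "nat \<Rightarrow> 'v set \<Rightarrow> real"
  assumes "k \<ge> 2" and "\<Delta> > 0" and "\<Delta>' > 0"
    and "cs \<ge> k * (4 * k + 1)" and "hs \<ge> k * (4 * k + 1) + k * \<Delta>'"
    and "valid_ensemble k cs hs \<Delta> \<delta> \<eta> \<epsilon>"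
    and "k_complex k VH H" and "max_degree VH H = \<Delta>" and "vertex_degeneracy VH H \<le> \<Delta>'"
    and "partial_embedding VH \<phi>"
    and "candidate_stack k VH H \<phi> V C"
    and "density_family k VH H D"
    and "good_partial_embedding k cs \<delta> \<eta> \<epsilon> VH H D \<phi> V C"
  shows "hom_density (C k) V id (VH - dom \<phi>) (induced_edges H (VH - dom \<phi>))
         \<ge> (1 - \<eta> k) ^ (card VH - card (dom \<phi>))
           * (C k {} * (\<Prod>l\<in>{0..k}. density_quotient (density_after VH \<phi> (D l)) id
                                      (induced_edges H (VH - dom \<phi>))))"
proof -
  interpret setting k cs hs \<Delta> \<Delta>' \<delta> \<eta> \<epsilon> VH H V D
    by unfold_locales (use assms in auto)
  \<comment> \<open>Moving from \<open>hits\<close> to \<open>sh + hits\<close> only weakens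
    regularity, since the parameters increase with the hit count.\<close>
  have reg: "regular_wrt e V (\<epsilon> l (card e) (sh + hits H \<phi> e)) (density_after VH \<phi> (D l) e)
      (replace_top V e (C l) (C (l - 1))) (C (l - 1))"
    if l: "l \<in> {1..k}" and e: "e \<in> H" "e \<noteq> {}" "e \<subseteq> VH - dom \<phi>" for l e
  proof (rule regular_mono)
    show "regular_wrt e V (\<epsilon> l (card e) (hits H \<phi> e)) (density_after VH \<phi> (D l) e)
      (replace_top V e (C l) (C (l - 1))) (C (l - 1))"
      using assms(13) l e unfolding good_partial_embedding_def by blast
    have "hits H \<phi> e \<le> \<Delta>'" by (rule hits_le[OF assms(10) e(1,3)])
    then show "\<epsilon> l (card e) (hits H \<phi> e) \<le> \<epsilon> l (card e) (sh + hits H \<phi> e)"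
      using hs_room by (intro \<epsilon>_mono[OF l card_in[OF e(1,2)]]) auto
    have l1: "l - 1 \<le> k" using l by auto
    show "0 \<le> hom_density (C (l - 1)) V fst (oct_vertices e (\<lambda>_. n)) (oct_edges e (\<lambda>_. n))" for n
      by (rule hom_nonneg[OF assms(11) l1]) (use e(3) in \<open>auto simp: oct_vertices_def oct_edges_def\<close>)
  qed
  have "gpe \<phi> C"
    unfolding gpe_def
  proof (intro conjI)
    show "VH - dom \<phi> \<noteq> {} \<longrightarrow> (\<exists>p. thc_graph k (\<eta> 0) cs V (VH - dom \<phi>) (C 0) p \<and>
        (\<forall>f\<subseteq>VH - dom \<phi>. p f = density_after VH \<phi> (D 0) f))"
      using assms(13) unfolding good_partial_embedding_def by blast
    show "\<forall>l\<in>{1..k}. \<forall>e\<subseteq>VH - dom \<phi>. e \<noteq> {} \<longrightarrow> \<delta> l \<le> (\<Prod>f\<in>{f. f \<subseteq> VH \<and> e \<subseteq> f}. D l f)"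
      using assms(13) unfolding good_partial_embedding_def by blast
  qed (use assms(10,11) reg in blast)+
  moreover have "card (VH - dom \<phi>) = card VH - card (dom \<phi>)"
    using assms(10) finVH by (intro card_Diff_subset) (auto simp: partial_embedding_def intro: finite_subset)
  ultimately show ?thesis by (rule gpe_count)
qed

end
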